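(* Let $\mathsf{M}$ be a loopless matroid on a finite ordered ground set $E$, and let $\mathcal{P}_-\subseteq\mathcal{P}_+$ be order filters of $\mathsf{M}$ with $\mathcal{P}_+\setminus\mathcal{P}_-=\{Z\}$ for a single flat $Z$. Then there is a long exact sequence of vector spaces \[ \cdots\to \mathrm{E}^{Z}_{t+1,s-1}\to \operatorname{Tor}_{t}^{S^{\circ}_{\mathsf{M}}}\big(\mathbb{C}[\Sigma_{\mathsf{M},\mathcal{P}_-}]\big)_{s}\to \operatorname{Tor}_{t}^{S^{\circ}_{\mathsf{M}}}\big(\mathbb{C}[\Sigma_{\mathsf{M},\mathcal{P}_+}]\big)_{s}\to \mathrm{E}^{Z}_{t,s}\to \operatorname{Tor}_{t-1}^{S^{\circ}_{\mathsf{M}}}\big(\mathbb{C}[\Sigma_{\mathsf{M},\mathcal{P}_-}]\big)_{s+1}\to\cdots, \] where \[ \mathrm{E}^Z_{t,s}=\bigoplus_{\substack{t_1+t_2=t,\ s_1+s_2=s\\ t_1+s_1>0}}\operatorname{Tor}_{t_1}^{S^{\circ}_{\mathsf{M}^Z}}\big(\mathbb{C}[\Sigma_{\mathsf{M}^Z,\emptyset}]\big)_{s_1}\otimes\operatorname{Tor}_{t_2}^{S^{\circ}_{\mathsf{M}_Z}}\big(\mathbb{C}[\Sigma_{\mathsf{M}_Z}]\big)_{s_2}. \]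
   Context: Matroids on a finite set $E\subset\mathbb{Z}$ (with its natural order) are given by bases; $\mathrm{rk}$ is the rank function, $r=\mathrm{rk}(E)$, $\mathrm{cl}$ the closure. $\widehat{\mathcal{L}}(\mathsf{M})$ is the poset of proper nonempty flats. An order filter is a subset $\mathcal{P}\subseteq\widehat{\mathcal{L}}(\mathsf{M})$ such that $F\in\mathcal{P}$, $F\subseteq G\in\widehat{\mathcal{L}}(\mathsf{M})$ imply $G\in\mathcal{P}$. For a flat $Z$: the restriction $\mathsf{M}^Z$ is the matroid on $Z$ whose bases are the maximal independent subsets of $Z$; the contraction $\mathsf{M}_Z$ is the matroid on $E\setminus Z$ whose bases are the sets $I\subseteq E\setminus Z$ with $|I|=r-\mathrm{rk}(Z)$ and $\mathrm{rk}(I\cup Z)=r$. Rings: $S_{\mathsf{M}}=\mathbb{C}[x_e:e\in E]$, and $S^{\circ}_{\mathsf{M}}\subseteq S_{\mathsf{M}}$ is the subalgebra generated by all differences $x_e-x_{e'}$; its degree-one part is $V=\{\sum c_ex_e:\sum c_e=0\}$. Stanley–Reisner ring of an order filter $\mathcal{P}$: variables $x_F$ for $F\in\mathcal{P}$ and $x_i$ for $i\in E$ with $\mathrm{cl}(\{i\})\notin\mathcal{P}\cup\{E\}$. A set $\{x_i:i\in I\}\cup\{x_F:F\in\mathcal{F}\}$ of variables is a face if $\mathcal{F}$ is a chain in $\mathcal{P}$, $I\subseteq F$ for every $F\in\mathcal{F}$, and $\mathrm{cl}(I)\notin\mathcal{P}\cup\{E\}$. $\mathbb{C}[\Sigma_{\mathsf{M},\mathcal{P}}]$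 is the polynomial ring in these variables modulo the ideal generated by the products of variables over all non-faces; it is graded by polynomial degree (Stanley–Reisner degree) and is an $S_{\mathsf{M}}$-algebra via $x_e\mapsto\delta_ex_e+\sum_{F\in\mathcal{P},\,e\in F}x_F$, where $\delta_ex_e=x_e$ if $x_e$ is a variable and $0$ otherwise. $\mathbb{C}[\Sigma_{\mathsf{M}}]:=\mathbb{C}[\Sigma_{\mathsf{M},\widehat{\mathcal{L}}(\mathsf{M})}]$. For $\mathcal{P}=\emptyset$, $\mathbb{C}[\Sigma_{\mathsf{M},\emptyset}]\cong S_{\mathsf{M}}/\langle\prod_{i\in B}x_i: B\text{ basis}\rangle$. Tor: for a polynomial ring $R$ generated by degree-one space $V$ and graded module $A=\bigoplus_sA_s$, the Koszul complex $A\otimes\bigwedge^\bullet V$ has $d(a\otimes\ell_1\wedge\cdots\wedge\ell_t)=\sum_j(-1)^j(\ell_ja)\otimes\ell_1\wedge\cdots\widehat{\ell_j}\cdots\wedge\ell_t$; $\operatorname{Tor}^R_t(A)_s$ is its homology at $A_s\otimes\bigwedge^tV$. *)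

theory Defs
  imports
    "HOL-Library.Poly_Mapping"
    "HOL-Algebra.Module"
    "HOL-Algebra.QuotRing"
    "HOL-Algebra.Generated_Rings"
    "HOL-Algebra.Algebraic_Closure_Type"
begin

section \<open>Matroids\<close>

record matroid_data =
  ground :: "int set"
  bases :: "int set set"

definition matroid :: "matroid_data \<Rightarrow> bool" where
  "matroid M \<longleftrightarrow> finite (ground M) \<and> bases M \<noteq> {} \<and> bases M \<subseteq> Pow (ground M) \<and>
     (\<forall>A\<in>bases M. \<forall>B\<in>bases M. \<forall>a\<in>A - B. \<exists>b\<in>B - A. insert b (A - {a}) \<in> bases M)"

definition indep :: "matroid_data \<Rightarrow> int set \<Rightarrow> bool" where
  "indep M I \<longleftrightarrow> (\<exists>B\<in>bases M. I \<subseteq> B)"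

definition rk :: "matroid_data \<Rightarrow> int set \<Rightarrow> nat" where
  "rk M A = Max {card I | I. I \<subseteq> A \<and> indep M I}"

definition cl :: "matroid_data \<Rightarrow> int set \<Rightarrow> int set" where
  "cl M A = {e \<in> ground M. rk M (insert e A) = rk M A}"

definition loopless :: "matroid_data \<Rightarrow> bool" where
  "loopless M \<longleftrightarrow> (\<forall>e\<in>ground M. indep M {e})"

definition flat :: "matroid_data \<Rightarrow> int set \<Rightarrow> bool" where
  "flat M F \<longleftrightarrow> F \<subseteq> ground M \<and> cl M F = F"

definition proper_flats :: "matroid_data \<Rightarrow> int set set" where
  "proper_flats M = {F. flat M F \<and> F \<noteq> {} \<and> F \<noteq> ground M}"

definition order_filter :: "matroid_data \<Rightarrow> int set set \<Rightarrow> bool" where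
  "order_filter M P \<longleftrightarrow> P \<subseteq> proper_flats M \<and>
     (\<forall>F\<in>P. \<forall>G\<in>proper_flats M. F \<subseteq> G \<longrightarrow> G \<in> P)"

definition restriction :: "matroid_data \<Rightarrow> int set \<Rightarrow> matroid_data" where
  "restriction M Z = \<lparr>ground = Z,
     bases = {I. I \<subseteq> Z \<and> indep M I \<and> (\<forall>J. I \<subseteq> J \<and> J \<subseteq> Z \<and> indep M J \<longrightarrow> J = I)}\<rparr>"

definition contraction :: "matroid_data \<Rightarrow> int set \<Rightarrow> matroid_data" where
  "contraction M Z = \<lparr>ground = ground M - Z,
     bases = {I. I \<subseteq> ground M - Z \<and> card I = rk M (ground M) - rk M Z \<and>
                 rk M (I \<union> Z) = rk M (ground M)}\<rparr>"


section \<open>Complex vector spaces\<close>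

text \<open>Vector spaces are modules, in the sense of HOL-Algebra, over the field of complex numbers.
  The module record extends the ring record; its multiplicative fields play no role for
  a vector space and are left undefined.\<close>

abbreviation complex_field :: "complex ring" where
  "complex_field \<equiv> ring_of_type_algebra"

definition linear_maps :: "(complex, 'a, 'm) module_scheme \<Rightarrow> (complex, 'b, 'n) module_scheme \<Rightarrow>
    ('a \<Rightarrow> 'b) set" where
  "linear_maps M N = {f \<in> carrier M \<rightarrow> carrier N.
     (\<forall>x\<in>carrier M. \<forall>y\<in>carrier M. f (x \<oplus>\<^bsub>M\<^esub> y) = f x \<oplus>\<^bsub>N\<^esub> f y) \<and>
     (\<forall>c. \<forall>x\<in>carrier M. f (c \<odot>\<^bsub>M\<^esub> x) = c \<odot>\<^bsub>N\<^esub> f x)}"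

definition span_in :: "(complex, 'a, 'm) module_scheme \<Rightarrow> 'a set \<Rightarrow> 'a set" where
  "span_in M S = \<Inter>{N. submodule N complex_field M \<and> S \<subseteq> N}"

definition quotient_space :: "(complex, 'a, 'm) module_scheme \<Rightarrow> 'a set \<Rightarrow> (complex, 'a set) module" where
  "quotient_space M N = \<lparr>carrier = a_rcosets\<^bsub>M\<^esub> N, monoid.mult = undefined, one = undefined,
     ring.zero = N, add = set_add M, module.smult = (\<lambda>c Y. \<Union>x\<in>Y. N +>\<^bsub>M\<^esub> (c \<odot>\<^bsub>M\<^esub> x))\<rparr>"

definition free_space :: "'x set \<Rightarrow> (complex, 'x \<Rightarrow>\<^sub>0 complex) module" where
  "free_space Y = \<lparr>carrier = {p. Poly_Mapping.keys p \<subseteq> Y}, monoid.mult = undefined, one = undefined,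
     ring.zero = 0, add = (+), module.smult = (\<lambda>c. Poly_Mapping.map ((*) c))\<rparr>"

definition presented_space :: "'x set \<Rightarrow> ('x \<Rightarrow>\<^sub>0 complex) set \<Rightarrow> (complex, ('x \<Rightarrow>\<^sub>0 complex) set) module" where
  "presented_space Y R = quotient_space (free_space Y) (span_in (free_space Y) R)"

abbreviation gen :: "'x \<Rightarrow> 'x \<Rightarrow>\<^sub>0 complex" where
  "gen x \<equiv> Poly_Mapping.single x 1"

definition tensor_relations :: "(complex, 'a, 'm) module_scheme \<Rightarrow> (complex, 'b, 'n) module_scheme \<Rightarrow>
    ('a \<times> 'b \<Rightarrow>\<^sub>0 complex) set" where
  "tensor_relations M N =
     {gen (x \<oplus>\<^bsub>M\<^esub> x', y) - gen (x, y) - gen (x', y) | x x' y.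
        x \<in> carrier M \<and> x' \<in> carrier M \<and> y \<in> carrier N} \<union>
     {gen (x, y \<oplus>\<^bsub>N\<^esub> y') - gen (x, y) - gen (x, y') | x y y'.
        x \<in> carrier M \<and> y \<in> carrier N \<and> y' \<in> carrier N} \<union>
     {gen (c \<odot>\<^bsub>M\<^esub> x, y) - Poly_Mapping.single (x, y) c | c x y.
        x \<in> carrier M \<and> y \<in> carrier N} \<union>
     {gen (x, c \<odot>\<^bsub>N\<^esub> y) - Poly_Mapping.single (x, y) c | c x y.
        x \<in> carrier M \<and> y \<in> carrier N}"

definition tensor :: "(complex, 'a, 'm) module_scheme \<Rightarrow> (complex, 'b, 'n) module_scheme \<Rightarrow>
    (complex, ('a \<times> 'b \<Rightarrow>\<^sub>0 complex) set) module" where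
  "tensor M N = presented_space (carrier M \<times> carrier N) (tensor_relations M N)"

definition direct_sum :: "'i set \<Rightarrow> ('i \<Rightarrow> (complex, 'a) module) \<Rightarrow> (complex, 'i \<Rightarrow> 'a) module" where
  "direct_sum I M = \<lparr>carrier = {f \<in> \<Pi>\<^sub>E i\<in>I. carrier (M i). finite {i \<in> I. f i \<noteq> \<zero>\<^bsub>M i\<^esub>}},
     monoid.mult = undefined, one = undefined,
     ring.zero = (\<lambda>i\<in>I. \<zero>\<^bsub>M i\<^esub>), add = (\<lambda>f g. \<lambda>i\<in>I. f i \<oplus>\<^bsub>M i\<^esub> g i),
     module.smult = (\<lambda>c f. \<lambda>i\<in>I. c \<odot>\<^bsub>M i\<^esub> f i)\<rparr>"


section \<open>Polynomial rings\<close>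

text \<open>Polynomials with variables in \<open>'v\<close>: finitely supported functions from monomials
  (finitely supported exponent vectors) to coefficients.\<close>

type_synonym 'v cpoly = "('v \<Rightarrow>\<^sub>0 nat) \<Rightarrow>\<^sub>0 complex"

definition Const :: "complex \<Rightarrow> 'v cpoly" where
  "Const c = Poly_Mapping.single 0 c"

definition Var :: "'v \<Rightarrow> 'v cpoly" where
  "Var v = Poly_Mapping.single (Poly_Mapping.single v 1) 1"

definition poly_ring :: "'v set \<Rightarrow> 'v cpoly ring" where
  "poly_ring Y = ring_of_type_algebra
     \<lparr>carrier := {p. \<forall>m\<in>Poly_Mapping.keys p. Poly_Mapping.keys m \<subseteq> Y}\<rparr>"

definition homogeneous :: "int \<Rightarrow> 'v cpoly set" where
  "homogeneous s = {p. \<forall>m\<in>Poly_Mapping.keys p.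
     int (\<Sum>v\<in>Poly_Mapping.keys m. Poly_Mapping.lookup m v) = s}"

definition substitute :: "('v \<Rightarrow> 'w cpoly) \<Rightarrow> 'v cpoly \<Rightarrow> 'w cpoly" where
  "substitute \<theta> p = (\<Sum>m\<in>Poly_Mapping.keys p. Const (Poly_Mapping.lookup p m) *
     (\<Prod>v\<in>Poly_Mapping.keys m. \<theta> v ^ Poly_Mapping.lookup m v))"

definition difference_subalgebra :: "int set \<Rightarrow> int cpoly set" where
  "difference_subalgebra E =
     generate_ring (poly_ring E) (range Const \<union> {Var e - Var e' | e e'. e \<in> E \<and> e' \<in> E})"


section \<open>Koszul homology\<close>

text \<open>A graded module over a polynomial ring; \<open>piece A s\<close> is the homogeneous part of degree \<open>s\<close>.
  Scalars act on it as constant polynomials.  Degrees are integers so that the modules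
  vanish, rather than being undefined, in negative degrees.\<close>

record ('a, 'b) graded_module = "('a, 'b) module" +
  piece :: "int \<Rightarrow> 'b set"

text \<open>The space \<open>A\<^sub>s \<otimes> \<Lambda>\<^sup>t V\<close> is presented by generators \<open>(a, [l\<^sub>1, \<dots>, l\<^sub>t])\<close>, standing for
  \<open>a \<otimes> l\<^sub>1 \<and> \<dots> \<and> l\<^sub>t\<close>, with the relations of multilinearity and those expressing that the
  wedge is alternating.\<close>

definition koszul_generators ::
    "'v cpoly set \<Rightarrow> ('v cpoly, 'b) graded_module \<Rightarrow> int \<Rightarrow> int \<Rightarrow> ('b \<times> 'v cpoly list) set" where
  "koszul_generators V A t s = {(a, ls). a \<in> piece A s \<and> set ls \<subseteq> V \<and> int (length ls) = t}"

definition koszul_relations ::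
    "'v cpoly set \<Rightarrow> ('v cpoly, 'b) graded_module \<Rightarrow> int \<Rightarrow> int \<Rightarrow> ('b \<times> 'v cpoly list \<Rightarrow>\<^sub>0 complex) set" where
  "koszul_relations V A t s =
     {gen (a \<oplus>\<^bsub>A\<^esub> a', ls) - gen (a, ls) - gen (a', ls) | a a' ls.
        (a, ls) \<in> koszul_generators V A t s \<and> (a', ls) \<in> koszul_generators V A t s} \<union>
     {gen (Const c \<odot>\<^bsub>A\<^esub> a, ls) - Poly_Mapping.single (a, ls) c | c a ls.
        (a, ls) \<in> koszul_generators V A t s} \<union>
     {gen (a, us @ (l + l') # vs) - gen (a, us @ l # vs) - gen (a, us @ l' # vs) | a us l l' vs.
        (a, us @ l # vs) \<in> koszul_generators V A t s \<and> l' \<in> V} \<union>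
     {gen (a, us @ (Const c * l) # vs) - Poly_Mapping.single (a, us @ l # vs) c | c a us l vs.
        (a, us @ l # vs) \<in> koszul_generators V A t s} \<union>
     {gen (a, ls) | a ls. (a, ls) \<in> koszul_generators V A t s \<and> \<not> distinct ls}"

definition koszul_space ::
    "'v cpoly set \<Rightarrow> ('v cpoly, 'b) graded_module \<Rightarrow> int \<Rightarrow> int \<Rightarrow>
     (complex, ('b \<times> 'v cpoly list \<Rightarrow>\<^sub>0 complex) set) module" where
  "koszul_space V A t s = presented_space (koszul_generators V A t s) (koszul_relations V A t s)"

text \<open>The differential is first defined on the free space on the generators, then on cosets.
  List positions start at 0, hence the sign \<open>(-1) ^ Suc j\<close>.\<close>

definition koszul_diff_free ::
    "('v cpoly, 'b) graded_module \<Rightarrow> ('b \<times> 'v cpoly list \<Rightarrow>\<^sub>0 complex) \<Rightarrow> ('b \<times> 'v cpoly list \<Rightarrow>\<^sub>0 complex)" where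
  "koszul_diff_free A p = (\<Sum>(a, ls)\<in>Poly_Mapping.keys p. \<Sum>j<length ls.
     Poly_Mapping.single (ls ! j \<odot>\<^bsub>A\<^esub> a, take j ls @ drop (Suc j) ls)
       ((-1) ^ Suc j * Poly_Mapping.lookup p (a, ls)))"

definition koszul_diff ::
    "'v cpoly set \<Rightarrow> ('v cpoly, 'b) graded_module \<Rightarrow> int \<Rightarrow> int \<Rightarrow>
     ('b \<times> 'v cpoly list \<Rightarrow>\<^sub>0 complex) set \<Rightarrow> ('b \<times> 'v cpoly list \<Rightarrow>\<^sub>0 complex) set" where
  "koszul_diff V A t s Y = (\<Union>x\<in>Y.
     span_in (free_space (koszul_generators V A (t - 1) (s + 1))) (koszul_relations V A (t - 1) (s + 1))
       +>\<^bsub>free_space (koszul_generators V A (t - 1) (s + 1))\<^esub> koszul_diff_free A x)"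

text \<open>\<open>tor R A t s\<close> is \<open>Tor\<^sup>R\<^sub>t(A)\<^sub>s\<close>: kernel modulo image at \<open>A\<^sub>s \<otimes> \<Lambda>\<^sup>t V\<close>,
  where \<open>V\<close> is the degree-one part of \<open>R\<close>.\<close>

definition tor ::
    "'v cpoly set \<Rightarrow> ('v cpoly, 'b) graded_module \<Rightarrow> int \<Rightarrow> int \<Rightarrow>
     (complex, ('b \<times> 'v cpoly list \<Rightarrow>\<^sub>0 complex) set set) module" where
  "tor R A t s = (let V = R \<inter> homogeneous 1 in
     quotient_space
       ((koszul_space V A t s)
          \<lparr>carrier := a_kernel (koszul_space V A t s) (koszul_space V A (t - 1) (s + 1)) (koszul_diff V A t s)\<rparr>)
       (koszul_diff V A (t + 1) (s - 1) ` carrier (koszul_space V A (t + 1) (s - 1))))"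


section \<open>The Stanley--Reisner ring of an order filter\<close>

datatype sr_var = Elt int | Flat "int set"

definition sr_vars :: "matroid_data \<Rightarrow> int set set \<Rightarrow> sr_var set" where
  "sr_vars M P = Flat ` P \<union> Elt ` {i \<in> ground M. cl M {i} \<notin> P \<union> {ground M}}"

definition sr_face :: "matroid_data \<Rightarrow> int set set \<Rightarrow> sr_var set \<Rightarrow> bool" where
  "sr_face M P \<sigma> \<longleftrightarrow> \<sigma> \<subseteq> sr_vars M P \<and>
     (\<exists>I \<F>. \<sigma> = Elt ` I \<union> Flat ` \<F> \<and> subset.chain P \<F> \<and> (\<forall>F\<in>\<F>. I \<subseteq> F) \<and>
            cl M I \<notin> P \<union> {ground M})"

definition sr_ideal :: "matroid_data \<Rightarrow> int set set \<Rightarrow> sr_var cpoly set" where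
  "sr_ideal M P = Idl\<^bsub>poly_ring (sr_vars M P)\<^esub>
     {\<Prod>v\<in>\<sigma>. Var v | \<sigma>. \<sigma> \<subseteq> sr_vars M P \<and> \<not> sr_face M P \<sigma>}"

text \<open>The image of the variable \<open>x\<^sub>e\<close> under the structure map.\<close>

definition sr_image :: "matroid_data \<Rightarrow> int set set \<Rightarrow> int \<Rightarrow> sr_var cpoly" where
  "sr_image M P e =
     (if Elt e \<in> sr_vars M P then Var (Elt e) else 0) + (\<Sum>F | F \<in> P \<and> e \<in> F. Var (Flat F))"

definition stanley_reisner ::
    "matroid_data \<Rightarrow> int set set \<Rightarrow> (int cpoly, sr_var cpoly set) graded_module" where
  "stanley_reisner M P =
     (let R = poly_ring (sr_vars M P); I = sr_ideal M P; Q = R Quot I in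
      \<lparr>carrier = carrier Q, monoid.mult = monoid.mult Q, one = monoid.one Q, ring.zero = ring.zero Q, add = ring.add Q,
       module.smult = (\<lambda>p Y. (I +>\<^bsub>R\<^esub> substitute (sr_image M P) p) \<otimes>\<^bsub>Q\<^esub> Y),
       piece = (\<lambda>s. {I +>\<^bsub>R\<^esub> p | p. p \<in> carrier R \<inter> homogeneous s})\<rparr>)"

text \<open>\<open>tor_sr M P t s\<close> is the degree-\<open>s\<close> part of the \<open>t\<close>-th Tor of the Stanley--Reisner ring
  of \<open>P\<close> over the subalgebra generated by the differences of variables.\<close>

definition tor_sr where
  "tor_sr M P t s = tor (difference_subalgebra (ground M)) (stanley_reisner M P) t s"

definition E_space where
  "E_space M Z t s = direct_sum {(t1, t2, s1, s2). t1 + t2 = t \<and> s1 + s2 = s \<and> t1 + s1 > 0}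
     (\<lambda>(t1, t2, s1, s2). tensor (tor_sr (restriction M Z) {} t1 s1)
        (tor_sr (contraction M Z) (proper_flats (contraction M Z)) t2 s2))"

end

theory Submission
  imports Defs "HOL-Library.Function_Algebras"
begin

text \<open>Tor of a Stanley--Reisner ring can be computed in the polynomial ring in all variables, modulo the
  ideal spanned by the monomials that are not supported on faces, with \<open>x\<^sub>i - x\<^sub>f\<close> for one fixed
  \<open>f \<notin> Z\<close> as Koszul variables.  The substitution \<open>x\<^sub>e \<mapsto> x\<^sub>e + x\<^sub>Z\<close> for \<open>e \<in> Z\<close>, \<open>x\<^sub>Z \<mapsto> 0\<close> maps the
  ring of the smaller filter to that of the larger one.  The two face complexes differ only near \<open>Z\<close>:
  the remaining faces are the same, and they span an ideal \<open>N\<close> of either ring on which the substitution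
  is the identity.  Hence comparing the quotients \<open>Y\<^sub>-\<close> and \<open>Y\<^sub>+\<close> of the two rings by \<open>N\<close> yields the long
  exact sequence, as soon as \<open>Y\<^sub>- \<rightarrow> Y\<^sub>+\<close> is injective on Koszul homology.
  In \<open>Y\<^sub>+\<close>, eliminating \<open>x\<^sub>Z\<close> by means of one Koszul variable leaves the tensor product of the Koszul
  complexes of the restriction and the contraction.  In \<open>Y\<^sub>-\<close>, eliminating \<open>x\<^sub>e\<close> for all \<open>e \<in> Z\<close> leaves
  the Koszul complex of the contraction alone, which becomes the excluded summand \<open>t\<^sub>1 = s\<^sub>1 = 0\<close>.\<close>

text \<open>Each ring is an extension of its quotient by the same N, so a diagram chase gives a long
  exact sequence whose third term is the cokernel of H(Y_-) -> H(Y_+), provided that this map is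
  injective. Injectivity is the crux. Every class of Y_- has a representative that involves only
  flats strictly above Z and Koszul variables outside Z. All maps on the way to the tensor product
  fix such a representative, and setting the element variables and the Koszul variables of the
  restriction to 0 retracts the tensor product onto the complex of the contraction. This retraction
  is well defined because the empty set is closed and Z is not empty, so that 1 is nonzero in the
  ring of the restriction. Taking f outside Z decouples the two factors: modulo non-faces the
  differences for elements outside Z then involve only flats strictly above Z, and all flats
  strictly above Z contribute the same form to the differences for elements of Z. The eliminations
  rest on cone points: a variable that never decides whether a monomial is a face makes every linear
  form with it as leading variable regular.\<close>

abbreviation keys :: "('k \<Rightarrow>\<^sub>0 'b::zero) \<Rightarrow> 'k set" where "keys \<equiv> Poly_Mapping.keys"
abbreviation lookup :: "('k \<Rightarrow>\<^sub>0 'b::zero) \<Rightarrow> 'k \<Rightarrow> 'b" where "lookup \<equiv> Poly_Mapping.lookup"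
abbreviation single :: "'k \<Rightarrow> 'b \<Rightarrow> 'k \<Rightarrow>\<^sub>0 'b::zero" where "single \<equiv> Poly_Mapping.single"

text \<open>A type class, so that one interpretation of the library's vector spaces serves
  polynomials, chains and formal sums alike.\<close>

class cvec = ab_group_add +
  fixes cscale :: "complex \<Rightarrow> 'a \<Rightarrow> 'a" (infixr \<open>*\<^sub>C\<close> 75)
  assumes cscale_right_distrib: "c *\<^sub>C (x + y) = c *\<^sub>C x + c *\<^sub>C y"
    and cscale_left_distrib: "(c + d) *\<^sub>C x = c *\<^sub>C x + d *\<^sub>C x"
    and cscale_cscale: "c *\<^sub>C (d *\<^sub>C x) = (c * d) *\<^sub>C x"
    and cscale_one: "1 *\<^sub>C x = x"

interpretation cv: vector_space "cscale :: complex \<Rightarrow> 'a \<Rightarrow> 'a::cvec"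
  by unfold_locales (auto simp: cscale_right_distrib cscale_left_distrib cscale_cscale cscale_one)

interpretation cvp: vector_space_pair "cscale :: complex \<Rightarrow> 'a \<Rightarrow> 'a::cvec"
  "cscale :: complex \<Rightarrow> 'b \<Rightarrow> 'b::cvec" ..

abbreviation clinear :: "('a::cvec \<Rightarrow> 'b::cvec) \<Rightarrow> bool" where
  "clinear f \<equiv> Vector_Spaces.linear cscale cscale f"

lemma clinearI:
  assumes "\<And>x y. f (x + y) = f x + f y" and "\<And>c x. f (c *\<^sub>C x) = c *\<^sub>C f x"
  shows "clinear f"
  using assms by (intro Vector_Spaces.linear_iff[THEN iffD2]) (auto intro!: cvp.vector_space_pair_axioms cv.vector_space_axioms)

lemma clinearD:
  assumes "clinear f"
  shows clinear_add: "f (x + y) = f x + f y" and clinear_scale: "f (c *\<^sub>C x) = c *\<^sub>C f x"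
    and clinear_zero: "f 0 = 0" and clinear_diff: "f (x - y) = f x - f y"
    and clinear_uminus: "f (- x) = - f x" and clinear_sum: "f (sum g A) = (\<Sum>a\<in>A. f (g a))"
  using assms by (rule cvp.linear_add cvp.linear_scale cvp.linear_0 cvp.linear_diff cvp.linear_neg cvp.linear_sum)+

instantiation complex :: cvec
begin
definition cscale_complex :: "complex \<Rightarrow> complex \<Rightarrow> complex" where "cscale_complex c x = c * x"
instance by standard (auto simp: cscale_complex_def algebra_simps)
end

instantiation "fun" :: (type, cvec) cvec
begin
definition cscale_fun :: "complex \<Rightarrow> ('a \<Rightarrow> 'b) \<Rightarrow> 'a \<Rightarrow> 'b" where "cscale_fun c f = (\<lambda>x. c *\<^sub>C f x)"
instance
  by standard (auto simp: cscale_fun_def fun_eq_iff cv.scale_right_distrib cv.scale_left_distrib)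
end

lemma cscale_fun_apply [simp]: "(c *\<^sub>C f) x = c *\<^sub>C f x"
  by (simp add: cscale_fun_def)

instantiation poly_mapping :: (type, cvec) cvec
begin
definition cscale_poly_mapping :: "complex \<Rightarrow> ('a \<Rightarrow>\<^sub>0 'b) \<Rightarrow> 'a \<Rightarrow>\<^sub>0 'b" where
  "cscale_poly_mapping c p = Poly_Mapping.map ((*\<^sub>C) c) p"
instance
proof
  have L: "lookup (c *\<^sub>C p) k = c *\<^sub>C lookup p k" for c k and p :: "'a \<Rightarrow>\<^sub>0 'b"
    by (simp add: cscale_poly_mapping_def Poly_Mapping.map.rep_eq when_def)
  fix c d :: complex and x y :: "'a \<Rightarrow>\<^sub>0 'b"
  show "c *\<^sub>C (x + y) = c *\<^sub>C x + c *\<^sub>C y"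
    by (rule poly_mapping_eqI) (simp add: L lookup_add cv.scale_right_distrib)
  show "(c + d) *\<^sub>C x = c *\<^sub>C x + d *\<^sub>C x"
    by (rule poly_mapping_eqI) (simp add: L lookup_add cv.scale_left_distrib)
  show "c *\<^sub>C (d *\<^sub>C x) = (c * d) *\<^sub>C x"
    by (rule poly_mapping_eqI) (simp add: L)
  show "1 *\<^sub>C x = x"
    by (rule poly_mapping_eqI) (simp add: L)
qed
end

lemma lookup_cscale [simp]: "lookup (c *\<^sub>C p) k = c *\<^sub>C lookup p k"
  by (simp add: cscale_poly_mapping_def Poly_Mapping.map.rep_eq when_def)

lemma map_mult_eq_cscale: "Poly_Mapping.map ((*) c) p = c *\<^sub>C p"
  by (rule poly_mapping_eqI) (simp add: cscale_complex_def Poly_Mapping.map.rep_eq when_def)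

lemma single_eq_cscale_gen: "single k c = c *\<^sub>C gen k"
  by (rule poly_mapping_eqI) (simp add: lookup_single cscale_complex_def when_def)

lemma keys_cscale: "keys (c *\<^sub>C p) \<subseteq> keys (p :: 'k \<Rightarrow>\<^sub>0 complex)"
  by (auto simp: in_keys_iff cscale_complex_def)

lemma subspace_keys: "cv.subspace {p :: 'k \<Rightarrow>\<^sub>0 complex. keys p \<subseteq> Y}"
  by (auto simp only: cv.subspace_def mem_Collect_eq keys_zero empty_subsetI Un_subset_iff
      intro!: order_trans[OF keys_add] order_trans[OF keys_cscale])

lemma poly_mapping_sum_gen: "p = (\<Sum>k\<in>keys p. lookup p k *\<^sub>C gen k)"
proof (rule poly_mapping_eqI)
  fix k
  have "lookup (\<Sum>k\<in>keys p. lookup p k *\<^sub>C gen k) k =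
    (\<Sum>j\<in>keys p. if j = k then lookup p j else 0)"
    unfolding lookup_sum by (intro sum.cong) (auto simp: cscale_complex_def lookup_single)
  also have "\<dots> = lookup p k" by (simp add: in_keys_iff)
  finally show "lookup p k =
    lookup (\<Sum>k\<in>keys p. lookup p k *\<^sub>C gen k) k" by simp
qed

lemma in_subspace_gen:
  assumes "cv.subspace S" and "\<And>k. k \<in> keys p \<Longrightarrow> gen k \<in> S"
  shows "p \<in> S"
proof -
  have "(\<Sum>k\<in>keys p. lookup p k *\<^sub>C gen k) \<in> S"
    by (intro cv.subspace_sum cv.subspace_scale assms)
  then show ?thesis by (simp add: poly_mapping_sum_gen[symmetric])
qed

text \<open>Linear extension of a map given on the basis vectors \<open>gen k\<close>.\<close>

definition lin :: "('k \<Rightarrow> 'a::cvec) \<Rightarrow> ('k \<Rightarrow>\<^sub>0 complex) \<Rightarrow> 'a" where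
  "lin f p = (\<Sum>k\<in>keys p. lookup p k *\<^sub>C f k)"

lemma lin_superset:
  assumes "finite A" and "keys p \<subseteq> A"
  shows "lin f p = (\<Sum>k\<in>A. lookup p k *\<^sub>C f k)"
  unfolding lin_def using assms by (intro sum.mono_neutral_left) (auto simp: in_keys_iff)

lemma clinear_lin: "clinear (lin f)"
proof (rule clinearI)
  fix p q :: "'a \<Rightarrow>\<^sub>0 complex" and c
  let ?A = "keys p \<union> keys q"
  have "lin f p = (\<Sum>k\<in>?A. lookup p k *\<^sub>C f k)" "lin f q = (\<Sum>k\<in>?A. lookup q k *\<^sub>C f k)"
    "lin f (p + q) = (\<Sum>k\<in>?A. lookup (p + q) k *\<^sub>C f k)"
    using keys_add[of p q] by (auto intro!: lin_superset)
  then show "lin f (p + q) = lin f p + lin f q"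
    by (simp add: lookup_add cv.scale_left_distrib sum.distrib)
  have "lin f (c *\<^sub>C p) = (\<Sum>k\<in>keys p. lookup (c *\<^sub>C p) k *\<^sub>C f k)"
    by (intro lin_superset keys_cscale) auto
  then show "lin f (c *\<^sub>C p) = c *\<^sub>C lin f p"
    by (simp add: lin_def cv.scale_sum_right cscale_complex_def)
qed

lemma lin_gen [simp]: "lin f (gen k) = f k"
  by (simp add: lin_def)

lemma lin_single [simp]: "lin f (single k c) = c *\<^sub>C f k"
  by (subst single_eq_cscale_gen) (simp only: clinear_scale[OF clinear_lin] lin_gen)

lemma clinear_eq_lin:
  assumes "clinear F" shows "F p = lin (\<lambda>k. F (gen k)) p"
proof -
  have "F (\<Sum>k\<in>keys p. lookup p k *\<^sub>C gen k) = lin (\<lambda>k. F (gen k)) p"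
    by (simp add: clinear_sum[OF assms] clinear_scale[OF assms] lin_def)
  then show ?thesis by (simp add: poly_mapping_sum_gen[symmetric])
qed

lemma clinear_comp: "clinear f \<Longrightarrow> clinear g \<Longrightarrow> clinear (\<lambda>x. f (g x))"
  using Vector_Spaces.linear_compose[of cscale cscale g cscale f] by (simp add: comp_def)

lemma clinear_eqI_gen:
  assumes "clinear F" "clinear G" "\<And>k. k \<in> keys p \<Longrightarrow> F (gen k) = G (gen k)"
  shows "F p = G p"
  by (simp add: clinear_eq_lin[OF assms(1), of p] clinear_eq_lin[OF assms(2), of p] lin_def assms(3))

lemma lin_in_subspace:
  assumes "cv.subspace S" "\<And>k. k \<in> keys p \<Longrightarrow> f k \<in> S"
  shows "lin f p \<in> S"
  unfolding lin_def by (intro cv.subspace_sum cv.subspace_scale assms)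

text \<open>Linear complements over a field: a left inverse of the inclusion of \<open>S\<close>,
  defined on the whole type.\<close>

lemma projection_onto_subspace:
  fixes S :: "'a::cvec set"
  assumes "cv.subspace S"
  obtains g where "clinear g" "\<And>x. g x \<in> S" "\<And>x. x \<in> S \<Longrightarrow> g x = x"
proof -
  have "clinear (\<lambda>x::'a. x)" by (rule clinearI) auto
  from cvp.linear_exists_left_inverse_on[OF this assms] obtain g where "g ` UNIV \<subseteq> S" "clinear g" "\<forall>v\<in>S. g v = v"
    by (auto simp: inj_on_def)
  then show ?thesis using that by blast
qed

subsection \<open>Presentations of vector spaces\<close>

text \<open>\<open>pres W Z B q\<close>: the map \<open>q\<close> identifies \<open>Z\<close> modulo \<open>B\<close> with \<open>W\<close>.  This moves all work from the
  records of \<open>Defs\<close>, whose elements are iterated cosets, to subspaces of types.\<close>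

definition pres :: "(complex, 'x, 'm) module_scheme \<Rightarrow> 'a::cvec set \<Rightarrow> 'a set \<Rightarrow> ('a \<Rightarrow> 'x) \<Rightarrow> bool" where
  "pres W Z B q \<longleftrightarrow> cv.subspace Z \<and> cv.subspace B \<and> B \<subseteq> Z \<and> carrier W = q ` Z \<and> \<zero>\<^bsub>W\<^esub> = q 0 \<and>
     (\<forall>x\<in>Z. \<forall>y\<in>Z. q (x + y) = q x \<oplus>\<^bsub>W\<^esub> q y \<and> (q x = q y \<longleftrightarrow> x - y \<in> B)) \<and>
     (\<forall>c. \<forall>x\<in>Z. q (c *\<^sub>C x) = c \<odot>\<^bsub>W\<^esub> q x)"

lemma presD:
  assumes "pres W Z B q"
  shows pres_subspace: "cv.subspace Z" "cv.subspace B" and pres_subset: "B \<subseteq> Z"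
    and pres_carrier: "carrier W = q ` Z" and pres_zero: "\<zero>\<^bsub>W\<^esub> = q 0"
    and pres_add: "\<And>x y. x \<in> Z \<Longrightarrow> y \<in> Z \<Longrightarrow> q (x + y) = q x \<oplus>\<^bsub>W\<^esub> q y"
    and pres_eq: "\<And>x y. x \<in> Z \<Longrightarrow> y \<in> Z \<Longrightarrow> q x = q y \<longleftrightarrow> x - y \<in> B"
    and pres_smult: "\<And>c x. x \<in> Z \<Longrightarrow> q (c *\<^sub>C x) = c \<odot>\<^bsub>W\<^esub> q x"
  using assms by (auto simp: pres_def)

lemma pres_eq_zero: "pres W Z B q \<Longrightarrow> x \<in> Z \<Longrightarrow> q x = \<zero>\<^bsub>W\<^esub> \<longleftrightarrow> x \<in> B"
  using pres_eq[of W Z B q x 0] pres_zero[of W Z B q] pres_subspace(1)[of W Z B q] cv.subspace_0[of Z] by simp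

lemma pres_restrict:
  assumes "pres W Z B q" "cv.subspace Z'" "B \<subseteq> Z'" "Z' \<subseteq> Z" "C = q ` Z'"
  shows "pres (W\<lparr>carrier := C\<rparr>) Z' B q"
proof -
  have "x \<in> Z" if "x \<in> Z'" for x using that assms(4) by blast
  with assms show ?thesis unfolding pres_def by simp
qed

text \<open>The coset of \<open>q z\<close> modulo the image of \<open>N\<close> is the image of the
  coset of \<open>z\<close>; sums and multiples of cosets in the record thereby reduce to those of
  representatives in \<open>Z\<close>.\<close>

lemma pres_quotient:
  assumes W: "pres W Z B q" and N: "cv.subspace N" "B \<subseteq> N" "N \<subseteq> Z" and N': "N' = q ` N"
  shows "pres (quotient_space W N') Z N (\<lambda>z. N' +>\<^bsub>W\<^esub> q z)"
proof -
  note Z = pres_subspace(1)[OF W]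
  have coset: "N' +>\<^bsub>W\<^esub> q z = q ` ((+) z ` N)" if "z \<in> Z" for z
  proof -
    have "N' +>\<^bsub>W\<^esub> q z = (\<lambda>n. q n \<oplus>\<^bsub>W\<^esub> q z) ` N"
      by (auto simp: a_r_coset_def r_coset_def N')
    also have "\<dots> = (\<lambda>n. q (z + n)) ` N"
      using that N(3) by (intro image_cong refl) (subst pres_add[OF W, symmetric], auto simp: add.commute)
    finally show ?thesis by (simp add: image_image)
  qed
  have eq: "(N' +>\<^bsub>W\<^esub> q x = N' +>\<^bsub>W\<^esub> q y) \<longleftrightarrow> x - y \<in> N" if "x \<in> Z" "y \<in> Z" for x y
  proof
    assume "N' +>\<^bsub>W\<^esub> q x = N' +>\<^bsub>W\<^esub> q y"
    then have "q (x + 0) \<in> q ` ((+) y ` N)"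
      using coset that cv.subspace_0[OF N(1)] by (metis imageI)
    then obtain n where n: "n \<in> N" "q x = q (y + n)" by auto
    then have "x - (y + n) \<in> B"
      using pres_eq[OF W] that N(3) cv.subspace_add[OF Z] by (metis subsetD)
    then have "(x - (y + n)) + n \<in> N" using N n cv.subspace_add by blast
    then show "x - y \<in> N" by (simp add: algebra_simps)
  next
    assume "x - y \<in> N"
    have "(+) x ` N = (+) y ` N"
    proof -
      have "x + n = y + ((x - y) + n)" "y + n = x + (n - (x - y))" for n by auto
      moreover have "(x - y) + n \<in> N" "n - (x - y) \<in> N" if "n \<in> N" for n
        using that \<open>x - y \<in> N\<close> N(1) cv.subspace_add cv.subspace_diff by blast+
      ultimately show ?thesis by (metis (no_types, lifting) image_eqI image_subset_iff subset_antisym)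
    qed
    then show "N' +>\<^bsub>W\<^esub> q x = N' +>\<^bsub>W\<^esub> q y" using coset that by simp
  qed
  show ?thesis unfolding pres_def
  proof (intro conjI ballI allI)
    show "cv.subspace Z" "cv.subspace N" "N \<subseteq> Z" by fact+
    show "carrier (quotient_space W N') = (\<lambda>z. N' +>\<^bsub>W\<^esub> q z) ` Z"
      by (auto simp: quotient_space_def A_RCOSETS_def RCOSETS_def a_r_coset_def pres_carrier[OF W])
    show "\<zero>\<^bsub>quotient_space W N'\<^esub> = N' +>\<^bsub>W\<^esub> q 0"
      using coset[OF cv.subspace_0[OF Z]] by (simp add: quotient_space_def N')
  next
    fix x y assume xy: "x \<in> Z" "y \<in> Z"
    then have xy': "x + y \<in> Z" using cv.subspace_add[OF Z] by blast
    show "(N' +>\<^bsub>W\<^esub> q x = N' +>\<^bsub>W\<^esub> q y) = (x - y \<in> N)" by (rule eq[OF xy])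
    show "N' +>\<^bsub>W\<^esub> q (x + y) = (N' +>\<^bsub>W\<^esub> q x) \<oplus>\<^bsub>quotient_space W N'\<^esub> (N' +>\<^bsub>W\<^esub> q y)"
    proof -
      have "(N' +>\<^bsub>W\<^esub> q x) \<oplus>\<^bsub>quotient_space W N'\<^esub> (N' +>\<^bsub>W\<^esub> q y) =
        {q (x + m) \<oplus>\<^bsub>W\<^esub> q (y + n) | m n. m \<in> N \<and> n \<in> N}"
        unfolding coset[OF xy(1)] coset[OF xy(2)]
        by (auto simp: quotient_space_def set_add_def set_mult_def)
      also have "\<dots> = {q ((x + m) + (y + n)) | m n. m \<in> N \<and> n \<in> N}"
      proof -
        have "q ((x + m) + (y + n)) = q (x + m) \<oplus>\<^bsub>W\<^esub> q (y + n)" if "m \<in> N" "n \<in> N" for m n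
          using that N(3) xy by (intro pres_add[OF W] cv.subspace_add[OF Z]) auto
        then show ?thesis by (metis (no_types, lifting))
      qed
      also have "\<dots> = q ` ((+) (x + y) ` N)"
      proof -
        have "q ((x + m) + (y + n)) \<in> q ` ((+) (x + y) ` N)" if "m \<in> N" "n \<in> N" for m n
          using cv.subspace_add[OF N(1) that] by (intro imageI image_eqI[where x = "m + n"]) auto
        moreover have "q ((x + y) + n) \<in> {q ((x + m) + (y + n)) | m n. m \<in> N \<and> n \<in> N}" if "n \<in> N" for n
        proof -
          have "(x + y) + n = (x + n) + (y + 0)" by (simp add: algebra_simps)
          then show ?thesis using that cv.subspace_0[OF N(1)] by (metis (mono_tags, lifting) mem_Collect_eq)
        qed
        ultimately show ?thesis by blast
      qed
      finally show ?thesis using coset[OF xy'] by simp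
    qed
  next
    fix c x assume x: "x \<in> Z"
    then have cx: "c *\<^sub>C x \<in> Z" using cv.subspace_scale[OF Z] by blast
    have "c \<odot>\<^bsub>quotient_space W N'\<^esub> (N' +>\<^bsub>W\<^esub> q x) = (\<Union>n\<in>N. N' +>\<^bsub>W\<^esub> (c \<odot>\<^bsub>W\<^esub> q (x + n)))"
      unfolding coset[OF x] by (simp add: quotient_space_def)
    also have "\<dots> = (\<Union>n\<in>N. N' +>\<^bsub>W\<^esub> q (c *\<^sub>C x))"
    proof (intro SUP_cong refl)
      fix n assume n: "n \<in> N"
      then have xn: "x + n \<in> Z" using x N(3) cv.subspace_add[OF Z] by blast
      have "N' +>\<^bsub>W\<^esub> (c \<odot>\<^bsub>W\<^esub> q (x + n)) = N' +>\<^bsub>W\<^esub> q (c *\<^sub>C (x + n))"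
        by (simp add: pres_smult[OF W xn])
      also have "\<dots> = N' +>\<^bsub>W\<^esub> q (c *\<^sub>C x)"
        using cv.subspace_scale[OF Z xn] cv.subspace_scale[OF N(1) n] by (simp add: eq cx cv.scale_right_distrib)
      finally show "N' +>\<^bsub>W\<^esub> (c \<odot>\<^bsub>W\<^esub> q (x + n)) = N' +>\<^bsub>W\<^esub> q (c *\<^sub>C x)" .
    qed
    also have "\<dots> = N' +>\<^bsub>W\<^esub> q (c *\<^sub>C x)" using cv.subspace_0[OF N(1)] by auto
    finally show "N' +>\<^bsub>W\<^esub> q (c *\<^sub>C x) = c \<odot>\<^bsub>quotient_space W N'\<^esub> (N' +>\<^bsub>W\<^esub> q x)" by simp
  qed
qed

lemma pres_free_space: "pres (free_space Y) {p. keys p \<subseteq> Y} {0} (\<lambda>p. p)"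
  unfolding pres_def free_space_def using subspace_keys[of Y] by (auto simp: map_mult_eq_cscale)

lemma module_free_space: "Module.module complex_field (free_space Y)"
proof -
  have sub: "keys (p + q) \<subseteq> Y" if "keys p \<subseteq> Y" "keys q \<subseteq> Y"
    for p q :: "'a \<Rightarrow>\<^sub>0 complex"
    using that keys_add[of p q] by blast
  have sc: "keys (c *\<^sub>C p) \<subseteq> Y" if "keys p \<subseteq> Y" for c and p :: "'a \<Rightarrow>\<^sub>0 complex"
    using that by (auto simp: in_keys_iff cscale_complex_def subset_iff)
  have "cring complex_field" by (rule cring_from_type_algebra)
  moreover have "abelian_group (free_space Y)"
  proof (rule abelian_groupI)
    fix p assume "p \<in> carrier (free_space Y)"
    then show "\<exists>q\<in>carrier (free_space Y). q \<oplus>\<^bsub>free_space Y\<^esub> p = \<zero>\<^bsub>free_space Y\<^esub>"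
      by (intro bexI[of _ "- p"]) (simp_all add: free_space_def)
  qed (simp_all add: free_space_def sub add.assoc add.commute)
  ultimately show ?thesis
    by (intro Module.module.intro Module.module_axioms.intro)
      (simp_all add: free_space_def ring_of_type_algebra_def map_mult_eq_cscale cv.scale_left_distrib
        cv.scale_right_distrib sc)
qed

text \<open>Each span is closed in the sense of the other: the vector-space span is a submodule of
  the record, and every submodule is a subspace of the type. The former needs negation in the record
  to be the usual one.\<close>

lemma span_in_free_space:
  assumes "R \<subseteq> {p. keys p \<subseteq> Y}"
  shows "span_in (free_space Y) R = cv.span R"
proof
  have sub: "cv.span R \<subseteq> {p. keys p \<subseteq> Y}"
    by (rule cv.span_minimal[OF assms subspace_keys])
  have "a_inv (free_space Y) p = - p" if "keys p \<subseteq> Y" for p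
  proof -
    interpret Module.module complex_field "free_space Y" by (rule module_free_space)
    show ?thesis using that
      by (intro minus_equality) (auto simp: free_space_def)
  qed
  then have "submodule (cv.span R) complex_field (free_space Y)"
    using sub
    by (intro Module.module.submoduleI[OF module_free_space])
      (auto simp: free_space_def map_mult_eq_cscale cv.span_zero cv.span_neg cv.span_add cv.span_scale subset_iff)
  then show "span_in (free_space Y) R \<subseteq> cv.span R"
    by (auto simp: span_in_def cv.span_base)
  show "cv.span R \<subseteq> span_in (free_space Y) R"
    unfolding span_in_def
  proof (intro Inter_greatest)
    fix N assume "N \<in> {N. submodule N complex_field (free_space Y) \<and> R \<subseteq> N}"
    then have N: "submodule N complex_field (free_space Y)" "R \<subseteq> N" by auto
    note E = Module.module.submoduleE[OF module_free_space N(1)]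
    \<comment> \<open>A submodule is nonempty; scaling one of its members by 0 gives the zero
      vector.\<close>
    obtain x where x: "x \<in> N" using E(2) by blast
    have sc: "c *\<^sub>C y \<in> N" if "y \<in> N" for c y
      using E(4)[of c y] that by (auto simp: free_space_def ring_of_type_algebra_def map_mult_eq_cscale)
    have "cv.subspace N"
      using sc[OF x, of 0] E(5) sc by (auto simp: cv.subspace_def free_space_def)
    then show "cv.span R \<subseteq> N" using N(2) cv.span_minimal by blast
  qed
qed

lemma pres_presented_space:
  assumes "R \<subseteq> {p. keys p \<subseteq> Y}"
  shows "pres (presented_space Y R) {p. keys p \<subseteq> Y} (cv.span R)
    (\<lambda>p. cv.span R +>\<^bsub>free_space Y\<^esub> p)"
  unfolding presented_space_def span_in_free_space[OF assms]
proof (rule pres_quotient[OF pres_free_space])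
  show "{0} \<subseteq> cv.span R" by (simp add: cv.span_zero)
  show "cv.span R \<subseteq> {p. keys p \<subseteq> Y}" by (rule cv.span_minimal[OF assms subspace_keys])
qed simp_all

text \<open>The last three hypotheses say that \<open>G\<close> induces an isomorphism from
  \<open>Z\<close> modulo \<open>B\<close> to \<open>Z'\<close> modulo \<open>B'\<close>; the
  presentation is transferred against its direction.\<close>

lemma pres_pullback:
  assumes W: "pres W Z' B' q" and "cv.subspace Z" "cv.subspace B" "B \<subseteq> Z" and G: "clinear G"
    and "\<And>z. z \<in> Z \<Longrightarrow> G z \<in> Z'" and onto: "\<And>z'. z' \<in> Z' \<Longrightarrow> \<exists>z\<in>Z. G z - z' \<in> B'"
    and ker: "\<And>z. z \<in> Z \<Longrightarrow> G z \<in> B' \<longleftrightarrow> z \<in> B"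
  shows "pres W Z B (\<lambda>z. q (G z))"
proof -
  have "q ` Z' \<subseteq> (\<lambda>z. q (G z)) ` Z"
  proof
    fix x assume "x \<in> q ` Z'"
    then obtain z' where z': "z' \<in> Z'" "x = q z'" by blast
    with onto obtain z where "z \<in> Z" "G z - z' \<in> B'" by blast
    then show "x \<in> (\<lambda>z. q (G z)) ` Z" using pres_eq[OF W] z' assms(6) by (metis image_eqI)
  qed
  moreover have "x - y \<in> Z" if "x \<in> Z" "y \<in> Z" for x y using that assms cv.subspace_diff by blast
  ultimately show ?thesis
    unfolding pres_def using assms
    by (auto simp: pres_carrier[OF W] pres_zero[OF W] clinear_zero[OF G] clinear_add[OF G] clinear_scale[OF G]
        pres_add[OF W] pres_smult[OF W] pres_eq[OF W] clinear_diff[OF G, symmetric])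
qed

text \<open>Transfer in the direction of the isomorphism. The presenting map has no closed form
  here: it is \<open>q'\<close> of a chosen preimage modulo \<open>B\<close>, and \<open>ker\<close>
  makes the choice irrelevant.\<close>

lemma pres_pushforward:
  assumes W: "pres W Z' B' q'" and Z: "cv.subspace Z" "cv.subspace B" "B \<subseteq> Z" and T: "clinear \<Theta>"
    and TZ: "\<And>z. z \<in> Z' \<Longrightarrow> \<Theta> z \<in> Z" and onto: "\<And>z. z \<in> Z \<Longrightarrow> \<exists>z'\<in>Z'. \<Theta> z' - z \<in> B"
    and ker: "\<And>z. z \<in> Z' \<Longrightarrow> \<Theta> z \<in> B \<longleftrightarrow> z \<in> B'"
  obtains q where "pres W Z B q" "\<And>z. z \<in> Z' \<Longrightarrow> q (\<Theta> z) = q' z"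
proof -
  define s where "s z = (SOME z'. z' \<in> Z' \<and> \<Theta> z' - z \<in> B)" for z
  have s: "s z \<in> Z'" "\<Theta> (s z) - z \<in> B" if "z \<in> Z" for z
    using someI_ex[of "\<lambda>z'. z' \<in> Z' \<and> \<Theta> z' - z \<in> B"] onto[OF that] by (auto simp: s_def)
  note Z' = pres_subspace(1)[OF W]
  have key: "q' (s z) = q' z'" if "z \<in> Z" "z' \<in> Z'" "\<Theta> z' - z \<in> B" for z z'
  proof -
    have "(\<Theta> (s z) - z) - (\<Theta> z' - z) \<in> B" by (rule cv.subspace_diff[OF Z(2) s(2)[OF that(1)] that(3)])
    then have "\<Theta> (s z - z') \<in> B" by (simp add: clinear_diff[OF T])
    then show ?thesis
      using pres_eq[OF W s(1)[OF that(1)] that(2)] ker[OF cv.subspace_diff[OF Z' s(1)[OF that(1)] that(2)]] by blast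
  qed
  have "pres W Z B (\<lambda>z. q' (s z))"
    unfolding pres_def
  proof (intro conjI ballI allI)
    show "cv.subspace Z" "cv.subspace B" "B \<subseteq> Z" by fact+
    show "carrier W = (\<lambda>z. q' (s z)) ` Z"
      unfolding pres_carrier[OF W]
    proof (intro equalityI subsetI)
      fix x assume "x \<in> q' ` Z'"
      then obtain z' where "z' \<in> Z'" "x = q' z'" by auto
      then show "x \<in> (\<lambda>z. q' (s z)) ` Z"
        using key[of "\<Theta> z'" z'] TZ cv.subspace_0[OF Z(2)] by (auto intro!: image_eqI[where x = "\<Theta> z'"])
    qed (use s in auto)
    show "\<zero>\<^bsub>W\<^esub> = q' (s 0)"
    proof -
      have "\<Theta> 0 - 0 \<in> B" using cv.subspace_0[OF Z(2)] by (simp add: clinear_zero[OF T])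
      from key[OF cv.subspace_0[OF Z(1)] cv.subspace_0[OF Z'] this] show ?thesis by (simp only: pres_zero[OF W])
    qed
  next
    fix x y assume xy: "x \<in> Z" "y \<in> Z"
    have "q' (s (x + y)) = q' (s x + s y)"
    proof (rule key)
      have "(\<Theta> (s x) - x) + (\<Theta> (s y) - y) \<in> B" by (rule cv.subspace_add[OF Z(2) s(2)[OF xy(1)] s(2)[OF xy(2)]])
      then show "\<Theta> (s x + s y) - (x + y) \<in> B" by (simp add: clinear_add[OF T] algebra_simps)
    qed (rule cv.subspace_add[OF Z(1) xy] cv.subspace_add[OF Z' s(1)[OF xy(1)] s(1)[OF xy(2)]])+
    then show "q' (s (x + y)) = q' (s x) \<oplus>\<^bsub>W\<^esub> q' (s y)" using pres_add[OF W] s xy by simp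
    have "(q' (s x) = q' (s y)) \<longleftrightarrow> \<Theta> (s x - s y) \<in> B"
      using pres_eq[OF W s(1)[OF xy(1)] s(1)[OF xy(2)]] ker[OF cv.subspace_diff[OF Z' s(1)[OF xy(1)] s(1)[OF xy(2)]]] by blast
    also have "\<dots> \<longleftrightarrow> x - y \<in> B"
    proof -
      have *: "(\<Theta> (s x) - x) - (\<Theta> (s y) - y) \<in> B" by (rule cv.subspace_diff[OF Z(2) s(2)[OF xy(1)] s(2)[OF xy(2)]])
      have "\<Theta> (s x - s y) - (x - y) = (\<Theta> (s x) - x) - (\<Theta> (s y) - y)"
        by (simp add: clinear_diff[OF T] algebra_simps)
      with * have "\<Theta> (s x - s y) - (x - y) \<in> B" by (simp only:)
      then show ?thesis
        using cv.subspace_add[OF Z(2), of "\<Theta> (s x - s y) - (x - y)" "x - y"]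
          cv.subspace_diff[OF Z(2), of "\<Theta> (s x - s y)" "\<Theta> (s x - s y) - (x - y)"] by auto
    qed
    finally show "(q' (s x) = q' (s y)) = (x - y \<in> B)" .
  next
    fix c x assume x: "x \<in> Z"
    have "q' (s (c *\<^sub>C x)) = q' (c *\<^sub>C s x)"
    proof (rule key)
      have "c *\<^sub>C (\<Theta> (s x) - x) \<in> B" by (rule cv.subspace_scale[OF Z(2) s(2)[OF x]])
      then show "\<Theta> (c *\<^sub>C s x) - c *\<^sub>C x \<in> B" by (simp add: clinear_scale[OF T] cv.scale_right_diff_distrib)
    qed (rule cv.subspace_scale[OF Z(1) x] cv.subspace_scale[OF Z' s(1)[OF x]])+
    then show "q' (s (c *\<^sub>C x)) = c \<odot>\<^bsub>W\<^esub> q' (s x)" using pres_smult[OF W] s x by simp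
  qed
  moreover have "q' (s (\<Theta> z)) = q' z" if "z \<in> Z'" for z
    using key[of "\<Theta> z" z] TZ that cv.subspace_0[OF Z(2)] by simp
  ultimately show ?thesis using that by blast
qed

text \<open>\<open>inv_into\<close> picks an arbitrary representative; by \<open>induced_eq\<close>
  the choice does not matter as soon as \<open>F\<close> respects the denominators.\<close>

definition induced :: "('a \<Rightarrow> 'x) \<Rightarrow> 'a set \<Rightarrow> ('b \<Rightarrow> 'y) \<Rightarrow> ('a \<Rightarrow> 'b) \<Rightarrow> 'x \<Rightarrow> 'y" where
  "induced q Z q' F x = q' (F (inv_into Z q x))"

lemma induced_eq:
  assumes W: "pres W Z B q" and W': "pres W' Z' B' q'" and F: "clinear F"
    and "\<And>z. z \<in> Z \<Longrightarrow> F z \<in> Z'" and "\<And>z. z \<in> B \<Longrightarrow> F z \<in> B'" and "z \<in> Z"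
  shows "induced q Z q' F (q z) = q' (F z)"
proof -
  have "inv_into Z q (q z) \<in> Z" "q (inv_into Z q (q z)) = q z"
    using assms(6) by (auto simp: inv_into_into f_inv_into_f)
  then show ?thesis
    using assms pres_eq[OF W] pres_eq[OF W'] unfolding induced_def
    by (metis clinear_diff)
qed

lemma induced_linear:
  assumes W: "pres W Z B q" and W': "pres W' Z' B' q'" and F: "clinear F"
    and FZ: "\<And>z. z \<in> Z \<Longrightarrow> F z \<in> Z'" and FB: "\<And>z. z \<in> B \<Longrightarrow> F z \<in> B'"
  shows "induced q Z q' F \<in> linear_maps W W'"
proof -
  note [simp] = induced_eq[OF W W' F FZ FB]
  show ?thesis
    unfolding linear_maps_def pres_carrier[OF W] pres_carrier[OF W']
    using FZ cv.subspace_add[OF pres_subspace(1)[OF W]] cv.subspace_scale[OF pres_subspace(1)[OF W]]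
    by (auto simp: pres_add[OF W, symmetric] pres_smult[OF W, symmetric] clinear_add[OF F] clinear_scale[OF F]
        pres_add[OF W'] pres_smult[OF W'])
qed

text \<open>Exactness at the middle space, expressed on representatives by \<open>ex\<close>; this
  is the form in which the diagram chase is carried out.\<close>

lemma induced_exact:
  assumes W: "pres W Z B q" and W': "pres W' Z' B' q'" and W'': "pres W'' Z'' B'' q''"
    and F: "clinear F" "\<And>z. z \<in> Z \<Longrightarrow> F z \<in> Z'" "\<And>z. z \<in> B \<Longrightarrow> F z \<in> B'"
    and G: "clinear G" "\<And>z. z \<in> Z' \<Longrightarrow> G z \<in> Z''" "\<And>z. z \<in> B' \<Longrightarrow> G z \<in> B''"
    and ex: "\<And>z'. z' \<in> Z' \<Longrightarrow> G z' \<in> B'' \<longleftrightarrow> (\<exists>z\<in>Z. F z - z' \<in> B')"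
  shows "induced q Z q' F ` carrier W = a_kernel W' W'' (induced q' Z' q'' G)"
proof -
  have "a_kernel W' W'' (induced q' Z' q'' G) = {q' z' | z'. z' \<in> Z' \<and> G z' \<in> B''}"
    unfolding a_kernel_def' pres_carrier[OF W']
    using induced_eq[OF W' W'' G] pres_eq_zero[OF W''] G(2) by auto
  also have "\<dots> = {q' z' | z'. \<exists>z\<in>Z. z' \<in> Z' \<and> q' (F z) = q' z'}"
    using ex pres_eq[OF W'] F(2) by blast
  also have "\<dots> = (\<lambda>z. q' (F z)) ` Z" using F(2) by force
  also have "\<dots> = induced q Z q' F ` carrier W"
    unfolding pres_carrier[OF W] image_image using induced_eq[OF W W' F] by (intro image_cong) auto
  finally show ?thesis by simp
qed

section \<open>Polynomials and monomial ideals\<close>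

lemma cscale_eq_Const_mult: "c *\<^sub>C p = Const c * p"
  by (simp add: map_mult_eq_cscale[symmetric] mult_map_scale_conv_mult Const_def)

lemma cscale_mult_left: "(c *\<^sub>C p) * q = c *\<^sub>C (p * q :: 'v cpoly)"
  unfolding cscale_eq_Const_mult by (rule mult.assoc)

lemma cscale_mult_right: "p * (c *\<^sub>C q) = c *\<^sub>C (p * q :: 'v cpoly)"
  unfolding cscale_eq_Const_mult by (rule mult.left_commute)

lemma clinear_mult: "clinear (\<lambda>p. a * p :: 'v cpoly)"
  by (rule clinearI) (rule distrib_left cscale_mult_right)+

lemma gen_mult_gen: "gen m * gen n = (gen (m + n) :: 'v cpoly)"
  by (simp add: mult_single)

definition mdeg :: "('v \<Rightarrow>\<^sub>0 nat) \<Rightarrow> nat" where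
  "mdeg m = (\<Sum>v\<in>keys m. lookup m v)"

lemma keys_plus_nat: "keys (m + n) = keys m \<union> keys (n :: 'v \<Rightarrow>\<^sub>0 nat)"
  by (auto simp: in_keys_iff lookup_add)

lemma mdeg_plus: "mdeg (m + n) = mdeg m + mdeg n"
proof -
  let ?A = "keys m \<union> keys n"
  have "mdeg m = (\<Sum>v\<in>?A. lookup m v)" "mdeg n = (\<Sum>v\<in>?A. lookup n v)"
    unfolding mdeg_def by (auto intro!: sum.mono_neutral_left simp: in_keys_iff)
  then show ?thesis by (simp add: mdeg_def keys_plus_nat lookup_add sum.distrib)
qed

lemma mdeg_single [simp]: "mdeg (single v k) = k"
  by (simp add: mdeg_def)

lemma mdeg_0 [simp]: "mdeg 0 = 0"
  by (simp add: mdeg_def)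

lemma monomial_induct [case_names zero Var]:
  assumes "P 0" and "\<And>v m. P m \<Longrightarrow> P (single v 1 + m)"
  shows "P (m :: 'v \<Rightarrow>\<^sub>0 nat)"
proof (induction "mdeg m" arbitrary: m)
  case 0
  then have "m = 0" by (auto simp: mdeg_def in_keys_iff intro: poly_mapping_eqI)
  then show ?case using assms(1) by simp
next
  case (Suc k)
  then have "m \<noteq> 0" by auto
  then obtain v where v: "v \<in> keys m" by (metis mdeg_def nat.distinct(1) Suc.hyps(2) sum.empty equals0I)
  define n where "n = m - single v 1"
  \<comment> \<open>Subtraction of exponents truncates at 0, which is harmless as \<open>v\<close>
    occurs in \<open>m\<close>.\<close>
  have m: "m = single v 1 + n"
    using v by (intro poly_mapping_eqI) (auto simp: n_def lookup_add lookup_minus lookup_single when_def in_keys_iff)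
  then have "k = mdeg n" using Suc.hyps(2) by (simp add: mdeg_plus)
  then show ?case using Suc.hyps(1) assms(2) m by metis
qed

lemma gen_Var: "gen (single v 1 + m) = Var v * gen m"
  by (simp add: Var_def gen_mult_gen)

lemma homogeneous_iff: "p \<in> homogeneous s \<longleftrightarrow> keys p \<subseteq> {m. int (mdeg m) = s}"
  by (auto simp: homogeneous_def mdeg_def)

lemma subspace_homogeneous: "cv.subspace (homogeneous s)"
  using subspace_keys[of "{m. int (mdeg m) = s}"] by (simp add: homogeneous_iff[symmetric])

lemmas homogeneous_closed = cv.subspace_0[OF subspace_homogeneous] cv.subspace_add[OF subspace_homogeneous]
  cv.subspace_diff[OF subspace_homogeneous] cv.subspace_neg[OF subspace_homogeneous]
  cv.subspace_scale[OF subspace_homogeneous] cv.subspace_sum[OF subspace_homogeneous]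

lemma homogeneous_mult:
  assumes "p \<in> homogeneous s" "q \<in> homogeneous t" shows "p * q \<in> homogeneous (s + t)"
  using assms keys_mult[of p q] unfolding homogeneous_iff by (fastforce simp: mdeg_plus)

lemma homogeneous_gen: "gen m \<in> homogeneous (int (mdeg m))"
  by (simp add: homogeneous_iff)

lemma homogeneous_Var: "Var v \<in> homogeneous 1"
  by (simp add: homogeneous_iff Var_def)

lemma homogeneous_one: "1 \<in> homogeneous 0"
  by (simp add: homogeneous_iff)

lemma homogeneous_sign: "p \<in> homogeneous s \<Longrightarrow> (-1) ^ n * p \<in> homogeneous s"
  by (cases "even n") (auto simp: homogeneous_closed)

text \<open>A span of monomials; it is an ideal once \<open>bad\<close> is \<open>upward\<close>.
  Congruences modulo it replace computations in quotient rings.\<close>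

definition mono_ideal :: "(('v \<Rightarrow>\<^sub>0 nat) \<Rightarrow> bool) \<Rightarrow> 'v cpoly set" where
  "mono_ideal bad = {p. keys p \<subseteq> Collect bad}"

lemma subspace_mono_ideal: "cv.subspace (mono_ideal bad)"
  unfolding mono_ideal_def by (rule subspace_keys)

lemmas mono_ideal_closed = cv.subspace_0[OF subspace_mono_ideal] cv.subspace_add[OF subspace_mono_ideal]
  cv.subspace_diff[OF subspace_mono_ideal] cv.subspace_neg[OF subspace_mono_ideal]
  cv.subspace_scale[OF subspace_mono_ideal] cv.subspace_sum[OF subspace_mono_ideal]

lemma gen_in_mono_ideal: "gen m \<in> mono_ideal bad \<longleftrightarrow> bad m"
  by (simp add: mono_ideal_def)

definition upward :: "(('v \<Rightarrow>\<^sub>0 nat) \<Rightarrow> bool) \<Rightarrow> bool" where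
  "upward bad \<longleftrightarrow> (\<forall>m n. bad m \<longrightarrow> bad (n + m))"

lemma mono_ideal_mult:
  assumes "upward bad" "p \<in> mono_ideal bad" shows "q * p \<in> mono_ideal bad"
  using assms keys_mult[of q p] unfolding mono_ideal_def upward_def by fastforce

lemma mono_ideal_mult2:
  assumes "upward bad" "p \<in> mono_ideal bad" shows "p * q \<in> mono_ideal bad"
  using mono_ideal_mult[OF assms, of q] by (simp add: mult.commute)

lemma mono_ideal_mono: "(\<And>m. bad m \<Longrightarrow> bad' m) \<Longrightarrow> mono_ideal bad \<subseteq> mono_ideal bad'"
  by (auto simp: mono_ideal_def)

text \<open>Projection onto the span of the good monomials. If good means not bad, this is the
  normal form modulo \<open>mono_ideal bad\<close>.\<close>

definition tr :: "(('v \<Rightarrow>\<^sub>0 nat) \<Rightarrow> bool) \<Rightarrow> 'v cpoly \<Rightarrow> 'v cpoly" where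
  "tr good = lin (\<lambda>m. if good m then gen m else 0)"

lemma clinear_tr: "clinear (tr good)"
  unfolding tr_def by (rule clinear_lin)

lemmas tr_simps = clinear_add[OF clinear_tr] clinear_diff[OF clinear_tr] clinear_zero[OF clinear_tr]
  clinear_uminus[OF clinear_tr] clinear_sum[OF clinear_tr] clinear_scale[OF clinear_tr]

lemma tr_gen: "tr good (gen m) = (if good m then gen m else 0)"
  by (simp add: tr_def)

lemma lookup_tr: "lookup (tr good p) m = (if good m then lookup p m else 0)"
proof -
  have "lookup (tr good p) m =
    (\<Sum>k\<in>keys p. if k = m then (if good m then lookup p k else 0) else 0)"
    unfolding tr_def lin_def lookup_sum by (intro sum.cong) (auto simp: cscale_complex_def lookup_single)
  also have "\<dots> = (if good m then lookup p m else 0)" by (simp add: in_keys_iff)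
  finally show ?thesis .
qed

lemma keys_tr: "keys (tr good p) = {m \<in> keys p. good m}"
  by (auto simp: in_keys_iff lookup_tr split: if_splits)

lemma tr_eq_0_iff: "tr good p = 0 \<longleftrightarrow> p \<in> mono_ideal (\<lambda>m. \<not> good m)"
  unfolding mono_ideal_def keys_eq_empty[symmetric] keys_tr by auto

lemma tr_tr: "tr g (tr h p) = tr (\<lambda>m. g m \<and> h m) p"
  by (rule poly_mapping_eqI) (auto simp: lookup_tr)

lemma diff_tr_in_mono_ideal: "p - tr good p \<in> mono_ideal (\<lambda>m. \<not> good m)"
  by (auto simp: mono_ideal_def in_keys_iff lookup_minus lookup_tr)

lemma tr_homogeneous: "p \<in> homogeneous s \<Longrightarrow> tr good p \<in> homogeneous s"
  by (auto simp: homogeneous_iff keys_tr)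

lemma tr_in_mono_ideal: "p \<in> mono_ideal bad \<Longrightarrow> tr good p \<in> mono_ideal bad"
  by (auto simp: mono_ideal_def keys_tr)

subsection \<open>Substitution\<close>

definition subst_mono :: "('v \<Rightarrow> 'w cpoly) \<Rightarrow> ('v \<Rightarrow>\<^sub>0 nat) \<Rightarrow> 'w cpoly" where
  "subst_mono \<theta> m = (\<Prod>v\<in>keys m. \<theta> v ^ lookup m v)"

lemma subst_mono_superset:
  "finite A \<Longrightarrow> keys m \<subseteq> A \<Longrightarrow> subst_mono \<theta> m = (\<Prod>v\<in>A. \<theta> v ^ lookup m v)"
  unfolding subst_mono_def by (rule prod.mono_neutral_left) (auto simp: in_keys_iff)

lemma subst_mono_plus: "subst_mono \<theta> (m + n) = subst_mono \<theta> m * subst_mono \<theta> n"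
proof -
  let ?A = "keys m \<union> keys n"
  have "subst_mono \<theta> (m + n) = (\<Prod>v\<in>?A. \<theta> v ^ lookup (m + n) v)"
    "subst_mono \<theta> m = (\<Prod>v\<in>?A. \<theta> v ^ lookup m v)"
    "subst_mono \<theta> n = (\<Prod>v\<in>?A. \<theta> v ^ lookup n v)"
    by (auto intro!: subst_mono_superset simp: keys_plus_nat)
  then show ?thesis by (simp add: lookup_add power_add prod.distrib)
qed

lemma substitute_eq_lin: "substitute \<theta> = lin (subst_mono \<theta>)"
  by (simp add: fun_eq_iff substitute_def lin_def subst_mono_def cscale_eq_Const_mult)

lemma clinear_substitute: "clinear (substitute \<theta>)"
  unfolding substitute_eq_lin by (rule clinear_lin)

lemmas substitute_linear = clinear_add[OF clinear_substitute] clinear_diff[OF clinear_substitute]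
  clinear_zero[OF clinear_substitute] clinear_uminus[OF clinear_substitute]
  clinear_sum[OF clinear_substitute] clinear_scale[OF clinear_substitute]

lemma substitute_gen: "substitute \<theta> (gen m) = subst_mono \<theta> m"
  by (simp add: substitute_eq_lin)

text \<open>Both sides are linear in each factor, so products of monomials suffice; commutativity
  reduces the second factor to the first.\<close>

lemma substitute_mult: "substitute \<theta> (p * q) = substitute \<theta> p * substitute \<theta> q"
proof -
  have 1: "substitute \<theta> (gen m * q) = substitute \<theta> (gen m) * substitute \<theta> q" for m q
  proof (rule clinear_eqI_gen[of "\<lambda>q. substitute \<theta> (gen m * q)" "\<lambda>q. substitute \<theta> (gen m) * substitute \<theta> q"])
    show "substitute \<theta> (gen m * gen k) = substitute \<theta> (gen m) * substitute \<theta> (gen k)" for k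
      by (simp only: gen_mult_gen substitute_gen subst_mono_plus)
  qed (rule clinear_comp[OF clinear_substitute clinear_mult] clinear_comp[OF clinear_mult clinear_substitute])+
  have "substitute \<theta> (q * p) = substitute \<theta> q * substitute \<theta> p"
  proof (rule clinear_eqI_gen[of "\<lambda>p. substitute \<theta> (q * p)" "\<lambda>p. substitute \<theta> q * substitute \<theta> p"])
    show "substitute \<theta> (q * gen k) = substitute \<theta> q * substitute \<theta> (gen k)" for k
      by (simp only: 1 mult.commute[of q] mult.commute[of "substitute \<theta> q"])
  qed (rule clinear_comp[OF clinear_substitute clinear_mult] clinear_comp[OF clinear_mult clinear_substitute])+
  then show ?thesis by (simp only: mult.commute)
qed

lemma substitute_one: "substitute \<theta> 1 = 1"
  using substitute_gen[of \<theta> 0] by (simp add: subst_mono_def)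

lemma substitute_Var: "substitute \<theta> (Var v) = \<theta> v"
  unfolding Var_def substitute_gen by (simp add: subst_mono_def)

lemma substitute_Const: "substitute \<theta> (Const c) = Const c"
proof -
  have "Const c = c *\<^sub>C 1" for c :: complex by (simp add: cscale_eq_Const_mult)
  then show ?thesis by (metis substitute_linear(6) substitute_one cscale_eq_Const_mult mult.right_neutral)
qed

lemma substitute_power: "substitute \<theta> (p ^ n) = substitute \<theta> p ^ n"
  by (induction n) (auto simp: substitute_one substitute_mult)

lemma substitute_prod: "substitute \<theta> (prod f A) = (\<Prod>a\<in>A. substitute \<theta> (f a))"
  by (induction A rule: infinite_finite_induct) (auto simp: substitute_one substitute_mult)

lemma substitute_substitute: "substitute \<eta> (substitute \<theta> p) = substitute (\<lambda>v. substitute \<eta> (\<theta> v)) p"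
  by (rule clinear_eqI_gen[of "\<lambda>p. substitute \<eta> (substitute \<theta> p)"])
    (auto intro!: clinear_comp[OF clinear_substitute] clinear_substitute
      simp: substitute_gen subst_mono_def substitute_prod substitute_power)

lemma substitute_cong:
  assumes "\<And>m v. m \<in> keys p \<Longrightarrow> v \<in> keys m \<Longrightarrow> \<theta> v = \<eta> v"
  shows "substitute \<theta> p = substitute \<eta> p"
  by (rule clinear_eqI_gen[OF clinear_substitute clinear_substitute])
    (auto simp: substitute_gen subst_mono_def assms)

lemma subst_mono_Var: "subst_mono Var m = gen m"
proof (induction m rule: monomial_induct)
  case zero show ?case by (simp add: subst_mono_def)
next
  case (Var v m)
  have "subst_mono Var (single v 1) = Var v" by (simp add: subst_mono_def)
  then show ?case using Var by (simp only: subst_mono_plus gen_Var)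
qed

lemma substitute_Var_id: "substitute Var p = p"
  by (rule clinear_eqI_gen[where G = "\<lambda>p. p"])
    (auto intro!: clinear_substitute clinearI simp: substitute_gen subst_mono_Var)

lemma substitute_gen_Var: "substitute \<theta> (gen (single v 1 + m)) = \<theta> v * substitute \<theta> (gen m)"
  by (simp only: gen_Var substitute_mult substitute_Var)

lemma substitute_homogeneous:
  assumes "\<And>v. \<theta> v \<in> homogeneous 1" "p \<in> homogeneous s"
  shows "substitute \<theta> p \<in> homogeneous s"
proof -
  have "substitute \<theta> (gen m) \<in> homogeneous (int (mdeg m))" for m
  proof (induction m rule: monomial_induct)
    case zero show ?case using homogeneous_one by (simp add: substitute_one)
  next
    case (Var v m)
    show ?case using homogeneous_mult[OF assms(1)[of v] Var] by (simp only: substitute_gen_Var mdeg_plus mdeg_single of_nat_add) simp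
  qed
  then show ?thesis using assms(2) unfolding substitute_eq_lin homogeneous_iff[of p]
    by (intro lin_in_subspace subspace_homogeneous) (auto simp: substitute_eq_lin)
qed

lemma substitute_in_mono_ideal:
  assumes "\<And>m. m \<in> keys p \<Longrightarrow> substitute \<theta> (gen m) \<in> mono_ideal bad"
  shows "substitute \<theta> p \<in> mono_ideal bad"
  using assms unfolding substitute_eq_lin
  by (intro lin_in_subspace subspace_mono_ideal) auto

section \<open>Koszul complexes\<close>

text \<open>A chain assigns to a set \<open>S\<close> of indices the coefficient of the wedge of the corresponding
  Koszul variables, in the order of the list \<open>js\<close>.\<close>

type_synonym 'v chain = "int set \<Rightarrow> 'v cpoly"

text \<open>The sign of sorting \<open>i\<close> into \<open>S\<close>: it counts the members of
  \<open>S\<close> that precede \<open>i\<close> in \<open>js\<close>.\<close>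

definition sg :: "int list \<Rightarrow> int \<Rightarrow> 'v chain" where
  "sg js i S = (- 1) ^ length (filter (\<lambda>k. k \<in> S) (takeWhile (\<lambda>k. k \<noteq> i) js))"

text \<open>The Koszul differential on coefficients: the value at \<open>S\<close> collects the
  contractions of all \<open>insert i S\<close>. Its sign is opposite to that of
  \<open>koszul_diff_free\<close>, which changes neither cycles nor boundaries.\<close>

definition dK :: "int list \<Rightarrow> (int \<Rightarrow> 'v cpoly) \<Rightarrow> ('v chain) \<Rightarrow> 'v chain" where
  "dK js L c = (\<lambda>S. \<Sum>i\<in>set js - S. sg js i S * (L i * c (insert i S)))"

lemma takeWhile_neq_tournament:
  "i \<in> set js \<Longrightarrow> j \<in> set js \<Longrightarrow> i \<noteq> j \<Longrightarrow>
    i \<in> set (takeWhile (\<lambda>k. k \<noteq> j) js) \<longleftrightarrow> j \<notin> set (takeWhile (\<lambda>k. k \<noteq> i) js)"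
  by (induction js) (auto dest: set_takeWhileD)

lemma length_filter_insert:
  "distinct xs \<Longrightarrow> i \<notin> S \<Longrightarrow> length (filter (\<lambda>k. k \<in> insert i S) xs) =
    length (filter (\<lambda>k. k \<in> S) xs) + (if i \<in> set xs then 1 else 0)"
  by (induction xs) auto

lemma sg_insert:
  assumes "distinct js" "j \<notin> S"
  shows "sg js i (insert j S) = (if j \<in> set (takeWhile (\<lambda>k. k \<noteq> i) js) then - sg js i S else sg js i S :: 'v cpoly)"
  using length_filter_insert[OF distinct_takeWhile[OF assms(1)] assms(2), of "\<lambda>k. k \<noteq> i"]
  unfolding sg_def by simp

text \<open>Inserting \<open>i\<close> flips the sign that belongs to \<open>j\<close> only if
  \<open>i\<close> precedes \<open>j\<close>. Exactly one of the two precedes the other, so exactly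
  one sign flips.\<close>

lemma sg_anticommute:
  assumes "distinct js" "i \<in> set js" "j \<in> set js" "i \<noteq> j" "i \<notin> S" "j \<notin> S"
  shows "sg js i S * sg js j (insert i S) = - (sg js j S * sg js i (insert j S) :: 'v cpoly)"
  using takeWhile_neq_tournament[OF assms(2-4)] by (simp add: sg_insert assms mult.commute)

lemma sg_square: "sg js i S * sg js i S = (1 :: 'v cpoly)"
  by (simp add: sg_def flip: power_add)

lemma sg_homogeneous: "p \<in> homogeneous s \<Longrightarrow> sg js i S * p \<in> homogeneous s"
  unfolding sg_def by (rule homogeneous_sign)

lemma sg_in_subspace: "cv.subspace V \<Longrightarrow> p \<in> V \<Longrightarrow> sg js i S * p \<in> V"
  unfolding sg_def by (cases "even (length (filter (\<lambda>k. k \<in> S) (takeWhile (\<lambda>k. k \<noteq> i) js)))")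
    (auto simp: cv.subspace_neg)

lemma clinear_dK: "clinear (dK js L)"
  by (rule clinearI) (auto simp: dK_def fun_eq_iff algebra_simps sum.distrib cscale_mult_right cv.scale_sum_right)

lemmas dK_simps = clinear_add[OF clinear_dK] clinear_diff[OF clinear_dK] clinear_zero[OF clinear_dK]
  clinear_uminus[OF clinear_dK] clinear_sum[OF clinear_dK] clinear_scale[OF clinear_dK]

lemma eq_uminus_self_iff: "x = - x \<longleftrightarrow> x = (0 :: 'a::cvec)"
proof
  assume "x = - x"
  then have "(1 + 1) *\<^sub>C x = 0" by (metis cv.scale_left_distrib cv.scale_one add.right_inverse)
  then show "x = 0" by simp
qed auto

text \<open>Exchanging the two summations shows that the sum equals its negative.\<close>

lemma sum_antisymmetric:
  fixes f :: "'i \<Rightarrow> 'i \<Rightarrow> 'a::cvec"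
  assumes "finite A" and "\<And>i j. i \<in> A \<Longrightarrow> j \<in> A \<Longrightarrow> i \<noteq> j \<Longrightarrow> f j i = - f i j"
  shows "(\<Sum>i\<in>A. \<Sum>j\<in>A - {i}. f i j) = 0"
proof -
  have "(\<Sum>i\<in>A. \<Sum>j\<in>A - {i}. f i j) = (\<Sum>j\<in>A. \<Sum>i\<in>A - {j}. f i j)"
  proof -
    have *: "A - {i} = {j \<in> A. i \<noteq> j}" "A - {i} = {j \<in> A. j \<noteq> i}" for i by auto
    show ?thesis
      using sum.swap_restrict[OF assms(1,1), of f "\<lambda>i j. i \<noteq> j"] unfolding *(1)[symmetric] *(2)[symmetric] .
  qed
  also have "\<dots> = (\<Sum>j\<in>A. \<Sum>i\<in>A - {j}. - f j i)"
    by (intro sum.cong refl assms(2)) auto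
  finally show ?thesis by (simp add: sum_negf eq_uminus_self_iff)
qed

lemma dK_dK:
  assumes "distinct js" shows "dK js L (dK js L c) = 0"
proof
  fix S
  define f where "f i j = sg js i S * (L i * (sg js j (insert i S) * (L j * c (insert j (insert i S)))))" for i j
  have f: "f j i = - f i j" if "i \<in> set js - S" "j \<in> set js - S" "i \<noteq> j" for i j
  proof -
    have "f j i = (sg js j S * sg js i (insert j S)) * (L i * L j * c (insert j (insert i S)))"
      unfolding f_def insert_commute[of i j] by (simp only: mult_ac)
    also have "sg js j S * sg js i (insert j S) = - (sg js i S * sg js j (insert i S) :: 'a cpoly)"
      using that by (intro sg_anticommute assms) auto
    finally show ?thesis unfolding f_def by (simp only: mult_minus_left mult_minus_right mult_ac)
  qed
  have "dK js L (dK js L c) S = (\<Sum>i\<in>set js - S. \<Sum>j\<in>(set js - S) - {i}. f i j)"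
  proof -
    have "set js - insert i S = (set js - S) - {i}" for i by blast
    then show ?thesis by (simp only: dK_def sum_distrib_left f_def)
  qed
  also have "\<dots> = 0" by (rule sum_antisymmetric) (auto intro: f)
  finally show "dK js L (dK js L c) S = 0 S" by (simp only: zero_fun_apply)
qed

text \<open>Chains of exterior degree \<open>t\<close> with coefficients of polynomial degree
  \<open>s\<close>. With integer degrees the space is zero as soon as one of them is negative, in
  agreement with \<open>tor\<close>.\<close>

definition Ch :: "int list \<Rightarrow> int \<Rightarrow> int \<Rightarrow> ('v chain) set" where
  "Ch js t s = {c. \<forall>S. c S \<in> homogeneous s \<and> (c S \<noteq> 0 \<longrightarrow> S \<subseteq> set js \<and> int (card S) = t)}"

definition IC :: "(('v \<Rightarrow>\<^sub>0 nat) \<Rightarrow> bool) \<Rightarrow> ('v chain) set" where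
  "IC bad = {c. \<forall>S. c S \<in> mono_ideal bad}"

text \<open>Cycles of the quotient by the ideal, lifted to polynomial chains: the differential has
  to vanish only modulo the ideal.\<close>

definition Zc :: "int list \<Rightarrow> (int \<Rightarrow> 'v cpoly) \<Rightarrow> (('v \<Rightarrow>\<^sub>0 nat) \<Rightarrow> bool) \<Rightarrow> int \<Rightarrow> int \<Rightarrow> ('v chain) set" where
  "Zc js L bad t s = {c \<in> Ch js t s. dK js L c \<in> IC bad}"

text \<open>The summand \<open>i\<close> counts all chains over the ideal as boundaries, so that
  \<open>Zc\<close> modulo \<open>Bd\<close> is the homology of the quotient complex.\<close>

definition Bd :: "int list \<Rightarrow> (int \<Rightarrow> 'v cpoly) \<Rightarrow> (('v \<Rightarrow>\<^sub>0 nat) \<Rightarrow> bool) \<Rightarrow> int \<Rightarrow> int \<Rightarrow> ('v chain) set" where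
  "Bd js L bad t s = {dK js L b + i | b i. b \<in> Ch js (t + 1) (s - 1) \<and> i \<in> Ch js t s \<and> i \<in> IC bad}"

lemma subspace_Ch: "cv.subspace (Ch js t s)"
  unfolding cv.subspace_def
proof (intro conjI ballI allI)
  fix x y :: "int set \<Rightarrow> 'a cpoly" assume "x \<in> Ch js t s" "y \<in> Ch js t s"
  moreover have "x S \<noteq> 0 \<or> y S \<noteq> 0" if "x S + y S \<noteq> 0" for S using that by auto
  ultimately show "x + y \<in> Ch js t s" unfolding Ch_def by (simp add: homogeneous_closed) blast
qed (simp_all add: Ch_def homogeneous_closed)

lemma subspace_IC: "cv.subspace (IC bad)"
  unfolding cv.subspace_def IC_def by (auto simp: mono_ideal_closed)

lemmas Ch_closed = cv.subspace_0[OF subspace_Ch] cv.subspace_add[OF subspace_Ch]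
  cv.subspace_diff[OF subspace_Ch] cv.subspace_neg[OF subspace_Ch]
  cv.subspace_scale[OF subspace_Ch] cv.subspace_sum[OF subspace_Ch]

lemmas IC_closed = cv.subspace_0[OF subspace_IC] cv.subspace_add[OF subspace_IC]
  cv.subspace_diff[OF subspace_IC] cv.subspace_neg[OF subspace_IC]
  cv.subspace_scale[OF subspace_IC] cv.subspace_sum[OF subspace_IC]

lemma subspace_Zc: "cv.subspace (Zc js L bad t s)"
  unfolding cv.subspace_def Zc_def by (auto simp: Ch_closed IC_closed dK_simps)

lemma BdI: "b \<in> Ch js (t + 1) (s - 1) \<Longrightarrow> i \<in> Ch js t s \<Longrightarrow> i \<in> IC bad \<Longrightarrow> dK js L b + i \<in> Bd js L bad t s"
  unfolding Bd_def by blast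

lemma subspace_Bd: "cv.subspace (Bd js L bad t s)"
  unfolding cv.subspace_def
proof (intro conjI ballI allI)
  show "0 \<in> Bd js L bad t s"
    using BdI[of 0 js t s 0 bad L] by (simp add: Ch_closed IC_closed dK_simps)
next
  fix x y assume "x \<in> Bd js L bad t s" "y \<in> Bd js L bad t s"
  then obtain b i b' i' where *: "x = dK js L b + i" "b \<in> Ch js (t + 1) (s - 1)" "i \<in> Ch js t s" "i \<in> IC bad"
    "y = dK js L b' + i'" "b' \<in> Ch js (t + 1) (s - 1)" "i' \<in> Ch js t s" "i' \<in> IC bad"
    unfolding Bd_def by blast
  then have eq: "x + y = dK js L (b + b') + (i + i')" by (simp add: dK_simps algebra_simps)
  show "x + y \<in> Bd js L bad t s" unfolding eq using * by (intro BdI Ch_closed IC_closed)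
next
  fix c x assume "x \<in> Bd js L bad t s"
  then obtain b i where *: "x = dK js L b + i" "b \<in> Ch js (t + 1) (s - 1)" "i \<in> Ch js t s" "i \<in> IC bad"
    unfolding Bd_def by blast
  then have eq: "c *\<^sub>C x = dK js L (c *\<^sub>C b) + c *\<^sub>C i" by (simp add: dK_simps cv.scale_right_distrib)
  show "c *\<^sub>C x \<in> Bd js L bad t s" unfolding eq using * by (intro BdI Ch_closed IC_closed)
qed

lemmas Zc_closed = cv.subspace_0[OF subspace_Zc] cv.subspace_add[OF subspace_Zc]
  cv.subspace_diff[OF subspace_Zc] cv.subspace_neg[OF subspace_Zc]
  cv.subspace_scale[OF subspace_Zc] cv.subspace_sum[OF subspace_Zc]

lemmas Bd_closed = cv.subspace_0[OF subspace_Bd] cv.subspace_add[OF subspace_Bd]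
  cv.subspace_diff[OF subspace_Bd] cv.subspace_neg[OF subspace_Bd]
  cv.subspace_scale[OF subspace_Bd] cv.subspace_sum[OF subspace_Bd]

lemma dK_Ch:
  assumes "\<And>i. i \<in> set js \<Longrightarrow> L i \<in> homogeneous 1" "c \<in> Ch js t s"
  shows "dK js L c \<in> Ch js (t - 1) (s + 1)"
  unfolding Ch_def
proof (intro CollectI allI conjI impI)
  fix S
  have "L i * c (insert i S) \<in> homogeneous (s + 1)" if "i \<in> set js" for i
    using homogeneous_mult[OF assms(1)[OF that], of "c (insert i S)" s] assms(2) by (simp add: Ch_def add.commute)
  then show "dK js L c S \<in> homogeneous (s + 1)"
    unfolding dK_def by (intro homogeneous_closed(6) sg_homogeneous) auto
  assume "dK js L c S \<noteq> 0"
  then obtain i where i: "i \<in> set js" "i \<notin> S" "c (insert i S) \<noteq> 0"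
    unfolding dK_def by (metis (no_types, lifting) DiffE mult_zero_right sum.neutral)
  then have *: "insert i S \<subseteq> set js" "int (card (insert i S)) = t" using assms(2) by (auto simp: Ch_def)
  then have "finite S" using finite_subset[OF *(1)] by simp
  then show "S \<subseteq> set js" "int (card S) = t - 1" using * i by auto
qed

lemma dK_IC:
  assumes "upward bad" "c \<in> IC bad" shows "dK js L c \<in> IC bad"
proof -
  have "sg js i S * (L i * c (insert i S)) \<in> mono_ideal bad" for i S
    using assms by (intro sg_in_subspace subspace_mono_ideal mono_ideal_mult) (auto simp: IC_def)
  then show ?thesis by (simp add: IC_def dK_def mono_ideal_closed(6))
qed

lemma dK_cong_mod:
  assumes "upward bad" "\<And>i. i \<in> set js \<Longrightarrow> L i - L' i \<in> mono_ideal bad"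
  shows "dK js L c - dK js L' c \<in> IC bad"
proof -
  have "dK js L c S - dK js L' c S = (\<Sum>i\<in>set js - S. sg js i S * ((L i - L' i) * c (insert i S)))" for S
    by (simp add: dK_def algebra_simps sum_subtractf)
  moreover have "sg js i S * ((L i - L' i) * c (insert i S)) \<in> mono_ideal bad" if "i \<in> set js" for i S
    by (rule sg_in_subspace[OF subspace_mono_ideal mono_ideal_mult2[OF assms(1) assms(2)[OF that]]])
  ultimately show ?thesis by (auto simp: IC_def intro!: mono_ideal_closed(6))
qed

lemma Bd_subset_Zc:
  assumes "distinct js" "upward bad" "\<And>i. i \<in> set js \<Longrightarrow> L i \<in> homogeneous 1"
  shows "Bd js L bad t s \<subseteq> Zc js L bad t s"
proof
  fix x assume "x \<in> Bd js L bad t s"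
  then obtain b i where *: "x = dK js L b + i" "b \<in> Ch js (t + 1) (s - 1)" "i \<in> Ch js t s" "i \<in> IC bad"
    unfolding Bd_def by blast
  have "dK js L b \<in> Ch js t s" using dK_Ch[OF assms(3) *(2)] by simp
  moreover have "dK js L x \<in> IC bad"
    using dK_IC[OF assms(2) *(4)] by (simp add: *(1) dK_simps(1) dK_dK[OF assms(1)])
  ultimately show "x \<in> Zc js L bad t s"
    using * by (simp add: Zc_def Ch_closed)
qed

lemma IC_subset_Bd: "c \<in> Ch js t s \<Longrightarrow> c \<in> IC bad \<Longrightarrow> c \<in> Bd js L bad t s"
  using BdI[where b = 0 and i = c] by (simp add: Ch_closed dK_simps)

lemma Zc_cong_mod:
  assumes "upward bad" "\<And>i. i \<in> set js \<Longrightarrow> L i - L' i \<in> mono_ideal bad"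
  shows "Zc js L bad t s = Zc js L' bad t s"
proof -
  have "dK js L c \<in> IC bad \<longleftrightarrow> dK js L' c \<in> IC bad" for c
  proof -
    have *: "dK js L c - dK js L' c \<in> IC bad" using assms by (rule dK_cong_mod)
    show ?thesis
      using IC_closed(3)[OF _ *, of "dK js L c"] IC_closed(2)[OF *, of "dK js L' c"] by auto
  qed
  then show ?thesis by (auto simp: Zc_def)
qed

definition mapc :: "('v \<Rightarrow> 'w cpoly) \<Rightarrow> ('v chain) \<Rightarrow> 'w chain" where
  "mapc \<theta> c = (\<lambda>S. substitute \<theta> (c S))"

lemma clinear_mapc: "clinear (mapc \<theta>)"
  by (rule clinearI) (auto simp: mapc_def substitute_linear)

lemma substitute_sg: "substitute \<theta> (sg js i S) = sg js i S"
  by (simp add: sg_def substitute_power substitute_linear substitute_one)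

lemma mapc_dK: "mapc \<theta> (dK js L c) = dK js (\<lambda>i. substitute \<theta> (L i)) (mapc \<theta> c)"
  by (simp only: mapc_def dK_def substitute_linear substitute_sg substitute_mult)

lemma mapc_Ch:
  assumes "\<And>v. \<theta> v \<in> homogeneous 1" "c \<in> Ch js t s" shows "mapc \<theta> c \<in> Ch js t s"
proof -
  have "c S \<noteq> 0" if "substitute \<theta> (c S) \<noteq> 0" for S
    using that by (auto simp: substitute_linear)
  moreover have "substitute \<theta> (c S) \<in> homogeneous s" for S
    using assms by (intro substitute_homogeneous) (auto simp: Ch_def)
  ultimately show ?thesis using assms(2) by (simp add: Ch_def mapc_def)
qed

lemma mapc_IC:
  assumes "\<And>m. bad m \<Longrightarrow> substitute \<theta> (gen m) \<in> mono_ideal bad'" "c \<in> IC bad"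
  shows "mapc \<theta> c \<in> IC bad'"
proof -
  have "substitute \<theta> (c S) \<in> mono_ideal bad'" for S
  proof (rule substitute_in_mono_ideal)
    fix m assume "m \<in> keys (c S)"
    then have "bad m" using assms(2) by (auto simp: IC_def mono_ideal_def)
    then show "substitute \<theta> (gen m) \<in> mono_ideal bad'" by (rule assms(1))
  qed
  then show ?thesis by (simp add: IC_def mapc_def)
qed

subsection \<open>Exterior multiplication\<close>

text \<open>Creation and annihilation: \<open>cr\<close> wedges from the left with the basis vector
  of index \<open>i\<close>, \<open>an\<close> contracts with it. In these terms the differential is
  a sum of annihilations (\<open>dK_eq_an\<close>).\<close>

definition cr :: "int list \<Rightarrow> int \<Rightarrow> ('v chain) \<Rightarrow> 'v chain" where
  "cr js i c = (\<lambda>S. if i \<in> S then sg js i (S - {i}) * c (S - {i}) else 0)"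

definition an :: "int list \<Rightarrow> int \<Rightarrow> ('v chain) \<Rightarrow> 'v chain" where
  "an js i c = (\<lambda>S. if i \<in> S then 0 else sg js i S * c (insert i S))"

definition scal :: "'v cpoly \<Rightarrow> ('v chain) \<Rightarrow> 'v chain" where
  "scal q c = (\<lambda>S. q * c S)"

lemma clinear_cr: "clinear (cr js i)"
  by (rule clinearI) (auto simp: cr_def fun_eq_iff distrib_left cscale_mult_right)

lemma clinear_an: "clinear (an js i)"
  by (rule clinearI) (auto simp: an_def fun_eq_iff distrib_left cscale_mult_right)

lemma clinear_scal: "clinear (scal q)"
  by (rule clinearI) (auto simp: scal_def fun_eq_iff distrib_left cscale_mult_right)

lemma scal_add_left: "scal (p + q) c = scal p c + scal q c"
  by (simp add: scal_def fun_eq_iff distrib_right)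

lemma scal_cscale_left: "scal (k *\<^sub>C q) c = k *\<^sub>C scal q c"
  by (simp add: scal_def fun_eq_iff cscale_mult_left)

lemma scal_zero_left: "scal 0 c = 0"
  by (simp add: scal_def fun_eq_iff)

lemma scal_sum_left: "scal (\<Sum>i\<in>A. f i) c = (\<Sum>i\<in>A. scal (f i) c)"
  by (induction A rule: infinite_finite_induct) (auto simp: scal_add_left scal_zero_left)

lemma scal_cr: "scal q (cr js i c) = cr js i (scal q c)"
  by (simp add: scal_def cr_def fun_eq_iff mult.left_commute)

lemma sum_fun_apply: "(\<Sum>i\<in>A. f i) x = (\<Sum>i\<in>A. f i x)"
  by (induction A rule: infinite_finite_induct) auto

lemma dK_eq_an: "dK js L c = (\<Sum>i\<in>set js. scal (L i) (an js i c))"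
proof
  fix S
  have "(\<Sum>i\<in>set js. scal (L i) (an js i c)) S = (\<Sum>i\<in>set js. if i \<in> S then 0 else sg js i S * (L i * c (insert i S)))"
    unfolding sum_fun_apply by (intro sum.cong) (auto simp: scal_def an_def mult.left_commute)
  also have "\<dots> = dK js L c S"
    unfolding dK_def by (rule sum.mono_neutral_cong_right) auto
  finally show "dK js L c S = (\<Sum>i\<in>set js. scal (L i) (an js i c)) S" by simp
qed

lemma sg_mult_cancel: "sg js i S * (sg js i S * p) = p"
  by (simp add: mult.assoc[symmetric] sg_square)

text \<open>\<open>sg_anticommute\<close> solved for another pair of signs, using that signs square
  to 1.\<close>

lemma sg_rearrange:
  assumes "distinct js" "i \<in> set js" "j \<in> set js" "i \<noteq> j" "i \<notin> S" "j \<notin> S"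
  shows "sg js i (insert j S) * (sg js j (insert i S) * p) = - (sg js j S * (sg js i S * p))"
proof -
  have A: "sg js i S * sg js j (insert i S) = - (sg js j S * sg js i (insert j S) :: 'a cpoly)"
    by (rule sg_anticommute[OF assms])
  have "sg js i (insert j S) * (sg js j (insert i S) * p) =
    sg js i (insert j S) * sg js i S * ((sg js i S * sg js j (insert i S)) * p)"
    by (simp only: mult.assoc sg_mult_cancel)
  also have "\<dots> = - (sg js i (insert j S) * (sg js i (insert j S) * (sg js j S * (sg js i S * p))))"
    unfolding A by (simp only: mult_minus_left mult_minus_right mult_ac)
  finally show ?thesis by (simp only: sg_mult_cancel)
qed

text \<open>With \<open>an_cr_distinct\<close> these are the canonical anticommutation relations,
  from which the Leibniz rule \<open>dK_wl\<close> follows.\<close>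

lemma an_cr_same: "an js i (cr js i c) + cr js i (an js i c) = c"
proof
  fix S show "(an js i (cr js i c) + cr js i (an js i c)) S = c S"
    by (cases "i \<in> S") (auto simp: an_def cr_def sg_mult_cancel insert_absorb)
qed

lemma an_cr_distinct:
  assumes "distinct js" "i \<in> set js" "j \<in> set js" "i \<noteq> j"
  shows "an js i (cr js j c) + cr js j (an js i c) = 0"
proof
  fix S
  show "(an js i (cr js j c) + cr js j (an js i c)) S = 0 S"
  proof (cases "i \<notin> S \<and> j \<in> S")
    case True
    define S' where "S' = S - {j}"
    have S: "S = insert j S'" "j \<notin> S'" "i \<notin> S'" using True by (auto simp: S'_def)
    have i: "insert i S - {j} = insert i S'" using S assms(4) by auto
    have "an js i (cr js j c) S = sg js i (insert j S') * (sg js j (insert i S') * c (insert i S'))"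
      using True i by (simp add: an_def cr_def S(1)[symmetric])
    moreover have "cr js j (an js i c) S = sg js j S' * (sg js i S' * c (insert i S'))"
      using True S(3) by (simp add: an_def cr_def S'_def[symmetric])
    ultimately show ?thesis using sg_rearrange[OF assms S(3,2), of "c (insert i S')"] by simp
  next
    case False
    then show ?thesis using assms(4) by (auto simp: an_def cr_def)
  qed
qed

lemma cr_cr_same: "cr js i (cr js i c) = 0"
  by (simp add: cr_def fun_eq_iff)

lemma cr_cr_distinct:
  assumes "distinct js" "i \<in> set js" "j \<in> set js" "i \<noteq> j"
  shows "cr js i (cr js j c) = - cr js j (cr js i c)"
proof
  fix S
  show "cr js i (cr js j c) S = (- cr js j (cr js i c)) S"
  proof (cases "i \<in> S \<and> j \<in> S")
    case True
    define S' where "S' = S - {i} - {j}"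
    have S: "S - {i} = insert j S'" "S - {j} = insert i S'" "S - {j} - {i} = S'" "S - {i} - {j} = S'"
      "insert j S' - {j} = S'" "insert i S' - {i} = S'" "j \<notin> S'" "i \<notin> S'"
      using True assms(4) by (auto simp: S'_def)
    have "sg js i (insert j S') * (sg js j S' * c S') = - (sg js j (insert i S') * (sg js i S' * c S'))"
    proof -
      \<comment> \<open>The square of a sign is inserted to reach the shape of
        \<open>sg_rearrange\<close>.\<close>
      have "sg js i (insert j S') * (sg js j S' * c S') =
        sg js i (insert j S') * (sg js j (insert i S') * (sg js j (insert i S') * (sg js j S' * c S')))"
        by (simp only: sg_mult_cancel)
      also have "\<dots> = - (sg js j S' * (sg js i S' * (sg js j (insert i S') * (sg js j S' * c S'))))"
        by (rule sg_rearrange[OF assms S(8,7)])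
      also have "\<dots> = - (sg js j (insert i S') * (sg js i S' * (sg js j S' * (sg js j S' * c S'))))"
        by (simp only: mult_ac)
      finally show ?thesis by (simp only: sg_mult_cancel)
    qed
    then show ?thesis using True assms(4) S by (simp add: cr_def)
  next
    case False
    then show ?thesis by (auto simp: cr_def)
  qed
qed

lemma cr_Ch:
  assumes "i \<in> set js" "c \<in> Ch js t s" shows "cr js i c \<in> Ch js (t + 1) s"
  unfolding Ch_def
proof (intro CollectI allI conjI impI)
  fix S
  show "cr js i c S \<in> homogeneous s"
    using assms(2) by (auto simp: cr_def Ch_def sg_homogeneous homogeneous_closed)
  assume "cr js i c S \<noteq> 0"
  then have S: "i \<in> S" "c (S - {i}) \<noteq> 0" by (auto simp: cr_def split: if_splits)
  then have *: "S - {i} \<subseteq> set js" "int (card (S - {i})) = t" using assms(2) by (auto simp: Ch_def)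
  then have "finite S" using finite_subset[OF *(1)] by simp
  then show "S \<subseteq> set js" "int (card S) = t + 1" using * S(1) assms(1) card_Suc_Diff1[of S i] by auto
qed

lemma cr_IC: "c \<in> IC bad \<Longrightarrow> cr js i c \<in> IC bad"
  by (auto simp: IC_def cr_def mono_ideal_closed intro!: sg_in_subspace subspace_mono_ideal)

lemma cscale_gen: "c *\<^sub>C gen k = single k c"
  by (rule single_eq_cscale_gen[symmetric])

section \<open>Koszul homology of a presented module\<close>

text \<open>What is needed to compute \<open>tor\<close> with chains: \<open>V\<close> has the basis
  \<open>bs\<close> with coordinates \<open>cf\<close>; the pieces of \<open>A\<close> are images
  under \<open>g\<close> of homogeneous polynomials, in variables that may differ from those of
  \<open>V\<close>, with the span of the bad monomials as kernel; and \<open>bs i\<close> acts as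
  multiplication by \<open>L i\<close>.\<close>

locale koszul_setup =
  fixes js :: "int list" and bs :: "int \<Rightarrow> 'v cpoly" and V :: "'v cpoly set" and cf :: "int \<Rightarrow> 'v cpoly \<Rightarrow> complex"
    and A :: "('v cpoly, 'b) graded_module" and g :: "'w cpoly \<Rightarrow> 'b"
    and bad :: "('w \<Rightarrow>\<^sub>0 nat) \<Rightarrow> bool" and L :: "int \<Rightarrow> 'w cpoly"
  assumes dist: "distinct js" and up: "upward bad" and L1: "\<And>i. i \<in> set js \<Longrightarrow> L i \<in> homogeneous 1"
    and V_bs: "\<And>i. i \<in> set js \<Longrightarrow> bs i \<in> V"
    and V_sub: "cv.subspace V"
    and V_exp: "\<And>l. l \<in> V \<Longrightarrow> l = (\<Sum>i\<in>set js. cf i l *\<^sub>C bs i)"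
    and cf_add: "\<And>i l l'. l \<in> V \<Longrightarrow> l' \<in> V \<Longrightarrow> cf i (l + l') = cf i l + cf i l'"
    and cf_scale: "\<And>i l c. l \<in> V \<Longrightarrow> cf i (c *\<^sub>C l) = c * cf i l"
    and cf_bs: "\<And>i j. i \<in> set js \<Longrightarrow> j \<in> set js \<Longrightarrow> cf i (bs j) = (if i = j then 1 else 0)"
    and g_piece: "\<And>s. piece A s = g ` homogeneous s"
    and g_add: "\<And>p q. g (p + q) = g p \<oplus>\<^bsub>A\<^esub> g q"
    and g_scale: "\<And>c p. g (c *\<^sub>C p) = Const c \<odot>\<^bsub>A\<^esub> g p"
    and g_eq: "\<And>p q. g p = g q \<longleftrightarrow> p - q \<in> mono_ideal bad"
    and g_act: "\<And>l p. l \<in> V \<Longrightarrow> l \<odot>\<^bsub>A\<^esub> g p = g ((\<Sum>i\<in>set js. cf i l *\<^sub>C L i) * p)"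
begin

definition Lam :: "'v cpoly \<Rightarrow> 'w cpoly" where
  "Lam l = (\<Sum>i\<in>set js. cf i l *\<^sub>C L i)"

lemma Lam_homogeneous: "Lam l \<in> homogeneous 1"
  unfolding Lam_def by (intro homogeneous_closed L1)

definition wl :: "'v cpoly \<Rightarrow> ('w chain) \<Rightarrow> 'w chain" where
  "wl l c = (\<Sum>i\<in>set js. cf i l *\<^sub>C cr js i c)"

text \<open>The chain of \<open>p\<close> times a wedge of arbitrary forms, each form being expanded
  in the basis.\<close>

primrec w :: "'v cpoly list \<Rightarrow> 'w cpoly \<Rightarrow> 'w chain" where
  "w [] p = (\<lambda>S. if S = {} then p else 0)"
| "w (l # ls) p = wl l (w ls p)"

lemma clinear_wl: "clinear (wl l)"
  unfolding wl_def
  by (rule clinearI)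
    (simp_all add: clinear_add[OF clinear_cr] clinear_scale[OF clinear_cr] cv.scale_right_distrib sum.distrib
      cv.scale_sum_right mult.commute)

lemma clinear_w: "clinear (w ls)"
proof (induction ls)
  case Nil show ?case by (rule clinearI) (auto simp: fun_eq_iff)
next
  case (Cons l ls)
  have "w (l # ls) = (\<lambda>p. wl l (w ls p))" by (rule ext) simp
  then show ?case using clinear_comp[OF clinear_wl Cons] by (simp only:)
qed

lemma wl_add: "l \<in> V \<Longrightarrow> l' \<in> V \<Longrightarrow> wl (l + l') c = wl l c + wl l' c"
  by (simp add: wl_def cf_add cv.scale_left_distrib sum.distrib)

lemma wl_cscale: "l \<in> V \<Longrightarrow> wl (k *\<^sub>C l) c = k *\<^sub>C wl l c"
  by (simp add: wl_def cf_scale cv.scale_sum_right)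

lemma wl_bs: "i \<in> set js \<Longrightarrow> wl (bs i) c = cr js i c"
proof -
  assume i: "i \<in> set js"
  have "wl (bs i) c = (\<Sum>j\<in>set js. if j = i then cr js j c else 0)"
    unfolding wl_def by (intro sum.cong refl) (simp add: cf_bs i)
  then show ?thesis using i by simp
qed

lemma wl_wl_anticommute: "wl l (wl l' c) = - wl l' (wl l c)"
proof -
  have "wl l (wl l' c) = (\<Sum>i\<in>set js. \<Sum>j\<in>set js. (cf i l * cf j l') *\<^sub>C cr js i (cr js j c))"
    by (simp add: wl_def clinear_sum[OF clinear_cr] clinear_scale[OF clinear_cr] cv.scale_sum_right)
  also have "\<dots> = (\<Sum>j\<in>set js. \<Sum>i\<in>set js. (cf i l * cf j l') *\<^sub>C cr js i (cr js j c))"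
    by (rule sum.swap)
  also have "\<dots> = (\<Sum>j\<in>set js. \<Sum>i\<in>set js. - ((cf j l' * cf i l) *\<^sub>C cr js j (cr js i c)))"
  proof (intro sum.cong refl)
    fix i j assume ij: "i \<in> set js" "j \<in> set js"
    show "(cf i l * cf j l') *\<^sub>C cr js i (cr js j c) = - ((cf j l' * cf i l) *\<^sub>C cr js j (cr js i c))"
      using cr_cr_distinct[OF dist ij, of c] by (cases "i = j") (simp_all add: cr_cr_same mult.commute)
  qed
  also have "\<dots> = - wl l' (wl l c)"
    by (simp add: wl_def clinear_sum[OF clinear_cr] clinear_scale[OF clinear_cr] cv.scale_sum_right sum_negf)
  finally show ?thesis .
qed

lemma wl_wl_same: "wl l (wl l c) = 0"
  using wl_wl_anticommute[of l l c] by (simp only: eq_uminus_self_iff)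

text \<open>The outer form is moved inward by anticommutation until it meets its copy.\<close>

lemma wl_w_member: "l \<in> set ls \<Longrightarrow> wl l (w ls p) = 0"
proof (induction ls)
  case (Cons l' ls)
  show ?case
  proof (cases "l = l'")
    case True then show ?thesis by (simp add: wl_wl_same)
  next
    case False
    then have "wl l (w ls p) = 0" using Cons.IH Cons.prems by (metis set_ConsD)
    then have "wl l (wl l' (w ls p)) = - wl l' 0" using wl_wl_anticommute[of l l' "w ls p"] by metis
    then show ?thesis by (simp only: w.simps clinear_zero[OF clinear_wl] minus_zero)
  qed
qed simp

lemma w_not_distinct: "\<not> distinct ls \<Longrightarrow> w ls p = 0"
  by (induction ls) (auto simp: wl_w_member clinear_zero[OF clinear_wl])

lemma w_add_slot: "l \<in> V \<Longrightarrow> l' \<in> V \<Longrightarrow> w (us @ (l + l') # vs) p = w (us @ l # vs) p + w (us @ l' # vs) p"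
  by (induction us) (auto simp: wl_add clinear_add[OF clinear_wl])

lemma w_cscale_slot: "l \<in> V \<Longrightarrow> w (us @ (k *\<^sub>C l) # vs) p = k *\<^sub>C w (us @ l # vs) p"
  by (induction us) (auto simp: wl_cscale clinear_scale[OF clinear_wl])

lemma w_scal: "scal q (w ls p) = w ls (q * p)"
proof (induction ls)
  case Nil show ?case by (auto simp: scal_def fun_eq_iff)
next
  case (Cons l ls)
  have "scal q (wl l c) = wl l (scal q c)" for c
    by (simp add: wl_def clinear_sum[OF clinear_scal] clinear_scale[OF clinear_scal] scal_cr)
  then show ?case using Cons by simp
qed

lemma w_Ch: "p \<in> homogeneous s \<Longrightarrow> w ls p \<in> Ch js (int (length ls)) s"
proof (induction ls)
  case Nil then show ?case by (auto simp: Ch_def homogeneous_closed)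
next
  case (Cons l ls)
  then have "wl l (w ls p) \<in> Ch js (int (length ls) + 1) s"
    unfolding wl_def by (intro Ch_closed cr_Ch) auto
  then show ?case by (simp add: add.commute)
qed

lemma w_IC: "p \<in> mono_ideal bad \<Longrightarrow> w ls p \<in> IC bad"
proof (induction ls)
  case Nil then show ?case by (auto simp: IC_def mono_ideal_closed)
next
  case (Cons l ls)
  then show ?case by (simp add: wl_def IC_closed cr_IC)
qed

text \<open>The differential is an antiderivation. In the sum of both orders only the
  anticommutators of \<open>an\<close> and \<open>cr\<close> remain, and these are 1 or 0.\<close>

lemma dK_wl: "dK js L (wl l c) = scal (Lam l) c - wl l (dK js L c)"
proof -
  have cr_scal: "cr js j (scal q c') = scal q (cr js j c')" for j q c' by (simp only: scal_cr)
  have "dK js L (wl l c) + wl l (dK js L c) =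
    (\<Sum>i\<in>set js. \<Sum>j\<in>set js. cf j l *\<^sub>C scal (L i) (an js i (cr js j c))) +
    (\<Sum>j\<in>set js. \<Sum>i\<in>set js. cf j l *\<^sub>C scal (L i) (cr js j (an js i c)))"
    by (simp add: dK_eq_an wl_def clinear_sum[OF clinear_cr] clinear_sum[OF clinear_an] clinear_sum[OF clinear_scal]
       clinear_scale[OF clinear_an] clinear_scale[OF clinear_scal] cv.scale_sum_right cr_scal)
  also have "(\<Sum>j\<in>set js. \<Sum>i\<in>set js. cf j l *\<^sub>C scal (L i) (cr js j (an js i c))) =
     (\<Sum>i\<in>set js. \<Sum>j\<in>set js. cf j l *\<^sub>C scal (L i) (cr js j (an js i c)))" by (rule sum.swap)
  also have "(\<Sum>i\<in>set js. \<Sum>j\<in>set js. cf j l *\<^sub>C scal (L i) (an js i (cr js j c))) + \<dots> =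
     (\<Sum>i\<in>set js. \<Sum>j\<in>set js. cf j l *\<^sub>C scal (L i) (an js i (cr js j c) + cr js j (an js i c)))"
    by (simp add: clinear_add[OF clinear_scal] cv.scale_right_distrib sum.distrib)
  also have "\<dots> = (\<Sum>i\<in>set js. \<Sum>j\<in>set js. if j = i then cf j l *\<^sub>C scal (L i) c else 0)"
  proof (intro sum.cong refl)
    fix i j assume ij: "i \<in> set js" "j \<in> set js"
    show "cf j l *\<^sub>C scal (L i) (an js i (cr js j c) + cr js j (an js i c)) =
      (if j = i then cf j l *\<^sub>C scal (L i) c else 0)"
    proof (cases "j = i")
      case True then show ?thesis by (simp only: an_cr_same refl if_True)
    next
      case False
      then have "an js i (cr js j c) + cr js j (an js i c) = 0" by (intro an_cr_distinct[OF dist ij]) simp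
      then show ?thesis using False by (simp only: if_False clinear_zero[OF clinear_scal] cv.scale_zero_right)
    qed
  qed
  also have "\<dots> = (\<Sum>i\<in>set js. cf i l *\<^sub>C scal (L i) c)" by simp
  also have "\<dots> = scal (Lam l) c" by (simp add: Lam_def scal_sum_left scal_cscale_left)
  finally show ?thesis by (simp only: eq_diff_eq)
qed

text \<open>Iterated Leibniz rule: the alternating sum by which the Koszul differential is defined
  on generators, up to the global sign.\<close>

lemma dK_w: "dK js L (w ls p) = (\<Sum>j<length ls. (-1) ^ j *\<^sub>C w (take j ls @ drop (Suc j) ls) (Lam (ls ! j) * p))"
proof (induction ls)
  case Nil
  have "dK js L (w [] p) S = 0" for S unfolding dK_def by (rule sum.neutral) auto
  then show ?case by (simp add: fun_eq_iff)
next
  case (Cons l ls)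
  have "dK js L (w (l # ls) p) = w ls (Lam l * p) - wl l (dK js L (w ls p))"
    by (simp add: dK_wl w_scal)
  also have "wl l (dK js L (w ls p)) =
    (\<Sum>j<length ls. (-1) ^ j *\<^sub>C w (l # take j ls @ drop (Suc j) ls) (Lam (ls ! j) * p))"
    unfolding Cons.IH by (simp only: clinear_sum[OF clinear_wl] clinear_scale[OF clinear_wl] w.simps append_Cons)
  finally show ?case
    by (simp only: length_Cons sum.lessThan_Suc_shift power_0 cv.scale_one take_0 append_Nil drop_0 drop_Suc_Cons
        nth_Cons_0 nth_Cons_Suc take_Suc_Cons append_Cons power_Suc mult_minus1 cv.scale_minus_left sum_negf
        diff_conv_add_uminus)
qed

definition bS :: "int set \<Rightarrow> 'v cpoly list" where
  "bS S = map bs (filter (\<lambda>i. i \<in> S) js)"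

text \<open>Induction over the suffixes of \<open>js\<close>: the new index precedes all indices
  wedged so far and therefore contributes the sign 1.\<close>

lemma w_bS_suffix:
  assumes "js = ys @ xs"
  shows "w (map bs (filter (\<lambda>i. i \<in> S) xs)) p = (\<lambda>S'. if S' = S \<inter> set xs then p else 0)"
  using assms
proof (induction xs arbitrary: ys)
  case Nil show ?case by (simp only: filter.simps list.map w.simps list.set Int_empty_right)
next
  case (Cons i xs)
  have IH: "w (map bs (filter (\<lambda>i. i \<in> S) xs)) p = (\<lambda>S'. if S' = S \<inter> set xs then p else 0)"
    by (rule Cons.IH[of "ys @ [i]"]) (simp add: Cons.prems)
  have i: "i \<notin> set ys" "i \<notin> set xs" "set ys \<inter> set xs = {}" "i \<in> set js" using dist Cons.prems by auto
  show ?case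
  proof (cases "i \<in> S")
    case False
    then have "S \<inter> set (i # xs) = S \<inter> set xs" by auto
    then show ?thesis using IH False by simp
  next
    case True
    have "takeWhile (\<lambda>k. k \<noteq> i) js = ys"
      unfolding Cons.prems using i(1) by (subst takeWhile_append2) auto
    then have sg1: "sg js i (S \<inter> set xs) = (1 :: 'w cpoly)"
    proof -
      have "filter (\<lambda>k. k \<in> S \<inter> set xs) ys = []" using i(3) by (auto simp: filter_empty_conv)
      with \<open>takeWhile (\<lambda>k. k \<noteq> i) js = ys\<close> show ?thesis by (simp add: sg_def)
    qed
    have "cr js i (\<lambda>S'. if S' = S \<inter> set xs then p else 0) = (\<lambda>S'. if S' = insert i (S \<inter> set xs) then p else 0)"
    proof
      fix S'
      have "S' = insert i (S \<inter> set xs) \<longleftrightarrow> i \<in> S' \<and> S' - {i} = S \<inter> set xs"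
        using i(2) by blast
      then show "cr js i (\<lambda>S'. if S' = S \<inter> set xs then p else 0) S' = (if S' = insert i (S \<inter> set xs) then p else 0)"
        using sg1 by (simp add: cr_def)
    qed
    moreover have "S \<inter> set (i # xs) = insert i (S \<inter> set xs)" using True by auto
    ultimately show ?thesis using True IH i(4) by (simp add: wl_bs)
  qed
qed

lemma w_bS: "S \<subseteq> set js \<Longrightarrow> w (bS S) p = (\<lambda>S'. if S' = S then p else 0)"
  using w_bS_suffix[of "[]" js S p] by (simp add: bS_def Int_absorb2)

lemma length_bS: "S \<subseteq> set js \<Longrightarrow> length (bS S) = card S"
proof -
  assume "S \<subseteq> set js"
  then have "set (filter (\<lambda>i. i \<in> S) js) = S" by auto
  then show ?thesis using distinct_card[OF distinct_filter[OF dist, of "\<lambda>i. i \<in> S"]] by (simp add: bS_def)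
qed

lemma bS_V: "set (bS S) \<subseteq> V"
  using V_bs by (auto simp: bS_def)

end

section \<open>The presented Koszul space is isomorphic to a space of chains\<close>

context koszul_setup begin

abbreviation NR :: "int \<Rightarrow> int \<Rightarrow> ('b \<times> 'v cpoly list \<Rightarrow>\<^sub>0 complex) set" where
  "NR t s \<equiv> cv.span (koszul_relations V A t s)"

text \<open>A linear map with kernel the relations; it turns congruences modulo relations into equations.\<close>

definition Q :: "int \<Rightarrow> int \<Rightarrow> ('b \<times> 'v cpoly list \<Rightarrow>\<^sub>0 complex) \<Rightarrow> 'b \<times> 'v cpoly list \<Rightarrow>\<^sub>0 complex" where
  "Q t s = (SOME f. clinear f \<and> (\<forall>x. f x = 0 \<longleftrightarrow> x \<in> NR t s))"

lemma Q: "clinear (Q t s)" "Q t s x = 0 \<longleftrightarrow> x \<in> NR t s"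
proof -
  \<comment> \<open>Subtracting a projection onto the relations leaves a linear map whose kernel is
    exactly the span of the relations.\<close>
  obtain P where P: "clinear P" "\<And>x. P x \<in> NR t s" "\<And>x. x \<in> NR t s \<Longrightarrow> P x = x"
    using projection_onto_subspace[OF cv.subspace_span] by blast
  have 1: "clinear (\<lambda>x. x - P x)"
    by (rule clinearI) (simp_all add: clinear_add[OF P(1)] clinear_scale[OF P(1)] cv.scale_right_diff_distrib)
  have 2: "\<forall>x. x - P x = 0 \<longleftrightarrow> x \<in> NR t s"
    using P(2,3) by (metis eq_iff_diff_eq_0)
  have "\<exists>f :: _ \<Rightarrow> 'b \<times> 'v cpoly list \<Rightarrow>\<^sub>0 complex. clinear f \<and> (\<forall>x. f x = 0 \<longleftrightarrow> x \<in> NR t s)"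
    by (intro exI[of _ "\<lambda>x. x - P x"] conjI 1 2)
  from someI_ex[OF this] show "clinear (Q t s)" "Q t s x = 0 \<longleftrightarrow> x \<in> NR t s" by (auto simp: Q_def)
qed

lemma Q_eq: "Q t s x = Q t s y \<longleftrightarrow> x - y \<in> NR t s"
  by (simp add: Q(2)[symmetric] clinear_diff[OF Q(1)])

lemma generators_iff: "(a, ls) \<in> koszul_generators V A t s \<longleftrightarrow> a \<in> piece A s \<and> set ls \<subseteq> V \<and> int (length ls) = t"
  by (simp add: koszul_generators_def)

lemma g_in_piece: "p \<in> homogeneous s \<Longrightarrow> g p \<in> piece A s"
  by (simp add: g_piece)

text \<open>The class of a generator. The relations of \<open>koszul_relations\<close> turn into
  equations between values of \<open>E\<close>.\<close>

definition E :: "int \<Rightarrow> int \<Rightarrow> 'v cpoly list \<Rightarrow> 'w cpoly \<Rightarrow> 'b \<times> 'v cpoly list \<Rightarrow>\<^sub>0 complex" where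
  "E t s ls p = Q t s (gen (g p, ls))"

lemma V_add: "l \<in> V \<Longrightarrow> l' \<in> V \<Longrightarrow> l + l' \<in> V" and V_scale: "l \<in> V \<Longrightarrow> c *\<^sub>C l \<in> V" and V_0: "0 \<in> V"
  by (rule cv.subspace_add[OF V_sub] cv.subspace_scale[OF V_sub] cv.subspace_0[OF V_sub]; assumption)+

lemma relation_add:
  assumes "(a, ls) \<in> koszul_generators V A t s" "(a', ls) \<in> koszul_generators V A t s"
  shows "gen (a \<oplus>\<^bsub>A\<^esub> a', ls) - gen (a, ls) - gen (a', ls) \<in> NR t s"
  by (rule cv.span_base) (use assms in \<open>unfold koszul_relations_def, blast\<close>)

lemma relation_scale:
  assumes "(a, ls) \<in> koszul_generators V A t s"
  shows "gen (Const c \<odot>\<^bsub>A\<^esub> a, ls) - single (a, ls) c \<in> NR t s"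
  by (rule cv.span_base) (use assms in \<open>unfold koszul_relations_def, blast\<close>)

lemma relation_slot_add:
  assumes "(a, us @ l # vs) \<in> koszul_generators V A t s" "l' \<in> V"
  shows "gen (a, us @ (l + l') # vs) - gen (a, us @ l # vs) - gen (a, us @ l' # vs) \<in> NR t s"
  by (rule cv.span_base) (use assms in \<open>unfold koszul_relations_def, blast\<close>)

lemma relation_slot_scale:
  assumes "(a, us @ l # vs) \<in> koszul_generators V A t s"
  shows "gen (a, us @ (Const c * l) # vs) - single (a, us @ l # vs) c \<in> NR t s"
  by (rule cv.span_base) (use assms in \<open>unfold koszul_relations_def, blast\<close>)

lemma relation_alternating:
  assumes "(a, ls) \<in> koszul_generators V A t s" "\<not> distinct ls"
  shows "gen (a, ls) \<in> NR t s"
  by (rule cv.span_base) (use assms in \<open>unfold koszul_relations_def, blast\<close>)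

lemma koszul_relations_cases:
  assumes "x \<in> koszul_relations V A t s"
  obtains (add) a a' ls where "x = gen (a \<oplus>\<^bsub>A\<^esub> a', ls) - gen (a, ls) - gen (a', ls)"
      "(a, ls) \<in> koszul_generators V A t s" "(a', ls) \<in> koszul_generators V A t s"
  | (scale) c a ls where "x = gen (Const c \<odot>\<^bsub>A\<^esub> a, ls) - single (a, ls) c"
      "(a, ls) \<in> koszul_generators V A t s"
  | (slot_add) a us k k' vs where "x = gen (a, us @ (k + k') # vs) - gen (a, us @ k # vs) - gen (a, us @ k' # vs)"
      "(a, us @ k # vs) \<in> koszul_generators V A t s" "k' \<in> V"
  | (slot_scale) c a us k vs where "x = gen (a, us @ (Const c * k) # vs) - single (a, us @ k # vs) c"
      "(a, us @ k # vs) \<in> koszul_generators V A t s"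
  | (alternating) a ls where "x = gen (a, ls)" "(a, ls) \<in> koszul_generators V A t s" "\<not> distinct ls"
  using assms unfolding koszul_relations_def by blast

lemma Q_relations:
  assumes "(a, ls) \<in> koszul_generators V A t s"
  shows "(a', ls) \<in> koszul_generators V A t s \<Longrightarrow>
      Q t s (gen (a \<oplus>\<^bsub>A\<^esub> a', ls)) = Q t s (gen (a, ls)) + Q t s (gen (a', ls))"
    and "Q t s (gen (Const c \<odot>\<^bsub>A\<^esub> a, ls)) = c *\<^sub>C Q t s (gen (a, ls))"
  using relation_add[OF assms, of a'] relation_scale[OF assms, of c]
  by (simp_all add: Q(2)[symmetric] clinear_diff[OF Q(1)] clinear_add[OF Q(1)] clinear_scale[OF Q(1)]
      single_eq_cscale_gen[of "(a, ls)" c] algebra_simps)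

context
  fixes t s :: int
begin

lemma E_add:
  assumes "p \<in> homogeneous s" "q \<in> homogeneous s" "set ls \<subseteq> V" "int (length ls) = t"
  shows "E t s ls (p + q) = E t s ls p + E t s ls q"
  unfolding E_def g_add using assms by (intro Q_relations(1)) (auto simp: generators_iff g_in_piece)

lemma E_scale:
  assumes "p \<in> homogeneous s" "set ls \<subseteq> V" "int (length ls) = t"
  shows "E t s ls (c *\<^sub>C p) = c *\<^sub>C E t s ls p"
  unfolding E_def g_scale using assms by (intro Q_relations(2)) (auto simp: generators_iff g_in_piece)

lemma E_zero:
  assumes "set ls \<subseteq> V" "int (length ls) = t"
  shows "E t s ls 0 = 0"
  using E_scale[OF homogeneous_closed(1) assms, of 0] by simp

lemma E_ideal:
  assumes "p \<in> mono_ideal bad" "set ls \<subseteq> V" "int (length ls) = t"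
  shows "E t s ls p = 0"
proof -
  have "g p = g 0" using assms(1) by (simp add: g_eq)
  then have "E t s ls p = E t s ls 0" by (simp add: E_def)
  then show ?thesis using E_zero[OF assms(2,3)] by simp
qed

lemma E_slot_add:
  assumes "p \<in> homogeneous s" "set (us @ vs) \<subseteq> V" "l \<in> V" "l' \<in> V" "int (length (us @ l # vs)) = t"
  shows "E t s (us @ (l + l') # vs) p = E t s (us @ l # vs) p + E t s (us @ l' # vs) p"
proof -
  have "gen (g p, us @ (l + l') # vs) - gen (g p, us @ l # vs) - gen (g p, us @ l' # vs) \<in> NR t s"
    using assms by (intro relation_slot_add) (auto simp: generators_iff g_in_piece)
  then show ?thesis by (simp add: E_def Q(2)[symmetric] clinear_diff[OF Q(1)] clinear_add[OF Q(1)] algebra_simps)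
qed

lemma E_slot_scale:
  assumes "p \<in> homogeneous s" "set (us @ vs) \<subseteq> V" "l \<in> V" "int (length (us @ l # vs)) = t"
  shows "E t s (us @ (c *\<^sub>C l) # vs) p = c *\<^sub>C E t s (us @ l # vs) p"
proof -
  have "gen (g p, us @ (Const c * l) # vs) - single (g p, us @ l # vs) c \<in> NR t s"
    using assms by (intro relation_slot_scale) (auto simp: generators_iff g_in_piece)
  then have "Q t s (gen (g p, us @ (Const c * l) # vs)) = Q t s (single (g p, us @ l # vs) c)"
    by (simp only: Q_eq)
  also have "single (g p, us @ l # vs) c = c *\<^sub>C gen (g p, us @ l # vs)" by (rule single_eq_cscale_gen)
  finally show ?thesis by (simp only: E_def clinear_scale[OF Q(1)] cscale_eq_Const_mult[symmetric])
qed

lemma E_not_distinct: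
  assumes "p \<in> homogeneous s" "set ls \<subseteq> V" "int (length ls) = t" "\<not> distinct ls"
  shows "E t s ls p = 0"
  using relation_alternating[of "g p" ls t s] assms by (simp add: E_def Q(2) generators_iff g_in_piece)

lemma E_slot_sum:
  assumes "p \<in> homogeneous s" "set vs \<subseteq> V" "int (length vs) + 1 = t" "finite I" "\<And>i. i \<in> I \<Longrightarrow> f i \<in> V"
  shows "E t s ((\<Sum>i\<in>I. k i *\<^sub>C f i) # vs) p = (\<Sum>i\<in>I. k i *\<^sub>C E t s (f i # vs) p)"
  using assms(4,5)
proof (induction I rule: finite_induct)
  case empty
  have "E t s ([] @ (0 *\<^sub>C 0) # vs) p = 0 *\<^sub>C E t s ([] @ 0 # vs) p"
    using assms V_0 by (intro E_slot_scale) auto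
  then show ?case by simp
next
  case (insert i I)
  have "(\<Sum>i\<in>I. k i *\<^sub>C f i) \<in> V" using insert by (intro cv.subspace_sum[OF V_sub] V_scale) auto
  moreover have "k i *\<^sub>C f i \<in> V" using insert V_scale by auto
  ultimately have "E t s ([] @ (k i *\<^sub>C f i + (\<Sum>i\<in>I. k i *\<^sub>C f i)) # vs) p =
    E t s ([] @ (k i *\<^sub>C f i) # vs) p + E t s ([] @ (\<Sum>i\<in>I. k i *\<^sub>C f i) # vs) p"
    using assms by (intro E_slot_add) auto
  moreover have "E t s ([] @ (k i *\<^sub>C f i) # vs) p = k i *\<^sub>C E t s ([] @ f i # vs) p"
    using assms insert by (intro E_slot_scale) auto
  ultimately show ?case using insert by simp
qed

text \<open>Expand the vanishing wedge that has \<open>l + l'\<close> in both slots.\<close>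

lemma E_swap:
  assumes "p \<in> homogeneous s" "set (us @ vs) \<subseteq> V" "l \<in> V" "l' \<in> V" "int (length (us @ l # l' # vs)) = t"
  shows "E t s (us @ l # l' # vs) p = - E t s (us @ l' # l # vs) p"
proof -
  have 0: "E t s (us @ x # x # vs) p = 0" if "x \<in> V" for x
    using that assms by (intro E_not_distinct) auto
  have V': "l + l' \<in> V" using assms V_add by auto
  have "0 = E t s (us @ (l + l') # (l + l') # vs) p" using 0[OF V'] by simp
  also have "\<dots> = E t s (us @ l # (l + l') # vs) p + E t s (us @ l' # (l + l') # vs) p"
    using assms V' by (intro E_slot_add) auto
  also have "E t s (us @ l # (l + l') # vs) p = E t s (us @ l # l # vs) p + E t s (us @ l # l' # vs) p"
    using E_slot_add[of p "us @ [l]" vs l l'] assms by simp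
  also have "E t s (us @ l' # (l + l') # vs) p = E t s (us @ l' # l # vs) p + E t s (us @ l' # l' # vs) p"
    using E_slot_add[of p "us @ [l']" vs l l'] assms by simp
  finally have "0 = E t s (us @ l # l' # vs) p + E t s (us @ l' # l # vs) p" using 0 assms by simp
  then show ?thesis by (simp only: eq_neg_iff_add_eq_0)
qed

lemma E_move:
  assumes "p \<in> homogeneous s" "l \<in> V" "set (zs @ us @ vs) \<subseteq> V" "int (length (zs @ l # us @ vs)) = t"
  shows "E t s (zs @ l # us @ vs) p = (-1) ^ length us *\<^sub>C E t s (zs @ us @ l # vs) p"
  using assms(3,4)
proof (induction us arbitrary: zs)
  case Nil show ?case by simp
next
  case (Cons u us)
  have "E t s (zs @ l # u # us @ vs) p = - E t s (zs @ u # l # us @ vs) p"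
    using assms Cons.prems by (intro E_swap) auto
  also have "E t s ((zs @ [u]) @ l # us @ vs) p = (-1) ^ length us *\<^sub>C E t s ((zs @ [u]) @ us @ l # vs) p"
    using Cons.prems by (intro Cons.IH) auto
  then have "E t s (zs @ u # l # us @ vs) p = (-1) ^ length us *\<^sub>C E t s (zs @ u # us @ l # vs) p" by simp
  finally show ?case by (simp only: append_Cons length_Cons power_Suc mult_minus1 cv.scale_minus_left)
qed

lemma E_bS_insert:
  assumes "p \<in> homogeneous s" "i \<in> set js" "i \<notin> S" "S \<subseteq> set js" "int (card S) + 1 = t"
  shows "E t s (bs i # bS S) p = E t s (bS (insert i S)) (sg js i S * p)"
proof -
  obtain xs ys where js: "js = xs @ i # ys" using assms(2) by (meson split_list)
  define X1 where "X1 = map bs (filter (\<lambda>k. k \<in> S) xs)"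
  define Y1 where "Y1 = map bs (filter (\<lambda>k. k \<in> S) ys)"
  have bS': "bS T = map bs (filter (\<lambda>k. k \<in> T) (xs @ i # ys))" for T by (simp only: bS_def js[symmetric])
  have bS1: "bS S = X1 @ Y1" unfolding bS' using assms(3) by (simp add: X1_def Y1_def)
  have "filter (\<lambda>k. k \<in> insert i S) zs = filter (\<lambda>k. k \<in> S) zs" if "i \<notin> set zs" for zs
    using that by (intro filter_cong) auto
  moreover have "i \<notin> set xs" "i \<notin> set ys" using dist unfolding js by auto
  ultimately have bS2: "bS (insert i S) = X1 @ bs i # Y1"
    unfolding bS' by (simp add: X1_def Y1_def insertI1 del: insert_iff)
  have "takeWhile (\<lambda>k. k \<noteq> i) js = xs"
    unfolding js using \<open>i \<notin> set xs\<close> by (subst takeWhile_append2) auto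
  then have sgp: "sg js i S * p = (-1) ^ length X1 *\<^sub>C p"
    unfolding sg_def X1_def by (cases "even (length (filter (\<lambda>k. k \<in> S) xs))") auto
  have len: "length (X1 @ Y1) = card S" using length_bS[OF assms(4)] bS1 by simp
  have sub: "set (X1 @ Y1) \<subseteq> V" using bS_V[of S] bS1 by simp
  have "E t s ([] @ bs i # X1 @ Y1) p = (-1) ^ length X1 *\<^sub>C E t s ([] @ X1 @ bs i # Y1) p"
    using assms V_bs len sub by (intro E_move) auto
  also have "E t s ([] @ X1 @ bs i # Y1) p = E t s (bS (insert i S)) p" by (simp add: bS2)
  also have "(-1) ^ length X1 *\<^sub>C E t s (bS (insert i S)) p = E t s (bS (insert i S)) ((-1) ^ length X1 *\<^sub>C p)"
    using assms len sub V_bs by (intro E_scale[symmetric]) (auto simp: bS2)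
  finally show ?thesis by (simp add: sgp bS1)
qed

end

definition subsets :: "int \<Rightarrow> int set set" where
  "subsets t = {S. S \<subseteq> set js \<and> int (card S) = t}"

lemma finite_subsets: "finite (subsets t)"
  by (rule finite_subset[of _ "Pow (set js)"]) (auto simp: subsets_def)

text \<open>The map back from chains to classes: a chain is written out in the sorted wedges of
  basis vectors.\<close>

definition F :: "int \<Rightarrow> int \<Rightarrow> ('w chain) \<Rightarrow> 'b \<times> 'v cpoly list \<Rightarrow>\<^sub>0 complex" where
  "F t s c = (\<Sum>S\<in>subsets t. E t s (bS S) (c S))"

lemma F_add: "c \<in> Ch js t s \<Longrightarrow> c' \<in> Ch js t s \<Longrightarrow> F t s (c + c') = F t s c + F t s c'"
  unfolding F_def sum.distrib[symmetric] plus_fun_apply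
  by (intro sum.cong refl E_add bS_V) (auto simp: subsets_def Ch_def length_bS)

lemma F_scale: "c \<in> Ch js t s \<Longrightarrow> F t s (k *\<^sub>C c) = k *\<^sub>C F t s c"
  unfolding F_def cv.scale_sum_right cscale_fun_apply
  by (intro sum.cong refl E_scale bS_V) (auto simp: subsets_def Ch_def length_bS)

lemma F_IC: "c \<in> IC bad \<Longrightarrow> F t s c = 0"
  unfolding F_def by (intro sum.neutral ballI E_ideal) (auto simp: IC_def subsets_def length_bS bS_V)

lemma F_sum:
  assumes "finite I" "\<And>i. i \<in> I \<Longrightarrow> f i \<in> Ch js t s"
  shows "F t s (\<Sum>i\<in>I. k i *\<^sub>C f i) = (\<Sum>i\<in>I. k i *\<^sub>C F t s (f i))"
  using assms
proof (induction I rule: finite_induct)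
  case empty show ?case by (simp only: sum.empty F_IC[OF IC_closed(1)])
next
  case (insert i I)
  have "F t s (k i *\<^sub>C f i + (\<Sum>i\<in>I. k i *\<^sub>C f i)) = F t s (k i *\<^sub>C f i) + F t s (\<Sum>i\<in>I. k i *\<^sub>C f i)"
    using insert.prems by (intro F_add Ch_closed) auto
  moreover have "F t s (k i *\<^sub>C f i) = k i *\<^sub>C F t s (f i)" using insert.prems by (intro F_scale) auto
  moreover have "F t s (\<Sum>i\<in>I. k i *\<^sub>C f i) = (\<Sum>i\<in>I. k i *\<^sub>C F t s (f i))"
    using insert.prems by (intro insert.IH) auto
  ultimately show ?case by (simp only: sum.insert[OF insert.hyps])
qed

text \<open>Inserting \<open>i\<close> is a bijection from the sets without \<open>i\<close> onto
  the larger sets with \<open>i\<close>; a set that already contains \<open>i\<close> yields a wedge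
  with a repeated form.\<close>

lemma F_cr:
  assumes c: "c \<in> Ch js t s" and i: "i \<in> set js"
  shows "F (t + 1) s (cr js i c) = (\<Sum>S\<in>subsets t. E (t + 1) s (bs i # bS S) (c S))"
proof -
  have hom: "c S \<in> homogeneous s" for S using c by (auto simp: Ch_def)
  have "(\<Sum>S\<in>subsets t. E (t + 1) s (bs i # bS S) (c S)) =
    (\<Sum>S\<in>{S \<in> subsets t. i \<notin> S}. E (t + 1) s (bs i # bS S) (c S))"
  proof (rule sum.mono_neutral_right[OF finite_subsets])
    show "\<forall>S\<in>subsets t - {S \<in> subsets t. i \<notin> S}. E (t + 1) s (bs i # bS S) (c S) = 0"
    proof
      fix S assume S: "S \<in> subsets t - {S \<in> subsets t. i \<notin> S}"
      then have "bs i \<in> set (bS S)" using i by (auto simp: bS_def)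
      then show "E (t + 1) s (bs i # bS S) (c S) = 0"
        using S V_bs[OF i] bS_V[of S] by (intro E_not_distinct hom) (auto simp: subsets_def length_bS)
    qed
  qed auto
  also have "\<dots> = (\<Sum>S\<in>{S \<in> subsets t. i \<notin> S}. E (t + 1) s (bS (insert i S)) (sg js i S * c S))"
    by (intro sum.cong refl E_bS_insert hom i) (auto simp: subsets_def)
  also have "\<dots> = (\<Sum>S\<in>{S \<in> subsets (t + 1). i \<in> S}. E (t + 1) s (bS S) (sg js i (S - {i}) * c (S - {i})))"
  proof (rule sum.reindex_bij_witness[of _ "\<lambda>S. S - {i}" "insert i"])
    fix S assume S: "S \<in> {S \<in> subsets t. i \<notin> S}"
    then have "finite S" using finite_subset[of S "set js"] by (auto simp: subsets_def)
    then show "insert i S \<in> {S \<in> subsets (t + 1). i \<in> S}" using S i by (auto simp: subsets_def)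
  next
    fix S assume S: "S \<in> {S \<in> subsets (t + 1). i \<in> S}"
    then have "finite S" using finite_subset[of S "set js"] by (auto simp: subsets_def)
    then have "card S = Suc (card (S - {i}))" using S by (intro card.remove) auto
    then show "S - {i} \<in> {S \<in> subsets t. i \<notin> S}" using S by (auto simp: subsets_def)
  qed auto
  also have "\<dots> = F (t + 1) s (cr js i c)"
    unfolding F_def
  proof (rule sum.mono_neutral_cong_left[OF finite_subsets])
    show "\<forall>S\<in>subsets (t + 1) - {S \<in> subsets (t + 1). i \<in> S}. E (t + 1) s (bS S) (cr js i c S) = 0"
      by (auto simp: cr_def subsets_def length_bS intro!: E_zero bS_V)
  qed (auto simp: cr_def)
  finally show ?thesis by simp
qed

text \<open>Wedging with \<open>l\<close> from the left, on formal sums of generators. It respects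
  the relations (\<open>Prep_NR\<close>), so an identity between classes may be prefixed with a
  form.\<close>

definition Prep :: "'v cpoly \<Rightarrow> ('b \<times> 'v cpoly list \<Rightarrow>\<^sub>0 complex) \<Rightarrow> 'b \<times> 'v cpoly list \<Rightarrow>\<^sub>0 complex" where
  "Prep l = lin (\<lambda>(a, ls). gen (a, l # ls))"

lemma clinear_Prep: "clinear (Prep l)"
  unfolding Prep_def by (rule clinear_lin)

lemma Prep_gen: "Prep l (gen (a, ls)) = gen (a, l # ls)"
  by (simp add: Prep_def)

lemma Prep_single: "Prep l (single (a, ls) c) = single (a, l # ls) c"
  by (simp add: Prep_def cscale_gen)

lemma Prep_NR:
  assumes l: "l \<in> V" and x: "x \<in> NR t s" shows "Prep l x \<in> NR (t + 1) s"
proof -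
  have "cv.subspace {x. Prep l x \<in> NR (t + 1) s}"
    by (auto simp: cv.subspace_def clinear_zero[OF clinear_Prep] clinear_add[OF clinear_Prep]
        clinear_scale[OF clinear_Prep] cv.span_zero cv.span_add cv.span_scale)
  moreover have "Prep l x \<in> NR (t + 1) s" if "x \<in> koszul_relations V A t s" for x
    using that
  proof (cases rule: koszul_relations_cases)
    case (add a a' ls)
    show ?thesis unfolding add(1) clinear_diff[OF clinear_Prep] Prep_gen
      using l add(2,3) by (intro relation_add) (auto simp: generators_iff)
  next
    case (scale c a ls)
    show ?thesis unfolding scale(1) clinear_diff[OF clinear_Prep] Prep_gen Prep_single
      using l scale(2) by (intro relation_scale) (auto simp: generators_iff)
  next
    case (slot_add a us k k' vs)
    show ?thesis unfolding slot_add(1) clinear_diff[OF clinear_Prep] Prep_gen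
      using l slot_add(2,3) relation_slot_add[of a "l # us" k vs "t + 1" s k'] by (simp add: generators_iff)
  next
    case (slot_scale c a us k vs)
    show ?thesis unfolding slot_scale(1) clinear_diff[OF clinear_Prep] Prep_gen Prep_single
      using l slot_scale(2) relation_slot_scale[of a "l # us" k vs "t + 1" s c] by (simp add: generators_iff)
  next
    case (alternating a ls)
    show ?thesis unfolding alternating(1) Prep_gen
      using l alternating(2,3) by (intro relation_alternating) (auto simp: generators_iff)
  qed
  ultimately show ?thesis using x cv.span_minimal[of "koszul_relations V A t s" "{x. Prep l x \<in> NR (t + 1) s}"] by blast
qed

text \<open>The sorted wedges span. By induction on the list the tail is expanded in them and the
  head in the basis; \<open>F_cr\<close> sorts the result.\<close>

lemma E_eq_F:
  assumes "p \<in> homogeneous s" "set ls \<subseteq> V"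
  shows "E (int (length ls)) s ls p = F (int (length ls)) s (w ls p)"
  using assms(2)
proof (induction ls)
  case Nil
  have "S = {}" if "S \<subseteq> set js" "card S = 0" for S
    using that finite_subset[of S "set js"] by simp
  then have "subsets 0 = {{}}" by (auto simp: subsets_def)
  then show ?case by (simp add: F_def bS_def)
next
  case (Cons l ls)
  let ?t = "int (length ls)"
  let ?c = "w ls p"
  have l: "l \<in> V" "set ls \<subseteq> V" using Cons.prems by auto
  have c: "?c \<in> Ch js ?t s" using assms(1) by (rule w_Ch)
  then have hom: "?c S \<in> homogeneous s" for S by (auto simp: Ch_def)
  have "Q ?t s (gen (g p, ls)) = Q ?t s (\<Sum>S\<in>subsets ?t. gen (g (?c S), bS S))"
    using Cons.IH l by (simp add: E_def F_def clinear_sum[OF Q(1)])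
  then have "Prep l (gen (g p, ls) - (\<Sum>S\<in>subsets ?t. gen (g (?c S), bS S))) \<in> NR (?t + 1) s"
    by (intro Prep_NR l(1)) (simp only: Q_eq)
  then have "gen (g p, l # ls) - (\<Sum>S\<in>subsets ?t. gen (g (?c S), l # bS S)) \<in> NR (?t + 1) s"
    by (simp only: clinear_diff[OF clinear_Prep] clinear_sum[OF clinear_Prep] Prep_gen)
  then have "E (?t + 1) s (l # ls) p = (\<Sum>S\<in>subsets ?t. E (?t + 1) s (l # bS S) (?c S))"
    by (simp only: Q_eq[symmetric] E_def clinear_sum[OF Q(1)])
  also have "\<dots> = (\<Sum>S\<in>subsets ?t. \<Sum>i\<in>set js. cf i l *\<^sub>C E (?t + 1) s (bs i # bS S) (?c S))"
  proof (intro sum.cong refl)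
    fix S assume "S \<in> subsets ?t"
    then have "E (?t + 1) s ((\<Sum>i\<in>set js. cf i l *\<^sub>C bs i) # bS S) (?c S) =
      (\<Sum>i\<in>set js. cf i l *\<^sub>C E (?t + 1) s (bs i # bS S) (?c S))"
      by (intro E_slot_sum hom bS_V V_bs) (auto simp: subsets_def length_bS)
    then show "E (?t + 1) s (l # bS S) (?c S) = (\<Sum>i\<in>set js. cf i l *\<^sub>C E (?t + 1) s (bs i # bS S) (?c S))"
      by (simp only: V_exp[OF l(1), symmetric])
  qed
  also have "\<dots> = (\<Sum>i\<in>set js. cf i l *\<^sub>C (\<Sum>S\<in>subsets ?t. E (?t + 1) s (bs i # bS S) (?c S)))"
    by (subst sum.swap) (simp only: cv.scale_sum_right)
  also have "\<dots> = (\<Sum>i\<in>set js. cf i l *\<^sub>C F (?t + 1) s (cr js i ?c))"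
    by (intro sum.cong refl) (simp only: F_cr[OF c])
  also have "\<dots> = F (?t + 1) s (wl l ?c)"
    unfolding wl_def by (rule F_sum[symmetric]) (auto intro: cr_Ch[OF _ c])
  finally show ?case by (simp add: add.commute)
qed

definition gi :: "int \<Rightarrow> 'b \<Rightarrow> 'w cpoly" where
  "gi s a = (SOME p. p \<in> homogeneous s \<and> g p = a)"

lemma gi: "a \<in> piece A s \<Longrightarrow> gi s a \<in> homogeneous s" "a \<in> piece A s \<Longrightarrow> g (gi s a) = a"
proof -
  assume "a \<in> piece A s"
  then have "\<exists>p. p \<in> homogeneous s \<and> g p = a" by (auto simp: g_piece)
  from someI_ex[OF this] show "gi s a \<in> homogeneous s" "g (gi s a) = a" by (auto simp: gi_def)
qed

text \<open>The chain of a generator, with a chosen homogeneous preimage of its coefficient. The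
  choice matters only modulo the ideal.\<close>

definition Th :: "int \<Rightarrow> ('b \<times> 'v cpoly list \<Rightarrow>\<^sub>0 complex) \<Rightarrow> 'w chain" where
  "Th s = lin (\<lambda>(a, ls). w ls (gi s a))"

lemma clinear_Th: "clinear (Th s)"
  unfolding Th_def by (rule clinear_lin)

lemma Th_gen: "Th s (gen (a, ls)) = w ls (gi s a)"
  by (simp add: Th_def)

lemma Th_single: "Th s (single (a, ls) c) = c *\<^sub>C w ls (gi s a)"
  by (simp add: Th_def)

lemma w_cong_IC: "p - q \<in> mono_ideal bad \<Longrightarrow> w ls p - w ls q \<in> IC bad"
  by (simp only: clinear_diff[OF clinear_w, symmetric] w_IC)

lemma Th_relations: "x \<in> NR t s \<Longrightarrow> Th s x \<in> IC bad"
proof -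
  assume x: "x \<in> NR t s"
  have "cv.subspace {x. Th s x \<in> IC bad}"
    by (auto simp: cv.subspace_def clinear_zero[OF clinear_Th] clinear_add[OF clinear_Th]
        clinear_scale[OF clinear_Th] IC_closed)
  moreover have "Th s x \<in> IC bad" if "x \<in> koszul_relations V A t s" for x
    using that
  proof (cases rule: koszul_relations_cases)
    case (add a a' ls)
    then have a: "a \<in> piece A s" "a' \<in> piece A s" by (auto simp: generators_iff)
    have aa: "a \<oplus>\<^bsub>A\<^esub> a' = g (gi s a + gi s a')" by (simp add: g_add gi a)
    have "a \<oplus>\<^bsub>A\<^esub> a' \<in> piece A s" unfolding aa by (intro g_in_piece homogeneous_closed gi a)
    then have "gi s (a \<oplus>\<^bsub>A\<^esub> a') - (gi s a + gi s a') \<in> mono_ideal bad"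
      unfolding g_eq[symmetric] using gi(2) aa by metis
    then have "w ls (gi s (a \<oplus>\<^bsub>A\<^esub> a')) - w ls (gi s a + gi s a') \<in> IC bad" by (rule w_cong_IC)
    then show ?thesis unfolding add(1) clinear_diff[OF clinear_Th] Th_gen
      by (simp only: clinear_add[OF clinear_w] diff_diff_eq)
  next
    case (scale c a ls)
    then have a: "a \<in> piece A s" by (auto simp: generators_iff)
    have aa: "Const c \<odot>\<^bsub>A\<^esub> a = g (c *\<^sub>C gi s a)" by (simp add: g_scale gi a)
    have "Const c \<odot>\<^bsub>A\<^esub> a \<in> piece A s" unfolding aa by (intro g_in_piece homogeneous_closed gi a)
    then have "gi s (Const c \<odot>\<^bsub>A\<^esub> a) - c *\<^sub>C gi s a \<in> mono_ideal bad"
      unfolding g_eq[symmetric] using gi(2) aa by metis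
    then have "w ls (gi s (Const c \<odot>\<^bsub>A\<^esub> a)) - w ls (c *\<^sub>C gi s a) \<in> IC bad" by (rule w_cong_IC)
    then show ?thesis
      by (simp only: scale(1) clinear_diff[OF clinear_Th] Th_gen Th_single clinear_scale[OF clinear_w] cv.scale_one)
  next
    case (slot_add a us k k' vs)
    then have "w (us @ (k + k') # vs) (gi s a) = w (us @ k # vs) (gi s a) + w (us @ k' # vs) (gi s a)"
      by (intro w_add_slot) (auto simp: generators_iff)
    then show ?thesis unfolding slot_add(1) clinear_diff[OF clinear_Th] Th_gen
      by (simp only: diff_diff_eq diff_self IC_closed)
  next
    case (slot_scale c a us k vs)
    then have "w (us @ (c *\<^sub>C k) # vs) (gi s a) = c *\<^sub>C w (us @ k # vs) (gi s a)"
      by (intro w_cscale_slot) (auto simp: generators_iff)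
    then show ?thesis
      by (simp only: slot_scale(1) clinear_diff[OF clinear_Th] Th_gen Th_single cv.scale_one
        cscale_eq_Const_mult[symmetric] diff_self IC_closed)
  next
    case (alternating a ls)
    then show ?thesis by (simp only: Th_gen w_not_distinct[OF alternating(3)] IC_closed)
  qed
  ultimately show ?thesis using x cv.span_minimal[of "koszul_relations V A t s" "{x. Th s x \<in> IC bad}"] by blast
qed

abbreviation FG :: "int \<Rightarrow> int \<Rightarrow> ('b \<times> 'v cpoly list \<Rightarrow>\<^sub>0 complex) set" where
  "FG t s \<equiv> {p. keys p \<subseteq> koszul_generators V A t s}"

lemma Th_Ch: "P \<in> FG t s \<Longrightarrow> Th s P \<in> Ch js t s"
  unfolding Th_def
proof (rule lin_in_subspace[OF subspace_Ch])
  fix k assume P: "P \<in> FG t s" and k: "k \<in> keys P"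
  obtain a ls where k': "k = (a, ls)" by (cases k)
  have "(a, ls) \<in> koszul_generators V A t s" using P k k' by auto
  then show "(case k of (a, ls) \<Rightarrow> w ls (gi s a)) \<in> Ch js t s"
    using w_Ch[of "gi s a" s ls] gi(1) by (auto simp: k' generators_iff)
qed

lemma Q_eq_F_Th:
  assumes P: "P \<in> FG t s" shows "Q t s P = F t s (Th s P)"
proof -
  have *: "(case k of (a, ls) \<Rightarrow> w ls (gi s a)) \<in> Ch js t s \<and>
      Q t s (gen k) = F t s (case k of (a, ls) \<Rightarrow> w ls (gi s a))"
    if k: "k \<in> keys P" for k
  proof -
    obtain a ls where k': "k = (a, ls)" by (cases k)
    have al: "a \<in> piece A s" "set ls \<subseteq> V" "int (length ls) = t"
      using P k k' by (auto simp: koszul_generators_def)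
    have "Q t s (gen (a, ls)) = F t s (w ls (gi s a))"
      using E_eq_F[OF gi(1)[OF al(1)] al(2)] by (simp add: al(3) E_def gi(2)[OF al(1)])
    moreover have "w ls (gi s a) \<in> Ch js t s" using w_Ch[OF gi(1)[OF al(1)], of ls] by (simp only: al(3))
    ultimately show ?thesis by (simp add: k')
  qed
  have "Q t s P = (\<Sum>k\<in>keys P. lookup P k *\<^sub>C Q t s (gen k))"
    by (subst clinear_eq_lin[OF Q(1)]) (simp only: lin_def)
  also have "\<dots> = (\<Sum>k\<in>keys P. lookup P k *\<^sub>C F t s (case k of (a, ls) \<Rightarrow> w ls (gi s a)))"
    using * by (intro sum.cong refl) auto
  also have "\<dots> = F t s (Th s P)"
    unfolding Th_def lin_def using * by (intro F_sum[symmetric]) auto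
  finally show ?thesis .
qed

text \<open>No relations are missing: by \<open>Q_eq_F_Th\<close> the class of a formal sum depends
  only on its chain, and \<open>F\<close> kills chains over the ideal.\<close>

lemma Th_kernel: "P \<in> FG t s \<Longrightarrow> Th s P \<in> IC bad \<longleftrightarrow> P \<in> NR t s"
proof
  assume "P \<in> FG t s" "Th s P \<in> IC bad"
  then have "Q t s P = 0" using Q_eq_F_Th[of P t s] F_IC[of "Th s P" t s] by simp
  then show "P \<in> NR t s" by (simp only: Q(2))
qed (rule Th_relations)

lemma Th_onto:
  assumes c: "c \<in> Ch js t s" shows "\<exists>P\<in>FG t s. Th s P - c \<in> IC bad"
proof -
  let ?P = "\<Sum>S\<in>subsets t. gen (g (c S), bS S)"
  have hom: "c S \<in> homogeneous s" for S using c by (auto simp: Ch_def)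
  have "?P \<in> FG t s"
    by (intro cv.subspace_sum[OF subspace_keys]) (auto simp: generators_iff g_in_piece hom bS_V length_bS subsets_def)
  moreover have "c = (\<Sum>S\<in>subsets t. w (bS S) (c S))"
  proof
    fix S'
    have "(\<Sum>S\<in>subsets t. w (bS S) (c S)) S' = (\<Sum>S\<in>subsets t. if S' = S then c S else 0)"
      unfolding sum_fun_apply by (intro sum.cong refl) (simp add: subsets_def w_bS)
    also have "\<dots> = (if S' \<in> subsets t then c S' else 0)" by (simp add: finite_subsets)
    also have "\<dots> = c S'" using c by (auto simp: Ch_def subsets_def)
    finally show "c S' = (\<Sum>S\<in>subsets t. w (bS S) (c S)) S'" by simp
  qed
  moreover have "Th s ?P - (\<Sum>S\<in>subsets t. w (bS S) (c S)) \<in> IC bad"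
  proof -
    have "w (bS S) (gi s (g (c S))) - w (bS S) (c S) \<in> IC bad" for S
      using gi(2)[OF g_in_piece[OF hom]] by (intro w_cong_IC) (simp only: g_eq[symmetric])
    then have "(\<Sum>S\<in>subsets t. w (bS S) (gi s (g (c S))) - w (bS S) (c S)) \<in> IC bad" by (intro IC_closed(6))
    then show ?thesis by (simp only: clinear_sum[OF clinear_Th] Th_gen sum_subtractf)
  qed
  ultimately show ?thesis by (intro bexI[of _ ?P]) (simp_all only:)
qed

end

section \<open>The Koszul differential on chains and the presentation of Tor\<close>

context koszul_setup begin

lemma relations_subset: "koszul_relations V A t s \<subseteq> FG t s"
proof
  fix x assume "x \<in> koszul_relations V A t s"
  note FG_closed = cv.subspace_add[OF subspace_keys] cv.subspace_diff[OF subspace_keys]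
  have gen: "single k c \<in> FG t s" if "k \<in> koszul_generators V A t s" for k c
    using that by (auto simp: in_keys_iff lookup_single when_def)
  have sum: "(a \<oplus>\<^bsub>A\<^esub> a', ls) \<in> koszul_generators V A t s"
    if "(a, ls) \<in> koszul_generators V A t s" "(a', ls) \<in> koszul_generators V A t s" for a a' ls
    using that by (auto simp: generators_iff g_piece g_add[symmetric] homogeneous_closed)
  have scale: "(Const c \<odot>\<^bsub>A\<^esub> a, ls) \<in> koszul_generators V A t s"
    if "(a, ls) \<in> koszul_generators V A t s" for a c ls
    using that by (auto simp: generators_iff g_piece g_scale[symmetric] homogeneous_closed)
  from \<open>x \<in> koszul_relations V A t s\<close> show "x \<in> FG t s"
  proof (cases rule: koszul_relations_cases)
    case (add a a' ls)
    then show ?thesis unfolding add(1) by (intro FG_closed gen sum)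
  next
    case (scale c a ls)
    then show ?thesis unfolding scale(1) by (intro FG_closed gen \<open>\<And>ls c a. (a, ls) \<in> koszul_generators V A t s \<Longrightarrow> (Const c \<odot>\<^bsub>A\<^esub> a, ls) \<in> koszul_generators V A t s\<close>)
  next
    case (slot_add a us k k' vs)
    then have "(a, us @ (k + k') # vs) \<in> koszul_generators V A t s" "(a, us @ k' # vs) \<in> koszul_generators V A t s"
      using V_add by (auto simp: generators_iff)
    then show ?thesis unfolding slot_add(1) using slot_add(2) by (intro FG_closed gen)
  next
    case (slot_scale c a us k vs)
    then have "(a, us @ (Const c * k) # vs) \<in> koszul_generators V A t s"
      using V_scale[of k c] by (auto simp: generators_iff cscale_eq_Const_mult)
    then show ?thesis unfolding slot_scale(1) using slot_scale(2) by (intro FG_closed gen)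
  next
    case (alternating a ls)
    then show ?thesis unfolding alternating(1) by (intro gen)
  qed
qed

definition coset :: "int \<Rightarrow> int \<Rightarrow> ('b \<times> 'v cpoly list \<Rightarrow>\<^sub>0 complex) \<Rightarrow> ('b \<times> 'v cpoly list \<Rightarrow>\<^sub>0 complex) set" where
  "coset t s P = NR t s +>\<^bsub>free_space (koszul_generators V A t s)\<^esub> P"

lemma pres_koszul_space: "pres (koszul_space V A t s) (FG t s) (NR t s) (coset t s)"
  using pres_presented_space[OF relations_subset] unfolding koszul_space_def coset_def .

lemma coset_elements: "x \<in> coset t s P \<longleftrightarrow> x - P \<in> NR t s"
proof
  assume "x - P \<in> NR t s"
  then show "x \<in> coset t s P"
    unfolding coset_def a_r_coset_def r_coset_def by (auto simp: free_space_def intro!: bexI[of _ "x - P"])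
qed (auto simp: coset_def a_r_coset_def r_coset_def free_space_def)

text \<open>A presentation of \<open>koszul_space\<close> by chains. Agreement with the cosets of
  the formal sums is part of the choice, since the differential is defined through those
  cosets.\<close>

definition proj :: "int \<Rightarrow> int \<Rightarrow> ('w chain) \<Rightarrow> ('b \<times> 'v cpoly list \<Rightarrow>\<^sub>0 complex) set" where
  "proj t s = (SOME f. pres (koszul_space V A t s) (Ch js t s) (Ch js t s \<inter> IC bad) f \<and>
     (\<forall>P\<in>FG t s. f (Th s P) = coset t s P))"

lemma proj: "pres (koszul_space V A t s) (Ch js t s) (Ch js t s \<inter> IC bad) (proj t s)"
  "P \<in> FG t s \<Longrightarrow> proj t s (Th s P) = coset t s P"
proof -
  have onto: "\<exists>P\<in>FG t s. Th s P - c \<in> Ch js t s \<inter> IC bad" if c: "c \<in> Ch js t s" for c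
  proof -
    from Th_onto[OF c] obtain P where "P \<in> FG t s" "Th s P - c \<in> IC bad" by blast
    then show ?thesis using Ch_closed(3)[OF Th_Ch c] by blast
  qed
  have ker: "Th s P \<in> Ch js t s \<inter> IC bad \<longleftrightarrow> P \<in> NR t s" if "P \<in> FG t s" for P
    using Th_kernel[OF that] Th_Ch[OF that] by blast
  obtain f where f: "pres (koszul_space V A t s) (Ch js t s) (Ch js t s \<inter> IC bad) f"
    "\<And>P. P \<in> FG t s \<Longrightarrow> f (Th s P) = coset t s P"
  proof (rule pres_pushforward[OF pres_koszul_space subspace_Ch cv.subspace_inter[OF subspace_Ch subspace_IC]
        Int_lower1 clinear_Th Th_Ch onto ker])
    fix f assume "pres (koszul_space V A t s) (Ch js t s) (Ch js t s \<inter> IC bad) f"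
      "\<And>P. P \<in> FG t s \<Longrightarrow> f (Th s P) = coset t s P"
    then show thesis by (rule that)
  qed
  then have "\<exists>f. pres (koszul_space V A t s) (Ch js t s) (Ch js t s \<inter> IC bad) f \<and> (\<forall>P\<in>FG t s. f (Th s P) = coset t s P)"
    by (intro exI[of _ f] conjI ballI f)
  from someI_ex[OF this] show "pres (koszul_space V A t s) (Ch js t s) (Ch js t s \<inter> IC bad) (proj t s)"
    "P \<in> FG t s \<Longrightarrow> proj t s (Th s P) = coset t s P"
    unfolding proj_def by blast+
qed

lemma koszul_diff_free_eq: "koszul_diff_free A = lin (\<lambda>(a, ls). \<Sum>j<length ls.
     single (ls ! j \<odot>\<^bsub>A\<^esub> a, take j ls @ drop (Suc j) ls) ((-1) ^ Suc j))"
proof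
  fix p
  have sc: "c *\<^sub>C single k d = single k (d * c)" for c d and k :: "'b \<times> 'v cpoly list"
    by (rule poly_mapping_eqI) (simp add: lookup_single when_def cscale_complex_def)
  show "koszul_diff_free A p = lin (\<lambda>(a, ls). \<Sum>j<length ls.
     single (ls ! j \<odot>\<^bsub>A\<^esub> a, take j ls @ drop (Suc j) ls) ((-1) ^ Suc j)) p"
    unfolding koszul_diff_free_def lin_def by (intro sum.cong refl) (simp add: split_beta cv.scale_sum_right sc)
qed

lemma clinear_kdf: "clinear (koszul_diff_free A)"
  unfolding koszul_diff_free_eq by (rule clinear_lin)

lemma act_in_piece:
  assumes "l \<in> V" "a \<in> piece A s"
  shows "l \<odot>\<^bsub>A\<^esub> a \<in> piece A (s + 1)" "gi (s + 1) (l \<odot>\<^bsub>A\<^esub> a) - Lam l * gi s a \<in> mono_ideal bad"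
proof -
  have eq: "l \<odot>\<^bsub>A\<^esub> a = g (Lam l * gi s a)"
    using g_act[OF assms(1), of "gi s a"] by (simp add: gi assms Lam_def)
  have "Lam l * gi s a \<in> homogeneous (1 + s)" by (rule homogeneous_mult[OF Lam_homogeneous gi(1)[OF assms(2)]])
  then show *: "l \<odot>\<^bsub>A\<^esub> a \<in> piece A (s + 1)" unfolding eq by (intro g_in_piece) (simp add: add.commute)
  show "gi (s + 1) (l \<odot>\<^bsub>A\<^esub> a) - Lam l * gi s a \<in> mono_ideal bad"
    unfolding g_eq[symmetric] gi(2)[OF *] by (rule eq)
qed

lemma kdf_FG: "P \<in> FG t s \<Longrightarrow> koszul_diff_free A P \<in> FG (t - 1) (s + 1)"
  unfolding koszul_diff_free_eq
proof (rule lin_in_subspace[OF subspace_keys])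
  fix k assume "P \<in> FG t s" "k \<in> keys P"
  moreover obtain a ls where k: "k = (a, ls)" by (cases k)
  ultimately have al: "a \<in> piece A s" "set ls \<subseteq> V" "int (length ls) = t"
    by (auto simp: koszul_generators_def)
  have "(ls ! j \<odot>\<^bsub>A\<^esub> a, take j ls @ drop (Suc j) ls) \<in> koszul_generators V A (t - 1) (s + 1)" if "j < length ls" for j
  proof -
    have "set (take j ls @ drop (Suc j) ls) \<subseteq> V"
      using al(2) set_take_subset[of j ls] set_drop_subset[of "Suc j" ls] by auto
    moreover have "int (length (take j ls @ drop (Suc j) ls)) = t - 1" using that al(3) by auto
    moreover have "ls ! j \<in> V" using that al(2) nth_mem by blast
    ultimately show ?thesis unfolding generators_iff using act_in_piece(1)[OF _ al(1)] by blast
  qed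
  then show "(case k of (a, ls) \<Rightarrow> \<Sum>j<length ls. single (ls ! j \<odot>\<^bsub>A\<^esub> a, take j ls @ drop (Suc j) ls) ((-1) ^ Suc j))
    \<in> FG (t - 1) (s + 1)"
    unfolding k prod.case by (intro cv.subspace_sum[OF subspace_keys]) auto
qed

text \<open>A sum instead of a difference, because \<open>koszul_diff_free\<close> and
  \<open>dK\<close> have opposite signs.\<close>

lemma Th_kdf: "P \<in> FG t s \<Longrightarrow> Th (s + 1) (koszul_diff_free A P) + dK js L (Th s P) \<in> IC bad"
proof -
  assume P: "P \<in> FG t s"
  define D where "D P = Th (s + 1) (koszul_diff_free A P) + dK js L (Th s P)" for P
  have D: "clinear D"
    unfolding D_def
    by (rule clinearI) (simp_all only: clinear_add[OF clinear_kdf] clinear_add[OF clinear_Th] dK_simps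
      clinear_scale[OF clinear_kdf] clinear_scale[OF clinear_Th] cv.scale_right_distrib add_ac)
  have "P \<in> {P. D P \<in> IC bad}"
  proof (rule in_subspace_gen)
    show "cv.subspace {P. D P \<in> IC bad}"
      by (auto simp only: cv.subspace_def mem_Collect_eq clinear_zero[OF D] clinear_add[OF D] clinear_scale[OF D] IC_closed)
  next
    fix k assume "k \<in> keys P"
    moreover obtain a ls where k: "k = (a, ls)" by (cases k)
    ultimately have al: "a \<in> piece A s" "set ls \<subseteq> V" using P by (auto simp: koszul_generators_def)
    let ?m = "\<lambda>j. take j ls @ drop (Suc j) ls"
    have kd: "koszul_diff_free A (gen (a, ls)) = (\<Sum>j<length ls. single (ls ! j \<odot>\<^bsub>A\<^esub> a, ?m j) ((-1) ^ Suc j))"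
      unfolding koszul_diff_free_eq by simp
    have "D (gen (a, ls)) = (\<Sum>j<length ls. (-1) ^ Suc j *\<^sub>C w (?m j) (gi (s + 1) (ls ! j \<odot>\<^bsub>A\<^esub> a)))
      + (\<Sum>j<length ls. (-1) ^ j *\<^sub>C w (?m j) (Lam (ls ! j) * gi s a))"
      unfolding D_def kd clinear_sum[OF clinear_Th] Th_single Th_gen cv.scale_one dK_w ..
    also have "\<dots> = (\<Sum>j<length ls. (-1) ^ Suc j *\<^sub>C (w (?m j) (gi (s + 1) (ls ! j \<odot>\<^bsub>A\<^esub> a)) - w (?m j) (Lam (ls ! j) * gi s a)))"
      by (simp only: sum.distrib[symmetric] cv.scale_right_diff_distrib power_Suc mult_minus1 cv.scale_minus_left diff_minus_eq_add)
    also have "\<dots> \<in> IC bad"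
    proof (intro IC_closed(6) IC_closed(5) w_cong_IC act_in_piece(2)[OF _ al(1)])
      fix j assume "j \<in> {..<length ls}"
      then show "ls ! j \<in> V" using al(2) nth_mem by blast
    qed
    finally show "gen k \<in> {P. D P \<in> IC bad}" by (simp only: k mem_Collect_eq)
  qed
  then show ?thesis by (simp only: D_def mem_Collect_eq)
qed

lemma proj_eq: "c \<in> Ch js t s \<Longrightarrow> c' \<in> Ch js t s \<Longrightarrow> proj t s c = proj t s c' \<longleftrightarrow> c - c' \<in> IC bad"
  using pres_eq[OF proj(1)] Ch_closed(3) by blast

lemma koszul_diff_proj:
  assumes c: "c \<in> Ch js t s"
  shows "koszul_diff V A t s (proj t s c) = proj (t - 1) (s + 1) (- dK js L c)"
proof -
  obtain P where P: "P \<in> FG t s" "Th s P - c \<in> IC bad" using Th_onto[OF c] by blast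
  have "proj t s c = proj t s (Th s P)"
    using P proj_eq[OF Th_Ch[OF P(1)] c] by simp
  then have Y: "proj t s c = coset t s P" using proj(2)[OF P(1)] by (simp only:)
  have 1: "koszul_diff V A t s (proj t s c) = (\<Union>x\<in>coset t s P. coset (t - 1) (s + 1) (koszul_diff_free A x))"
    unfolding koszul_diff_def Y coset_def span_in_free_space[OF relations_subset] ..
  have NF: "NR t s \<subseteq> FG t s" by (rule cv.span_minimal[OF relations_subset subspace_keys])
  \<comment> \<open>\<open>koszul_diff\<close> is a union over all representatives of the coset;
    each of them contributes the same coset.\<close>
  have "coset (t - 1) (s + 1) (koszul_diff_free A x) = proj (t - 1) (s + 1) (- dK js L c)" if x: "x \<in> coset t s P" for x
  proof -
    have xP: "x - P \<in> NR t s" using x by (simp only: coset_elements)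
    have "(x - P) + P \<in> FG t s" using NF xP P(1) by (intro cv.subspace_add[OF subspace_keys]) auto
    then have xF: "x \<in> FG t s" by simp
    have "Th s (x - P) + (Th s P - c) \<in> IC bad" using Th_relations[OF xP] P(2) by (rule IC_closed(2))
    then have xc: "Th s x - c \<in> IC bad" by (simp only: clinear_diff[OF clinear_Th] diff_add_cancel add_diff_eq)
    have "(Th (s + 1) (koszul_diff_free A x) + dK js L (Th s x)) - dK js L (Th s x - c) \<in> IC bad"
      by (rule IC_closed(3)[OF Th_kdf[OF xF] dK_IC[OF up xc]])
    moreover have "(Th (s + 1) (koszul_diff_free A x) + dK js L (Th s x)) - dK js L (Th s x - c) =
      Th (s + 1) (koszul_diff_free A x) - (- dK js L c)"
      unfolding dK_simps by (rule ext) simp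
    ultimately have "Th (s + 1) (koszul_diff_free A x) - (- dK js L c) \<in> IC bad" by (simp only:)
    then have "proj (t - 1) (s + 1) (Th (s + 1) (koszul_diff_free A x)) = proj (t - 1) (s + 1) (- dK js L c)"
      using Th_Ch[OF kdf_FG[OF xF]] Ch_closed(4)[OF dK_Ch[OF L1 c]] by (subst proj_eq)
    then show ?thesis using proj(2)[OF kdf_FG[OF xF]] by (simp only:)
  qed
  moreover have "P \<in> coset t s P" by (simp add: coset_elements cv.span_zero)
  ultimately show ?thesis unfolding 1 by blast
qed

text \<open>Kernel and image of \<open>koszul_diff\<close> are the images of \<open>Zc\<close> and
  \<open>Bd\<close> under \<open>proj\<close>. The quotient of the one by the other is then covered
  by \<open>pres_restrict\<close> and \<open>pres_quotient\<close>.\<close>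

theorem tor_presentation:
  assumes R: "V = R \<inter> homogeneous 1"
  obtains f where "pres (tor R A t s) (Zc js L bad t s) (Bd js L bad t s) f"
proof -
  let ?K = "koszul_space V A"
  let ?ker = "a_kernel (?K t s) (?K (t - 1) (s + 1)) (koszul_diff V A t s)"
  let ?im = "koszul_diff V A (t + 1) (s - 1) ` carrier (?K (t + 1) (s - 1))"
  have tor: "tor R A t s = quotient_space ((?K t s)\<lparr>carrier := ?ker\<rparr>) ?im"
    by (simp add: tor_def Let_def R)
  have ker: "?ker = proj t s ` Zc js L bad t s"
  proof -
    have "koszul_diff V A t s (proj t s c) = \<zero>\<^bsub>?K (t - 1) (s + 1)\<^esub> \<longleftrightarrow> dK js L c \<in> IC bad" if c: "c \<in> Ch js t s" for c
    proof -
      have d: "- dK js L c \<in> Ch js (t - 1) (s + 1)" by (rule Ch_closed(4)[OF dK_Ch[OF L1 c]])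
      have "koszul_diff V A t s (proj t s c) = \<zero>\<^bsub>?K (t - 1) (s + 1)\<^esub> \<longleftrightarrow> - dK js L c \<in> IC bad"
        using pres_eq_zero[OF proj(1) d] d by (simp add: koszul_diff_proj[OF c])
      also have "\<dots> \<longleftrightarrow> dK js L c \<in> IC bad" using IC_closed(4)[of "dK js L c" bad] IC_closed(4)[of "- dK js L c" bad] minus_minus[of "dK js L c"] by (simp only:) blast
      finally show ?thesis .
    qed
    then show ?thesis unfolding a_kernel_def' pres_carrier[OF proj(1)] Zc_def by auto
  qed
  have sub: "Ch js t s \<inter> IC bad \<subseteq> Zc js L bad t s" using dK_IC[OF up] by (auto simp: Zc_def)
  have im: "?im = proj t s ` Bd js L bad t s"
  proof -
    have B: "proj t s (dK js L b + i) = koszul_diff V A (t + 1) (s - 1) (proj (t + 1) (s - 1) (- b))"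
      if b: "b \<in> Ch js (t + 1) (s - 1)" and i: "i \<in> Ch js t s" "i \<in> IC bad" for b i
    proof -
      have d: "dK js L b \<in> Ch js t s" using dK_Ch[OF L1 b] by simp
      have "koszul_diff V A (t + 1) (s - 1) (proj (t + 1) (s - 1) (- b)) = proj t s (dK js L b)"
        using koszul_diff_proj[OF Ch_closed(4)[OF b]] by (simp add: dK_simps)
      also have "\<dots> = proj t s (dK js L b + i)"
        using proj_eq[OF d Ch_closed(2)[OF d i(1)]] IC_closed(4)[OF i(2)] by simp
      finally show ?thesis by simp
    qed
    show ?thesis
    proof (intro equalityI subsetI)
      fix x assume "x \<in> ?im"
      then obtain b where b: "b \<in> Ch js (t + 1) (s - 1)" "x = koszul_diff V A (t + 1) (s - 1) (proj (t + 1) (s - 1) b)"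
        unfolding pres_carrier[OF proj(1)] by blast
      have "x = proj t s (dK js L (- b) + 0)"
        using B[OF Ch_closed(4)[OF b(1)] Ch_closed(1) IC_closed(1)] b(2) by simp
      then show "x \<in> proj t s ` Bd js L bad t s"
        using BdI[OF Ch_closed(4)[OF b(1)] Ch_closed(1) IC_closed(1)] by blast
    next
      fix x assume "x \<in> proj t s ` Bd js L bad t s"
      then obtain b i where "b \<in> Ch js (t + 1) (s - 1)" "i \<in> Ch js t s" "i \<in> IC bad" "x = proj t s (dK js L b + i)"
        unfolding Bd_def by blast
      then show "x \<in> ?im" unfolding pres_carrier[OF proj(1)] using B Ch_closed(4) by blast
    qed
  qed
  have Zpres: "pres ((?K t s)\<lparr>carrier := ?ker\<rparr>) (Zc js L bad t s) (Ch js t s \<inter> IC bad) (proj t s)"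
    by (rule pres_restrict[OF proj(1) subspace_Zc sub _ ker]) (auto simp: Zc_def)
  have "Ch js t s \<inter> IC bad \<subseteq> Bd js L bad t s" using IC_subset_Bd by blast
  then have "pres (tor R A t s) (Zc js L bad t s) (Bd js L bad t s)
     (\<lambda>z. ?im +>\<^bsub>(?K t s)\<lparr>carrier := ?ker\<rparr>\<^esub> proj t s z)"
    unfolding tor by (rule pres_quotient[OF Zpres subspace_Bd _ Bd_subset_Zc[OF dist up L1] im])
  then show ?thesis by (rule that)
qed

end

section \<open>Stanley--Reisner rings\<close>

lemma poly_ring_simps [simp]:
  "carrier (poly_ring Y) = {p. \<forall>m\<in>keys p. keys m \<subseteq> Y}"
  "p \<otimes>\<^bsub>poly_ring Y\<^esub> q = p * q" "p \<oplus>\<^bsub>poly_ring Y\<^esub> q = p + q"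
  "\<one>\<^bsub>poly_ring Y\<^esub> = 1" "\<zero>\<^bsub>poly_ring Y\<^esub> = 0"
  by (simp_all add: poly_ring_def ring_of_type_algebra_def)

lemma poly_carrier_iff: "p \<in> carrier (poly_ring Y) \<longleftrightarrow> keys p \<subseteq> {m. keys m \<subseteq> Y}"
  by auto

lemma subspace_poly_carrier: "cv.subspace (carrier (poly_ring Y))"
proof -
  have "carrier (poly_ring Y) = {p. keys p \<subseteq> {m. keys m \<subseteq> Y}}" by auto
  then show ?thesis using subspace_keys by metis
qed

lemmas poly_carrier_closed = cv.subspace_0[OF subspace_poly_carrier] cv.subspace_add[OF subspace_poly_carrier]
  cv.subspace_diff[OF subspace_poly_carrier] cv.subspace_neg[OF subspace_poly_carrier]
  cv.subspace_scale[OF subspace_poly_carrier] cv.subspace_sum[OF subspace_poly_carrier]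

lemma poly_carrier_mult:
  assumes "p \<in> carrier (poly_ring Y)" "q \<in> carrier (poly_ring Y)" shows "p * q \<in> carrier (poly_ring Y)"
  using assms keys_mult[of p q] unfolding poly_carrier_iff by (fastforce simp: keys_plus_nat)

lemma poly_carrier_one: "1 \<in> carrier (poly_ring Y)"
  by simp

lemma cring_poly_ring: "cring (poly_ring Y)"
proof (rule cringI)
  show "abelian_group (poly_ring Y)"
  proof (rule abelian_groupI)
    fix p assume "p \<in> carrier (poly_ring Y)"
    then show "\<exists>q\<in>carrier (poly_ring Y). q \<oplus>\<^bsub>poly_ring Y\<^esub> p = \<zero>\<^bsub>poly_ring Y\<^esub>"
      by (intro bexI[of _ "- p"]) (simp_all only: poly_ring_simps(3,5) add.left_inverse poly_carrier_closed)
  qed (simp_all only: poly_ring_simps(3,5) poly_carrier_closed add_ac add_0_left add_0_right)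
  show "comm_monoid (poly_ring Y)"
    by (rule comm_monoidI) (simp_all only: poly_ring_simps(2,4) poly_carrier_mult poly_carrier_one mult_ac mult_1_left mult_1_right)
qed (simp only: poly_ring_simps(2,3) distrib_right)

lemma substitute_carrier:
  assumes "\<And>v. v \<in> Y \<Longrightarrow> \<theta> v \<in> carrier (poly_ring Y')" "p \<in> carrier (poly_ring Y)"
  shows "substitute \<theta> p \<in> carrier (poly_ring Y')"
proof -
  have pow: "q ^ n \<in> carrier (poly_ring Y')" if "q \<in> carrier (poly_ring Y')" for q n
    using that by (induction n) (simp_all only: power_0 power_Suc poly_carrier_one poly_carrier_mult)
  have pr: "prod f A \<in> carrier (poly_ring Y')" if "\<And>a. a \<in> A \<Longrightarrow> f a \<in> carrier (poly_ring Y')" for f and A :: "'a set"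
    using that by (induction A rule: infinite_finite_induct)
      (simp_all only: prod.infinite prod.empty prod.insert poly_carrier_one poly_carrier_mult insert_iff simp_thms)
  show ?thesis unfolding substitute_eq_lin
  proof (rule lin_in_subspace[OF subspace_poly_carrier])
    fix m assume "m \<in> keys p"
    then have "keys m \<subseteq> Y" using assms(2) by auto
    then show "subst_mono \<theta> m \<in> carrier (poly_ring Y')"
      unfolding subst_mono_def by (intro pr pow assms(1)) blast
  qed
qed

lemma Var_carrier: "v \<in> Y \<Longrightarrow> Var v \<in> carrier (poly_ring Y)"
  by (simp add: Var_def)

subsection \<open>Linear forms with zero coefficient sum\<close>

lemma lookup_Var: "lookup (Var v) m = (if m = single v 1 then 1 else 0)"
  by (auto simp: Var_def lookup_single when_def)

lemma mdeg_eq_1_iff: "mdeg m = 1 \<longleftrightarrow> (\<exists>v. m = single v 1)"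
proof
  show "mdeg m = 1 \<Longrightarrow> \<exists>v. m = single v 1"
  proof (induction m rule: monomial_induct)
    case (Var v m)
    then have "mdeg m = 0" by (simp add: mdeg_plus)
    then have "m = 0" by (auto simp: mdeg_def in_keys_iff intro: poly_mapping_eqI)
    then show ?case by auto
  qed simp
qed auto

lemma linear_form_expansion:
  assumes "finite E" "p \<in> carrier (poly_ring E)" "p \<in> homogeneous 1"
  shows "p = (\<Sum>e\<in>E. lookup p (single e 1) *\<^sub>C Var e)"
proof (rule poly_mapping_eqI)
  fix m
  have "lookup (\<Sum>e\<in>E. lookup p (single e 1) *\<^sub>C Var e) m =
    (\<Sum>e\<in>E. if m = single e 1 then lookup p m else 0)"
    unfolding lookup_sum by (intro sum.cong refl) (simp add: lookup_Var cscale_complex_def)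
  also have "\<dots> = lookup p m"
  proof (cases "m \<in> keys p")
    case True
    then have "mdeg m = 1" "keys m \<subseteq> E" using assms(2,3) by (auto simp: homogeneous_iff)
    then obtain v where v: "m = single v 1" unfolding mdeg_eq_1_iff by blast
    then have vE: "v \<in> E" using \<open>keys m \<subseteq> E\<close> by simp
    have "(\<Sum>e\<in>E. if m = single e 1 then lookup p m else 0) =
      (\<Sum>e\<in>E. if e = v then lookup p m else 0)"
    proof (intro sum.cong refl)
      fix e
      have "m = single e 1 \<longleftrightarrow> e = v"
        unfolding v by (metis keys_single singleton_inject zero_neq_one)
      then show "(if m = single e 1 then lookup p m else 0) = (if e = v then lookup p m else 0)"
        by simp
    qed
    then show ?thesis using vE assms(1) by simp
  next
    case False
    then have 0: "lookup p m = 0" by (simp add: in_keys_iff)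
    show ?thesis unfolding 0 by simp
  qed
  finally show "lookup p m =
    lookup (\<Sum>e\<in>E. lookup p (single e 1) *\<^sub>C Var e) m" by simp
qed

definition diff_forms :: "int set \<Rightarrow> int cpoly set" where
  "diff_forms E = difference_subalgebra E \<inter> homogeneous 1"

lemma difference_subalgebra_carrier: "difference_subalgebra E \<subseteq> carrier (poly_ring E)"
proof -
  interpret cring "poly_ring E" by (rule cring_poly_ring)
  have "Const c \<in> carrier (poly_ring E)" for c by (simp add: Const_def)
  then show ?thesis unfolding difference_subalgebra_def
    by (intro generate_ring_incl) (auto simp del: poly_ring_simps(1) intro: poly_carrier_closed Var_carrier)
qed

text \<open>Identifying all variables with each other maps the subalgebra generated by the differences
  to the constants, which forces the coefficients of its linear forms to sum to zero.\<close>

lemma difference_subalgebra_diagonal: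
  assumes "p \<in> difference_subalgebra E"
  shows "substitute (\<lambda>_. Var ()) p \<in> range Const"
proof -
  interpret cring "poly_ring E" by (rule cring_poly_ring)
  let ?s = "substitute (\<lambda>_. Var ()) :: int cpoly \<Rightarrow> unit cpoly"
  have C: "Const a + Const b = Const (a + b)" "Const a * Const b = Const (a * b)" "- Const a = Const (- a)"
    "Const 1 = 1" "Const 0 = 0" for a b :: complex
    by (simp_all add: Const_def single_add mult_single single_uminus)
  have car: "q \<in> generate_ring (poly_ring E) (range Const \<union> {Var e - Var e' | e e'. e \<in> E \<and> e' \<in> E}) \<Longrightarrow> q \<in> carrier (poly_ring E)" for q
    using difference_subalgebra_carrier unfolding difference_subalgebra_def by blast
  from assms show ?thesis unfolding difference_subalgebra_def
  proof (induction rule: generate_ring.induct)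
    case one
    have "?s 1 = Const 1" by (simp only: substitute_one C)
    then show ?case by (simp only: poly_ring_simps rangeI)
  next
    case (incl h)
    then consider c where "h = Const c" | e e' where "h = Var e - Var e'" by blast
    then show ?case
    proof cases
      case 1 then show ?thesis by (simp only: substitute_Const rangeI)
    next
      case 2
      have "?s h = Const 0" by (simp only: 2 substitute_linear substitute_Var diff_self C)
      then show ?thesis by (simp only: rangeI)
    qed
  next
    case (a_inv h)
    then obtain c where c: "?s h = Const c" by blast
    have "\<ominus>\<^bsub>poly_ring E\<^esub> h = - h"
      using car[OF a_inv.hyps] poly_carrier_closed(4)[OF car[OF a_inv.hyps]] by (intro minus_equality) (simp_all only: poly_ring_simps(3,5) add.left_inverse)
    then have "?s (\<ominus>\<^bsub>poly_ring E\<^esub> h) = Const (- c)" by (simp only: substitute_linear c C)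
    then show ?case by (simp only: rangeI)
  next
    case (eng_add h1 h2)
    then obtain c d where "?s h1 = Const c" "?s h2 = Const d" by blast
    then have "?s (h1 \<oplus>\<^bsub>poly_ring E\<^esub> h2) = Const (c + d)" by (simp only: poly_ring_simps substitute_linear C)
    then show ?case by (simp only: rangeI)
  next
    case (eng_mult h1 h2)
    then obtain c d where "?s h1 = Const c" "?s h2 = Const d" by blast
    then have "?s (h1 \<otimes>\<^bsub>poly_ring E\<^esub> h2) = Const (c * d)" by (simp only: poly_ring_simps substitute_mult C)
    then show ?case by (simp only: rangeI)
  qed
qed

lemma subspace_diff_forms: "cv.subspace (diff_forms E)"
proof -
  have C: "Const c \<in> difference_subalgebra E" for c
    unfolding difference_subalgebra_def by (rule generate_ring.incl) blast
  have "cv.subspace (difference_subalgebra E)"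
    unfolding cv.subspace_def
  proof (intro conjI ballI allI)
    have "(0 :: int cpoly) = Const 0" by (simp add: Const_def)
    then show "0 \<in> difference_subalgebra E" using C by metis
    show "x + y \<in> difference_subalgebra E" if "x \<in> difference_subalgebra E" "y \<in> difference_subalgebra E" for x y
      using generate_ring.eng_add[OF that[unfolded difference_subalgebra_def]] unfolding difference_subalgebra_def poly_ring_simps .
    show "c *\<^sub>C x \<in> difference_subalgebra E" if "x \<in> difference_subalgebra E" for c x
      using generate_ring.eng_mult[OF C[unfolded difference_subalgebra_def] that[unfolded difference_subalgebra_def]]
      unfolding difference_subalgebra_def poly_ring_simps cscale_eq_Const_mult .
  qed
  then show ?thesis unfolding diff_forms_def by (rule cv.subspace_inter[OF _ subspace_homogeneous])
qed

lemma Var_diff_in_diff_forms: "i \<in> E \<Longrightarrow> j \<in> E \<Longrightarrow> Var i - Var j \<in> diff_forms E"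
  unfolding diff_forms_def difference_subalgebra_def
  by (intro IntI generate_ring.incl homogeneous_closed homogeneous_Var) blast

lemma diff_forms_expansion:
  assumes E: "finite E" "j \<in> E" and l: "l \<in> diff_forms E"
  shows "l = (\<Sum>i\<in>E - {j}. lookup l (single i 1) *\<^sub>C (Var i - Var j))"
proof -
  let ?c = "\<lambda>e. lookup l (single e 1)"
  have l': "l \<in> difference_subalgebra E" "l \<in> homogeneous 1" using l by (auto simp: diff_forms_def)
  have exp: "l = (\<Sum>e\<in>E. ?c e *\<^sub>C Var e)"
    using l' difference_subalgebra_carrier by (intro linear_form_expansion E(1)) blast+
  \<comment> \<open>Identifying all variables turns \<open>l\<close> into its coefficient sum times
    one variable. The result is also constant, so the coefficient sum is zero.\<close>
  have "substitute (\<lambda>_. Var ()) l = (\<Sum>e\<in>E. ?c e *\<^sub>C Var ())"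
    by (subst exp) (simp only: substitute_linear substitute_Var)
  also have "\<dots> = (\<Sum>e\<in>E. ?c e) *\<^sub>C Var ()" by (rule cv.scale_sum_left[symmetric])
  finally have *: "substitute (\<lambda>_. Var ()) l = (\<Sum>e\<in>E. ?c e) *\<^sub>C Var ()" .
  obtain d where "substitute (\<lambda>_. Var ()) l = Const d" using difference_subalgebra_diagonal[OF l'(1)] by blast
  then have d: "(\<Sum>e\<in>E. ?c e) *\<^sub>C Var () = Const d" using * by (simp only:)
  let ?u = "single () (1 :: nat)"
  have ne: "?u \<noteq> 0"
  proof
    assume "?u = 0"
    then have "lookup ?u () = lookup 0 ()" by (simp only:)
    then show False by simp
  qed
  have "lookup ((\<Sum>e\<in>E. ?c e) *\<^sub>C Var ()) ?u = lookup (Const d) ?u"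
    by (simp only: d)
  moreover have "lookup (Const d) ?u = 0" using ne unfolding Const_def lookup_single when_def by (simp only: if_False eq_commute)
  ultimately have sum0: "(\<Sum>e\<in>E. ?c e) = 0"
    by (simp only: lookup_Var cscale_complex_def lookup_cscale refl if_True mult_1_right)
  have "(\<Sum>i\<in>E - {j}. ?c i *\<^sub>C (Var i - Var j)) = (\<Sum>i\<in>E. ?c i *\<^sub>C (Var i - Var j))"
    using E by (simp add: sum.remove[of E j])
  also have "\<dots> = (\<Sum>i\<in>E. ?c i *\<^sub>C Var i) - (\<Sum>i\<in>E. ?c i) *\<^sub>C Var j"
    by (simp only: cv.scale_right_diff_distrib sum_subtractf cv.scale_sum_left)
  also have "\<dots> = l" unfolding sum0 exp[symmetric] by (simp only: cv.scale_zero_left diff_zero)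
  finally show ?thesis by simp
qed

subsection \<open>The face ideal\<close>

text \<open>The squarefree monomial with support \<open>\<sigma>\<close>.\<close>

definition supp_mono :: "'v set \<Rightarrow> 'v \<Rightarrow>\<^sub>0 nat" where
  "supp_mono \<sigma> = (\<Sum>v\<in>\<sigma>. single v 1)"

lemma prod_Var: "(\<Prod>v\<in>\<sigma>. Var v) = gen (supp_mono \<sigma>)"
  unfolding supp_mono_def by (induction \<sigma> rule: infinite_finite_induct) (simp_all add: gen_mult_gen Var_def)

lemma lookup_supp_mono: "finite \<sigma> \<Longrightarrow> lookup (supp_mono \<sigma>) v = (if v \<in> \<sigma> then 1 else 0)"
  unfolding supp_mono_def by (simp add: lookup_sum lookup_single when_def)

lemma keys_supp_mono: "finite \<sigma> \<Longrightarrow> keys (supp_mono \<sigma>) = \<sigma>"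
  by (auto simp: in_keys_iff lookup_supp_mono split: if_splits)

text \<open>A monomial whose support is not a face is divisible by the squarefree generator of that
  support. Conversely, non-faces stay non-faces when enlarged, so the monomials with such support
  span an ideal.\<close>

lemma sr_ideal_eq:
  assumes fin: "finite (sr_vars N P)"
    and down: "\<And>\<sigma> \<tau>. sr_face N P \<tau> \<Longrightarrow> \<sigma> \<subseteq> \<tau> \<Longrightarrow> sr_face N P \<sigma>"
  shows "ideal (sr_ideal N P) (poly_ring (sr_vars N P))"
    and "sr_ideal N P = {p \<in> carrier (poly_ring (sr_vars N P)). p \<in> mono_ideal (\<lambda>m. \<not> sr_face N P (keys m))}"
proof -
  let ?R = "poly_ring (sr_vars N P)"
  let ?nf = "\<lambda>m. \<not> sr_face N P (keys m)"
  let ?G = "{\<Prod>v\<in>\<sigma>. Var v | \<sigma>. \<sigma> \<subseteq> sr_vars N P \<and> \<not> sr_face N P \<sigma>}"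
  let ?J = "{p \<in> carrier ?R. p \<in> mono_ideal ?nf}"
  interpret cring ?R by (rule cring_poly_ring)
  have up: "upward ?nf" unfolding upward_def keys_plus_nat using down by blast
  have gens: "g \<in> ?J" if "g \<in> ?G" for g
  proof -
    from that obtain \<sigma> where s: "\<sigma> \<subseteq> sr_vars N P" "\<not> sr_face N P \<sigma>" "g = gen (supp_mono \<sigma>)"
      unfolding prod_Var by blast
    have "keys (supp_mono \<sigma>) = \<sigma>" by (rule keys_supp_mono[OF finite_subset[OF s(1) fin]])
    then show ?thesis using s by (simp add: gen_in_mono_ideal)
  qed
  have G: "?G \<subseteq> carrier ?R" using gens by blast
  show id: "ideal (sr_ideal N P) ?R" unfolding sr_ideal_def by (rule genideal_ideal[OF G])
  interpret I: ideal "sr_ideal N P" ?R by (rule id)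
  have J: "ideal ?J ?R"
  proof (rule idealI)
    show "ring ?R" by (rule ring_axioms)
    show "subgroup ?J (add_monoid ?R)"
    proof
      fix x assume x: "x \<in> ?J"
      then have "inv\<^bsub>add_monoid ?R\<^esub> x = - x"
        using poly_carrier_closed(4)[of x "sr_vars N P"] by (intro minus_equality[unfolded a_inv_def]) (simp_all del: poly_ring_simps(1))
      then show "inv\<^bsub>add_monoid ?R\<^esub> x \<in> ?J"
        using x by (simp only: mem_Collect_eq poly_carrier_closed mono_ideal_closed)
    next
      show "?J \<subseteq> carrier (add_monoid ?R)" by auto
      show "\<one>\<^bsub>add_monoid ?R\<^esub> \<in> ?J" by (simp add: mono_ideal_closed)
      show "x \<otimes>\<^bsub>add_monoid ?R\<^esub> y \<in> ?J" if "x \<in> ?J" "y \<in> ?J" for x y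
        using that by (simp del: poly_ring_simps(1) add: poly_carrier_closed mono_ideal_closed)
    qed
  qed (simp_all only: mem_Collect_eq poly_ring_simps(2) poly_carrier_mult mono_ideal_mult[OF up] mono_ideal_mult2[OF up])
  show "sr_ideal N P = ?J"
  proof
    show "sr_ideal N P \<subseteq> ?J" unfolding sr_ideal_def by (rule genideal_minimal[OF J subsetI[OF gens]])
    show "?J \<subseteq> sr_ideal N P"
    proof
      fix p assume p: "p \<in> ?J"
      have Ic: "x \<in> sr_ideal N P \<Longrightarrow> x \<in> carrier ?R" for x by (rule I.a_Hcarr)
      have sc: "q * x \<in> sr_ideal N P" if "x \<in> sr_ideal N P" "q \<in> carrier ?R" for x q
        using I.I_l_closed[OF that] by (simp only: poly_ring_simps)
      have sub: "cv.subspace (sr_ideal N P)"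
        unfolding cv.subspace_def
      proof (intro conjI ballI allI)
        show "0 \<in> sr_ideal N P" using I.zero_closed by (simp only: poly_ring_simps)
        show "x + y \<in> sr_ideal N P" if "x \<in> sr_ideal N P" "y \<in> sr_ideal N P" for x y
          using I.a_closed[OF that] by (simp only: poly_ring_simps)
        show "c *\<^sub>C x \<in> sr_ideal N P" if "x \<in> sr_ideal N P" for c x
          unfolding cscale_eq_Const_mult by (rule sc[OF that]) (simp add: Const_def)
      qed
      show "p \<in> sr_ideal N P"
      proof (rule in_subspace_gen[OF sub])
        fix m assume m: "m \<in> keys p"
        then have *: "keys m \<subseteq> sr_vars N P" "\<not> sr_face N P (keys m)"
          using p by (auto simp: mono_ideal_def)
        have "gen (supp_mono (keys m)) \<in> ?G"
          unfolding prod_Var using * by blast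
        then have "gen (supp_mono (keys m)) \<in> sr_ideal N P"
          unfolding sr_ideal_def using genideal_self[OF G] by blast
        then have "gen (m - supp_mono (keys m)) * gen (supp_mono (keys m)) \<in> sr_ideal N P"
        proof (rule sc)
          have "keys (m - supp_mono (keys m)) \<subseteq> keys m"
            by (auto simp: in_keys_iff lookup_minus)
          then show "gen (m - supp_mono (keys m)) \<in> carrier ?R" using *(1) by simp
        qed
        moreover have "m - supp_mono (keys m) + supp_mono (keys m) = m"
          by (rule poly_mapping_eqI) (simp add: lookup_add lookup_minus lookup_supp_mono in_keys_iff)
        ultimately show "gen m \<in> sr_ideal N P" by (simp only: gen_mult_gen)
      qed
    qed
  qed
qed

subsection \<open>Koszul homology of Stanley--Reisner rings\<close>

definition ren :: "('v \<Rightarrow> 'w) \<Rightarrow> 'v cpoly \<Rightarrow> 'w cpoly" where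
  "ren \<rho> = substitute (\<lambda>v. Var (\<rho> v))"

lemma clinear_ren: "clinear (ren \<rho>)"
  unfolding ren_def by (rule clinear_substitute)

lemma ren_gen:
  obtains m' where "ren \<rho> (gen m) = gen m'" "keys m' = \<rho> ` keys m"
proof -
  have "\<exists>m'. ren \<rho> (gen m) = gen m' \<and> keys m' = \<rho> ` keys m"
  proof (induction m rule: monomial_induct)
    case zero
    show ?case by (intro exI[of _ 0]) (simp add: ren_def substitute_one)
  next
    case (Var v m)
    then obtain m' where m': "ren \<rho> (gen m) = gen m'" "keys m' = \<rho> ` keys m" by blast
    have "ren \<rho> (gen (single v 1 + m)) = gen (single (\<rho> v) 1 + m')"
    proof -
      have "ren \<rho> (gen (single v 1 + m)) = Var (\<rho> v) * ren \<rho> (gen m)"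
        by (simp only: ren_def substitute_gen_Var)
      then show ?thesis by (simp only: m'(1) gen_Var)
    qed
    moreover have "keys (single (\<rho> v) 1 + m') = \<rho> ` keys (single v 1 + m)"
      by (simp add: keys_plus_nat m'(2))
    ultimately show ?case by blast
  qed
  then show ?thesis using that by blast
qed

lemma ren_homogeneous: "p \<in> homogeneous s \<Longrightarrow> ren \<rho> p \<in> homogeneous s"
  unfolding ren_def by (rule substitute_homogeneous[OF homogeneous_Var])

lemma ren_carrier:
  "(\<And>v. v \<in> Y \<Longrightarrow> \<rho> v \<in> Y') \<Longrightarrow> p \<in> carrier (poly_ring Y) \<Longrightarrow> ren \<rho> p \<in> carrier (poly_ring Y')"
  unfolding ren_def by (rule substitute_carrier[OF Var_carrier])

lemma ren_ren_id:
  assumes "\<And>v. v \<in> Y \<Longrightarrow> \<rho>' (\<rho> v) = v" "p \<in> carrier (poly_ring Y)"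
  shows "ren \<rho>' (ren \<rho> p) = p"
proof -
  have "ren \<rho>' (ren \<rho> p) = substitute (\<lambda>v. Var (\<rho>' (\<rho> v))) p"
    unfolding ren_def substitute_substitute substitute_Var ..
  also have "\<dots> = substitute Var p"
  proof (rule substitute_cong)
    fix m v assume "m \<in> keys p" "v \<in> keys m"
    then have "v \<in> Y" using assms(2) by auto
    then show "Var (\<rho>' (\<rho> v)) = Var v" by (simp only: assms(1))
  qed
  finally show ?thesis by (simp only: substitute_Var_id)
qed

lemma sr_image_carrier: "sr_image N P e \<in> carrier (poly_ring (sr_vars N P))"
  unfolding sr_image_def
proof (intro poly_carrier_closed(2,6))
  show "(if Elt e \<in> sr_vars N P then Var (Elt e) else 0) \<in> carrier (poly_ring (sr_vars N P))"
    using Var_carrier[of "Elt e" "sr_vars N P"] poly_carrier_closed(1)[of "sr_vars N P"] by (simp only: split: if_split) blast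
  show "Var (Flat F) \<in> carrier (poly_ring (sr_vars N P))" if "F \<in> {F \<in> P. e \<in> F}" for F
    using that by (intro Var_carrier) (simp add: sr_vars_def)
qed

text \<open>A copy of a Stanley--Reisner ring inside the polynomial ring over all of
  \<open>'v\<close>: \<open>\<rho>\<close> and \<open>\<rho>'\<close> match \<open>Y\<close> with
  the variables of the ring, and a monomial is bad if it uses a variable outside \<open>Y\<close> or
  its support is not a face. In this way rings with different variables, and the contraction with
  its flats \<open>F - Z\<close>, share one polynomial ring. The forms \<open>L\<close> are
  prescribed only modulo bad monomials.\<close>

locale sr_model =
  fixes N :: matroid_data and P :: "int set set" and f0 :: int and js :: "int list"
    and Y :: "'v set" and \<rho> :: "'v \<Rightarrow> sr_var" and \<rho>' :: "sr_var \<Rightarrow> 'v"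
    and bad :: "('v \<Rightarrow>\<^sub>0 nat) \<Rightarrow> bool" and L :: "int \<Rightarrow> 'v cpoly"
  assumes finE: "finite (ground N)" and finV: "finite (sr_vars N P)" and f0: "f0 \<in> ground N"
    and dist: "distinct js" and js: "set js = ground N - {f0}"
    and down: "\<And>\<sigma> \<tau>. sr_face N P \<tau> \<Longrightarrow> \<sigma> \<subseteq> \<tau> \<Longrightarrow> sr_face N P \<sigma>"
    and r1: "\<And>v. v \<in> Y \<Longrightarrow> \<rho> v \<in> sr_vars N P" and r2: "\<And>v. v \<in> Y \<Longrightarrow> \<rho>' (\<rho> v) = v"
    and r3: "\<And>u. u \<in> sr_vars N P \<Longrightarrow> \<rho>' u \<in> Y" and r4: "\<And>u. u \<in> sr_vars N P \<Longrightarrow> \<rho> (\<rho>' u) = u"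
    and bad: "\<And>m. bad m \<longleftrightarrow> \<not> (keys m \<subseteq> Y \<and> sr_face N P (\<rho> ` keys m))"
    and L: "\<And>i. i \<in> set js \<Longrightarrow> L i - ren \<rho>' (sr_image N P i - sr_image N P f0) \<in> mono_ideal bad"
    and L1: "\<And>i. i \<in> set js \<Longrightarrow> L i \<in> homogeneous 1"
begin

abbreviation "R \<equiv> poly_ring (sr_vars N P)"
abbreviation "I \<equiv> sr_ideal N P"
abbreviation "A \<equiv> stanley_reisner N P"

lemma ideal_I: "ideal I R"
  using finV by (rule sr_ideal_eq(1)) (rule down)

lemma I_eq: "I = {p \<in> carrier R. p \<in> mono_ideal (\<lambda>m. \<not> sr_face N P (keys m))}"
  using finV by (rule sr_ideal_eq(2)) (rule down)

lemma ren_in_R: "r \<in> carrier (poly_ring Y) \<Longrightarrow> ren \<rho> r \<in> carrier R"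
  using r1 ren_carrier[of Y \<rho> "sr_vars N P" r] by (simp only:)

lemma ren_in_Y: "r \<in> carrier R \<Longrightarrow> ren \<rho>' r \<in> carrier (poly_ring Y)"
  using r3 ren_carrier[of "sr_vars N P" \<rho>' Y r] by (simp only:)

lemma ren_back: "r \<in> carrier (poly_ring Y) \<Longrightarrow> ren \<rho>' (ren \<rho> r) = r"
  using r2 ren_ren_id[of Y \<rho>' \<rho> r] by (simp only:)

lemma ren_forth: "r \<in> carrier R \<Longrightarrow> ren \<rho> (ren \<rho>' r) = r"
  using r4 ren_ren_id[of "sr_vars N P" \<rho> \<rho>' r] by (simp only:)

lemma subspace_I: "cv.subspace I"
proof -
  have "I = carrier R \<inter> mono_ideal (\<lambda>m. \<not> sr_face N P (keys m))" unfolding I_eq by blast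
  then show ?thesis using cv.subspace_inter[OF subspace_poly_carrier subspace_mono_ideal] by (simp only:)
qed

lemma up: "upward bad"
  unfolding upward_def bad
proof (intro allI impI notI)
  fix m n :: "'v \<Rightarrow>\<^sub>0 nat" assume a: "\<not> (keys m \<subseteq> Y \<and> sr_face N P (\<rho> ` keys m))"
    and b: "keys (n + m) \<subseteq> Y \<and> sr_face N P (\<rho> ` keys (n + m))"
  have "keys m \<subseteq> keys (n + m)" by (simp add: keys_plus_nat)
  then show False using a b down[of "\<rho> ` keys (n + m)" "\<rho> ` keys m"] by blast
qed

lemma coset_eq: "I +>\<^bsub>R\<^esub> a = I +>\<^bsub>R\<^esub> b \<longleftrightarrow> a - b \<in> I"
proof -
  have c: "x \<in> I +>\<^bsub>R\<^esub> a \<longleftrightarrow> x - a \<in> I" for x a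
  proof
    assume "x - a \<in> I"
    then show "x \<in> I +>\<^bsub>R\<^esub> a" unfolding a_r_coset_def r_coset_def
      by (auto intro!: bexI[of _ "x - a"] simp del: poly_ring_simps(1) simp: poly_ring_def ring_of_type_algebra_def)
  qed (auto simp: a_r_coset_def r_coset_def poly_ring_def ring_of_type_algebra_def)
  show ?thesis
  proof
    assume "I +>\<^bsub>R\<^esub> a = I +>\<^bsub>R\<^esub> b"
    then have "a \<in> I +>\<^bsub>R\<^esub> b" using c[of a a] cv.subspace_0[OF subspace_I] by simp
    then show "a - b \<in> I" by (simp only: c)
  next
    assume ab: "a - b \<in> I"
    have "x - a \<in> I \<longleftrightarrow> x - b \<in> I" for x
      using cv.subspace_add[OF subspace_I _ ab, of "x - a"] cv.subspace_diff[OF subspace_I _ ab, of "x - b"] by auto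
    then show "I +>\<^bsub>R\<^esub> a = I +>\<^bsub>R\<^esub> b" by (auto simp only: c)
  qed
qed

lemma ren_bad_in_I: "r \<in> carrier (poly_ring Y) \<Longrightarrow> r \<in> mono_ideal bad \<Longrightarrow> ren \<rho> r \<in> I"
proof -
  assume r: "r \<in> carrier (poly_ring Y)" "r \<in> mono_ideal bad"
  have "ren \<rho> r \<in> mono_ideal (\<lambda>m. \<not> sr_face N P (keys m))"
    unfolding ren_def
  proof (rule substitute_in_mono_ideal)
    fix m assume m: "m \<in> keys r"
    then have "keys m \<subseteq> Y" "bad m" using r by (auto simp: mono_ideal_def)
    then have nf: "\<not> sr_face N P (\<rho> ` keys m)" using bad by blast
    obtain m' where m': "ren \<rho> (gen m) = gen m'" "keys m' = \<rho> ` keys m" by (rule ren_gen)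
    show "substitute (\<lambda>v. Var (\<rho> v)) (gen m) \<in> mono_ideal (\<lambda>m. \<not> sr_face N P (keys m))"
      using nf m' by (simp only: ren_def[symmetric] gen_in_mono_ideal not_False_eq_True)
  qed
  then show ?thesis unfolding I_eq using ren_in_R[OF r(1)] by blast
qed

lemma I_imp_bad: "r \<in> carrier (poly_ring Y) \<Longrightarrow> ren \<rho> r \<in> I \<Longrightarrow> r \<in> mono_ideal bad"
proof -
  assume r: "r \<in> carrier (poly_ring Y)" "ren \<rho> r \<in> I"
  have "ren \<rho>' (ren \<rho> r) \<in> mono_ideal bad"
    unfolding ren_def[of \<rho>']
  proof (rule substitute_in_mono_ideal)
    fix m assume "m \<in> keys (ren \<rho> r)"
    then have m: "keys m \<subseteq> sr_vars N P" "\<not> sr_face N P (keys m)"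
      using r(2) unfolding I_eq by (auto simp: mono_ideal_def)
    obtain m' where m': "ren \<rho>' (gen m) = gen m'" "keys m' = \<rho>' ` keys m" by (rule ren_gen)
    have "\<rho> ` keys m' = keys m"
      unfolding m'(2) image_image using r4 m(1) by (force simp: subset_iff)
    then have "bad m'" using m(2) bad by simp
    then show "substitute (\<lambda>v. Var (\<rho>' v)) (gen m) \<in> mono_ideal bad"
      using m'(1) by (simp only: ren_def[symmetric] gen_in_mono_ideal)
  qed
  then show ?thesis by (simp only: ren_back[OF r(1)])
qed

text \<open>Truncation precedes the renaming, since \<open>\<rho>\<close> is meaningful only on
  \<open>Y\<close>.\<close>

definition qq :: "'v cpoly \<Rightarrow> sr_var cpoly" where
  "qq p = ren \<rho> (tr (\<lambda>m. \<not> bad m) p)"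

definition g :: "'v cpoly \<Rightarrow> sr_var cpoly set" where
  "g p = I +>\<^bsub>R\<^esub> qq p"

lemma clinear_qq: "clinear qq"
  unfolding qq_def by (rule clinear_comp[OF clinear_ren clinear_tr])

lemma tr_carrier: "tr (\<lambda>m. \<not> bad m) p \<in> carrier (poly_ring Y)"
  unfolding poly_carrier_iff keys_tr using bad by blast

lemma qq_carrier: "qq p \<in> carrier R"
  unfolding qq_def by (rule ren_in_R[OF tr_carrier])

lemma qq_homogeneous: "p \<in> homogeneous s \<Longrightarrow> qq p \<in> homogeneous s"
  unfolding qq_def by (intro ren_homogeneous tr_homogeneous)

lemma qq_in_I: "qq p \<in> I \<longleftrightarrow> p \<in> mono_ideal bad"
proof
  assume "qq p \<in> I"
  then have "tr (\<lambda>m. \<not> bad m) p \<in> mono_ideal bad" unfolding qq_def by (intro I_imp_bad tr_carrier)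
  then have "tr (\<lambda>m. \<not> bad m) p + (p - tr (\<lambda>m. \<not> bad m) p) \<in> mono_ideal bad"
    using diff_tr_in_mono_ideal[of p "\<lambda>m. \<not> bad m"] by (intro mono_ideal_closed(2)) simp_all
  then show "p \<in> mono_ideal bad" by simp
next
  assume "p \<in> mono_ideal bad"
  then have "tr (\<lambda>m. \<not> bad m) p = 0" unfolding tr_eq_0_iff by simp
  then show "qq p \<in> I" by (simp only: qq_def clinear_zero[OF clinear_ren] cv.subspace_0[OF subspace_I])
qed

lemma qq_ren:
  assumes "r \<in> carrier (poly_ring Y)" shows "qq r - ren \<rho> r \<in> I"
proof -
  have "ren \<rho> (r - tr (\<lambda>m. \<not> bad m) r) \<in> I"
    using diff_tr_in_mono_ideal[of r "\<lambda>m. \<not> bad m"]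
    by (intro ren_bad_in_I poly_carrier_closed(3) assms tr_carrier) simp
  then have "- ren \<rho> (r - tr (\<lambda>m. \<not> bad m) r) \<in> I" by (rule cv.subspace_neg[OF subspace_I])
  then show ?thesis by (simp only: qq_def clinear_diff[OF clinear_ren] minus_diff_eq)
qed

lemma SR_simps:
  "add A = set_add R" "module.smult A p Z = rcoset_mult R I (I +>\<^bsub>R\<^esub> substitute (sr_image N P) p) Z"
  "piece A s = {I +>\<^bsub>R\<^esub> p | p. p \<in> carrier R \<inter> homogeneous s}"
  by (simp_all add: stanley_reisner_def Let_def FactRing_def del: poly_ring_simps)

lemma act: "x \<in> carrier R \<Longrightarrow> substitute (sr_image N P) l = x \<Longrightarrow> l \<odot>\<^bsub>A\<^esub> g p = I +>\<^bsub>R\<^esub> (x * qq p)"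
  unfolding SR_simps g_def using ideal.rcoset_mult_add[OF ideal_I _ qq_carrier] by (simp del: poly_ring_simps(1))

lemma substitute_diff_form:
  assumes l: "l \<in> diff_forms (ground N)"
  shows "substitute (sr_image N P) l =
    (\<Sum>i\<in>set js. lookup l (single i 1) *\<^sub>C (sr_image N P i - sr_image N P f0))"
  by (subst diff_forms_expansion[OF finE f0 l]) (simp only: substitute_linear substitute_Var js)

text \<open>The differences with the fixed element \<open>f0\<close> form a basis of the linear
  forms with zero coefficient sum, and the coordinate at \<open>i\<close> is the coefficient of
  \<open>Var i\<close>.\<close>

sublocale koszul: koszul_setup js "\<lambda>i. Var i - Var f0" "diff_forms (ground N)"
  "\<lambda>i l. lookup l (single i 1)" A g bad L
proof
  show "distinct js" by (rule dist)
  show "upward bad" by (rule up)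
  show "L i \<in> homogeneous 1" if "i \<in> set js" for i using that by (rule L1)
  show "Var i - Var f0 \<in> diff_forms (ground N)" if "i \<in> set js" for i
    using that js f0 by (intro Var_diff_in_diff_forms) auto
  show "cv.subspace (diff_forms (ground N))" by (rule subspace_diff_forms)
  show "l = (\<Sum>i\<in>set js. lookup l (single i 1) *\<^sub>C (Var i - Var f0))"
    if "l \<in> diff_forms (ground N)" for l
    unfolding js using that by (rule diff_forms_expansion[OF finE f0])
  show "lookup (Var j - Var f0) (single i 1) = (if i = j then 1 else 0)"
    if "i \<in> set js" "j \<in> set js" for i j
  proof -
    have "(single a (1 :: nat) = single b 1) \<longleftrightarrow> a = b" for a b :: int
      by (metis keys_single singleton_inject zero_neq_one)
    then show ?thesis using that js by (simp add: lookup_minus lookup_Var)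
  qed
  show "piece A s = g ` homogeneous s" for s
    unfolding SR_simps
  proof (intro equalityI subsetI)
    fix z assume "z \<in> {I +>\<^bsub>R\<^esub> p | p. p \<in> carrier R \<inter> homogeneous s}"
    then obtain p where p: "z = I +>\<^bsub>R\<^esub> p" "p \<in> carrier R" "p \<in> homogeneous s" by blast
    have "qq (ren \<rho>' p) - ren \<rho> (ren \<rho>' p) \<in> I" by (rule qq_ren[OF ren_in_Y[OF p(2)]])
    then have "z = g (ren \<rho>' p)" unfolding p(1) g_def ren_forth[OF p(2)] coset_eq[symmetric] by (rule sym)
    then show "z \<in> g ` homogeneous s" using ren_homogeneous[OF p(3)] by blast
  next
    fix z assume "z \<in> g ` homogeneous s"
    then show "z \<in> {I +>\<^bsub>R\<^esub> p | p. p \<in> carrier R \<inter> homogeneous s}"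
      unfolding g_def using qq_carrier qq_homogeneous by blast
  qed
  show "g (p + q) = g p \<oplus>\<^bsub>A\<^esub> g q" for p q
    unfolding SR_simps g_def clinear_add[OF clinear_qq]
  proof -
    interpret additive_subgroup I R using ideal_I by (rule ideal.axioms(1))
    interpret abelian_group R using cring_poly_ring by (meson cring.axioms(1) ring.is_abelian_group)
    have "abelian_subgroup I R" by (rule abelian_subgroupI3) unfold_locales
    from abelian_subgroup.a_rcos_sum[OF this qq_carrier[of p] qq_carrier[of q]]
    show "I +>\<^bsub>R\<^esub> (qq p + qq q) = (I +>\<^bsub>R\<^esub> qq p) <+>\<^bsub>R\<^esub> (I +>\<^bsub>R\<^esub> qq q)" by simp
  qed
  show "g (c *\<^sub>C p) = Const c \<odot>\<^bsub>A\<^esub> g p" for c p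
  proof -
    have "Const c \<odot>\<^bsub>A\<^esub> g p = I +>\<^bsub>R\<^esub> (Const c * qq p)" by (rule act[OF _ substitute_Const]) (simp add: Const_def)
    then show ?thesis unfolding g_def clinear_scale[OF clinear_qq] unfolding cscale_eq_Const_mult by (rule sym)
  qed
  show "g p = g q \<longleftrightarrow> p - q \<in> mono_ideal bad" for p q
    unfolding g_def coset_eq clinear_diff[OF clinear_qq, symmetric] by (rule qq_in_I)
  show "l \<odot>\<^bsub>A\<^esub> g p = g ((\<Sum>i\<in>set js. lookup l (single i 1) *\<^sub>C L i) * p)"
    if l: "l \<in> diff_forms (ground N)" for l p
  proof -
    let ?c = "\<lambda>i. lookup l (single i 1)"
    define x where "x = (\<Sum>i\<in>set js. ?c i *\<^sub>C (sr_image N P i - sr_image N P f0))"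
    have xR: "x \<in> carrier R" unfolding x_def by (intro poly_carrier_closed sr_image_carrier)
    \<comment> \<open>The true value of \<open>l\<close> under the structure map, carried back to
      \<open>'v\<close>. The combination of the \<open>L i\<close> is replaced by it and
      \<open>p\<close> by its truncation, both modulo bad monomials.\<close>
    define y where "y = ren \<rho>' x"
    have yY: "y \<in> carrier (poly_ring Y)" unfolding y_def by (rule ren_in_Y[OF xR])
    have xy: "ren \<rho> y = x" unfolding y_def by (rule ren_forth[OF xR])
    let ?t = "tr (\<lambda>m. \<not> bad m) p"
    have "(\<Sum>i\<in>set js. ?c i *\<^sub>C L i) - y = (\<Sum>i\<in>set js. ?c i *\<^sub>C (L i - ren \<rho>' (sr_image N P i - sr_image N P f0)))"
    proof -
      define Z where "Z i = ren \<rho>' (sr_image N P i - sr_image N P f0)" for i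
      have "y = (\<Sum>i\<in>set js. ?c i *\<^sub>C Z i)"
        unfolding y_def x_def Z_def clinear_sum[OF clinear_ren] clinear_scale[OF clinear_ren] ..
      then show ?thesis unfolding Z_def[symmetric] by (simp only: cv.scale_right_diff_distrib sum_subtractf)
    qed
    also have "\<dots> \<in> mono_ideal bad" by (intro mono_ideal_closed L)
    finally have "((\<Sum>i\<in>set js. ?c i *\<^sub>C L i) - y) * p \<in> mono_ideal bad" by (rule mono_ideal_mult2[OF up])
    moreover have "y * (p - ?t) \<in> mono_ideal bad"
      using diff_tr_in_mono_ideal[of p "\<lambda>m. \<not> bad m"] by (intro mono_ideal_mult[OF up]) simp
    ultimately have "((\<Sum>i\<in>set js. ?c i *\<^sub>C L i) - y) * p + y * (p - ?t) \<in> mono_ideal bad" by (rule mono_ideal_closed(2))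
    then have "(\<Sum>i\<in>set js. ?c i *\<^sub>C L i) * p - y * ?t \<in> mono_ideal bad" by (simp add: algebra_simps)
    then have 1: "qq ((\<Sum>i\<in>set js. ?c i *\<^sub>C L i) * p) - qq (y * ?t) \<in> I"
      unfolding clinear_diff[OF clinear_qq, symmetric] qq_in_I .
    have "qq (y * ?t) - ren \<rho> (y * ?t) \<in> I" by (rule qq_ren[OF poly_carrier_mult[OF yY tr_carrier]])
    moreover have "ren \<rho> (y * ?t) = x * qq p" unfolding qq_def xy[symmetric] by (simp only: ren_def substitute_mult)
    ultimately have "qq (y * ?t) - x * qq p \<in> I" by (simp only:)
    from cv.subspace_add[OF subspace_I 1 this]
    have "qq ((\<Sum>i\<in>set js. ?c i *\<^sub>C L i) * p) - x * qq p \<in> I" by simp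
    then have "g ((\<Sum>i\<in>set js. ?c i *\<^sub>C L i) * p) = I +>\<^bsub>R\<^esub> (x * qq p)" unfolding g_def coset_eq .
    also have "\<dots> = l \<odot>\<^bsub>A\<^esub> g p" using substitute_diff_form[OF l] by (intro act[symmetric] xR) (simp only: x_def)
    finally show ?thesis by (rule sym)
  qed
qed (simp_all add: lookup_add cscale_complex_def)

lemma tor_sr_presentation:
  obtains f where "pres (tor_sr N P t s) (Zc js L bad t s) (Bd js L bad t s) f"
  using koszul.tor_presentation[OF diff_forms_def] unfolding tor_sr_def by blast

end

section \<open>Matroids\<close>

locale matroid_loc =
  fixes M :: matroid_data
  assumes mat: "matroid M"
begin

abbreviation "E \<equiv> ground M"

lemma finE: "finite E" and bases_ne: "bases M \<noteq> {}" and bases_sub: "B \<in> bases M \<Longrightarrow> B \<subseteq> E"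
  using mat by (auto simp: matroid_def)

lemma exchange: "A \<in> bases M \<Longrightarrow> B \<in> bases M \<Longrightarrow> a \<in> A - B \<Longrightarrow> \<exists>b\<in>B - A. insert b (A - {a}) \<in> bases M"
  using mat unfolding matroid_def by blast

lemma finite_basis: "B \<in> bases M \<Longrightarrow> finite B"
  using bases_sub finE finite_subset by blast

text \<open>An exchange brings \<open>A\<close> one element closer to \<open>B\<close> without
  changing its size.\<close>

lemma bases_card: "A \<in> bases M \<Longrightarrow> B \<in> bases M \<Longrightarrow> card A = card B"
proof (induction "card (A - B)" arbitrary: A)
  case 0
  then have "A \<subseteq> B" using finite_basis[of A] by auto
  moreover have "B \<subseteq> A" using exchange[OF 0(3,2)] \<open>A \<subseteq> B\<close> by blast
  ultimately show ?case by simp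
next
  case (Suc n)
  then obtain a where a: "a \<in> A - B" by (metis card.empty equals0I nat.distinct(1))
  then obtain b where b: "b \<in> B - A" "insert b (A - {a}) \<in> bases M" using exchange Suc.prems by blast
  have fin: "finite A" using Suc.prems finite_basis by blast
  have "insert b (A - {a}) - B = (A - B) - {a}" using b by blast
  then have "n = card (insert b (A - {a}) - B)" using a Suc.hyps(2) fin by simp
  then have "card (insert b (A - {a})) = card B" using Suc.hyps(1) b(2) Suc.prems(2) by blast
  moreover have "card (insert b (A - {a})) = card A"
  proof -
    have "card (insert b (A - {a})) = Suc (card (A - {a}))" using b(1) fin by simp
    also have "\<dots> = card A" using a fin by (intro card_Suc_Diff1) auto
    finally show ?thesis .
  qed
  ultimately show ?case by simp
qed

lemma indep_sub: "indep M I \<Longrightarrow> I \<subseteq> E" and indep_finite: "indep M I \<Longrightarrow> finite I"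
  unfolding indep_def using bases_sub finite_basis finite_subset by blast+

lemma indep_mono: "indep M I \<Longrightarrow> J \<subseteq> I \<Longrightarrow> indep M J"
  unfolding indep_def by blast

lemma indep_empty: "indep M {}"
  unfolding indep_def using bases_ne by blast

text \<open>Among the bases that contain \<open>J\<close>, one with the fewest elements outside
  \<open>J \<union> B1\<close> lies inside that union, since otherwise an exchange would improve it.
  If no element of \<open>J\<close> could be added to \<open>I\<close>, comparing this basis with
  \<open>B1\<close> would contradict the sizes.\<close>

lemma augment:
  assumes I: "indep M I" and J: "indep M J" and less: "card I < card J"
  shows "\<exists>e\<in>J - I. indep M (insert e I)"
proof (rule ccontr)
  assume no: "\<not> ?thesis"
  obtain B1 where B1: "B1 \<in> bases M" "I \<subseteq> B1" using I by (auto simp: indep_def)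
  define B2 where "B2 = arg_min (\<lambda>B. card (B - (J \<union> B1))) (\<lambda>B. B \<in> bases M \<and> J \<subseteq> B)"
  have "\<exists>B. B \<in> bases M \<and> J \<subseteq> B" using J by (auto simp: indep_def)
  then have B2: "B2 \<in> bases M" "J \<subseteq> B2"
    and min: "\<And>B. B \<in> bases M \<Longrightarrow> J \<subseteq> B \<Longrightarrow> card (B2 - (J \<union> B1)) \<le> card (B - (J \<union> B1))"
    unfolding B2_def using arg_min_nat_lemma[of "\<lambda>B. B \<in> bases M \<and> J \<subseteq> B" _ "\<lambda>B. card (B - (J \<union> B1))"] by blast+
  have JI: "J \<inter> B1 \<subseteq> I" using no B1 indep_mono[of B1] unfolding indep_def by blast
  have "B2 - (J \<union> B1) = {}"
  proof (rule ccontr)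
    assume "B2 - (J \<union> B1) \<noteq> {}"
    then obtain x where x: "x \<in> B2 - (J \<union> B1)" by blast
    then obtain y where y: "y \<in> B1 - B2" "insert y (B2 - {x}) \<in> bases M" using exchange[OF B2(1) B1(1)] by blast
    have "insert y (B2 - {x}) - (J \<union> B1) = (B2 - (J \<union> B1)) - {x}" using y by blast
    then have "card (insert y (B2 - {x}) - (J \<union> B1)) < card (B2 - (J \<union> B1))"
      using x finite_basis[OF B2(1)] by (simp only:) (intro card_Diff1_less, auto)
    moreover have "J \<subseteq> insert y (B2 - {x})" using B2(2) x by blast
    ultimately show False using min y(2) by fastforce
  qed
  then have 1: "B2 - B1 \<subseteq> J - I" using JI B1(2) by blast
  have "B1 - (I \<union> B2) = {}"
  proof (rule ccontr)
    assume "B1 - (I \<union> B2) \<noteq> {}"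
    then obtain x where x: "x \<in> B1 - (I \<union> B2)" by blast
    then obtain y where y: "y \<in> B2 - B1" "insert y (B1 - {x}) \<in> bases M" using exchange[OF B1(1) B2(1)] by blast
    have "insert y I \<subseteq> insert y (B1 - {x})" using x B1(2) by blast
    then have "indep M (insert y I)" using y(2) unfolding indep_def by blast
    then show False using no y(1) 1 by blast
  qed
  then have 2: "B1 - B2 \<subseteq> I - J" using B2(2) by blast
  have fin: "finite B1" "finite B2" "finite I" "finite J" using finite_basis B1 B2 indep_finite I J by auto
  have "J - I \<subseteq> B2 - B1" using JI B2(2) by blast
  then have "card (J - I) \<le> card (B2 - B1)" using fin by (intro card_mono) auto
  also have "card (B2 - B1) = card (B1 - B2)"
    using bases_card[OF B1(1) B2(1)] card_Int_Diff[OF fin(1), of B2] card_Int_Diff[OF fin(2), of B1] by (simp add: Int_commute)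
  also have "\<dots> \<le> card (I - J)" using 2 fin by (intro card_mono) auto
  finally have "card (J - I) \<le> card (I - J)" .
  then show False
    using less card_Int_Diff[OF fin(3), of J] card_Int_Diff[OF fin(4), of I] by (simp add: Int_commute)
qed

text \<open>Maximality is required against single elements only; by \<open>augment\<close> it
  implies maximality of size, hence the value of the rank.\<close>

definition basis_of :: "int set \<Rightarrow> int set \<Rightarrow> bool" where
  "basis_of I A \<longleftrightarrow> I \<subseteq> A \<and> indep M I \<and> (\<forall>e\<in>A - I. \<not> indep M (insert e I))"

lemma basis_of_card_max: "basis_of I A \<Longrightarrow> J \<subseteq> A \<Longrightarrow> indep M J \<Longrightarrow> card J \<le> card I"
proof (rule ccontr)
  assume a: "basis_of I A" "J \<subseteq> A" "indep M J" "\<not> card J \<le> card I"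
  then obtain e where "e \<in> J - I" "indep M (insert e I)" using augment[of I J] by (auto simp: basis_of_def)
  then show False using a(1,2) by (auto simp: basis_of_def)
qed

lemma rk_basis_of: "basis_of I A \<Longrightarrow> rk M A = card I"
  unfolding rk_def
proof (rule Max_eqI)
  show "finite {card I |I. I \<subseteq> A \<and> indep M I}"
    by (rule finite_subset[of _ "card ` Pow E"]) (use indep_sub finE in auto)
  show "basis_of I A \<Longrightarrow> card I \<in> {card I |I. I \<subseteq> A \<and> indep M I}" by (auto simp: basis_of_def)
  show "\<And>y. basis_of I A \<Longrightarrow> y \<in> {card I |I. I \<subseteq> A \<and> indep M I} \<Longrightarrow> y \<le> card I"
    using basis_of_card_max by blast
qed

lemma extend_basis_of:
  assumes "I \<subseteq> A" "indep M I"
  obtains J where "I \<subseteq> J" "basis_of J A"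
proof -
  have "\<exists>J. (I \<subseteq> J \<and> J \<subseteq> A \<and> indep M J) \<and> (\<forall>y. I \<subseteq> y \<and> y \<subseteq> A \<and> indep M y \<longrightarrow> card y \<le> card J)"
  proof (rule ex_has_greatest_nat[where b = "Suc (card E)" and k = I])
    show "\<forall>y. I \<subseteq> y \<and> y \<subseteq> A \<and> indep M y \<longrightarrow> card y < Suc (card E)"
      using card_mono[OF finE] indep_sub by (simp add: less_Suc_eq_le)
  qed (simp add: assms)
  then obtain J where J0: "(I \<subseteq> J \<and> J \<subseteq> A \<and> indep M J) \<and> (\<forall>y. I \<subseteq> y \<and> y \<subseteq> A \<and> indep M y \<longrightarrow> card y \<le> card J)"
    by (elim exE)
  have J: "I \<subseteq> J" "J \<subseteq> A" "indep M J" "\<And>y. I \<subseteq> y \<Longrightarrow> y \<subseteq> A \<Longrightarrow> indep M y \<Longrightarrow> card y \<le> card J"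
    using J0 by simp_all
  have "\<not> indep M (insert e J)" if "e \<in> A - J" for e
    using J(4)[of "insert e J"] J(1,2) that card_insert_disjoint[OF indep_finite[OF J(3)], of e] by auto
  then have "basis_of J A" using J by (auto simp: basis_of_def)
  then show ?thesis using that J by blast
qed

lemma basis_of_exists:
  obtains I where "basis_of I A"
  by (rule extend_basis_of[OF empty_subsetI indep_empty])

lemma rk_ge: "I \<subseteq> A \<Longrightarrow> indep M I \<Longrightarrow> card I \<le> rk M A"
proof -
  assume I: "I \<subseteq> A" "indep M I"
  obtain J where "basis_of J A" by (rule extend_basis_of[OF I])
  then show ?thesis using basis_of_card_max[OF _ I] rk_basis_of by simp
qed

text \<open>Reads the closure off a single maximal independent subset; monotonicity and idempotence
  then reduce to properties of \<open>indep\<close>.\<close>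

lemma cl_basis_of:
  assumes "basis_of I A"
  shows "cl M A = {e \<in> E. e \<in> I \<or> \<not> indep M (insert e I)}"
proof -
  have "rk M (insert e A) = rk M A \<longleftrightarrow> e \<in> I \<or> \<not> indep M (insert e I)" for e
  proof
    assume r: "rk M (insert e A) = rk M A"
    show "e \<in> I \<or> \<not> indep M (insert e I)"
    proof (rule ccontr)
      assume "\<not> ?thesis"
      then have "e \<notin> I" "indep M (insert e I)" by auto
      then have "card I < card (insert e I)" using indep_finite[of "insert e I"] by simp
      also have "\<dots> \<le> rk M (insert e A)" using \<open>indep M (insert e I)\<close> assms by (intro rk_ge) (auto simp: basis_of_def)
      finally show False using r rk_basis_of[OF assms] by simp
    qed
  next
    assume "e \<in> I \<or> \<not> indep M (insert e I)"
    then have "basis_of I (insert e A)" using assms by (auto simp: basis_of_def insert_absorb)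
    then show "rk M (insert e A) = rk M A" using rk_basis_of[OF assms] rk_basis_of[of I "insert e A"] by simp
  qed
  then show ?thesis by (simp add: cl_def)
qed

lemma cl_sub: "cl M A \<subseteq> E"
  by (auto simp: cl_def)

lemma cl_superset: "A \<subseteq> E \<Longrightarrow> A \<subseteq> cl M A"
  by (auto simp: cl_def insert_absorb)

lemma cl_mono:
  assumes "A \<subseteq> B" shows "cl M A \<subseteq> cl M B"
proof -
  obtain I where I: "basis_of I A" by (rule basis_of_exists)
  have IB: "I \<subseteq> B" "indep M I" using I assms by (auto simp: basis_of_def)
  obtain J where J: "I \<subseteq> J" "basis_of J B" by (rule extend_basis_of[OF IB])
  have "\<not> indep M (insert e J)" if "\<not> indep M (insert e I)" for e
    using indep_mono[of "insert e J" "insert e I"] J(1) that by blast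
  then show ?thesis unfolding cl_basis_of[OF I] cl_basis_of[OF J(2)] using J(1) by blast
qed

lemma cl_idem:
  assumes "A \<subseteq> E" shows "cl M (cl M A) = cl M A"
proof -
  obtain I where I: "basis_of I A" by (rule basis_of_exists)
  have "basis_of I (cl M A)"
    using I cl_superset[OF assms] unfolding basis_of_def cl_basis_of[OF I] by blast
  then show ?thesis using cl_basis_of[OF I] cl_basis_of[of I "cl M A"] by simp
qed

lemma flat_cl: "A \<subseteq> E \<Longrightarrow> flat M (cl M A)"
  by (simp add: flat_def cl_sub cl_idem)

lemma cl_subset_flat: "A \<subseteq> F \<Longrightarrow> flat M F \<Longrightarrow> cl M A \<subseteq> F"
  using cl_mono[of A F] by (simp add: flat_def)

lemma cl_proper_or_ground: "A \<subseteq> E \<Longrightarrow> A \<noteq> {} \<Longrightarrow> cl M A \<in> proper_flats M \<union> {E}"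
  using flat_cl[of A] cl_superset[of A] by (auto simp: proper_flats_def)

lemma proper_flatsD: "F \<in> proper_flats M \<Longrightarrow> F \<subseteq> E" "F \<in> proper_flats M \<Longrightarrow> flat M F" "F \<in> proper_flats M \<Longrightarrow> F \<noteq> {}"
    "F \<in> proper_flats M \<Longrightarrow> F \<noteq> E"
  by (auto simp: proper_flats_def flat_def)

lemma finite_proper_flats: "finite (proper_flats M)"
  by (rule finite_subset[of _ "Pow E"]) (use proper_flatsD finE in auto)

text \<open>Makes the closure condition in the definition of a face hereditary: enlarging a nonempty
  set cannot take its closure out of the filter.\<close>

lemma cl_in_filter:
  assumes P: "order_filter M P" and "A \<subseteq> B" "B \<subseteq> E" "A \<noteq> {}" "cl M A \<in> P \<union> {E}"
  shows "cl M B \<in> P \<union> {E}"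
proof -
  have AB: "cl M A \<subseteq> cl M B" using assms by (intro cl_mono)
  have "cl M B \<in> proper_flats M \<union> {E}" using assms by (intro cl_proper_or_ground) auto
  then show ?thesis using AB P assms(5) cl_sub[of B] unfolding order_filter_def by blast
qed

subsection \<open>Restriction and contraction\<close>

lemma indep_restriction:
  assumes "Z \<subseteq> E" shows "indep (restriction M Z) I \<longleftrightarrow> I \<subseteq> Z \<and> indep M I"
proof
  assume "indep (restriction M Z) I"
  then obtain B where "B \<in> bases (restriction M Z)" "I \<subseteq> B" unfolding indep_def by blast
  then have "B \<subseteq> Z" "indep M B" by (simp_all add: restriction_def)
  then show "I \<subseteq> Z \<and> indep M I" using indep_mono[of B I] \<open>I \<subseteq> B\<close> by blast
next
  assume "I \<subseteq> Z \<and> indep M I"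
  then have IZ: "I \<subseteq> Z" "indep M I" by auto
  obtain J where J: "I \<subseteq> J" "basis_of J Z" by (rule extend_basis_of[OF IZ])
  have "K = J" if KJ: "J \<subseteq> K" "K \<subseteq> Z" "indep M K" for K
  proof (rule ccontr)
    assume "K \<noteq> J"
    then obtain e where "e \<in> K - J" using KJ by blast
    then have "\<not> indep M (insert e J)" "insert e J \<subseteq> K" using J(2) KJ by (auto simp: basis_of_def)
    then show False using indep_mono KJ(3) by blast
  qed
  then have "J \<in> bases (restriction M Z)" using J(2) by (auto simp: restriction_def basis_of_def)
  then show "indep (restriction M Z) I" using J(1) by (auto simp: indep_def)
qed

lemma rk_restriction: "Z \<subseteq> E \<Longrightarrow> A \<subseteq> Z \<Longrightarrow> rk (restriction M Z) A = rk M A"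
  unfolding rk_def using indep_restriction[of Z] by (intro arg_cong[where f = Max]) blast

lemma cl_restriction: "Z \<subseteq> E \<Longrightarrow> A \<subseteq> Z \<Longrightarrow> cl (restriction M Z) A = cl M A \<inter> Z"
proof -
  assume Z: "Z \<subseteq> E" "A \<subseteq> Z"
  have "ground (restriction M Z) = Z" by (simp add: restriction_def)
  moreover have "rk (restriction M Z) (insert e A) = rk M (insert e A)" if "e \<in> Z" for e
    using Z that by (intro rk_restriction) auto
  ultimately show ?thesis using Z rk_restriction[OF Z] by (auto simp: cl_def)
qed

text \<open>An independent set that contains the basis \<open>K\<close> of \<open>Z\<close> meets
  \<open>Z\<close> in \<open>K\<close> only. Hence the bases of the contraction are the bases of
  \<open>M\<close> through \<open>K\<close> with \<open>K\<close> removed.\<close>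

lemma indep_contraction:
  assumes Z: "Z \<subseteq> E" and K: "basis_of K Z"
  shows "indep (contraction M Z) I \<longleftrightarrow> I \<inter> Z = {} \<and> indep M (I \<union> K)"
proof
  have K': "K \<subseteq> Z" "indep M K" "finite K" "rk M Z = card K"
    using K indep_finite rk_basis_of[OF K] by (auto simp: basis_of_def)
  have KZ: "J \<inter> Z = K" if KJ: "K \<subseteq> J" "indep M J" for J
  proof (rule ccontr)
    assume "J \<inter> Z \<noteq> K"
    then obtain e where "e \<in> J" "e \<in> Z - K" using KJ K'(1) by blast
    then show False using K indep_mono[OF KJ(2), of "insert e K"] KJ(1) by (auto simp: basis_of_def)
  qed
  {
    assume "indep (contraction M Z) I"
    then obtain B where B0: "B \<in> bases (contraction M Z)" "I \<subseteq> B" unfolding indep_def by (elim bexE)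
    have B: "I \<subseteq> B" "B \<subseteq> E" "card B = rk M E - rk M Z" "rk M (B \<union> Z) = rk M E"
      using B0 by (auto simp: contraction_def)
    have KB: "K \<subseteq> B \<union> Z" using K'(1) by blast
    obtain J where J: "K \<subseteq> J" "basis_of J (B \<union> Z)" by (rule extend_basis_of[OF KB K'(2)])
    have J': "J \<subseteq> B \<union> Z" "indep M J" "card J = rk M E" "finite J"
      using J(2) rk_basis_of[OF J(2)] B(4) indep_finite by (auto simp: basis_of_def)
    have "J - K \<subseteq> B" using J'(1) KZ[OF J(1) J'(2)] by blast
    moreover have "card (J - K) = card B" using J' K' B(3) card_Diff_subset[OF K'(3) J(1)] by simp
    moreover have "finite B" by (rule finite_subset[OF B(2) finE])
    ultimately have JB: "J - K = B" using card_subset_eq[of B "J - K"] by simp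
    have "B \<inter> Z = {}" using JB KZ[OF J(1) J'(2)] by blast
    moreover have "I \<union> K \<subseteq> J" using B(1) JB J(1) by blast
    ultimately show "I \<inter> Z = {} \<and> indep M (I \<union> K)" using B(1) indep_mono[OF J'(2)] by blast
  }
  {
    assume I: "I \<inter> Z = {} \<and> indep M (I \<union> K)"
    then have IK: "I \<union> K \<subseteq> E" "indep M (I \<union> K)" using indep_sub by auto
    obtain B where B: "I \<union> K \<subseteq> B" "basis_of B E" by (rule extend_basis_of[OF IK])
    have B': "B \<subseteq> E" "indep M B" "card B = rk M E" using B(2) rk_basis_of[OF B(2)] by (auto simp: basis_of_def)
    have "card (B - K) = rk M E - rk M Z" using B B' K' card_Diff_subset[OF K'(3), of B] by simp
    moreover have "rk M ((B - K) \<union> Z) = rk M E"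
    proof (rule antisym)
      have "card B \<le> rk M ((B - K) \<union> Z)" using B' K'(1) by (intro rk_ge) auto
      then show "rk M E \<le> rk M ((B - K) \<union> Z)" using B' by simp
      obtain J where "basis_of J ((B - K) \<union> Z)" by (rule basis_of_exists)
      then show "rk M ((B - K) \<union> Z) \<le> rk M E"
        using rk_ge[of J E] indep_sub[of J] by (simp add: rk_basis_of basis_of_def)
    qed
    moreover have "B - K \<subseteq> E - Z"
    proof
      fix e assume e: "e \<in> B - K"
      have "K \<subseteq> B" using B(1) by blast
      then show "e \<in> E - Z" using e B'(1) KZ[OF _ B'(2)] by blast
    qed
    ultimately have "B - K \<in> bases (contraction M Z)" by (simp add: contraction_def)
    moreover have "I \<subseteq> B - K" using I B(1) K'(1) by blast
    ultimately show "indep (contraction M Z) I" unfolding indep_def[of "contraction M Z"] by (intro bexI[of _ "B - K"])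
  }
qed

text \<open>The independent sets of the contraction are counted as extensions of one fixed basis of
  \<open>Z\<close>.\<close>

lemma rk_contraction:
  assumes Z: "Z \<subseteq> E" and A: "A \<inter> Z = {}"
  shows "rk (contraction M Z) A + rk M Z = rk M (A \<union> Z)"
proof -
  obtain K where K: "basis_of K Z" by (rule basis_of_exists)
  have KA: "K \<subseteq> A \<union> Z" "indep M K" using K by (auto simp: basis_of_def)
  obtain J where J: "K \<subseteq> J" "basis_of J (A \<union> Z)" by (rule extend_basis_of[OF KA])
  have J': "J \<subseteq> A \<union> Z" "indep M J" "finite J" "finite K" "K \<subseteq> Z" using J(2) K indep_finite by (auto simp: basis_of_def)
  have JZ: "J \<inter> Z = K"
  proof (rule ccontr)
    assume "J \<inter> Z \<noteq> K"
    then obtain e where "e \<in> J" "e \<in> Z - K" using J(1) J'(5) by blast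
    then show False using K indep_mono[OF J'(2), of "insert e K"] J(1) by (auto simp: basis_of_def)
  qed
  have "rk (contraction M Z) A = card (J - K)"
    unfolding rk_def
  proof (rule Max_eqI)
    show "finite {card I |I. I \<subseteq> A \<and> indep (contraction M Z) I}"
    proof (rule finite_subset[of _ "card ` Pow E"])
      have "I \<subseteq> E" if "indep (contraction M Z) I" for I
        using that indep_contraction[OF Z K, of I] indep_sub[of "I \<union> K"] by blast
      then show "{card I |I. I \<subseteq> A \<and> indep (contraction M Z) I} \<subseteq> card ` Pow E" by blast
    qed (simp add: finE)
    have "J - K \<union> K = J" "J - K \<subseteq> A" "(J - K) \<inter> Z = {}" using J(1) J'(1) JZ by auto
    then show "card (J - K) \<in> {card I |I. I \<subseteq> A \<and> indep (contraction M Z) I}"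
      using J'(2) by (auto simp: indep_contraction[OF Z K] intro!: exI[of _ "J - K"])
  next
    fix y assume "y \<in> {card I |I. I \<subseteq> A \<and> indep (contraction M Z) I}"
    then obtain I where I: "y = card I" "I \<subseteq> A" "I \<inter> Z = {}" "indep M (I \<union> K)"
      by (auto simp: indep_contraction[OF Z K])
    have "card (I \<union> K) \<le> card J" using I J'(5) by (intro basis_of_card_max[OF J(2)]) auto
    moreover have "card (I \<union> K) = card I + card K"
      using I J'(5) indep_finite[OF I(4)] by (intro card_Un_disjoint) auto
    ultimately show "y \<le> card (J - K)" using I(1) card_Diff_subset[OF J'(4) J(1)] by simp
  qed
  moreover have "card (J - K) + card K = card J"
    using card_Diff_subset[OF J'(4) J(1)] card_mono[OF J'(3) J(1)] by simp
  ultimately show ?thesis using rk_basis_of[OF K] rk_basis_of[OF J(2)] by simp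
qed

lemma ground_restriction [simp]: "ground (restriction M Z) = Z"
  and ground_contraction [simp]: "ground (contraction M Z) = E - Z"
  by (simp_all add: restriction_def contraction_def)

lemma cl_contraction:
  assumes Z: "Z \<subseteq> E" and A: "A \<inter> Z = {}"
  shows "cl (contraction M Z) A = cl M (A \<union> Z) - Z"
proof -
  have "rk (contraction M Z) (insert e A) = rk (contraction M Z) A \<longleftrightarrow> rk M (insert e (A \<union> Z)) = rk M (A \<union> Z)"
    if "e \<notin> Z" for e
    using rk_contraction[OF Z A] rk_contraction[OF Z, of "insert e A"] A that by auto
  then show ?thesis by (auto simp: cl_def)
qed

lemma proper_flats_contraction:
  assumes Z: "flat M Z"
  shows "G \<in> proper_flats (contraction M Z) \<longleftrightarrow> G \<inter> Z = {} \<and> G \<union> Z \<in> proper_flats M \<and> Z \<subset> G \<union> Z"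
proof -
  have ZE: "Z \<subseteq> E" using Z by (simp add: flat_def)
  show ?thesis
  proof (cases "G \<subseteq> E \<and> G \<inter> Z = {}")
    case True
    have "Z \<subseteq> cl M (G \<union> Z)" using cl_superset[of "G \<union> Z"] ZE True by blast
    then have "cl M (G \<union> Z) - Z = G \<longleftrightarrow> cl M (G \<union> Z) = G \<union> Z" using True by blast
    moreover have "cl (contraction M Z) G = cl M (G \<union> Z) - Z" using True by (intro cl_contraction ZE) blast
    ultimately have c: "cl (contraction M Z) G = G \<longleftrightarrow> cl M (G \<union> Z) = G \<union> Z" by (simp only:)
    have "G \<noteq> {} \<longleftrightarrow> Z \<subset> G \<union> Z \<and> G \<union> Z \<noteq> {}" "G = E - Z \<longleftrightarrow> G \<union> Z = E" "G \<subseteq> E - Z \<longleftrightarrow> G \<union> Z \<subseteq> E"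
      using True ZE by blast+
    then show ?thesis
      unfolding proper_flats_def flat_def ground_contraction mem_Collect_eq c using True by (elim conjE) (simp only: simp_thms conj_ac)
  next
    case False
    then have "\<not> G \<subseteq> E - Z" "\<not> (G \<inter> Z = {} \<and> G \<union> Z \<subseteq> E)" by blast+
    then have "G \<notin> proper_flats (contraction M Z)" by (simp add: proper_flats_def flat_def)
    moreover have "\<not> (G \<inter> Z = {} \<and> G \<union> Z \<in> proper_flats M \<and> Z \<subset> G \<union> Z)"
      using \<open>\<not> (G \<inter> Z = {} \<and> G \<union> Z \<subseteq> E)\<close> proper_flatsD(1)[of "G \<union> Z"] by blast
    ultimately show ?thesis by (simp only:)
  qed
qed

lemma cl_contraction_empty: "flat M Z \<Longrightarrow> cl (contraction M Z) {} = {}"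
  using cl_contraction[of Z "{}"] by (simp add: flat_def)

text \<open>Shows later that the contraction, with all its proper flats as filter, has no element
  variables: every closure of a nonempty set is a proper flat or the whole ground set.\<close>

lemma cl_contraction_nonempty:
  assumes Z: "flat M Z" and A: "A \<subseteq> E - Z" "A \<noteq> {}"
  shows "cl (contraction M Z) A \<in> proper_flats (contraction M Z) \<union> {ground (contraction M Z)}"
proof -
  have ZE: "Z \<subseteq> E" using Z by (simp add: flat_def)
  let ?C = "cl M (A \<union> Z)"
  have AZ: "A \<union> Z \<subseteq> E" "A \<inter> Z = {}" using A ZE by auto
  have C: "A \<union> Z \<subseteq> ?C" "?C \<subseteq> E" "cl M ?C = ?C" using cl_superset[OF AZ(1)] cl_sub cl_idem[OF AZ(1)] by auto
  have eq: "cl (contraction M Z) A = ?C - Z" using cl_contraction[OF ZE AZ(2)] .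
  show ?thesis
  proof (cases "?C = E")
    case True then show ?thesis by (simp add: eq)
  next
    case False
    have "(?C - Z) \<union> Z = ?C" using C(1) by blast
    moreover have "?C \<in> proper_flats M"
    proof -
      have "?C \<noteq> {}" using C(1) A(2) by blast
      then show ?thesis unfolding proper_flats_def flat_def using C(2,3) False by (simp only: mem_Collect_eq simp_thms)
    qed
    moreover have "Z \<subset> ?C" using C(1) A by blast
    ultimately have "?C - Z \<in> proper_flats (contraction M Z)"
      unfolding proper_flats_contraction[OF Z] by (simp only: simp_thms) blast
    then show ?thesis unfolding eq by (rule UnI1)
  qed
qed

end

section \<open>The long exact sequence\<close>

lemma BdI':
  assumes "b \<in> Ch js t s" "i \<in> Ch js (t - 1) (s + 1)" "i \<in> IC bad"
  shows "dK js L b + i \<in> Bd js L bad (t - 1) (s + 1)"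
proof (rule BdI)
  have "t - 1 + 1 = t" "s + 1 - 1 = s" by simp_all
  then show "b \<in> Ch js (t - 1 + 1) (s + 1 - 1)" using assms(1) by (simp only:)
qed (rule assms)+

lemma BdE':
  assumes "x \<in> Bd js L bad (t - 1) (s + 1)"
  obtains b i where "x = dK js L b + i" "b \<in> Ch js t s" "i \<in> Ch js (t - 1) (s + 1)" "i \<in> IC bad"
proof -
  have "t - 1 + 1 = t" "s + 1 - 1 = s" by simp_all
  moreover obtain b i where "x = dK js L b + i" "b \<in> Ch js (t - 1 + 1) (s + 1 - 1)" "i \<in> Ch js (t - 1) (s + 1)" "i \<in> IC bad"
    using assms unfolding Bd_def by blast
  ultimately show thesis by (intro that[of b i]) (simp_all only:)
qed

lemma BdE:
  assumes "x \<in> Bd js L bad t s"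
  obtains b i where "x = dK js L b + i" "b \<in> Ch js (t + 1) (s - 1)" "i \<in> Ch js t s" "i \<in> IC bad"
  using assms unfolding Bd_def by auto

lemma IC_mono: "(\<And>m. bad m \<Longrightarrow> bad' m) \<Longrightarrow> c \<in> IC bad \<Longrightarrow> c \<in> IC bad'"
  using mono_ideal_mono[of bad bad'] unfolding IC_def by blast

lemma Zc_mono: "(\<And>m. bad m \<Longrightarrow> bad' m) \<Longrightarrow> c \<in> Zc js L bad t s \<Longrightarrow> c \<in> Zc js L bad' t s"
  unfolding Zc_def using IC_mono[of bad bad'] by blast

lemma Bd_mono: "(\<And>m. bad m \<Longrightarrow> bad' m) \<Longrightarrow> c \<in> Bd js L bad t s \<Longrightarrow> c \<in> Bd js L bad' t s"
  by (elim BdE) (auto intro!: BdI intro: IC_mono)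

lemma ZcD: "c \<in> Zc js L bad t s \<Longrightarrow> c \<in> Ch js t s" "c \<in> Zc js L bad t s \<Longrightarrow> dK js L c \<in> IC bad"
  by (simp_all add: Zc_def)

lemma ZcI: "c \<in> Ch js t s \<Longrightarrow> dK js L c \<in> IC bad \<Longrightarrow> c \<in> Zc js L bad t s"
  by (simp add: Zc_def)

definition trc :: "(('v \<Rightarrow>\<^sub>0 nat) \<Rightarrow> bool) \<Rightarrow> ('v chain) \<Rightarrow> 'v chain" where
  "trc good c = (\<lambda>S. tr good (c S))"

abbreviation nf :: "(('v \<Rightarrow>\<^sub>0 nat) \<Rightarrow> bool) \<Rightarrow> ('v chain) \<Rightarrow> 'v chain" where
  "nf bad \<equiv> trc (\<lambda>m. \<not> bad m)"

lemma clinear_trc: "clinear (trc good)"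
  by (rule clinearI) (auto simp: trc_def tr_simps)

lemma trc_Ch:
  assumes "c \<in> Ch js t s" shows "trc good c \<in> Ch js t s"
proof -
  have "c S \<noteq> 0" if "tr good (c S) \<noteq> 0" for S
    using that by (auto simp: tr_simps(3))
  moreover have "tr good (c S) \<in> homogeneous s" for S
    using assms by (intro tr_homogeneous) (simp add: Ch_def)
  ultimately show ?thesis using assms by (simp add: Ch_def trc_def)
qed

lemma trc_IC_self: "(\<And>m. good m \<Longrightarrow> bad m) \<Longrightarrow> trc good c \<in> IC bad"
  by (auto simp: IC_def trc_def mono_ideal_def keys_tr)

lemma trc_eq_0: "(\<And>m. bad m \<Longrightarrow> \<not> good m) \<Longrightarrow> c \<in> IC bad \<Longrightarrow> trc good c = 0"
  by (rule ext) (auto simp: IC_def trc_def tr_eq_0_iff mono_ideal_def)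

lemma trc_rest:
  assumes "\<And>m. bad' m \<Longrightarrow> \<not> bad m \<Longrightarrow> good m" "c \<in> IC bad'"
  shows "c - trc good c \<in> IC bad"
  unfolding IC_def
proof (intro CollectI allI)
  fix S
  have "c S - tr good (c S) \<in> mono_ideal (\<lambda>m. \<not> good m)" by (rule diff_tr_in_mono_ideal)
  moreover have "c S \<in> mono_ideal bad'" using assms(2) by (simp add: IC_def)
  then have "c S - tr good (c S) \<in> mono_ideal bad'" by (intro mono_ideal_closed(3) tr_in_mono_ideal)
  ultimately show "(c - trc good c) S \<in> mono_ideal bad"
    using assms(1) unfolding mono_ideal_def trc_def minus_apply by blast
qed

lemma IC_diff_trans: "a - b \<in> IC bad \<Longrightarrow> b - c \<in> IC bad \<Longrightarrow> a - c \<in> IC bad"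
  using IC_closed(2)[of "a - b" bad "b - c"] by (simp only: diff_add_cancel add_diff_eq)

lemma IC_diff_sym: "a - b \<in> IC bad \<Longrightarrow> b - a \<in> IC bad"
  using IC_closed(4)[of "a - b" bad] by (simp only: minus_diff_eq)

lemma IC_diff_cong: "a - b \<in> IC bad \<Longrightarrow> b \<in> IC bad \<Longrightarrow> a \<in> IC bad"
  using IC_closed(2)[of "a - b" bad b] by (simp only: diff_add_cancel)

lemma IC_diff_dK: "upward bad \<Longrightarrow> a - b \<in> IC bad \<Longrightarrow> dK js L a - dK js L b \<in> IC bad"
  using dK_IC[of bad "a - b" js L] by (simp only: dK_simps)

text \<open>The primed monomials define the quotients by \<open>N\<close>; assumption \<open>new\<close> says that both rings have the
  same \<open>N\<close>, so that the part \<open>T\<close> of a boundary in \<open>N\<close> can be moved from one ring to the other.\<close>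

locale les =
  fixes js :: "int list" and Lm Lp :: "int \<Rightarrow> 'v cpoly" and bm bp bm' bp' :: "('v \<Rightarrow>\<^sub>0 nat) \<Rightarrow> bool"
    and \<theta> :: "'v \<Rightarrow> 'v cpoly"
  assumes dist: "distinct js"
    and up: "upward bm" "upward bp" "upward bm'" "upward bp'"
    and Lm1: "\<And>i. i \<in> set js \<Longrightarrow> Lm i \<in> homogeneous 1" and Lp1: "\<And>i. i \<in> set js \<Longrightarrow> Lp i \<in> homogeneous 1"
    and \<theta>1: "\<And>v. \<theta> v \<in> homogeneous 1"
    and subm: "\<And>m. bm m \<Longrightarrow> bm' m" and subp: "\<And>m. bp m \<Longrightarrow> bp' m"
    and new: "\<And>m. bm' m \<and> \<not> bm m \<longleftrightarrow> bp' m \<and> \<not> bp m"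
    and \<theta>I: "\<And>m. bm m \<Longrightarrow> substitute \<theta> (gen m) \<in> mono_ideal bp"
    and \<theta>N: "\<And>m. bm' m \<Longrightarrow> \<not> bm m \<Longrightarrow> substitute \<theta> (gen m) - gen m \<in> mono_ideal bp"
    and \<theta>L: "\<And>i. i \<in> set js \<Longrightarrow> substitute \<theta> (Lm i) = Lp i"
begin

abbreviation "F \<equiv> mapc \<theta>"
abbreviation "dm \<equiv> dK js Lm"
abbreviation "dp \<equiv> dK js Lp"
abbreviation "T \<equiv> trc (\<lambda>m. bm' m \<and> \<not> bm m)"

text \<open>The connecting map. For a cycle \<open>z\<close> of Y_+ the chain \<open>dp z\<close>
  lies in N modulo non-faces of the larger ring; its normal form \<open>T (dp z)\<close> is read as
  a chain over the smaller ring, which has the same N.\<close>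

definition H :: "('v chain) \<Rightarrow> 'v chain" where
  "H z = T (dp z)"

text \<open>Boundaries of Y_+ together with the image of the cycles of Y_-. Dividing the cycles of
  Y_+ by it gives the cokernel on homology, which is identified with \<open>E_space\<close>
  later.\<close>

definition BE :: "int \<Rightarrow> int \<Rightarrow> ('v chain) set" where
  "BE t s = {x + y | x y. x \<in> Bd js Lp bp' t s \<and> y \<in> F ` Zc js Lm bm' t s}"

lemma subspace_BE: "cv.subspace (BE t s)"
  unfolding BE_def by (intro cv.subspace_sums subspace_Bd cvp.linear_subspace_image clinear_mapc subspace_Zc)

lemma clinear_H: "clinear H"
  unfolding H_def by (rule clinear_comp[OF clinear_trc clinear_dK])

lemmas F_lin = clinear_add[OF clinear_mapc] clinear_diff[OF clinear_mapc] clinear_uminus[OF clinear_mapc] clinear_zero[OF clinear_mapc]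
lemmas T_lin = clinear_add[OF clinear_trc] clinear_diff[OF clinear_trc] clinear_uminus[OF clinear_trc] clinear_zero[OF clinear_trc]
lemmas H_lin = clinear_add[OF clinear_H] clinear_diff[OF clinear_H] clinear_uminus[OF clinear_H] clinear_zero[OF clinear_H]

lemma F_dK: "F (dm c) = dp (F c)"
  unfolding mapc_dK by (simp add: dK_def \<theta>L)

lemma F_Ch: "c \<in> Ch js t s \<Longrightarrow> F c \<in> Ch js t s"
  by (rule mapc_Ch[OF \<theta>1])

lemma F_IC: "c \<in> IC bm \<Longrightarrow> F c \<in> IC bp"
  by (rule mapc_IC[OF \<theta>I])

lemma F_T: "F (T c) - T c \<in> IC bp"
  unfolding IC_def
proof (intro CollectI allI)
  fix S
  have "T c S \<in> {p. substitute \<theta> p - p \<in> mono_ideal bp}"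
  proof (rule in_subspace_gen)
    show "cv.subspace {p. substitute \<theta> p - p \<in> mono_ideal bp}"
    proof -
      have "clinear (\<lambda>p. substitute \<theta> p - p)"
        by (rule clinearI) (simp_all add: substitute_linear cv.scale_right_diff_distrib)
      from cvp.linear_subspace_vimage[OF this subspace_mono_ideal] show ?thesis by (simp add: vimage_def)
    qed
    show "gen k \<in> {p. substitute \<theta> p - p \<in> mono_ideal bp}" if "k \<in> keys (T c S)" for k
      using that \<theta>N by (auto simp: trc_def keys_tr)
  qed
  then show "(F (T c) - T c) S \<in> mono_ideal bp" by (simp only: minus_apply mapc_def mem_Collect_eq)
qed

lemma rest_m: "c \<in> IC bm' \<Longrightarrow> c - T c \<in> IC bm"
  by (rule trc_rest[where bad' = bm']) auto

lemma rest_p: "c \<in> IC bp' \<Longrightarrow> c - T c \<in> IC bp"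
  using new by (intro trc_rest[where bad' = bp']) auto

lemma F_minus: "c \<in> IC bm' \<Longrightarrow> F c - T c \<in> IC bp"
  using IC_closed(2)[OF F_IC[OF rest_m] F_T, of c c] by (simp only: F_lin) simp

lemma F_plus: "c \<in> IC bp' \<Longrightarrow> F (T c) - c \<in> IC bp"
  using IC_diff_trans[OF F_T IC_diff_sym[OF rest_p]] by simp

lemma T_zero: "c \<in> IC bp \<Longrightarrow> T c = 0"
  using new by (intro trc_eq_0[where bad = bp]) auto

lemma T_cong: "a - b \<in> IC bp \<Longrightarrow> T a = T b"
  using T_zero[of "a - b"] by (simp only: T_lin eq_iff_diff_eq_0[symmetric])

lemma T_T: "T (T c) = T c"
  by (simp add: trc_def tr_tr)

lemma T_ICm: "T c \<in> IC bm'" and T_ICp: "T c \<in> IC bp'"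
  using new by (auto intro!: trc_IC_self)

text \<open>\<open>F\<close> is injective on N, since \<open>T\<close> recovers a member of N from
  its image.\<close>

lemma reflect: "c \<in> IC bm' \<Longrightarrow> F c \<in> IC bp \<Longrightarrow> c \<in> IC bm"
proof -
  assume c: "c \<in> IC bm'" "F c \<in> IC bp"
  have "T c = T (F c)" using T_cong[OF F_minus[OF c(1)]] by (simp only: T_T)
  also have "\<dots> = 0" by (rule T_zero[OF c(2)])
  finally show "c \<in> IC bm" using rest_m[OF c(1)] by simp
qed

lemma Bp_Zp: "upward bad \<Longrightarrow> c \<in> Bd js Lp bad t s \<Longrightarrow> c \<in> Zc js Lp bad t s"
  using Bd_subset_Zc[of js bad Lp t s] dist Lp1 by blast

lemma F_Zc: "c \<in> Zc js Lm bm t s \<Longrightarrow> F c \<in> Zc js Lp bp t s"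
  by (auto simp: Zc_def F_Ch F_dK[symmetric] F_IC)

lemma F_Bd: "c \<in> Bd js Lm bm t s \<Longrightarrow> F c \<in> Bd js Lp bp t s"
  by (elim BdE) (simp add: F_lin F_dK, intro BdI F_Ch F_IC)

lemma Zp_ZY: "c \<in> Zc js Lp bp t s \<Longrightarrow> c \<in> Zc js Lp bp' t s"
  using subp by (rule Zc_mono)

lemma BE_I: "x \<in> Bd js Lp bp' t s \<Longrightarrow> y \<in> Zc js Lm bm' t s \<Longrightarrow> x + F y \<in> BE t s"
  unfolding BE_def by blast

lemma Bp_BE: "c \<in> Bd js Lp bp t s \<Longrightarrow> c \<in> BE t s"
  using BE_I[OF Bd_mono[OF subp] Zc_closed(1)] by (simp add: F_lin)

lemma BE_ZY: "x \<in> BE t s \<Longrightarrow> x \<in> Zc js Lp bp' t s"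
proof -
  assume "x \<in> BE t s"
  then obtain b y where x: "x = b + F y" "b \<in> Bd js Lp bp' t s" "y \<in> Zc js Lm bm' t s" unfolding BE_def by blast
  have "b \<in> Zc js Lp bp' t s" using x(2) by (rule Bp_Zp[OF up(4)])
  moreover have "F y \<in> Zc js Lp bp' t s"
  proof (rule ZcI)
    have y: "dm y \<in> IC bm'" using x(3) by (rule ZcD)
    have "F (dm y) \<in> IC bp'" using F_minus[OF y] by (intro IC_diff_cong[OF IC_mono[OF subp] T_ICp])
    then show "dp (F y) \<in> IC bp'" by (simp only: F_dK)
  qed (rule F_Ch[OF ZcD(1)[OF x(3)]])
  ultimately show ?thesis unfolding x(1) by (rule Zc_closed(2))
qed

lemma F_IC': "c \<in> IC bm' \<Longrightarrow> F c \<in> IC bp'"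
  by (rule IC_diff_cong[OF IC_mono[OF subp F_minus] T_ICp])

lemma F_Bd': "c \<in> Bd js Lm bm' t s \<Longrightarrow> F c \<in> Bd js Lp bp' t s"
  by (elim BdE) (simp add: F_lin F_dK, intro BdI F_Ch F_IC')

lemma F_Zc': "c \<in> Zc js Lm bm' t s \<Longrightarrow> F c \<in> Zc js Lp bp' t s"
  by (auto simp: Zc_def F_Ch F_dK[symmetric] F_IC')

lemma H_Ch: "z \<in> Ch js t s \<Longrightarrow> H z \<in> Ch js (t - 1) (s + 1)"
  unfolding H_def by (intro trc_Ch dK_Ch Lp1)

lemma F_H: "dp z \<in> IC bp' \<Longrightarrow> F (H z) - dp z \<in> IC bp"
  unfolding H_def by (rule F_plus)

text \<open>Modulo non-faces the image of \<open>dm (H z)\<close> under \<open>F\<close> is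
  \<open>dp (dp z)\<close>, which is zero; \<open>reflect\<close> carries this back to the smaller
  ring.\<close>

lemma H_Zc: "z \<in> Zc js Lp bp' t s \<Longrightarrow> H z \<in> Zc js Lm bm (t - 1) (s + 1)"
proof (rule ZcI)
  assume z: "z \<in> Zc js Lp bp' t s"
  show "H z \<in> Ch js (t - 1) (s + 1)" by (rule H_Ch[OF ZcD(1)[OF z]])
  show "dm (H z) \<in> IC bm"
  proof (rule reflect)
    show "dm (H z) \<in> IC bm'" unfolding H_def by (rule dK_IC[OF up(3) T_ICm])
    have "dp (F (H z)) - dp (dp z) \<in> IC bp" by (rule IC_diff_dK[OF up(2) F_H[OF ZcD(2)[OF z]]])
    then show "F (dm (H z)) \<in> IC bp" by (simp only: F_dK dK_dK[OF dist] diff_0_right)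
  qed
qed

text \<open>On cycles that come from Y_- the connecting map is that of the smaller ring:
  \<open>dm y\<close> up to non-faces, a boundary.\<close>

lemma H_F: "y \<in> Zc js Lm bm' t s \<Longrightarrow> H (F y) \<in> Bd js Lm bm (t - 1) (s + 1)"
proof -
  assume y: "y \<in> Zc js Lm bm' t s"
  have "H (F y) = T (F (dm y))" by (simp only: H_def F_dK)
  also have "\<dots> = T (T (dm y))" by (rule T_cong[OF F_minus[OF ZcD(2)[OF y]]])
  finally have eq: "H (F y) = dm y + - (dm y - T (dm y))" by (simp only: T_T minus_diff_eq add_diff_cancel_left' diff_add_cancel add_diff_eq)
  show ?thesis unfolding eq
  proof (rule BdI'[OF ZcD(1)[OF y]])
    have d: "dm y \<in> Ch js (t - 1) (s + 1)" by (rule dK_Ch[OF Lm1 ZcD(1)[OF y]])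
    show "- (dm y - T (dm y)) \<in> Ch js (t - 1) (s + 1)" by (rule Ch_closed(4)[OF Ch_closed(3)[OF d trc_Ch[OF d]]])
    show "- (dm y - T (dm y)) \<in> IC bm" by (rule IC_closed(4)[OF rest_m[OF ZcD(2)[OF y]]])
  qed
qed

lemma H_BE: "x \<in> BE t s \<Longrightarrow> H x \<in> Bd js Lm bm (t - 1) (s + 1)"
proof -
  assume "x \<in> BE t s"
  then obtain b i y where x: "x = (dp b + i) + F y" "i \<in> Ch js t s" "i \<in> IC bp'" "y \<in> Zc js Lm bm' t s"
    unfolding BE_def by (auto elim!: BdE)
  have "T i \<in> Zc js Lm bm' t s" by (rule ZcI[OF trc_Ch[OF x(2)] dK_IC[OF up(3) T_ICm]])
  then have 1: "H (F (T i)) \<in> Bd js Lm bm (t - 1) (s + 1)" by (rule H_F)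
  have "H (F (T i)) = H i"
    unfolding H_def by (rule T_cong[OF IC_diff_dK[OF up(2) F_plus[OF x(3)]]])
  moreover have "H (dp b) = 0" by (simp only: H_def dK_dK[OF dist] T_lin)
  ultimately have "H x = H (F (T i)) + H (F y)" by (simp only: x(1) H_lin add_0)
  then show ?thesis using Bd_closed(2)[OF 1 H_F[OF x(4)]] by (simp only:)
qed

lemma exact1:
  assumes z: "z \<in> Zc js Lp bp t s"
  shows "z \<in> BE t s \<longleftrightarrow> (\<exists>c\<in>Zc js Lm bm t s. F c - z \<in> Bd js Lp bp t s)"
proof
  assume "z \<in> BE t s"
  then obtain b i y where x: "z = (dp b + i) + F y" "b \<in> Ch js (t + 1) (s - 1)" "i \<in> Ch js t s" "i \<in> IC bp'" "y \<in> Zc js Lm bm' t s"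
    unfolding BE_def by (auto elim!: BdE)
  \<comment> \<open>\<open>T i\<close> is the part of \<open>z\<close> that lies in N, read in the
    smaller ring.\<close>
  define c where "c = T i + y"
  have cCh: "c \<in> Ch js t s" unfolding c_def by (rule Ch_closed(2)[OF trc_Ch[OF x(3)] ZcD(1)[OF x(5)]])
  have "F c - z = dp (- b) + (F (T i) - i)" unfolding c_def x(1) F_lin dK_simps by (rule ext) simp
  also have "\<dots> \<in> Bd js Lp bp t s" 
    by (rule BdI[OF Ch_closed(4)[OF x(2)] Ch_closed(3)[OF F_Ch[OF trc_Ch[OF x(3)]] x(3)] F_plus[OF x(4)]])
  finally have 1: "F c - z \<in> Bd js Lp bp t s" .
  have "c \<in> Zc js Lm bm t s"
  proof (rule ZcI[OF cCh reflect])
    show "dm c \<in> IC bm'" unfolding c_def dK_simps by (rule IC_closed(2)[OF dK_IC[OF up(3) T_ICm] ZcD(2)[OF x(5)]])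
    have "dp (F c - z) \<in> IC bp" by (rule ZcD(2)[OF Bp_Zp[OF up(2) 1]])
    then have "dp (F c) - dp z \<in> IC bp" by (simp only: dK_simps)
    then show "F (dm c) \<in> IC bp" unfolding F_dK by (rule IC_diff_cong[OF _ ZcD(2)[OF z]])
  qed
  then show "\<exists>c\<in>Zc js Lm bm t s. F c - z \<in> Bd js Lp bp t s" using 1 by blast
next
  assume "\<exists>c\<in>Zc js Lm bm t s. F c - z \<in> Bd js Lp bp t s"
  then obtain c where c: "c \<in> Zc js Lm bm t s" "F c - z \<in> Bd js Lp bp t s" by blast
  have "- (F c - z) + F c \<in> BE t s"
    by (rule BE_I[OF Bd_mono[OF subp Bd_closed(4)[OF c(2)]] Zc_mono[OF subm c(1)]])
  then show "z \<in> BE t s" by simp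
qed

lemma exact2:
  assumes z: "z \<in> Zc js Lp bp' t s"
  shows "H z \<in> Bd js Lm bm (t - 1) (s + 1) \<longleftrightarrow> (\<exists>c\<in>Zc js Lp bp t s. c - z \<in> BE t s)"
proof
  assume "H z \<in> Bd js Lm bm (t - 1) (s + 1)"
  then obtain b i where b: "H z = dm b + i" "b \<in> Ch js t s" "i \<in> IC bm" by (rule BdE')
  \<comment> \<open>\<open>b\<close> bounds \<open>H z\<close> modulo non-faces, so
    \<open>F b\<close> has the same differential as \<open>z\<close> and the difference is a
    cycle.\<close>
  define c where "c = z - F b"
  have "c \<in> Zc js Lp bp t s"
  proof (rule ZcI)
    show "c \<in> Ch js t s" unfolding c_def by (rule Ch_closed(3)[OF ZcD(1)[OF z] F_Ch[OF b(2)]])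
    have "F (H z) = dp (F b) + F i" by (simp only: b(1) F_lin F_dK)
    then have "dp c = F i - (F (H z) - dp z)" unfolding c_def dK_simps by simp
    also have "\<dots> \<in> IC bp" by (rule IC_closed(3)[OF F_IC[OF b(3)] F_H[OF ZcD(2)[OF z]]])
    finally show "dp c \<in> IC bp" .
  qed
  moreover have "- b \<in> Zc js Lm bm' t s"
  proof (rule Zc_closed(4)[OF ZcI[OF b(2)]])
    have "dm b = H z - i" by (simp add: b(1))
    also have "\<dots> \<in> IC bm'" unfolding H_def by (rule IC_closed(3)[OF T_ICm IC_mono[OF subm b(3)]])
    finally show "dm b \<in> IC bm'" .
  qed
  then have "0 + F (- b) \<in> BE t s" by (rule BE_I[OF Bd_closed(1)])
  then have "c - z \<in> BE t s" by (simp add: c_def F_lin)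
  ultimately show "\<exists>c\<in>Zc js Lp bp t s. c - z \<in> BE t s" by blast
next
  assume "\<exists>c\<in>Zc js Lp bp t s. c - z \<in> BE t s"
  then obtain c where c: "c \<in> Zc js Lp bp t s" "c - z \<in> BE t s" by blast
  have "H c = 0" unfolding H_def by (rule T_zero[OF ZcD(2)[OF c(1)]])
  then have "H z = - H (c - z)" by (simp add: H_lin)
  then show "H z \<in> Bd js Lm bm (t - 1) (s + 1)" using Bd_closed(4)[OF H_BE[OF c(2)]] by (simp only:)
qed

text \<open>Exactness at the Tor of the smaller ring. This is the place where injectivity of the map
  from the homology of Y_- to that of Y_+ enters.\<close>

lemma exact3:
  assumes inj: "\<And>t s y. y \<in> Zc js Lm bm' t s \<Longrightarrow> F y \<in> Bd js Lp bp' t s \<Longrightarrow> y \<in> Bd js Lm bm' t s"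
    and c: "c \<in> Zc js Lm bm (t - 1) (s + 1)"
  shows "F c \<in> Bd js Lp bp (t - 1) (s + 1) \<longleftrightarrow> (\<exists>z\<in>Zc js Lp bp' t s. H z - c \<in> Bd js Lm bm (t - 1) (s + 1))"
proof
  assume Fc: "F c \<in> Bd js Lp bp (t - 1) (s + 1)"
  then obtain b i where b: "F c = dp b + i" "b \<in> Ch js t s" "i \<in> IC bp" by (rule BdE')
  have "c \<in> Bd js Lm bm' (t - 1) (s + 1)"
    by (rule inj[OF Zc_mono[OF subm c] Bd_mono[OF subp Fc]])
  then obtain a i' where a: "c = dm a + i'" "a \<in> Ch js t s" "i' \<in> Ch js (t - 1) (s + 1)" "i' \<in> IC bm'" by (rule BdE')
  \<comment> \<open>\<open>b\<close> bounds \<open>F c\<close> in the larger ring, and by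
    injectivity \<open>a\<close> bounds \<open>c\<close> in Y_-. The difference of the two
    primitives is a cycle of Y_+ that the connecting map sends to the class of
    \<open>c\<close>.\<close>
  define z where "z = b - F a"
  have dz: "dp z - T i' \<in> IC bp"
  proof -
    have "F c = dp (F a) + F i'" by (simp only: a(1) F_lin F_dK)
    then have "dp b + i = dp (F a) + F i'" by (simp only: b(1))
    then have "dp b = dp (F a) + F i' - i" by (simp only: eq_diff_eq)
    then have "dp z - T i' = (F i' - T i') - i" unfolding z_def dK_simps by simp
    also have "\<dots> \<in> IC bp" by (rule IC_closed(3)[OF F_minus[OF a(4)] b(3)])
    finally show ?thesis .
  qed
  have "z \<in> Zc js Lp bp' t s"
  proof (rule ZcI)
    show "z \<in> Ch js t s" unfolding z_def by (rule Ch_closed(3)[OF b(2) F_Ch[OF a(2)]])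
    show "dp z \<in> IC bp'" by (rule IC_diff_cong[OF IC_mono[OF subp dz] T_ICp])
  qed
  moreover have Hz: "H z = T i'" unfolding H_def using T_cong[OF dz] by (simp only: T_T)
  have "H z - c = dm (- a) + - (i' - T i')" unfolding Hz a(1) dK_simps by (rule ext) simp
  then have "H z - c \<in> Bd js Lm bm (t - 1) (s + 1)"
    using BdI'[OF Ch_closed(4)[OF a(2)] Ch_closed(4)[OF Ch_closed(3)[OF a(3) trc_Ch[OF a(3)]]] IC_closed(4)[OF rest_m[OF a(4)]]]
    by (simp only:)
  ultimately show "\<exists>z\<in>Zc js Lp bp' t s. H z - c \<in> Bd js Lm bm (t - 1) (s + 1)" by blast
next
  assume "\<exists>z\<in>Zc js Lp bp' t s. H z - c \<in> Bd js Lm bm (t - 1) (s + 1)"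
  then obtain z where z: "z \<in> Zc js Lp bp' t s" "H z - c \<in> Bd js Lm bm (t - 1) (s + 1)" by blast
  have "F c = (dp z + (F (H z) - dp z)) - F (H z - c)" by (simp add: F_lin)
  also have "\<dots> \<in> Bd js Lp bp (t - 1) (s + 1)"
  proof (rule Bd_closed(3)[OF BdI' F_Bd[OF z(2)]])
    show "z \<in> Ch js t s" by (rule ZcD(1)[OF z(1)])
    then show "F (H z) - dp z \<in> Ch js (t - 1) (s + 1)" by (intro Ch_closed(3) F_Ch H_Ch dK_Ch Lp1)
    show "F (H z) - dp z \<in> IC bp" by (rule F_H[OF ZcD(2)[OF z(1)]])
  qed
  finally show "F c \<in> Bd js Lp bp (t - 1) (s + 1)" .
qed

end

section \<open>Eliminating one operator\<close>

text \<open>With \<open>e0\<close> in front, a chain is a pair of chains over \<open>js\<close>, and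
  the differential is that of the mapping cone of multiplication by \<open>L e0\<close>.\<close>

lemma dK_Cons:
  assumes "e0 \<notin> set js" "e0 \<notin> S"
  shows "dK (e0 # js) L c S = L e0 * c (insert e0 S) + dK js L c S"
    and "dK (e0 # js) L c (insert e0 S) = - dK js L (\<lambda>S. c (insert e0 S)) S"
proof -
  have eq: "set (e0 # js) - S = insert e0 (set js - S)" "set (e0 # js) - insert e0 S = set js - S"
    using assms by auto
  have sg1: "sg (e0 # js) i S = (sg js i S :: 'a cpoly)" if "i \<in> set js - S" for i
    using that assms by (auto simp: sg_def)
  have sg0: "sg (e0 # js) e0 S = (1 :: 'a cpoly)" by (simp add: sg_def)
  have sg2: "sg (e0 # js) i (insert e0 S) = - (sg js i S :: 'a cpoly)" if "i \<in> set js - S" for i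
  proof -
    have "e0 \<notin> set (takeWhile (\<lambda>k. k \<noteq> i) js)" using assms(1) by (auto dest: set_takeWhileD)
    then have "filter (\<lambda>k. k = e0 \<or> k \<in> S) (takeWhile (\<lambda>k. k \<noteq> i) js) = filter (\<lambda>k. k \<in> S) (takeWhile (\<lambda>k. k \<noteq> i) js)"
      by (intro filter_cong) auto
    then show ?thesis using that assms by (auto simp: sg_def)
  qed
  have "dK (e0 # js) L c S = sg (e0 # js) e0 S * (L e0 * c (insert e0 S)) + (\<Sum>i\<in>set js - S. sg (e0 # js) i S * (L i * c (insert i S)))"
    unfolding dK_def eq using assms by (intro sum.insert) auto
  also have "(\<Sum>i\<in>set js - S. sg (e0 # js) i S * (L i * c (insert i S))) = dK js L c S"
    unfolding dK_def by (intro sum.cong refl) (simp only: sg1)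
  finally show "dK (e0 # js) L c S = L e0 * c (insert e0 S) + dK js L c S" by (simp only: sg0 mult_1_left)
  show "dK (e0 # js) L c (insert e0 S) = - dK js L (\<lambda>S. c (insert e0 S)) S"
    unfolding dK_def eq sum_negf[symmetric]
    by (intro sum.cong refl) (simp only: sg2 insert_commute[of e0] mult_minus_left)
qed

lemma dK_in_mono_ideal:
  assumes "upward bad" "\<And>i. i \<in> set js - S \<Longrightarrow> c (insert i S) \<in> mono_ideal bad"
  shows "dK js L c S \<in> mono_ideal bad"
  unfolding dK_def
  by (intro mono_ideal_closed(6) sg_in_subspace subspace_mono_ideal mono_ideal_mult assms)

lemma Ch_cases:
  assumes "\<And>S. c S \<in> homogeneous s" "\<And>S. c S \<noteq> 0 \<Longrightarrow> S \<subseteq> set js \<and> int (card S) = t"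
  shows "c \<in> Ch js t s"
  using assms by (simp add: Ch_def)

lemma Ch_homogeneous: "c \<in> Ch js t s \<Longrightarrow> c S \<in> homogeneous s"
  by (simp add: Ch_def)

lemma Ch_zero: "c \<in> Ch js t s \<Longrightarrow> \<not> (S \<subseteq> set js \<and> int (card S) = t) \<Longrightarrow> c S = 0"
  by (auto simp: Ch_def)

lemma Ch_Cons: "c \<in> Ch js t s \<Longrightarrow> c \<in> Ch (e0 # js) t s"
  by (auto simp: Ch_def)

lemma eq_mod_sub: "a - b \<in> mono_ideal bad \<Longrightarrow> b \<in> mono_ideal bad \<Longrightarrow> a \<in> mono_ideal bad"
  using mono_ideal_closed(2)[of "a - b" bad b] by (simp only: diff_add_cancel)

text \<open>Division by a regular linear form. \<open>E1\<close>, \<open>E2'\<close>,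
  \<open>E3\<close> and \<open>E4\<close> say that \<open>\<theta>\<close> identifies the quotient
  by \<open>L e0\<close> with the ring of \<open>bad2\<close>, and \<open>E5\<close> says that
  \<open>L e0\<close> is not a zero divisor modulo bad monomials. The Koszul variable
  \<open>e0\<close> can then be dropped without changing the homology.\<close>

locale elim =
  fixes e0 :: int and js :: "int list" and L :: "int \<Rightarrow> 'v cpoly" and L2 :: "int \<Rightarrow> 'w cpoly"
    and bad :: "('v \<Rightarrow>\<^sub>0 nat) \<Rightarrow> bool" and bad2 :: "('w \<Rightarrow>\<^sub>0 nat) \<Rightarrow> bool" and \<theta> :: "'v \<Rightarrow> 'w cpoly"
  assumes dist: "distinct js" and e0: "e0 \<notin> set js"
    and up: "upward bad" and up2: "upward bad2"
    and L1: "\<And>i. i \<in> set (e0 # js) \<Longrightarrow> L i \<in> homogeneous 1"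
    and \<theta>1: "\<And>v. \<theta> v \<in> homogeneous 1"
    and E1: "\<And>m. bad m \<Longrightarrow> substitute \<theta> (gen m) \<in> mono_ideal bad2"
    and E2: "\<And>i. i \<in> set js \<Longrightarrow> substitute \<theta> (L i) - L2 i \<in> mono_ideal bad2"
    and E2': "substitute \<theta> (L e0) \<in> mono_ideal bad2"
    and E3: "\<And>q s. q \<in> homogeneous s \<Longrightarrow> \<exists>p\<in>homogeneous s. substitute \<theta> p - q \<in> mono_ideal bad2"
    and E4: "\<And>p s. p \<in> homogeneous s \<Longrightarrow> substitute \<theta> p \<in> mono_ideal bad2 \<Longrightarrow>
      \<exists>q\<in>homogeneous (s - 1). p - L e0 * q \<in> mono_ideal bad"
    and E5: "\<And>q. L e0 * q \<in> mono_ideal bad \<Longrightarrow> q \<in> mono_ideal bad"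
begin

text \<open>The map from the mapping cone to the quotient ring: components that involve
  \<open>e0\<close> are discarded.\<close>

definition \<kappa> :: "('v chain) \<Rightarrow> 'w chain" where
  "\<kappa> c = (\<lambda>S. if e0 \<in> S then 0 else substitute \<theta> (c S))"

lemma clinear_\<kappa>: "clinear \<kappa>"
  by (rule clinearI) (auto simp: \<kappa>_def substitute_linear)

lemmas \<kappa>_lin = clinear_add[OF clinear_\<kappa>] clinear_diff[OF clinear_\<kappa>] clinear_uminus[OF clinear_\<kappa>] clinear_zero[OF clinear_\<kappa>]

lemma \<kappa>_Ch:
  assumes "c \<in> Ch (e0 # js) t s" shows "\<kappa> c \<in> Ch js t s"
proof (rule Ch_cases)
  show "\<kappa> c S \<in> homogeneous s" for S
    using substitute_homogeneous[OF \<theta>1 Ch_homogeneous[OF assms, of S]] by (simp add: \<kappa>_def homogeneous_closed)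
  show "S \<subseteq> set js \<and> int (card S) = t" if "\<kappa> c S \<noteq> 0" for S
  proof -
    have "e0 \<notin> S" "c S \<noteq> 0" using that by (auto simp: \<kappa>_def substitute_linear split: if_splits)
    then show ?thesis using assms by (auto simp: Ch_def)
  qed
qed

lemma \<kappa>_IC: "c \<in> IC bad \<Longrightarrow> \<kappa> c \<in> IC bad2"
  using mapc_IC[of bad \<theta> bad2 c, OF E1] by (auto simp: IC_def \<kappa>_def mapc_def mono_ideal_closed(1))

lemma \<kappa>_dK: "\<kappa> (dK (e0 # js) L c) - dK js L2 (\<kappa> c) \<in> IC bad2"
  unfolding IC_def
proof (intro CollectI allI)
  fix S
  show "(\<kappa> (dK (e0 # js) L c) - dK js L2 (\<kappa> c)) S \<in> mono_ideal bad2"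
  proof (cases "e0 \<in> S")
    case True
    then have "\<kappa> (dK (e0 # js) L c) S = 0" "dK js L2 (\<kappa> c) S = 0" by (auto simp: \<kappa>_def dK_def)
    then show ?thesis by (simp add: mono_ideal_closed(1))
  next
    case False
    have ins: "e0 \<notin> insert i S" if "i \<in> set js" for i using e0 that False by auto
    have "\<kappa> (dK (e0 # js) L c) S = substitute \<theta> (L e0) * substitute \<theta> (c (insert e0 S)) + substitute \<theta> (dK js L c S)"
      using False by (simp add: \<kappa>_def dK_Cons[OF e0 False] substitute_linear substitute_mult)
    moreover have "substitute \<theta> (dK js L c S) = dK js (\<lambda>i. substitute \<theta> (L i)) (mapc \<theta> c) S"
      using mapc_dK[of \<theta> js L c] by (simp add: mapc_def fun_eq_iff)
    moreover have "dK js L2 (\<kappa> c) S = dK js L2 (mapc \<theta> c) S"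
      unfolding dK_def by (intro sum.cong refl) (use ins in \<open>auto simp: \<kappa>_def mapc_def\<close>)
    ultimately have "(\<kappa> (dK (e0 # js) L c) - dK js L2 (\<kappa> c)) S =
        substitute \<theta> (L e0) * substitute \<theta> (c (insert e0 S)) + (dK js (\<lambda>i. substitute \<theta> (L i)) (mapc \<theta> c) - dK js L2 (mapc \<theta> c)) S"
      by simp
    moreover have "(dK js (\<lambda>i. substitute \<theta> (L i)) (mapc \<theta> c) - dK js L2 (mapc \<theta> c)) S \<in> mono_ideal bad2"
      using dK_cong_mod[of bad2 js "\<lambda>i. substitute \<theta> (L i)" L2, OF up2 E2] by (simp only: IC_def mem_Collect_eq)
    ultimately show ?thesis using mono_ideal_mult2[OF up2 E2'] by (simp only: mono_ideal_closed(2))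
  qed
qed

lemma \<kappa>_Zc: "z \<in> Zc (e0 # js) L bad t s \<Longrightarrow> \<kappa> z \<in> Zc js L2 bad2 t s"
proof (rule ZcI)
  assume z: "z \<in> Zc (e0 # js) L bad t s"
  show "\<kappa> z \<in> Ch js t s" by (rule \<kappa>_Ch[OF ZcD(1)[OF z]])
  show "dK js L2 (\<kappa> z) \<in> IC bad2"
    by (rule IC_diff_cong[OF IC_diff_sym[OF \<kappa>_dK] \<kappa>_IC[OF ZcD(2)[OF z]]])
qed

lemma L2_hom: "\<kappa> (dK (e0 # js) L b) \<in> Bd js L2 bad2 t s" if b: "b \<in> Ch (e0 # js) (t + 1) (s - 1)"
  and h: "\<And>i. i \<in> set js \<Longrightarrow> L2 i \<in> homogeneous 1"
proof -
  have "dK (e0 # js) L b \<in> Ch (e0 # js) t s" using dK_Ch[OF L1 b] by simp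
  then have "\<kappa> (dK (e0 # js) L b) \<in> Ch js t s" by (rule \<kappa>_Ch)
  moreover have "dK js L2 (\<kappa> b) \<in> Ch js t s" using dK_Ch[OF h \<kappa>_Ch[OF b]] by simp
  ultimately have "dK js L2 (\<kappa> b) + (\<kappa> (dK (e0 # js) L b) - dK js L2 (\<kappa> b)) \<in> Bd js L2 bad2 t s"
    by (rule BdI[OF \<kappa>_Ch[OF b] Ch_closed(3) \<kappa>_dK])
  then show ?thesis by simp
qed

lemma \<kappa>_Bd:
  assumes "\<And>i. i \<in> set js \<Longrightarrow> L2 i \<in> homogeneous 1" "z \<in> Bd (e0 # js) L bad t s"
  shows "\<kappa> z \<in> Bd js L2 bad2 t s"
proof -
  obtain b i where z: "z = dK (e0 # js) L b + i" "b \<in> Ch (e0 # js) (t + 1) (s - 1)" "i \<in> Ch (e0 # js) t s" "i \<in> IC bad"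
    using assms(2) by (rule BdE)
  show ?thesis unfolding z(1) \<kappa>_lin
    by (rule Bd_closed(2)[OF L2_hom[OF z(2) assms(1)] IC_subset_Bd[OF \<kappa>_Ch[OF z(3)] \<kappa>_IC[OF z(4)]]])
qed

text \<open>If the components without \<open>e0\<close> vanish modulo the ideal, the differential
  there multiplies the other components by the regular form \<open>L e0\<close>; so these vanish as
  well.\<close>

lemma IC_propagate:
  assumes "\<And>S. e0 \<notin> S \<Longrightarrow> w S \<in> mono_ideal bad" "dK (e0 # js) L w \<in> IC bad"
  shows "w \<in> IC bad"
  unfolding IC_def
proof (intro CollectI allI)
  fix S
  show "w S \<in> mono_ideal bad"
  proof (cases "e0 \<in> S")
    case True
    define S' where "S' = S - {e0}"
    have S': "e0 \<notin> S'" "insert e0 S' = S" using True by (auto simp: S'_def)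
    have "dK js L w S' \<in> mono_ideal bad"
    proof (rule dK_in_mono_ideal[OF up])
      fix i assume "i \<in> set js - S'"
      then have "e0 \<notin> insert i S'" using e0 S'(1) by auto
      then show "w (insert i S') \<in> mono_ideal bad" by (rule assms(1))
    qed
    moreover have "L e0 * w S + dK js L w S' \<in> mono_ideal bad"
    proof -
      have "dK (e0 # js) L w S' \<in> mono_ideal bad" using assms(2) by (simp add: IC_def)
      then show ?thesis unfolding dK_Cons(1)[OF e0 S'(1)] S'(2) .
    qed
    ultimately have "L e0 * w S \<in> mono_ideal bad"
      using mono_ideal_closed(3)[of "L e0 * w S + dK js L w S'" bad "dK js L w S'"] by simp
    then show ?thesis by (rule E5)
  qed (rule assms(1))
qed

lemma lift:
  assumes "u \<in> Ch js t s"
  obtains v where "v \<in> Ch (e0 # js) t s" "\<kappa> v - u \<in> IC bad2"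
proof -
  have "\<forall>S. \<exists>p. p \<in> homogeneous s \<and> substitute \<theta> p - u S \<in> mono_ideal bad2 \<and> (\<not> (S \<subseteq> set js \<and> int (card S) = t) \<longrightarrow> p = 0)"
  proof
    fix S
    show "\<exists>p. p \<in> homogeneous s \<and> substitute \<theta> p - u S \<in> mono_ideal bad2 \<and> (\<not> (S \<subseteq> set js \<and> int (card S) = t) \<longrightarrow> p = 0)"
    proof (cases "S \<subseteq> set js \<and> int (card S) = t")
      case True
      then show ?thesis using E3[OF Ch_homogeneous[OF assms, of S]] by auto
    next
      case False
      then have "u S = 0" by (rule Ch_zero[OF assms])
      then show ?thesis by (intro exI[of _ 0]) (simp add: substitute_linear homogeneous_closed mono_ideal_closed(1))
    qed
  qed
  then obtain v where v: "\<And>S. v S \<in> homogeneous s" "\<And>S. substitute \<theta> (v S) - u S \<in> mono_ideal bad2"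
    "\<And>S. \<not> (S \<subseteq> set js \<and> int (card S) = t) \<Longrightarrow> v S = 0" by metis
  have "v \<in> Ch js t s" by (rule Ch_cases) (use v in auto)
  then have "v \<in> Ch (e0 # js) t s" by (rule Ch_Cons)
  moreover have "\<kappa> v - u \<in> IC bad2"
    unfolding IC_def
  proof (intro CollectI allI)
    fix S
    show "(\<kappa> v - u) S \<in> mono_ideal bad2"
    proof (cases "e0 \<in> S")
      case True
      then have "\<not> (S \<subseteq> set js \<and> int (card S) = t)" using e0 by auto
      then have "u S = 0" by (rule Ch_zero[OF assms])
      then show ?thesis using True by (simp add: \<kappa>_def mono_ideal_closed(1))
    qed (use v(2) in \<open>simp add: \<kappa>_def\<close>)
  qed
  ultimately show thesis by (rule that)
qed

text \<open>A component that the substitution kills is a multiple of \<open>L e0\<close>. The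
  quotients, placed at \<open>insert e0 S\<close>, form a chain \<open>b\<close> whose differential
  removes these components.\<close>

lemma divide_step:
  assumes "w \<in> Ch (e0 # js) t s" "\<kappa> w \<in> IC bad2"
  obtains b where "b \<in> Ch (e0 # js) (t + 1) (s - 1)" "\<kappa> b = 0"
    "\<And>S. e0 \<notin> S \<Longrightarrow> (w - dK (e0 # js) L b) S \<in> mono_ideal bad"
proof -
  have "\<forall>S. \<exists>q. q \<in> homogeneous (s - 1) \<and> (e0 \<notin> S \<longrightarrow> w S - L e0 * q \<in> mono_ideal bad) \<and> (w S = 0 \<longrightarrow> q = 0)"
  proof
    fix S
    show "\<exists>q. q \<in> homogeneous (s - 1) \<and> (e0 \<notin> S \<longrightarrow> w S - L e0 * q \<in> mono_ideal bad) \<and> (w S = 0 \<longrightarrow> q = 0)"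
    proof (cases "e0 \<in> S \<or> w S = 0")
      case True then show ?thesis by (intro exI[of _ 0]) (auto simp: homogeneous_closed mono_ideal_closed(1))
    next
      case False
      then have "substitute \<theta> (w S) = \<kappa> w S" by (simp add: \<kappa>_def)
      then have "substitute \<theta> (w S) \<in> mono_ideal bad2" using assms(2) by (simp add: IC_def)
      then show ?thesis using E4[OF Ch_homogeneous[OF assms(1), of S]] False by auto
    qed
  qed
  then obtain q where q: "\<And>S. q S \<in> homogeneous (s - 1)" "\<And>S. e0 \<notin> S \<Longrightarrow> w S - L e0 * q S \<in> mono_ideal bad"
    "\<And>S. w S = 0 \<Longrightarrow> q S = 0" by metis
  define b where "b = (\<lambda>S. if e0 \<in> S then q (S - {e0}) else 0)"
  have b0: "b S = 0" if "e0 \<notin> S" for S using that by (simp add: b_def)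
  have "b \<in> Ch (e0 # js) (t + 1) (s - 1)"
  proof (rule Ch_cases)
    show "b S \<in> homogeneous (s - 1)" for S using q(1) by (simp add: b_def homogeneous_closed)
    show "S \<subseteq> set (e0 # js) \<and> int (card S) = t + 1" if "b S \<noteq> 0" for S
    proof -
      have S: "e0 \<in> S" "w (S - {e0}) \<noteq> 0" using that q(3) by (auto simp: b_def split: if_splits)
      then have *: "S - {e0} \<subseteq> set (e0 # js)" "int (card (S - {e0})) = t" using assms(1) by (auto simp: Ch_def)
      have "finite (S - {e0})" using *(1) by (rule finite_subset) simp
      then have "card (insert e0 (S - {e0})) = Suc (card (S - {e0}))" by (intro card_insert_disjoint) auto
      then show ?thesis using * S(1) by (auto simp: insert_absorb)
    qed
  qed
  moreover have "\<kappa> b = 0" by (rule ext) (simp add: \<kappa>_def b0 substitute_linear)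
  moreover have "(w - dK (e0 # js) L b) S \<in> mono_ideal bad" if S: "e0 \<notin> S" for S
  proof -
    have "dK js L b S = 0" unfolding dK_def
    proof (rule sum.neutral, rule ballI)
      fix i assume "i \<in> set js - S"
      then have "e0 \<notin> insert i S" using e0 S by auto
      then have "b (insert i S) = 0" by (rule b0)
      then show "sg js i S * (L i * b (insert i S)) = 0" by (simp only: mult_zero_right)
    qed
    moreover have "b (insert e0 S) = q S" using S by (simp add: b_def)
    ultimately show ?thesis using q(2)[OF S] by (simp add: dK_Cons[OF e0 S])
  qed
  ultimately show thesis by (rule that)
qed

lemma dist0: "distinct (e0 # js)" using dist e0 by simp

text \<open>A primitive of the image is lifted and subtracted; the rest is killed by the
  substitution, so \<open>divide_step\<close> clears its components without \<open>e0\<close> and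
  \<open>IC_propagate\<close> the others.\<close>

lemma \<kappa>_inj:
  assumes z: "z \<in> Zc (e0 # js) L bad t s" and \<kappa>z: "\<kappa> z \<in> Bd js L2 bad2 t s"
  shows "z \<in> Bd (e0 # js) L bad t s"
proof -
  obtain u i where u: "\<kappa> z = dK js L2 u + i" "u \<in> Ch js (t + 1) (s - 1)" "i \<in> Ch js t s" "i \<in> IC bad2"
    using \<kappa>z by (rule BdE)
  obtain v where v: "v \<in> Ch (e0 # js) (t + 1) (s - 1)" "\<kappa> v - u \<in> IC bad2" using u(2) by (rule lift)
  define z1 where "z1 = z - dK (e0 # js) L v"
  have dv: "dK (e0 # js) L v \<in> Ch (e0 # js) t s" using dK_Ch[OF L1 v(1)] by simp
  have z1: "z1 \<in> Ch (e0 # js) t s" unfolding z1_def by (rule Ch_closed(3)[OF ZcD(1)[OF z] dv])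
  have "\<kappa> z1 = i - (\<kappa> (dK (e0 # js) L v) - dK js L2 (\<kappa> v)) - (dK js L2 (\<kappa> v) - dK js L2 u)"
    unfolding z1_def \<kappa>_lin u(1) by (rule ext) simp
  also have "\<dots> \<in> IC bad2"
    by (rule IC_closed(3)[OF IC_closed(3)[OF u(4) \<kappa>_dK] IC_diff_dK[OF up2 v(2)]])
  finally obtain b where b: "b \<in> Ch (e0 # js) (t + 1) (s - 1)" "\<kappa> b = 0"
    "\<And>S. e0 \<notin> S \<Longrightarrow> (z1 - dK (e0 # js) L b) S \<in> mono_ideal bad" by (rule divide_step[OF z1]) blast
  have db: "dK (e0 # js) L b \<in> Ch (e0 # js) t s" using dK_Ch[OF L1 b(1)] by simp
  have "z1 - dK (e0 # js) L b \<in> IC bad"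
  proof (rule IC_propagate[OF b(3)])
    show "dK (e0 # js) L (z1 - dK (e0 # js) L b) \<in> IC bad"
      unfolding z1_def dK_simps dK_dK[OF dist0] diff_0_right by (rule ZcD(2)[OF z])
  qed
  then have "dK (e0 # js) L (v + b) + (z1 - dK (e0 # js) L b) \<in> Bd (e0 # js) L bad t s"
    by (rule BdI[OF Ch_closed(2)[OF v(1) b(1)] Ch_closed(3)[OF z1 db]])
  moreover have "dK (e0 # js) L (v + b) + (z1 - dK (e0 # js) L b) = z"
    unfolding z1_def dK_simps by (rule ext) simp
  ultimately show ?thesis by (simp only:)
qed

text \<open>A lift of a cycle is a cycle only modulo \<open>L e0\<close>;
  \<open>divide_step\<close>, applied to its differential, supplies the correction.\<close>

lemma \<kappa>_onto:
  assumes y: "y \<in> Zc js L2 bad2 t s"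
  obtains z where "z \<in> Zc (e0 # js) L bad t s" "\<kappa> z - y \<in> IC bad2"
proof -
  obtain a where a: "a \<in> Ch (e0 # js) t s" "\<kappa> a - y \<in> IC bad2" using ZcD(1)[OF y] by (rule lift)
  have da: "dK (e0 # js) L a \<in> Ch (e0 # js) (t - 1) (s + 1)" by (rule dK_Ch[OF L1 a(1)])
  have "\<kappa> (dK (e0 # js) L a) \<in> IC bad2"
    by (rule IC_diff_cong[OF IC_diff_trans[OF \<kappa>_dK IC_diff_dK[OF up2 a(2)]] ZcD(2)[OF y]])
  then obtain b where b: "b \<in> Ch (e0 # js) (t - 1 + 1) (s + 1 - 1)" "\<kappa> b = 0"
    "\<And>S. e0 \<notin> S \<Longrightarrow> (dK (e0 # js) L a - dK (e0 # js) L b) S \<in> mono_ideal bad" by (rule divide_step[OF da]) blast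
  have bC: "b \<in> Ch (e0 # js) t s" using b(1) by simp
  define z where "z = a - b"
  have "dK (e0 # js) L z \<in> IC bad"
  proof (rule IC_propagate)
    show "dK (e0 # js) L z S \<in> mono_ideal bad" if "e0 \<notin> S" for S
      unfolding z_def dK_simps by (rule b(3)[OF that])
    show "dK (e0 # js) L (dK (e0 # js) L z) \<in> IC bad" unfolding dK_dK[OF dist0] by (rule IC_closed(1))
  qed
  then have "z \<in> Zc (e0 # js) L bad t s" unfolding z_def by (rule ZcI[OF Ch_closed(3)[OF a(1) bC]])
  moreover have "\<kappa> z - y \<in> IC bad2" unfolding z_def \<kappa>_lin b(2) diff_0_right by (rule a(2))
  ultimately show thesis by (rule that)
qed

end


subsection \<open>Eliminating a variable\<close>

definition free_of :: "'v \<Rightarrow> 'v cpoly \<Rightarrow> bool" where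
  "free_of y p \<longleftrightarrow> (\<forall>m\<in>keys p. y \<notin> keys m)"

lemma keys_substitute_Var:
  assumes "k \<in> keys (substitute \<theta> (gen (single v 1 + m)))"
  obtains k1 k2 where "k = k1 + k2" "k1 \<in> keys (\<theta> v)" "k2 \<in> keys (substitute \<theta> (gen m))"
  using subsetD[OF keys_mult assms[unfolded substitute_gen_Var]] by (elim CollectE exE conjE) (rule that)

lemma keys_Var: "keys (Var v) = {single v 1}"
  by (simp add: Var_def)

lemma keys_upd_lower:
  assumes "k \<in> keys (substitute (Var(y := a)) (gen m))"
  shows "keys m - {y} \<subseteq> keys k"
  using assms
proof (induction m arbitrary: k rule: monomial_induct)
  case (Var v m)
  obtain k1 k2 where k: "k = k1 + k2" "k1 \<in> keys ((Var(y := a)) v)"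
    "k2 \<in> keys (substitute (Var(y := a)) (gen m))"
    using Var.prems by (rule keys_substitute_Var)
  have "v \<in> keys k1" if "v \<noteq> y" using k(2) that by (simp add: keys_Var)
  then show ?case using Var.IH[OF k(3)] unfolding k(1) keys_plus_nat by auto
qed simp

lemma free_of_substitute:
  assumes "\<And>v. free_of y (\<theta> v)" shows "free_of y (substitute \<theta> p)"
proof -
  have "substitute \<theta> (gen m) \<in> mono_ideal (\<lambda>m. y \<notin> keys m)" for m
  proof (induction m rule: monomial_induct)
    case zero show ?case by (simp add: substitute_one mono_ideal_def)
  next
    case (Var v m)
    show ?case unfolding mono_ideal_def
    proof (intro CollectI subsetI)
      fix k assume "k \<in> keys (substitute \<theta> (gen (single v 1 + m)))"
      then obtain k1 k2 where k: "k = k1 + k2" "k1 \<in> keys (\<theta> v)" "k2 \<in> keys (substitute \<theta> (gen m))"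
        by (rule keys_substitute_Var)
      then show "y \<notin> keys k"
        using assms[of v] Var unfolding free_of_def mono_ideal_def k(1) keys_plus_nat by blast
    qed
  qed
  then have "substitute \<theta> p \<in> mono_ideal (\<lambda>m. y \<notin> keys m)" by (rule substitute_in_mono_ideal)
  then show ?thesis by (auto simp: free_of_def mono_ideal_def)
qed

lemma substitute_free_of: "free_of y p \<Longrightarrow> substitute (Var(y := a)) p = p"
proof -
  assume p: "free_of y p"
  have "substitute (Var(y := a)) p = substitute Var p"
    by (rule substitute_cong) (use p in \<open>auto simp: free_of_def\<close>)
  then show ?thesis by (simp only: substitute_Var_id)
qed

text \<open>The factor theorem with control of the degree, by induction on monomials. It provides
  the condition \<open>E4\<close> of \<open>elim\<close>.\<close>

lemma divide_by_Var_plus: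
  assumes a: "a \<in> homogeneous 1" and p: "p \<in> homogeneous s"
  obtains q where "q \<in> homogeneous (s - 1)" "p - substitute (Var(y := - a)) p = (Var y + a) * q"
proof -
  define \<theta> where "\<theta> = Var(y := - a)"
  have \<theta>1: "\<theta> v \<in> homogeneous 1" for v using a by (simp add: \<theta>_def homogeneous_Var homogeneous_closed)
  define G where "G s = {p. \<exists>q\<in>homogeneous (s - 1). p - substitute \<theta> p = (Var y + a) * q}" for s
  have G: "cv.subspace (G s)" for s
    unfolding cv.subspace_def
  proof (intro conjI ballI allI)
    show "0 \<in> G s" unfolding G_def by (auto simp: substitute_linear intro!: bexI[of _ 0] homogeneous_closed)
  next
    fix p p' assume "p \<in> G s" "p' \<in> G s"
    then obtain q q' where "q \<in> homogeneous (s - 1)" "p - substitute \<theta> p = (Var y + a) * q"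
      "q' \<in> homogeneous (s - 1)" "p' - substitute \<theta> p' = (Var y + a) * q'" unfolding G_def by blast
    moreover from this have "p + p' - substitute \<theta> (p + p') = (Var y + a) * (q + q')"
      by (simp only: substitute_linear add_diff_add distrib_left)
    ultimately show "p + p' \<in> G s" unfolding G_def using homogeneous_closed(2) by blast
  next
    fix c p assume "p \<in> G s"
    then obtain q where "q \<in> homogeneous (s - 1)" "p - substitute \<theta> p = (Var y + a) * q" unfolding G_def by blast
    moreover from this have "c *\<^sub>C p - substitute \<theta> (c *\<^sub>C p) = (Var y + a) * (c *\<^sub>C q)"
      by (simp only: substitute_linear cv.scale_right_diff_distrib[symmetric] cscale_mult_right)
    ultimately show "c *\<^sub>C p \<in> G s" unfolding G_def using homogeneous_closed(5) by blast
  qed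
  have gen: "gen m \<in> G (int (mdeg m))" for m
  proof (induction m rule: monomial_induct)
    case zero show ?case by (auto simp: G_def substitute_one intro!: bexI[of _ 0] homogeneous_closed)
  next
    case (Var v m)
    obtain q where q: "q \<in> homogeneous (int (mdeg m) - 1)" "gen m - substitute \<theta> (gen m) = (Var y + a) * q"
      using Var unfolding G_def by blast
    have s: "substitute \<theta> (gen m) \<in> homogeneous (int (mdeg m))"
      by (rule substitute_homogeneous[OF \<theta>1 homogeneous_gen])
    have dv: "Var v - \<theta> v = (Var y + a) * (if v = y then 1 else 0)" by (simp add: \<theta>_def)
    have "gen (single v 1 + m) - substitute \<theta> (gen (single v 1 + m))
      = Var v * (gen m - substitute \<theta> (gen m)) + (Var v - \<theta> v) * substitute \<theta> (gen m)"
      unfolding gen_Var substitute_mult substitute_Var by (simp add: algebra_simps)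
    also have "\<dots> = (Var y + a) * (Var v * q + (if v = y then 1 else 0) * substitute \<theta> (gen m))"
      unfolding q(2) dv by (simp only: distrib_left mult_ac)
    finally have eq: "gen (single v 1 + m) - substitute \<theta> (gen (single v 1 + m)) = \<dots>" .
    have "Var v * q \<in> homogeneous (int (mdeg m))" using homogeneous_mult[OF homogeneous_Var q(1)] by simp
    then have "Var v * q + (if v = y then 1 else 0) * substitute \<theta> (gen m) \<in> homogeneous (int (mdeg (single v 1 + m)) - 1)"
      using s by (cases "v = y") (simp_all add: mdeg_plus homogeneous_closed)
    then show ?case using eq unfolding G_def by blast
  qed
  have "p \<in> G s"
    by (rule in_subspace_gen[OF G]) (use p gen in \<open>auto simp: homogeneous_iff\<close>)
  then show thesis using that unfolding G_def \<theta>_def by blast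
qed

lemma lookup_Var_mult: "lookup (Var y * p) (single y 1 + m) = lookup p m"
proof -
  have "clinear (\<lambda>p :: 'a cpoly. lookup p n)" for n
    by (rule clinearI) (simp_all add: lookup_add cscale_complex_def)
  note l = this
  show ?thesis
  proof (rule clinear_eqI_gen[of "\<lambda>p. lookup (Var y * p) (single y 1 + m)"])
    show "clinear (\<lambda>p. lookup (Var y * p) (single y 1 + m))"
      by (rule clinear_comp[OF l clinear_mult])
    show "lookup (Var y * gen k) (single y 1 + m) = lookup (gen k) m" for k
      by (simp add: gen_Var[symmetric] lookup_single when_def)
  qed (rule l)
qed

text \<open>Among the terms of \<open>q\<close> that are not bad, take one with the highest power of
  \<open>y\<close>. Multiplying it by \<open>Var y\<close> gives a term that \<open>a * q\<close>
  cannot cancel, since \<open>a\<close> does not raise the power of \<open>y\<close>; by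
  \<open>sat\<close> this term is not bad.\<close>

lemma Var_plus_regular:
  assumes up: "upward bad" and sat: "\<And>m. bad (single y 1 + m) \<Longrightarrow> bad m"
    and a: "free_of y a" and q: "(Var y + a) * q \<in> mono_ideal bad"
  shows "q \<in> mono_ideal bad"
proof (rule ccontr)
  assume "q \<notin> mono_ideal bad"
  then have ne: "{m \<in> keys q. \<not> bad m} \<noteq> {}" by (auto simp: mono_ideal_def)
  have fin: "finite {m \<in> keys q. \<not> bad m}" by simp
  define N where "N = Max ((\<lambda>m. lookup m y) ` {m \<in> keys q. \<not> bad m})"
  have "N \<in> (\<lambda>m. lookup m y) ` {m \<in> keys q. \<not> bad m}"
    unfolding N_def using ne fin by (intro Max_in) auto
  then obtain m where m: "m \<in> keys q" "\<not> bad m" "lookup m y = N" by auto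
  have max: "lookup m' y \<le> N" if "m' \<in> keys q" "\<not> bad m'" for m'
    unfolding N_def using that fin by (intro Max_ge) auto
  let ?k = "single y 1 + m"
  have kb: "\<not> bad ?k" using sat m(2) by blast
  have "?k \<notin> keys (a * q)"
  proof
    assume "?k \<in> keys (a * q)"
    then obtain m1 m2 where k: "?k = m1 + m2" "m1 \<in> keys a" "m2 \<in> keys q"
      using keys_mult[of a q] by blast
    have "lookup m1 y = 0" using a k(2) by (auto simp: free_of_def in_keys_iff)
    then have "lookup m2 y = Suc N"
      using arg_cong[OF k(1), of "\<lambda>k. lookup k y"] by (simp add: lookup_add m(3))
    then have "bad m2" using max[OF k(3)] by auto
    then have "bad (m1 + m2)" using up by (auto simp: upward_def)
    then show False using kb k(1) by simp
  qed
  then have "lookup ((Var y + a) * q) ?k = lookup q m"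
    by (simp only: distrib_right lookup_add lookup_Var_mult in_keys_iff not_not add_0_right)
  also have "\<dots> \<noteq> 0" using m(1) by (simp add: in_keys_iff)
  finally have "?k \<in> keys ((Var y + a) * q)" by (simp only: in_keys_iff not_False_eq_True)
  then show False using q kb by (auto simp: mono_ideal_def)
qed

text \<open>Elimination of \<open>y\<close> by the equation \<open>y = - a\<close>. By
  \<open>C3\<close> the variable \<open>y\<close> is a cone point of the complex of good supports,
  which makes \<open>y + a\<close> regular; \<open>C1\<close>, \<open>C2\<close> and
  \<open>C4\<close> say that \<open>bad2\<close> holds for the bad monomials and for those that
  contain \<open>y\<close>.\<close>

lemma elim_variable:
  fixes L L2 :: "int \<Rightarrow> 'v cpoly"
  assumes js: "distinct js" "e0 \<notin> set js" and up: "upward bad" "upward bad2"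
    and L1: "\<And>i. i \<in> set (e0 # js) \<Longrightarrow> L i \<in> homogeneous 1"
    and a1: "a \<in> homogeneous 1" and free: "free_of y a"
    and C1: "\<And>m k. bad m \<Longrightarrow> keys m - {y} \<subseteq> keys k \<Longrightarrow> bad2 k"
    and C2: "\<And>m. bad2 m \<Longrightarrow> y \<notin> keys m \<Longrightarrow> bad m"
    and C3: "\<And>m. bad (single y 1 + m) \<Longrightarrow> bad m"
    and C4: "\<And>m. y \<in> keys m \<Longrightarrow> bad2 m"
    and L0: "L e0 - (Var y + a) \<in> mono_ideal bad"
    and L: "\<And>i. i \<in> set js \<Longrightarrow> substitute (Var(y := - a)) (L i) - L2 i \<in> mono_ideal bad2"
  shows "elim e0 js L L2 bad bad2 (Var(y := - a))"
proof (unfold_locales, goal_cases)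
  case (6 v)
  then show ?case using a1 by (simp add: homogeneous_Var homogeneous_closed)
next
  case (7 m)
  show ?case unfolding mono_ideal_def using C1[OF 7 keys_upd_lower] by blast
next
  case 9
  have "substitute (Var(y := - a)) (L e0 - (Var y + a)) \<in> mono_ideal bad2"
  proof (rule substitute_in_mono_ideal)
    fix m assume "m \<in> keys (L e0 - (Var y + a))"
    then have "bad m" using L0 by (auto simp: mono_ideal_def)
    then show "substitute (Var(y := - a)) (gen m) \<in> mono_ideal bad2"
      unfolding mono_ideal_def using C1[OF _ keys_upd_lower] by blast
  qed
  moreover have "substitute (Var(y := - a)) (Var y + a) = 0"
    by (simp add: substitute_linear(1) substitute_Var substitute_free_of[OF free])
  ultimately show ?case by (simp add: substitute_linear(2))
next
  case (10 q s)
  let ?p = "tr (\<lambda>m. y \<notin> keys m) q"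
  have "free_of y ?p" by (simp add: free_of_def keys_tr)
  then have "substitute (Var(y := - a)) ?p = ?p" by (rule substitute_free_of)
  moreover have "?p - q \<in> mono_ideal bad2"
  proof -
    have "q - ?p \<in> mono_ideal (\<lambda>m. \<not> y \<notin> keys m)" by (rule diff_tr_in_mono_ideal)
    then have "- (q - ?p) \<in> mono_ideal bad2"
      using C4 by (intro mono_ideal_closed(4)) (auto simp: mono_ideal_def)
    then show ?thesis by simp
  qed
  ultimately show ?case using tr_homogeneous[OF 10] by (intro bexI[of _ ?p]) simp_all
next
  case (11 p s)
  obtain q where q: "q \<in> homogeneous (s - 1)" "p - substitute (Var(y := - a)) p = (Var y + a) * q"
    using divide_by_Var_plus[OF a1 11(1)] .
  have "free_of y (- a)" using free by (simp add: free_of_def)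
  then have "free_of y ((Var(y := - a)) v)" for v by (simp add: free_of_def keys_Var)
  then have "free_of y (substitute (Var(y := - a)) p)" by (rule free_of_substitute)
  then have "substitute (Var(y := - a)) p \<in> mono_ideal bad"
    using 11(2) C2 unfolding mono_ideal_def free_of_def by blast
  moreover have "(L e0 - (Var y + a)) * q \<in> mono_ideal bad" by (rule mono_ideal_mult2[OF up(1) L0])
  ultimately have "substitute (Var(y := - a)) p - (L e0 - (Var y + a)) * q \<in> mono_ideal bad" by (rule mono_ideal_closed(3))
  moreover have "p - L e0 * q = substitute (Var(y := - a)) p - (L e0 - (Var y + a)) * q"
  proof -
    have "p = substitute (Var(y := - a)) p + (Var y + a) * q" using q(2) by (simp add: algebra_simps)
    then have "p - L e0 * q = substitute (Var(y := - a)) p + (Var y + a) * q - L e0 * q" by (rule arg_cong)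
    then show ?thesis by (simp add: algebra_simps)
  qed
  ultimately show ?case using q(1) by (intro bexI[of _ q]) (simp_all only:)
next
  case (12 q)
  have "(Var y + a) * q = L e0 * q - (L e0 - (Var y + a)) * q" by (simp add: algebra_simps)
  also have "\<dots> \<in> mono_ideal bad" by (rule mono_ideal_closed(3)[OF 12 mono_ideal_mult2[OF up(1) L0]])
  finally have *: "(Var y + a) * q \<in> mono_ideal bad" .
  show ?case by (rule Var_plus_regular[OF up(1) _ free *]) (rule C3)
qed (use js up L1 L in auto)

section \<open>Tensor products of Koszul complexes\<close>

definition normal_chains :: "int list \<Rightarrow> (('v \<Rightarrow>\<^sub>0 nat) \<Rightarrow> bool) \<Rightarrow> int \<Rightarrow> int \<Rightarrow> ('v chain) set" where
  "normal_chains js bad t s = {c \<in> Ch js t s. nf bad c = c}"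

text \<open>On normal forms the quotient complex becomes a complex of subspaces in which the
  differential squares to zero exactly, so that it can be split over the field.\<close>

definition dl :: "int list \<Rightarrow> (int \<Rightarrow> 'v cpoly) \<Rightarrow> (('v \<Rightarrow>\<^sub>0 nat) \<Rightarrow> bool) \<Rightarrow> ('v chain) \<Rightarrow> 'v chain" where
  "dl js L bad c = nf bad (dK js L c)"

lemma clinear_dl: "clinear (dl js L bad)"
  unfolding dl_def by (rule clinear_comp[OF clinear_trc clinear_dK])

lemmas dl_lin = clinear_add[OF clinear_dl] clinear_diff[OF clinear_dl] clinear_uminus[OF clinear_dl]
  clinear_zero[OF clinear_dl] clinear_scale[OF clinear_dl]

lemmas trc_lin = clinear_add[OF clinear_trc] clinear_diff[OF clinear_trc] clinear_uminus[OF clinear_trc]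
  clinear_zero[OF clinear_trc] clinear_scale[OF clinear_trc]

lemma subspace_normal_chains: "cv.subspace (normal_chains js bad t s)"
  using subspace_Ch[of js t s] unfolding cv.subspace_def normal_chains_def by (simp add: trc_lin) blast

lemmas normal_closed = cv.subspace_0[OF subspace_normal_chains] cv.subspace_add[OF subspace_normal_chains]
  cv.subspace_diff[OF subspace_normal_chains] cv.subspace_neg[OF subspace_normal_chains]
  cv.subspace_scale[OF subspace_normal_chains]

lemma trc_trc: "trc g (trc g c) = trc g c"
  by (simp add: trc_def tr_tr)

lemma trc_normal: "c \<in> Ch js t s \<Longrightarrow> nf bad c \<in> normal_chains js bad t s"
  by (simp add: normal_chains_def trc_Ch trc_trc)

lemma diff_trc_IC: "c - nf bad c \<in> IC bad"
  unfolding IC_def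
proof (intro CollectI allI)
  fix S
  have "c S - tr (\<lambda>m. \<not> bad m) (c S) \<in> mono_ideal (\<lambda>m. \<not> \<not> bad m)" by (rule diff_tr_in_mono_ideal)
  then show "(c - nf bad c) S \<in> mono_ideal bad" by (simp add: trc_def)
qed

lemma trc_IC: "c \<in> IC bad \<Longrightarrow> nf bad c = 0"
  by (rule trc_eq_0) auto

lemma trc_IC_iff: "nf bad c = 0 \<longleftrightarrow> c \<in> IC bad"
  using trc_IC[of c bad] diff_trc_IC[of c bad] by auto

lemma trc_cong_IC: "a - b \<in> IC bad \<Longrightarrow> nf bad a = nf bad b"
  using trc_IC[of "a - b" bad] by (simp only: trc_lin eq_iff_diff_eq_0[symmetric])

lemma dl_normal:
  assumes "\<And>i. i \<in> set js \<Longrightarrow> L i \<in> homogeneous 1" "c \<in> Ch js t s"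
  shows "dl js L bad c \<in> normal_chains js bad (t - 1) (s + 1)"
  unfolding dl_def by (rule trc_normal[OF dK_Ch[OF assms]])

lemma dl_trc: "upward bad \<Longrightarrow> dl js L bad (nf bad c) = dl js L bad c"
  unfolding dl_def by (rule trc_cong_IC[OF IC_diff_dK[OF _ IC_diff_sym[OF diff_trc_IC]]])

lemma dl_dl: "distinct js \<Longrightarrow> upward bad \<Longrightarrow> dl js L bad (dl js L bad c) = 0"
  unfolding dl_def[of js L bad c] dl_trc unfolding dl_def by (simp only: dK_dK trc_lin)

lemma normal_Ch: "c \<in> normal_chains js bad t s \<Longrightarrow> c \<in> Ch js t s"
  by (simp add: normal_chains_def)

lemma dl_Bd:
  assumes "\<And>i. i \<in> set js \<Longrightarrow> L i \<in> homogeneous 1" "u \<in> Ch js (t + 1) (s - 1)"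
  shows "dl js L bad u \<in> Bd js L bad t s"
proof -
  have d: "dK js L u \<in> Ch js t s" using dK_Ch[OF assms] by simp
  have "dK js L u + - (dK js L u - nf bad (dK js L u)) \<in> Bd js L bad t s"
    by (rule BdI[OF assms(2) Ch_closed(4)[OF Ch_closed(3)[OF d trc_Ch[OF d]]] IC_closed(4)[OF diff_trc_IC]])
  then show ?thesis by (simp add: dl_def)
qed

lemma normal_cycle: "c \<in> normal_chains js bad t s \<Longrightarrow> dl js L bad c = 0 \<longleftrightarrow> c \<in> Zc js L bad t s"
  by (simp add: normal_chains_def Zc_def dl_def trc_IC_iff)

lemma trc_Zc: "upward bad \<Longrightarrow> c \<in> Zc js L bad t s \<Longrightarrow> dl js L bad (nf bad c) = 0"
  unfolding dl_trc by (simp add: dl_def trc_IC Zc_def)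

text \<open>Every complex over a field splits: \<open>p\<close> projects onto representatives of the
  homology, and \<open>h\<close> is a homotopy from the identity to \<open>p\<close>.\<close>

lemma homotopy_exists:
  fixes L :: "int \<Rightarrow> 'v cpoly"
  assumes js: "distinct js" and up: "upward bad" and L1: "\<And>i. i \<in> set js \<Longrightarrow> L i \<in> homogeneous 1"
  obtains p h :: "int \<Rightarrow> int \<Rightarrow> ('v chain) \<Rightarrow> 'v chain" where
    "\<And>t s. clinear (p t s)" "\<And>t s. clinear (h t s)"
    "\<And>t s x. x \<in> normal_chains js bad t s \<Longrightarrow> p t s x \<in> normal_chains js bad t s"
    "\<And>t s x. x \<in> normal_chains js bad t s \<Longrightarrow> dl js L bad (p t s x) = 0"
    "\<And>t s x. p t s (p t s x) = p t s x"
    "\<And>t s x. x \<in> normal_chains js bad t s \<Longrightarrow> h t s x \<in> normal_chains js bad (t + 1) (s - 1)"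
    "\<And>t s x. x \<in> normal_chains js bad t s \<Longrightarrow> x - p t s x = dl js L bad (h t s x) + h (t - 1) (s + 1) (dl js L bad x)"
    "\<And>t s u. u \<in> normal_chains js bad (t + 1) (s - 1) \<Longrightarrow> p t s (dl js L bad u) = 0"
proof -
  let ?W = "normal_chains js bad" and ?d = "dl js L bad"
  define K where "K t s = {x \<in> ?W t s. ?d x = 0}" for t s
  define B where "B t s = ?d ` ?W (t + 1) (s - 1)" for t s
  have K: "cv.subspace (K t s)" for t s
    using subspace_normal_chains[of js bad t s] unfolding cv.subspace_def K_def by (simp add: dl_lin)
  have B: "cv.subspace (B t s)" for t s
    unfolding B_def by (rule cvp.linear_subspace_image[OF clinear_dl subspace_normal_chains])
  have BK: "B t s \<subseteq> K t s" for t s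
  proof
    fix x assume "x \<in> B t s"
    then obtain u where u: "x = ?d u" "u \<in> ?W (t + 1) (s - 1)" unfolding B_def by blast
    have "x \<in> ?W t s" using dl_normal[OF L1 normal_Ch[OF u(2)]] unfolding u(1) by simp
    then show "x \<in> K t s" by (simp add: K_def u(1) dl_dl[OF js up])
  qed
  have "\<exists>g. clinear g \<and> (\<forall>x. g x \<in> K t s) \<and> (\<forall>x\<in>K t s. g x = x)" for t s
    using projection_onto_subspace[OF K] by metis
  then obtain q where q: "\<And>t s. clinear (q t s)" "\<And>t s x. q t s x \<in> K t s" "\<And>t s x. x \<in> K t s \<Longrightarrow> q t s x = x" by metis
  have "\<exists>g. clinear g \<and> (\<forall>x. g x \<in> B t s) \<and> (\<forall>x\<in>B t s. g x = x)" for t s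
    using projection_onto_subspace[OF B] by metis
  then obtain b where b: "\<And>t s. clinear (b t s)" "\<And>t s x. b t s x \<in> B t s" "\<And>t s x. x \<in> B t s \<Longrightarrow> b t s x = x" by metis
  \<comment> \<open>A complement of the cycles, one exterior degree higher. The differential is
    injective on it, and \<open>\<sigma>\<close> is a linear inverse.\<close>
  define V where "V t s = {x \<in> ?W (t + 1) (s - 1). q (t + 1) (s - 1) x = 0}" for t s
  have V: "cv.subspace (V t s)" for t s
    using subspace_normal_chains[of js bad "t + 1" "s - 1"] unfolding cv.subspace_def V_def
    by (simp add: clinear_add[OF q(1)] clinear_zero[OF q(1)] clinear_scale[OF q(1)])
  have inj: "inj_on ?d (V t s)" for t s
  proof (rule inj_onI)
    fix x y assume x: "x \<in> V t s" and y: "y \<in> V t s" and "?d x = ?d y"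
    then have "x - y \<in> K (t + 1) (s - 1)" by (simp add: K_def V_def normal_closed dl_lin)
    then have "x - y = q (t + 1) (s - 1) (x - y)" by (simp only: q(3))
    also have "\<dots> = 0" using x y by (simp add: V_def clinear_diff[OF q(1)])
    finally show "x = y" by simp
  qed
  have "\<exists>g. g ` UNIV \<subseteq> V t s \<and> clinear g \<and> (\<forall>v\<in>V t s. g (?d v) = v)" for t s
    by (rule cvp.linear_exists_left_inverse_on[OF clinear_dl V inj])
  then obtain \<sigma> where \<sigma>: "\<And>t s. \<sigma> t s ` UNIV \<subseteq> V t s" "\<And>t s. clinear (\<sigma> t s)" "\<And>t s v. v \<in> V t s \<Longrightarrow> \<sigma> t s (?d v) = v"
    by metis
  have \<sigma>V: "\<sigma> t s x \<in> V t s" for t s x using \<sigma>(1)[of t s] by blast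
  have dq: "?d (q t s u) = 0" for t s u using q(2)[of t s u] by (simp add: K_def)
  have qW: "q t s u \<in> ?W t s" for t s u using q(2)[of t s u] by (simp add: K_def)
  have \<sigma>d: "\<sigma> t s (?d u) = u - q (t + 1) (s - 1) u" if u: "u \<in> ?W (t + 1) (s - 1)" for t s u
  proof -
    have "u - q (t + 1) (s - 1) u \<in> V t s"
      using u qW by (simp add: V_def normal_closed clinear_diff[OF q(1)] q(3)[OF q(2)])
    then have "\<sigma> t s (?d (u - q (t + 1) (s - 1) u)) = u - q (t + 1) (s - 1) u" by (rule \<sigma>(3))
    then show ?thesis by (simp only: dl_lin dq diff_0_right)
  qed
  \<comment> \<open>The cycle part minus its boundary part; \<open>h\<close> takes a primitive of
    that boundary part.\<close>
  define p where "p t s x = q t s x - b t s (q t s x)" for t s x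
  define h where "h t s x = \<sigma> t s (b t s (q t s x))" for t s x
  have bK: "b t s x \<in> K t s" for t s x using b(2)[of t s x] BK by blast
  have dh: "?d (h t s x) = b t s (q t s x)" for t s x
  proof -
    obtain u where u: "b t s (q t s x) = ?d u" "u \<in> ?W (t + 1) (s - 1)" using b(2)[of t s "q t s x"] unfolding B_def by blast
    show ?thesis unfolding h_def u(1) \<sigma>d[OF u(2)] by (simp only: dl_lin dq diff_0_right)
  qed
  show thesis
  proof (rule that[of p h])
    show "clinear (p t s)" for t s unfolding p_def
      by (rule clinearI) (simp_all add: clinear_add[OF q(1)] clinear_add[OF b(1)] clinear_scale[OF q(1)] clinear_scale[OF b(1)] cv.scale_right_diff_distrib)
    show "clinear (h t s)" for t s unfolding h_def
      by (rule clinear_comp[OF \<sigma>(2) clinear_comp[OF b(1) q(1)]])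
    have pK: "p t s x \<in> K t s" for t s x unfolding p_def by (rule cv.subspace_diff[OF K q(2) bK])
    show "p t s (p t s x) = p t s x" for t s x
    proof -
      have "q t s (p t s x) = p t s x" by (rule q(3)[OF pK])
      moreover have "b t s (p t s x) = 0" unfolding p_def clinear_diff[OF b(1)] by (simp only: b(3)[OF b(2)] diff_self)
      ultimately show ?thesis by (simp only: p_def[of t s "p t s x"] diff_0_right)
    qed
    show "p t s x \<in> ?W t s" "?d (p t s x) = 0" for t s x using pK[of t s x] by (simp_all add: K_def)
    show "h t s x \<in> ?W (t + 1) (s - 1)" for t s x using \<sigma>V[of t s "b t s (q t s x)"] by (simp add: h_def V_def)
    show "x - p t s x = ?d (h t s x) + h (t - 1) (s + 1) (?d x)" if x: "x \<in> ?W t s" for t s x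
    proof -
      have "?d x \<in> B (t - 1) (s + 1)" using x by (simp add: B_def)
      moreover from this have "?d x \<in> K (t - 1) (s + 1)" using BK by blast
      ultimately have "h (t - 1) (s + 1) (?d x) = \<sigma> (t - 1) (s + 1) (?d x)" by (simp only: h_def q(3) b(3))
      also have "\<dots> = x - q t s x" using \<sigma>d[of x "t - 1" "s + 1"] x by simp
      finally show ?thesis by (simp add: dh p_def)
    qed
    show "p t s (?d u) = 0" if u: "u \<in> ?W (t + 1) (s - 1)" for t s u
    proof -
      have "?d u \<in> B t s" using u by (simp add: B_def)
      moreover from this have "?d u \<in> K t s" using BK by blast
      ultimately show ?thesis by (simp only: p_def q(3) b(3) diff_self)
    qed
  qed
qed

subsection \<open>Products of chains\<close>

definition part :: "'v set \<Rightarrow> ('v \<Rightarrow>\<^sub>0 nat) \<Rightarrow> 'v \<Rightarrow>\<^sub>0 nat" where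
  "part A m = (\<Sum>v\<in>keys m \<inter> A. single v (lookup m v))"

lemma lookup_part: "lookup (part A m) v = (if v \<in> A then lookup m v else 0)"
proof -
  have "lookup (part A m) v = (\<Sum>w\<in>keys m \<inter> A. if w = v then lookup m w else 0)"
    unfolding part_def lookup_sum by (intro sum.cong) (auto simp: lookup_single when_def)
  also have "\<dots> = (if v \<in> A then lookup m v else 0)" by (simp add: in_keys_iff)
  finally show ?thesis .
qed

lemma keys_part: "keys (part A m) = keys m \<inter> A"
  by (auto simp: in_keys_iff lookup_part split: if_splits)

lemma part_plus_part: "part A m + part (- A) m = m"
  by (rule poly_mapping_eqI) (simp add: lookup_add lookup_part)

lemma part_of_sum:
  assumes "keys m1 \<subseteq> A" "keys m2 \<inter> A = {}"
  shows "part A (m1 + m2) = m1" "part (- A) (m1 + m2) = m2"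
proof -
  have "lookup m1 v = 0" if "v \<notin> A" for v using assms(1) that by (auto simp: in_keys_iff)
  moreover have "lookup m2 v = 0" if "v \<in> A" for v using assms(2) that by (auto simp: in_keys_iff)
  ultimately show "part A (m1 + m2) = m1" "part (- A) (m1 + m2) = m2"
    by (auto intro!: poly_mapping_eqI simp: lookup_part lookup_add)
qed

text \<open>The basis vectors of the space of chains.\<close>

definition bs :: "int set \<Rightarrow> ('v \<Rightarrow>\<^sub>0 nat) \<Rightarrow> 'v chain" where
  "bs S m = (\<lambda>S'. if S' = S then gen m else 0)"

lemma bs_normal:
  "S \<subseteq> set js \<Longrightarrow> \<not> bad m \<Longrightarrow> bs S m \<in> normal_chains js bad (int (card S)) (int (mdeg m))"
  unfolding normal_chains_def by (auto simp: Ch_def bs_def trc_def fun_eq_iff tr_gen tr_simps homogeneous_gen homogeneous_closed)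

lemma clinear_coordinate: "clinear (\<lambda>p S'. if S' = S then p else (0 :: 'v cpoly))"
  by (rule clinearI) (auto simp: fun_eq_iff)

lemma lin_bs: "lin (bs S) p = (\<lambda>S'. if S' = S then p else 0)"
proof -
  have "bs S = (\<lambda>k S'. if S' = S then gen k else (0 :: 'a cpoly))" by (simp add: bs_def fun_eq_iff)
  then show ?thesis using clinear_eq_lin[OF clinear_coordinate[of S], of p] by (simp only:)
qed

lemma chain_expand:
  assumes "c \<in> Ch js t s" shows "c = (\<Sum>S\<in>Pow (set js). lin (bs S) (c S))"
proof
  fix S'
  have "(\<Sum>S\<in>Pow (set js). lin (bs S) (c S)) S' = (\<Sum>S\<in>Pow (set js). if S = S' then c S else 0)"
    unfolding sum_fun_apply lin_bs by (intro sum.cong) auto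
  also have "\<dots> = c S'" using Ch_zero[OF assms, of S'] by auto
  finally show "c S' = (\<Sum>S\<in>Pow (set js). lin (bs S) (c S)) S'" by simp
qed

lemma normal_chains_induct:
  assumes T: "cv.subspace T"
    and bs: "\<And>S m. S \<subseteq> set js \<Longrightarrow> int (card S) = t \<Longrightarrow> int (mdeg m) = s \<Longrightarrow> \<not> bad m \<Longrightarrow> bs S m \<in> T"
    and c: "c \<in> normal_chains js bad t s"
  shows "c \<in> T"
proof -
  have "lin (bs S) (c S) \<in> T" for S
  proof (rule lin_in_subspace[OF T])
    fix m assume m: "m \<in> keys (c S)"
    then have "c S \<noteq> 0" by auto
    then have "S \<subseteq> set js" "int (card S) = t" using Ch_zero[OF normal_Ch[OF c], of S] by auto
    moreover have "int (mdeg m) = s" using Ch_homogeneous[OF normal_Ch[OF c], of S] m by (auto simp: homogeneous_iff)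
    moreover have "c S = tr (\<lambda>m. \<not> bad m) (c S)" using c by (auto simp: normal_chains_def trc_def fun_eq_iff)
    then have "\<not> bad m" using m keys_tr[of "\<lambda>m. \<not> bad m" "c S"] by auto
    ultimately show "bs S m \<in> T" by (rule bs)
  qed
  then have "(\<Sum>S\<in>Pow (set js). lin (bs S) (c S)) \<in> T" by (intro cv.subspace_sum T)
  then show ?thesis by (simp only: chain_expand[OF normal_Ch[OF c], symmetric])
qed


text \<open>The product of two chains in the tensor product of Koszul complexes. Listing
  \<open>J1\<close> before \<open>J2\<close> makes it free of signs.\<close>

definition conv :: "int list \<Rightarrow> int list \<Rightarrow> ('v chain) \<Rightarrow> ('v chain) \<Rightarrow> 'v chain" where
  "conv J1 J2 x y = (\<lambda>S. if S \<subseteq> set J1 \<union> set J2 then x (S \<inter> set J1) * y (S \<inter> set J2) else 0)"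

lemma clinear_conv_left: "clinear (\<lambda>x. conv J1 J2 x y)"
  by (rule clinearI) (auto simp: conv_def fun_eq_iff distrib_right cscale_mult_left)

lemma clinear_conv_right: "clinear (conv J1 J2 x)"
  by (rule clinearI) (auto simp: conv_def fun_eq_iff distrib_left cscale_mult_right)

lemmas conv_lin = clinear_add[OF clinear_conv_left] clinear_diff[OF clinear_conv_left] clinear_zero[OF clinear_conv_left]
  clinear_scale[OF clinear_conv_left] clinear_uminus[OF clinear_conv_left]
  clinear_add[OF clinear_conv_right] clinear_diff[OF clinear_conv_right] clinear_zero[OF clinear_conv_right]
  clinear_scale[OF clinear_conv_right] clinear_uminus[OF clinear_conv_right]

text \<open>Linear extension of a map given on products of basis chains. The degrees of both factors
  are handed to \<open>g\<close>, since projections, homotopies and target summands depend on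
  them.\<close>

definition Lam :: "int list \<Rightarrow> int list \<Rightarrow> 'v set \<Rightarrow>
    (int \<Rightarrow> int \<Rightarrow> int \<Rightarrow> int \<Rightarrow> ('v chain) \<Rightarrow> ('v chain) \<Rightarrow> 'e::cvec) \<Rightarrow> ('v chain) \<Rightarrow> 'e" where
  "Lam J1 J2 A g c = (\<Sum>S\<in>Pow (set J1 \<union> set J2).
     lin (\<lambda>m. g (int (card (S \<inter> set J1))) (int (mdeg (part A m))) (int (card (S \<inter> set J2))) (int (mdeg (part (- A) m)))
       (bs (S \<inter> set J1) (part A m)) (bs (S \<inter> set J2) (part (- A) m))) (c S))"

lemma clinear_Lam: "clinear (Lam J1 J2 A g)"
  unfolding Lam_def by (rule clinearI)
    (simp_all add: clinear_add[OF clinear_lin] clinear_scale[OF clinear_lin] sum.distrib cv.scale_sum_right)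

lemma Lam_bs:
  assumes "S \<subseteq> set J1 \<union> set J2"
  shows "Lam J1 J2 A g (bs S m) = g (int (card (S \<inter> set J1))) (int (mdeg (part A m))) (int (card (S \<inter> set J2)))
     (int (mdeg (part (- A) m))) (bs (S \<inter> set J1) (part A m)) (bs (S \<inter> set J2) (part (- A) m))"
proof -
  define G where "G S m = g (int (card (S \<inter> set J1))) (int (mdeg (part A m))) (int (card (S \<inter> set J2)))
     (int (mdeg (part (- A) m))) (bs (S \<inter> set J1) (part A m)) (bs (S \<inter> set J2) (part (- A) m))" for S m
  have "Lam J1 J2 A g (bs S m) = (\<Sum>S'\<in>Pow (set J1 \<union> set J2). if S = S' then G S m else 0)"
    unfolding Lam_def G_def[symmetric] by (intro sum.cong) (auto simp: bs_def clinear_zero[OF clinear_lin])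
  also have "\<dots> = G S m" using assms by simp
  finally show ?thesis unfolding G_def .
qed

lemma tr_mult:
  assumes "\<And>m1 m2. m1 \<in> keys p \<Longrightarrow> m2 \<in> keys q \<Longrightarrow> good (m1 + m2) \<longleftrightarrow> g1 m1 \<and> g2 m2"
  shows "tr good (p * q) = tr g1 p * tr g2 (q :: 'v cpoly)"
proof -
  have 1: "tr good (gen m * q) = tr g1 (gen m) * tr g2 q" if m: "m \<in> keys p" for m
  proof (rule clinear_eqI_gen[of "\<lambda>q. tr good (gen m * q)" "\<lambda>q. tr g1 (gen m) * tr g2 q"])
    show "tr good (gen m * gen k) = tr g1 (gen m) * tr g2 (gen k)" if "k \<in> keys q" for k
      using assms[OF m that] by (cases "g1 m"; cases "g2 k") (simp_all only: gen_mult_gen tr_gen mult_zero_left mult_zero_right simp_thms if_True if_False)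
  qed (rule clinear_comp[OF clinear_tr clinear_mult] clinear_comp[OF clinear_mult clinear_tr])+
  show ?thesis
  proof (rule clinear_eqI_gen[of "\<lambda>p. tr good (p * q)" "\<lambda>p. tr g1 p * tr g2 q"])
    have r: "clinear (\<lambda>p. p * r)" for r :: "'v cpoly" unfolding mult.commute[of _ r] by (rule clinear_mult)
    show "clinear (\<lambda>p. tr good (p * q))" by (rule clinear_comp[OF clinear_tr r])
    show "clinear (\<lambda>p. tr g1 p * tr g2 q)" by (rule clinear_comp[OF r clinear_tr])
  qed (rule 1)
qed

text \<open>\<open>A\<close> separates the variables of the two factors, and by \<open>gD\<close> a
  support is good if and only if its parts in \<open>A\<close> and outside \<open>A\<close> are. The
  complex of good supports is thus a join and the ring a tensor product.\<close>

locale kunneth =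
  fixes J1 J2 :: "int list" and A :: "'v set" and L :: "int \<Rightarrow> 'v cpoly" and bB bC bD :: "('v \<Rightarrow>\<^sub>0 nat) \<Rightarrow> bool"
  assumes dist: "distinct (J1 @ J2)" and upB: "upward bB" and upC: "upward bC" and upD: "upward bD"
    and L1: "\<And>i. i \<in> set (J1 @ J2) \<Longrightarrow> L i \<in> homogeneous 1"
    and LA: "\<And>i. i \<in> set J1 \<Longrightarrow> L i \<in> mono_ideal (\<lambda>m. keys m \<subseteq> A)"
    and LC: "\<And>i. i \<in> set J2 \<Longrightarrow> L i \<in> mono_ideal (\<lambda>m. keys m \<inter> A = {})"
    and gB: "\<And>m. \<not> bB m \<Longrightarrow> keys m \<subseteq> A" and gC: "\<And>m. \<not> bC m \<Longrightarrow> keys m \<inter> A = {}"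
    and gD: "\<And>m1 m2. keys m1 \<subseteq> A \<Longrightarrow> keys m2 \<inter> A = {} \<Longrightarrow> bD (m1 + m2) \<longleftrightarrow> bB m1 \<or> bC m2"
begin

abbreviation "WB \<equiv> normal_chains J1 bB"
abbreviation "WC \<equiv> normal_chains J2 bC"
abbreviation "WD \<equiv> normal_chains (J1 @ J2) bD"
abbreviation "dB \<equiv> dl J1 L bB"
abbreviation "dC \<equiv> dl J2 L bC"
abbreviation "dD \<equiv> dl (J1 @ J2) L bD"
abbreviation cprod (infixl "\<star>" 70) where "x \<star> y \<equiv> conv J1 J2 x y"
abbreviation "Lm \<equiv> Lam J1 J2 A"

lemma dist1: "distinct J1" and dist2: "distinct J2" and disj: "set J1 \<inter> set J2 = {}"
  using dist by auto

lemma LB1: "\<And>i. i \<in> set J1 \<Longrightarrow> L i \<in> homogeneous 1" and LC1: "\<And>i. i \<in> set J2 \<Longrightarrow> L i \<in> homogeneous 1"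
  using L1 by auto

lemma normal_keys:
  "x \<in> normal_chains js bad t s \<Longrightarrow> m \<in> keys (x S) \<Longrightarrow> \<not> bad m"
proof -
  assume x: "x \<in> normal_chains js bad t s" and m: "m \<in> keys (x S)"
  have "x S = tr (\<lambda>m. \<not> bad m) (x S)" using x by (auto simp: normal_chains_def trc_def fun_eq_iff)
  then show "\<not> bad m" using m keys_tr[of "\<lambda>m. \<not> bad m" "x S"] by auto
qed

lemma trc_conv:
  assumes "\<And>S. x S \<in> mono_ideal (\<lambda>m. keys m \<subseteq> A)" "\<And>S. y S \<in> mono_ideal (\<lambda>m. keys m \<inter> A = {})"
  shows "nf bD (x \<star> y) = nf bB x \<star> nf bC y"
proof
  fix S
  have "tr (\<lambda>m. \<not> bD m) (x S1 * y S2) = tr (\<lambda>m. \<not> bB m) (x S1) * tr (\<lambda>m. \<not> bC m) (y S2)" for S1 S2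
  proof (rule tr_mult)
    fix m1 m2 assume "m1 \<in> keys (x S1)" "m2 \<in> keys (y S2)"
    then have "keys m1 \<subseteq> A" "keys m2 \<inter> A = {}" using assms[of S1] assms(2)[of S2] by (auto simp: mono_ideal_def)
    then show "\<not> bD (m1 + m2) \<longleftrightarrow> \<not> bB m1 \<and> \<not> bC m2" using gD by simp
  qed
  then show "nf bD (x \<star> y) S = (nf bB x \<star> nf bC y) S"
    by (simp add: trc_def conv_def tr_simps)
qed

lemma normal_pureB: "x \<in> WB t s \<Longrightarrow> x S \<in> mono_ideal (\<lambda>m. keys m \<subseteq> A)"
  unfolding mono_ideal_def by (auto dest!: normal_keys gB)

lemma normal_pureC: "x \<in> WC t s \<Longrightarrow> x S \<in> mono_ideal (\<lambda>m. keys m \<inter> A = {})"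
  unfolding mono_ideal_def by (auto dest!: normal_keys gC)

lemma mono_mult_closed:
  assumes "\<And>m n. Q m \<Longrightarrow> Q n \<Longrightarrow> Q (m + n)" "p \<in> mono_ideal Q" "q \<in> mono_ideal Q"
  shows "p * q \<in> mono_ideal Q"
  using assms keys_mult[of p q] unfolding mono_ideal_def by fastforce

lemma dK_closed:
  assumes "\<And>m n. Q m \<Longrightarrow> Q n \<Longrightarrow> Q (m + n)" "\<And>i. i \<in> set js \<Longrightarrow> L i \<in> mono_ideal Q" "\<And>S. x S \<in> mono_ideal Q"
  shows "dK js L x S \<in> mono_ideal Q"
  unfolding dK_def
  by (intro mono_ideal_closed(6) sg_in_subspace subspace_mono_ideal mono_mult_closed assms) auto

lemma dK_pureB: "x \<in> WB t s \<Longrightarrow> dK J1 L x S \<in> mono_ideal (\<lambda>m. keys m \<subseteq> A)"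
  by (rule dK_closed) (auto simp: keys_plus_nat LA normal_pureB)

lemma dK_pureC: "x \<in> WC t s \<Longrightarrow> dK J2 L x S \<in> mono_ideal (\<lambda>m. keys m \<inter> A = {})"
  by (rule dK_closed) (auto simp: keys_plus_nat LC normal_pureC)

lemma conv_Ch:
  assumes "x \<in> Ch J1 t1 s1" "y \<in> Ch J2 t2 s2" shows "x \<star> y \<in> Ch (J1 @ J2) (t1 + t2) (s1 + s2)"
proof (rule Ch_cases)
  fix S
  show "(x \<star> y) S \<in> homogeneous (s1 + s2)"
    using homogeneous_mult[OF Ch_homogeneous[OF assms(1)] Ch_homogeneous[OF assms(2)]] by (simp add: conv_def homogeneous_closed)
  assume nz: "(x \<star> y) S \<noteq> 0"
  then have S: "S \<subseteq> set J1 \<union> set J2" by (auto simp: conv_def split: if_splits)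
  have "x (S \<inter> set J1) \<noteq> 0" "y (S \<inter> set J2) \<noteq> 0" using nz S by (auto simp: conv_def)
  then have "int (card (S \<inter> set J1)) = t1" "int (card (S \<inter> set J2)) = t2"
    using Ch_zero[OF assms(1), of "S \<inter> set J1"] Ch_zero[OF assms(2), of "S \<inter> set J2"] by auto
  moreover have "card (S \<inter> set J1 \<union> S \<inter> set J2) = card (S \<inter> set J1) + card (S \<inter> set J2)"
    using disj by (intro card_Un_disjoint) auto
  moreover have "S \<inter> set J1 \<union> S \<inter> set J2 = S" using S by auto
  ultimately show "S \<subseteq> set (J1 @ J2) \<and> int (card S) = t1 + t2" using S by simp
qed

lemma trc_fix: "x \<in> normal_chains js bad t s \<Longrightarrow> nf bad x = x"
  by (simp add: normal_chains_def)

lemma conv_normal: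
  assumes "x \<in> WB t1 s1" "y \<in> WC t2 s2" shows "x \<star> y \<in> WD (t1 + t2) (s1 + s2)"
  using conv_Ch[OF normal_Ch[OF assms(1)] normal_Ch[OF assms(2)]] trc_conv[OF normal_pureB[OF assms(1)] normal_pureC[OF assms(2)]]
  by (simp add: normal_chains_def trc_fix[OF assms(1)] trc_fix[OF assms(2)])

definition sgt :: "int \<Rightarrow> complex" where "sgt t = (if even t then 1 else - 1)"

lemma sgt_simps: "sgt (t + 1) = - sgt t" "sgt (t - 1) = - sgt t" "sgt t * sgt t = 1"
  by (simp_all add: sgt_def)

text \<open>Leibniz rule: a contraction in \<open>J2\<close> has to pass the \<open>t1\<close>
  indices of the first factor.\<close>

lemma dK_conv:
  assumes x: "x \<in> Ch J1 t1 s1"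
  shows "dK (J1 @ J2) L (x \<star> y) = dK J1 L x \<star> y + sgt t1 *\<^sub>C (x \<star> dK J2 L y)"
proof
  fix S
  show "dK (J1 @ J2) L (x \<star> y) S = (dK J1 L x \<star> y + sgt t1 *\<^sub>C (x \<star> dK J2 L y)) S"
  proof (cases "S \<subseteq> set J1 \<union> set J2")
    case False
    then have "(x \<star> y) (insert i S) = 0" for i by (simp add: conv_def)
    then have "dK (J1 @ J2) L (x \<star> y) S = 0" by (simp add: dK_def)
    then show ?thesis using False by (simp add: conv_def)
  next
    case True
    let ?S1 = "S \<inter> set J1" and ?S2 = "S \<inter> set J2"
    have c: "(x \<star> y) (insert i S) = x (insert i S \<inter> set J1) * y (insert i S \<inter> set J2)" if "i \<in> set J1 \<union> set J2" for i
      using True that by (simp add: conv_def)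
    have 1: "(\<Sum>i\<in>set J1 - S. sg (J1 @ J2) i S * (L i * (x \<star> y) (insert i S))) = dK J1 L x ?S1 * y ?S2"
      unfolding dK_def sum_distrib_right
    proof (rule sum.cong)
      show "set J1 - S = set J1 - S \<inter> set J1" by auto
      fix i assume "i \<in> set J1 - S \<inter> set J1"
      then have i: "i \<in> set J1" "i \<notin> S" "i \<notin> set J2" using disj by auto
      have "filter (\<lambda>k. k \<in> S) (takeWhile (\<lambda>k. k \<noteq> i) J1) = filter (\<lambda>k. k \<in> ?S1) (takeWhile (\<lambda>k. k \<noteq> i) J1)"
        by (rule filter_cong) (auto dest: set_takeWhileD)
      then have s: "sg (J1 @ J2) i S = (sg J1 i ?S1 :: 'v cpoly)"
        using i by (simp add: sg_def takeWhile_append1[of i])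
      have "insert i S \<inter> set J1 = insert i ?S1" "insert i S \<inter> set J2 = ?S2" using i by auto
      then have "(x \<star> y) (insert i S) = x (insert i ?S1) * y ?S2" using c[of i] i(1) by simp
      then show "sg (J1 @ J2) i S * (L i * (x \<star> y) (insert i S)) = sg J1 i ?S1 * (L i * x (insert i ?S1)) * y ?S2"
        by (simp only: s mult.assoc)
    qed
    have 2: "(\<Sum>i\<in>set J2 - S. sg (J1 @ J2) i S * (L i * (x \<star> y) (insert i S))) = sgt t1 *\<^sub>C (x ?S1 * dK J2 L y ?S2)"
      unfolding dK_def sum_distrib_left cv.scale_sum_right
    proof (rule sum.cong)
      show "set J2 - S = set J2 - S \<inter> set J2" by auto
      fix i assume "i \<in> set J2 - S \<inter> set J2"
      then have i: "i \<in> set J2" "i \<notin> S" "i \<notin> set J1" using disj by auto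
      have eq: "insert i S \<inter> set J1 = ?S1" "insert i S \<inter> set J2 = insert i ?S2" using i by auto
      have 3: "(x \<star> y) (insert i S) = x ?S1 * y (insert i ?S2)" using c[OF UnI2[OF i(1)]] by (simp only: eq)
      show "sg (J1 @ J2) i S * (L i * (x \<star> y) (insert i S)) = sgt t1 *\<^sub>C (x ?S1 * (sg J2 i ?S2 * (L i * y (insert i ?S2))))"
      \<comment> \<open>If this coefficient is zero the sign does not matter; otherwise its index
        set has exactly \<open>t1\<close> members.\<close>
      proof (cases "x ?S1 = 0")
        case False
        then have t1: "int (card ?S1) = t1" using Ch_zero[OF x, of ?S1] by auto
        have "filter (\<lambda>k. k \<in> S) (takeWhile (\<lambda>k. k \<noteq> i) J2) = filter (\<lambda>k. k \<in> ?S2) (takeWhile (\<lambda>k. k \<noteq> i) J2)"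
          by (rule filter_cong) (auto dest: set_takeWhileD)
        moreover have "takeWhile (\<lambda>k. k \<noteq> i) (J1 @ J2) = J1 @ takeWhile (\<lambda>k. k \<noteq> i) J2"
          using i(3) by (intro takeWhile_append2) auto
        moreover have "length (filter (\<lambda>k. k \<in> S) J1) = card ?S1"
          using dist1 distinct_card[of "filter (\<lambda>k. k \<in> S) J1"] by (simp add: Int_def conj_commute)
        ultimately have "sg (J1 @ J2) i S = ((- 1) ^ card ?S1 * sg J2 i ?S2 :: 'v cpoly)"
          by (simp add: sg_def power_add)
        moreover have "(- 1) ^ card ?S1 * r = sgt t1 *\<^sub>C r" for r :: "'v cpoly"
          using t1[symmetric] by (cases "even (card ?S1)") (simp_all add: sgt_def)
        ultimately have "sg (J1 @ J2) i S * (L i * (x \<star> y) (insert i S)) = sgt t1 *\<^sub>C (sg J2 i ?S2 * (L i * (x ?S1 * y (insert i ?S2))))"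
          by (simp only: 3 mult.assoc cscale_mult_left)
        then show ?thesis by (simp only: mult_ac)
      qed (simp add: 3)
    qed
    have "set (J1 @ J2) - S = (set J1 - S) \<union> (set J2 - S)" by auto
    moreover have "(set J1 - S) \<inter> (set J2 - S) = {}" using disj by auto
    ultimately have "dK (J1 @ J2) L (x \<star> y) S = dK J1 L x ?S1 * y ?S2 + sgt t1 *\<^sub>C (x ?S1 * dK J2 L y ?S2)"
      unfolding dK_def[of "J1 @ J2"] by (simp only:) (subst sum.union_disjoint, simp_all only: 1 2 finite_Diff finite_set)
    then show ?thesis using True by (simp add: conv_def)
  qed
qed

lemma dl_conv:
  assumes x: "x \<in> WB t1 s1" and y: "y \<in> WC t2 s2"
  shows "dD (x \<star> y) = dB x \<star> y + sgt t1 *\<^sub>C (x \<star> dC y)"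
proof -
  have "nf bD (dK J1 L x \<star> y) = dB x \<star> y"
    using trc_conv[OF dK_pureB[OF x] normal_pureC[OF y]] by (simp only: trc_fix[OF y] dl_def)
  moreover have "nf bD (x \<star> dK J2 L y) = x \<star> dC y"
    using trc_conv[OF normal_pureB[OF x] dK_pureC[OF y]] by (simp only: trc_fix[OF x] dl_def)
  ultimately show ?thesis by (simp only: dl_def[of "J1 @ J2"] dK_conv[OF normal_Ch[OF x]] trc_lin)
qed

lemma bs_conv: "S1 \<subseteq> set J1 \<Longrightarrow> S2 \<subseteq> set J2 \<Longrightarrow> bs S1 m1 \<star> bs S2 m2 = bs (S1 \<union> S2) (m1 + m2)"
proof
  fix S assume S12: "S1 \<subseteq> set J1" "S2 \<subseteq> set J2"
  have "S \<inter> set J1 = S1 \<and> S \<inter> set J2 = S2 \<longleftrightarrow> S = S1 \<union> S2" if "S \<subseteq> set J1 \<union> set J2"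
    using that S12 disj by blast
  moreover have "S \<noteq> S1 \<union> S2" if "\<not> S \<subseteq> set J1 \<union> set J2" using that S12 by blast
  ultimately show "(bs S1 m1 \<star> bs S2 m2) S = bs (S1 \<union> S2) (m1 + m2) S"
    by (auto simp: conv_def bs_def gen_mult_gen)
qed

lemma Lam_conv_bs:
  assumes "S1 \<subseteq> set J1" "S2 \<subseteq> set J2" "keys m1 \<subseteq> A" "keys m2 \<inter> A = {}"
  shows "Lm g (bs S1 m1 \<star> bs S2 m2) = g (int (card S1)) (int (mdeg m1)) (int (card S2)) (int (mdeg m2)) (bs S1 m1) (bs S2 m2)"
proof -
  have "(S1 \<union> S2) \<inter> set J1 = S1" "(S1 \<union> S2) \<inter> set J2 = S2" "S1 \<union> S2 \<subseteq> set J1 \<union> set J2" using assms(1,2) disj by auto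
  then show ?thesis unfolding bs_conv[OF assms(1,2)] by (subst Lam_bs) (simp_all add: part_of_sum[OF assms(3,4)])
qed

text \<open>Bilinearity is assumed only modulo \<open>R\<close>: in the application to tensor
  products the values of \<open>g\<close> are formal generators and \<open>R\<close> is spanned by
  the tensor relations. The factors are expanded in basis chains one after the other.\<close>

lemma Lam_conv_mod:
  fixes R :: "'e::cvec set"
  assumes R: "cv.subspace R"
    and l1: "\<And>x x' y. x \<in> WB t1 s1 \<Longrightarrow> x' \<in> WB t1 s1 \<Longrightarrow> y \<in> WC t2 s2 \<Longrightarrow> g t1 s1 t2 s2 (x + x') y - g t1 s1 t2 s2 x y - g t1 s1 t2 s2 x' y \<in> R"
    and l2: "\<And>x y y'. x \<in> WB t1 s1 \<Longrightarrow> y \<in> WC t2 s2 \<Longrightarrow> y' \<in> WC t2 s2 \<Longrightarrow> g t1 s1 t2 s2 x (y + y') - g t1 s1 t2 s2 x y - g t1 s1 t2 s2 x y' \<in> R"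
    and l3: "\<And>c x y. x \<in> WB t1 s1 \<Longrightarrow> y \<in> WC t2 s2 \<Longrightarrow> g t1 s1 t2 s2 (c *\<^sub>C x) y - c *\<^sub>C g t1 s1 t2 s2 x y \<in> R"
    and l4: "\<And>c x y. x \<in> WB t1 s1 \<Longrightarrow> y \<in> WC t2 s2 \<Longrightarrow> g t1 s1 t2 s2 x (c *\<^sub>C y) - c *\<^sub>C g t1 s1 t2 s2 x y \<in> R"
    and x: "x \<in> WB t1 s1" and y: "y \<in> WC t2 s2"
  shows "Lm g (x \<star> y) - g t1 s1 t2 s2 x y \<in> R"
proof -
  let ?g = "g t1 s1 t2 s2"
  have zeroR: "- ?g 0 y \<in> R" if "y \<in> WC t2 s2" for y
    using cv.subspace_neg[OF R l3[OF normal_closed(1) that, of 0]] by simp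
  have zeroR': "- ?g x 0 \<in> R" if "x \<in> WB t1 s1" for x
    using cv.subspace_neg[OF R l4[OF that normal_closed(1), of 0]] by simp
  have combine: "a + b - z \<in> R" if "a - u \<in> R" "b - v \<in> R" "z - u - v \<in> R" for a b u v z :: 'e
  proof -
    have "a + b - z = (a - u) + (b - v) - (z - u - v)" by simp
    also have "\<dots> \<in> R" by (rule cv.subspace_diff[OF R cv.subspace_add[OF R that(1,2)] that(3)])
    finally show ?thesis .
  qed
  have combine2: "c *\<^sub>C a - z \<in> R" if "a - u \<in> R" "z - c *\<^sub>C u \<in> R" for a u z :: 'e and c
  proof -
    have "c *\<^sub>C a - z = c *\<^sub>C (a - u) - (z - c *\<^sub>C u)" by (simp add: cv.scale_right_diff_distrib)
    also have "\<dots> \<in> R" by (rule cv.subspace_diff[OF R cv.subspace_scale[OF R that(1)] that(2)])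
    finally show ?thesis .
  qed
  have 1: "Lm g (bs S1 m1 \<star> y) - ?g (bs S1 m1) y \<in> R"
    if S1: "S1 \<subseteq> set J1" "int (card S1) = t1" "int (mdeg m1) = s1" "\<not> bB m1" for S1 m1
  proof -
    have b1: "bs S1 m1 \<in> WB t1 s1" using bs_normal[of S1 J1 bB m1, OF S1(1,4)] S1(2,3) by simp
    define Q where "Q = {y \<in> WC t2 s2. Lm g (bs S1 m1 \<star> y) - ?g (bs S1 m1) y \<in> R}"
    have "cv.subspace Q"
      unfolding cv.subspace_def Q_def
    proof (intro conjI ballI allI CollectI; (elim CollectE conjE)?)
      show "Lm g (bs S1 m1 \<star> 0) - ?g (bs S1 m1) 0 \<in> R"
        using zeroR'[OF b1] by (simp add: conv_lin clinear_zero[OF clinear_Lam])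
      show "Lm g (bs S1 m1 \<star> (y + y')) - ?g (bs S1 m1) (y + y') \<in> R"
        if "y \<in> WC t2 s2" "y' \<in> WC t2 s2" "Lm g (bs S1 m1 \<star> y) - ?g (bs S1 m1) y \<in> R" "Lm g (bs S1 m1 \<star> y') - ?g (bs S1 m1) y' \<in> R" for y y'
        unfolding conv_lin clinear_add[OF clinear_Lam] by (rule combine[OF that(3,4) l2[OF b1 that(1,2)]])
      show "Lm g (bs S1 m1 \<star> (c *\<^sub>C y)) - ?g (bs S1 m1) (c *\<^sub>C y) \<in> R"
        if "y \<in> WC t2 s2" "Lm g (bs S1 m1 \<star> y) - ?g (bs S1 m1) y \<in> R" for c y
        unfolding conv_lin clinear_scale[OF clinear_Lam] by (rule combine2[OF that(2) l4[OF b1 that(1)]])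
    qed (rule normal_closed; assumption)+
    moreover have "bs S2 m2 \<in> Q" if S2: "S2 \<subseteq> set J2" "int (card S2) = t2" "int (mdeg m2) = s2" "\<not> bC m2" for S2 m2
    proof -
      have "bs S2 m2 \<in> WC t2 s2" using bs_normal[of S2 J2 bC m2, OF S2(1,4)] S2(2,3) by simp
      moreover have "Lm g (bs S1 m1 \<star> bs S2 m2) = ?g (bs S1 m1) (bs S2 m2)"
        using Lam_conv_bs[OF S1(1) S2(1) gB[OF S1(4)] gC[OF S2(4)], of g] S1(2,3) S2(2,3) by simp
      ultimately show ?thesis using cv.subspace_0[OF R] by (simp add: Q_def)
    qed
    ultimately have "y \<in> Q" using y by (rule normal_chains_induct)
    then show ?thesis by (simp add: Q_def)
  qed
  define Q where "Q = {x \<in> WB t1 s1. Lm g (x \<star> y) - ?g x y \<in> R}"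
  have "cv.subspace Q"
    unfolding cv.subspace_def Q_def
  proof (intro conjI ballI allI CollectI; (elim CollectE conjE)?)
    show "Lm g (0 \<star> y) - ?g 0 y \<in> R"
      using zeroR[OF y] by (simp add: conv_lin clinear_zero[OF clinear_Lam])
    show "Lm g ((x + x') \<star> y) - ?g (x + x') y \<in> R"
      if "x \<in> WB t1 s1" "x' \<in> WB t1 s1" "Lm g (x \<star> y) - ?g x y \<in> R" "Lm g (x' \<star> y) - ?g x' y \<in> R" for x x'
      unfolding conv_lin clinear_add[OF clinear_Lam] by (rule combine[OF that(3,4) l1[OF that(1,2) y]])
    show "Lm g ((c *\<^sub>C x) \<star> y) - ?g (c *\<^sub>C x) y \<in> R"
      if "x \<in> WB t1 s1" "Lm g (x \<star> y) - ?g x y \<in> R" for c x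
      unfolding conv_lin clinear_scale[OF clinear_Lam] by (rule combine2[OF that(2) l3[OF that(1) y]])
  qed (rule normal_closed; assumption)+
  moreover have "bs S1 m1 \<in> Q" if S1: "S1 \<subseteq> set J1" "int (card S1) = t1" "int (mdeg m1) = s1" "\<not> bB m1" for S1 m1
    using bs_normal[of S1 J1 bB m1, OF S1(1,4)] S1(2,3) 1[OF S1] by (simp add: Q_def)
  ultimately have "x \<in> Q" using x by (rule normal_chains_induct)
  then show ?thesis by (simp add: Q_def)
qed

end

subsection \<open>Direct sums and tensor products\<close>

lemma pres_closed:
  assumes "pres W Z B q"
  shows "x \<in> carrier W \<Longrightarrow> y \<in> carrier W \<Longrightarrow> x \<oplus>\<^bsub>W\<^esub> y \<in> carrier W" "x \<in> carrier W \<Longrightarrow> c \<odot>\<^bsub>W\<^esub> x \<in> carrier W"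
proof -
  note Z = pres_subspace(1)[OF assms]
  show "x \<oplus>\<^bsub>W\<^esub> y \<in> carrier W" if "x \<in> carrier W" "y \<in> carrier W"
  proof -
    obtain a b where "a \<in> Z" "b \<in> Z" "x = q a" "y = q b" using \<open>x \<in> carrier W\<close> \<open>y \<in> carrier W\<close> unfolding pres_carrier[OF assms] by blast
    then show ?thesis using pres_add[OF assms, of a b] cv.subspace_add[OF Z, of a b] imageI[of "a + b" Z q] by (simp add: pres_carrier[OF assms])
  qed
  show "c \<odot>\<^bsub>W\<^esub> x \<in> carrier W" if "x \<in> carrier W"
  proof -
    obtain a where "a \<in> Z" "x = q a" using \<open>x \<in> carrier W\<close> unfolding pres_carrier[OF assms] by blast
    then show ?thesis using pres_smult[OF assms, of a c] cv.subspace_scale[OF Z, of a c] imageI[of "c *\<^sub>C a" Z q] by (simp add: pres_carrier[OF assms])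
  qed
qed

lemma pres_tensor:
  assumes M: "pres M Z B q" and N: "pres N Z' B' q'"
  shows "pres (tensor M N) {p. keys p \<subseteq> carrier M \<times> carrier N} (cv.span (tensor_relations M N))
    (\<lambda>p. cv.span (tensor_relations M N) +>\<^bsub>free_space (carrier M \<times> carrier N)\<^esub> p)"
  unfolding tensor_def
proof (rule pres_presented_space)
  let ?Y = "carrier M \<times> carrier N"
  have g: "gen (x, y) \<in> {p. keys p \<subseteq> ?Y}" if "x \<in> carrier M" "y \<in> carrier N" for x y
    using that by simp
  have s: "single (x, y) c \<in> {p. keys p \<subseteq> ?Y}" if "x \<in> carrier M" "y \<in> carrier N" for x y and c :: complex
    unfolding single_eq_cscale_gen[of _ c] by (rule cv.subspace_scale[OF subspace_keys g[OF that]])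
  show "tensor_relations M N \<subseteq> {p. keys p \<subseteq> ?Y}"
    unfolding tensor_relations_def
    by (intro Un_least subsetI; elim CollectE exE conjE; hypsubst;
        intro cv.subspace_diff[OF subspace_keys] g s pres_closed[OF M] pres_closed[OF N]; assumption)
qed

text \<open>Families are 0 outside \<open>I\<close>, whereas the members of
  \<open>direct_sum\<close> are undefined there; this makes the families a subspace of a function
  type.\<close>

definition dsum :: "'i set \<Rightarrow> ('i \<Rightarrow> 'a::cvec set) \<Rightarrow> ('i \<Rightarrow> 'a) set" where
  "dsum I Z = {u. (\<forall>i\<in>I. u i \<in> Z i) \<and> (\<forall>i. i \<notin> I \<longrightarrow> u i = 0) \<and> finite {i. u i \<noteq> 0}}"

lemma subspace_dsum:
  assumes "\<And>i. i \<in> I \<Longrightarrow> cv.subspace (Z i)" shows "cv.subspace (dsum I Z)"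
  unfolding cv.subspace_def
proof (intro conjI ballI allI)
  show "0 \<in> dsum I Z" using assms by (simp add: dsum_def cv.subspace_0)
next
  fix u v assume u: "u \<in> dsum I Z" "v \<in> dsum I Z"
  have "{i. (u + v) i \<noteq> 0} \<subseteq> {i. u i \<noteq> 0} \<union> {i. v i \<noteq> 0}" by auto
  then have "finite {i. (u + v) i \<noteq> 0}" by (rule finite_subset) (use u in \<open>simp add: dsum_def\<close>)
  then show "u + v \<in> dsum I Z" using u assms by (simp add: dsum_def cv.subspace_add)
next
  fix c u assume u: "u \<in> dsum I Z"
  have "{i. (c *\<^sub>C u) i \<noteq> 0} \<subseteq> {i. u i \<noteq> 0}" by auto
  then have "finite {i. (c *\<^sub>C u) i \<noteq> 0}" by (rule finite_subset) (use u in \<open>simp add: dsum_def\<close>)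
  then show "c *\<^sub>C u \<in> dsum I Z" using u assms by (simp add: dsum_def cv.subspace_scale)
qed

lemma pres_direct_sum:
  assumes M: "\<And>i. i \<in> I \<Longrightarrow> pres (M i) (Z i) (B i) (q i)"
  shows "pres (direct_sum I M) (dsum I Z) (dsum I B) (\<lambda>u. \<lambda>i\<in>I. q i (u i))"
  unfolding pres_def
proof (intro conjI ballI allI)
  show "cv.subspace (dsum I Z)" "cv.subspace (dsum I B)"
    using pres_subspace[OF M] by (auto intro!: subspace_dsum)
  have BZ: "B i \<subseteq> Z i" if "i \<in> I" for i using pres_subset[OF M[OF that]] .
  then show "dsum I B \<subseteq> dsum I Z" by (auto simp: dsum_def)
  have q0: "q i 0 = \<zero>\<^bsub>M i\<^esub>" if "i \<in> I" for i using pres_zero[OF M[OF that]] by simp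
  show "\<zero>\<^bsub>direct_sum I M\<^esub> = (\<lambda>i\<in>I. q i (0 i))" by (auto simp: direct_sum_def q0)
  show "carrier (direct_sum I M) = (\<lambda>u. \<lambda>i\<in>I. q i (u i)) ` dsum I Z"
  proof (intro equalityI subsetI)
    fix f assume f: "f \<in> carrier (direct_sum I M)"
    \<comment> \<open>Where \<open>f i\<close> is zero the representative 0 is taken, which keeps
      the support finite.\<close>
    define u where "u i = (if i \<in> I \<and> f i \<noteq> \<zero>\<^bsub>M i\<^esub> then SOME z. z \<in> Z i \<and> q i z = f i else 0)" for i
    have fi: "f i \<in> carrier (M i)" if "i \<in> I" for i using f that by (auto simp: direct_sum_def)
    have some: "(SOME z. z \<in> Z i \<and> q i z = f i) \<in> Z i \<and> q i (SOME z. z \<in> Z i \<and> q i z = f i) = f i" if i: "i \<in> I" for i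
    proof -
      have "\<exists>z. z \<in> Z i \<and> q i z = f i" using fi[OF i] unfolding pres_carrier[OF M[OF i]] by auto
      then show ?thesis by (rule someI_ex)
    qed
    have u: "u i \<in> Z i \<and> q i (u i) = f i" if i: "i \<in> I" for i
      using some[OF i] i q0[OF i] cv.subspace_0[OF pres_subspace(1)[OF M[OF i]]] by (auto simp: u_def)
    have "{i. u i \<noteq> 0} \<subseteq> {i \<in> I. f i \<noteq> \<zero>\<^bsub>M i\<^esub>}" by (auto simp: u_def)
    then have "finite {i. u i \<noteq> 0}" by (rule finite_subset) (use f in \<open>simp add: direct_sum_def\<close>)
    then have "u \<in> dsum I Z" using u by (simp add: dsum_def) (simp add: u_def)
    moreover have "f = (\<lambda>i\<in>I. q i (u i))" using f u by (auto simp: direct_sum_def fun_eq_iff PiE_def extensional_def)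
    ultimately show "f \<in> (\<lambda>u. \<lambda>i\<in>I. q i (u i)) ` dsum I Z" by blast
  next
    fix f assume "f \<in> (\<lambda>u. \<lambda>i\<in>I. q i (u i)) ` dsum I Z"
    then obtain u where u: "f = (\<lambda>i\<in>I. q i (u i))" "u \<in> dsum I Z" by blast
    have "{i \<in> I. f i \<noteq> \<zero>\<^bsub>M i\<^esub>} \<subseteq> {i. u i \<noteq> 0}" using q0 by (auto simp: u(1))
    then have "finite {i \<in> I. f i \<noteq> \<zero>\<^bsub>M i\<^esub>}" by (rule finite_subset) (use u(2) in \<open>simp add: dsum_def\<close>)
    moreover have "f i \<in> carrier (M i)" if "i \<in> I" for i
      using u(2) that by (simp add: u(1) dsum_def pres_carrier[OF M[OF that]])
    ultimately show "f \<in> carrier (direct_sum I M)" by (auto simp: direct_sum_def u(1))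
  qed
next
  fix u v assume u: "u \<in> dsum I Z" and v: "v \<in> dsum I Z"
  have ui: "u i \<in> Z i" "v i \<in> Z i" if "i \<in> I" for i using u v that by (auto simp: dsum_def)
  have add: "q i (u i + v i) = q i (u i) \<oplus>\<^bsub>M i\<^esub> q i (v i)" if "i \<in> I" for i
    by (rule pres_add[OF M[OF that] ui[OF that]])
  show "(\<lambda>i\<in>I. q i ((u + v) i)) = (\<lambda>i\<in>I. q i (u i)) \<oplus>\<^bsub>direct_sum I M\<^esub> (\<lambda>i\<in>I. q i (v i))"
    by (auto simp: direct_sum_def fun_eq_iff add)
  have "u - v \<in> dsum I Z" by (rule cv.subspace_diff[OF subspace_dsum u v]) (rule pres_subspace(1)[OF M])
  then have "u - v \<in> dsum I B \<longleftrightarrow> (\<forall>i\<in>I. u i - v i \<in> B i)" by (simp add: dsum_def)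
  moreover have "q i (u i) = q i (v i) \<longleftrightarrow> u i - v i \<in> B i" if "i \<in> I" for i
    by (rule pres_eq[OF M[OF that] ui[OF that]])
  ultimately show "((\<lambda>i\<in>I. q i (u i)) = (\<lambda>i\<in>I. q i (v i))) = (u - v \<in> dsum I B)"
    by (auto simp: fun_eq_iff)
next
  fix c u assume u: "u \<in> dsum I Z"
  have "q i (c *\<^sub>C u i) = c \<odot>\<^bsub>M i\<^esub> q i (u i)" if "i \<in> I" for i
    using u that by (intro pres_smult[OF M[OF that]]) (simp add: dsum_def)
  then show "(\<lambda>i\<in>I. q i ((c *\<^sub>C u) i)) = c \<odot>\<^bsub>direct_sum I M\<^esub> (\<lambda>i\<in>I. q i (u i))"
    by (auto simp: direct_sum_def fun_eq_iff)
qed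

text \<open>A complex with a deformation \<open>p\<close>, \<open>h\<close> onto representatives of
  its homology, together with spaces \<open>M\<close> that are presented as this homology.\<close>

locale retract =
  fixes js :: "int list" and L :: "int \<Rightarrow> 'v cpoly" and bad :: "('v \<Rightarrow>\<^sub>0 nat) \<Rightarrow> bool"
    and p h :: "int \<Rightarrow> int \<Rightarrow> ('v chain) \<Rightarrow> 'v chain"
    and M :: "int \<Rightarrow> int \<Rightarrow> (complex, 'x) module" and f :: "int \<Rightarrow> int \<Rightarrow> ('v chain) \<Rightarrow> 'x"
  assumes js: "distinct js" and up: "upward bad" and L1: "\<And>i. i \<in> set js \<Longrightarrow> L i \<in> homogeneous 1"
    and p_lin: "\<And>t s. clinear (p t s)" and h_lin: "\<And>t s. clinear (h t s)"
    and p_normal: "\<And>t s x. x \<in> normal_chains js bad t s \<Longrightarrow> p t s x \<in> normal_chains js bad t s"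
    and dl_p: "\<And>t s x. x \<in> normal_chains js bad t s \<Longrightarrow> dl js L bad (p t s x) = 0"
    and p_p: "\<And>t s x. p t s (p t s x) = p t s x"
    and h_normal: "\<And>t s x. x \<in> normal_chains js bad t s \<Longrightarrow> h t s x \<in> normal_chains js bad (t + 1) (s - 1)"
    and homotopy: "\<And>t s x. x \<in> normal_chains js bad t s \<Longrightarrow> x - p t s x = dl js L bad (h t s x) + h (t - 1) (s + 1) (dl js L bad x)"
    and p_dl: "\<And>t s u. u \<in> normal_chains js bad (t + 1) (s - 1) \<Longrightarrow> p t s (dl js L bad u) = 0"
    and M: "\<And>t s. pres (M t s) (Zc js L bad t s) (Bd js L bad t s) (f t s)"
begin

text \<open>A section of \<open>f\<close>. Although \<open>inv_into\<close> is not linear, the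
  section is, because \<open>p\<close> takes the same value on all representatives of a
  class.\<close>

definition r :: "int \<Rightarrow> int \<Rightarrow> 'x \<Rightarrow> 'v chain" where
  "r t s y = p t s (nf bad (inv_into (Zc js L bad t s) (f t s) y))"

lemma trc_Bd: "x \<in> Bd js L bad t s \<Longrightarrow> \<exists>u\<in>normal_chains js bad (t + 1) (s - 1). nf bad x = dl js L bad u"
proof -
  assume "x \<in> Bd js L bad t s"
  then obtain b i where x: "x = dK js L b + i" "b \<in> Ch js (t + 1) (s - 1)" "i \<in> IC bad" by (rule BdE)
  have "nf bad x = dl js L bad b" by (simp add: x(1) trc_lin trc_IC[OF x(3)] dl_def)
  also have "\<dots> = dl js L bad (nf bad b)" by (rule dl_trc[OF up, symmetric])
  finally show ?thesis using trc_normal[OF x(2)] by blast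
qed

lemma p_Bd: "x \<in> Bd js L bad t s \<Longrightarrow> p t s (nf bad x) = 0"
  using trc_Bd p_dl by force

lemma p_cong: "x - y \<in> Bd js L bad t s \<Longrightarrow> p t s (nf bad x) = p t s (nf bad y)"
  using p_Bd[of "x - y" t s] by (simp add: trc_lin clinear_diff[OF p_lin])

lemma r_f: "x \<in> Zc js L bad t s \<Longrightarrow> r t s (f t s x) = p t s (nf bad x)"
proof -
  assume x: "x \<in> Zc js L bad t s"
  let ?x' = "inv_into (Zc js L bad t s) (f t s) (f t s x)"
  have "?x' \<in> Zc js L bad t s" "f t s ?x' = f t s x"
    using inv_into_into[of "f t s x" "f t s" "Zc js L bad t s"] f_inv_into_f[of "f t s x" "f t s" "Zc js L bad t s"] x by simp_all
  then have "?x' - x \<in> Bd js L bad t s" using pres_eq[OF M, of ?x' t s x] x by simp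
  then show ?thesis unfolding r_def by (rule p_cong)
qed

lemma carrierE:
  assumes "\<xi> \<in> carrier (M t s)"
  obtains x where "x \<in> Zc js L bad t s" "\<xi> = f t s x"
  using assms unfolding pres_carrier[OF M] by blast

lemma trc_diff_Bd: "x \<in> Ch js t s \<Longrightarrow> nf bad x - x \<in> Bd js L bad t s"
  by (rule IC_subset_Bd[OF Ch_closed(3)[OF trc_Ch] IC_diff_sym[OF diff_trc_IC]])

lemma p_diff_Bd: "x \<in> normal_chains js bad t s \<Longrightarrow> dl js L bad x = 0 \<Longrightarrow> p t s x - x \<in> Bd js L bad t s"
proof -
  assume x: "x \<in> normal_chains js bad t s" "dl js L bad x = 0"
  have "dl js L bad (h t s x) \<in> Bd js L bad t s" by (rule dl_Bd[OF L1 normal_Ch[OF h_normal[OF x(1)]]])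
  then have "- (x - p t s x) \<in> Bd js L bad t s"
    unfolding homotopy[OF x(1)] x(2) clinear_zero[OF h_lin] add_0_right by (rule Bd_closed(4))
  then show ?thesis by simp
qed

lemma p_Zc: "x \<in> normal_chains js bad t s \<Longrightarrow> p t s x \<in> Zc js L bad t s"
  using normal_cycle[OF p_normal] dl_p by blast

lemma r_props:
  assumes "\<xi> \<in> carrier (M t s)"
  shows r_normal: "r t s \<xi> \<in> normal_chains js bad t s" and dl_r: "dl js L bad (r t s \<xi>) = 0"
    and r_Zc: "r t s \<xi> \<in> Zc js L bad t s" and f_r: "f t s (r t s \<xi>) = \<xi>" and p_r: "p t s (r t s \<xi>) = r t s \<xi>"
proof -
  obtain x where x: "x \<in> Zc js L bad t s" "\<xi> = f t s x" using assms by (rule carrierE)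
  have n: "nf bad x \<in> normal_chains js bad t s" by (rule trc_normal[OF ZcD(1)[OF x(1)]])
  have r: "r t s \<xi> = p t s (nf bad x)" unfolding x(2) by (rule r_f[OF x(1)])
  show 1: "r t s \<xi> \<in> normal_chains js bad t s" "dl js L bad (r t s \<xi>) = 0" "r t s \<xi> \<in> Zc js L bad t s"
    unfolding r using n by (rule p_normal dl_p p_Zc)+
  have "(p t s (nf bad x) - nf bad x) + (nf bad x - x) \<in> Bd js L bad t s"
    by (rule Bd_closed(2)[OF p_diff_Bd[OF n trc_Zc[OF up x(1)]] trc_diff_Bd[OF ZcD(1)[OF x(1)]]])
  then have "r t s \<xi> - x \<in> Bd js L bad t s" by (simp add: r)
  then show "f t s (r t s \<xi>) = \<xi>" unfolding x(2) using pres_eq[OF M, of "r t s \<xi>" t s x] 1(3) x by simp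
  show "p t s (r t s \<xi>) = r t s \<xi>" unfolding r by (rule p_p)
qed

lemma r_add: "\<xi> \<in> carrier (M t s) \<Longrightarrow> \<eta> \<in> carrier (M t s) \<Longrightarrow> r t s (\<xi> \<oplus>\<^bsub>M t s\<^esub> \<eta>) = r t s \<xi> + r t s \<eta>"
proof (elim carrierE)
  fix x y assume "x \<in> Zc js L bad t s" "\<xi> = f t s x" "y \<in> Zc js L bad t s" "\<eta> = f t s y"
  then show ?thesis using pres_add[OF M, of x t s y] r_f[of "x + y" t s]
    by (simp add: r_f Zc_closed trc_lin clinear_add[OF p_lin])
qed

lemma r_scale: "\<xi> \<in> carrier (M t s) \<Longrightarrow> r t s (c \<odot>\<^bsub>M t s\<^esub> \<xi>) = c *\<^sub>C r t s \<xi>"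
proof (elim carrierE)
  fix x assume "x \<in> Zc js L bad t s" "\<xi> = f t s x"
  then show ?thesis using pres_smult[OF M, of x t s c] r_f[of "c *\<^sub>C x" t s]
    by (simp add: r_f Zc_closed trc_lin clinear_scale[OF p_lin])
qed

lemma fp_carrier: "x \<in> normal_chains js bad t s \<Longrightarrow> f t s (p t s x) \<in> carrier (M t s)"
  unfolding pres_carrier[OF M] by (intro imageI p_Zc)

lemma r_fp: "x \<in> normal_chains js bad t s \<Longrightarrow> r t s (f t s (p t s x)) = p t s x"
  using r_f[OF p_Zc] trc_IC_iff p_normal by (simp add: normal_chains_def p_p)

lemma fp_add: "x \<in> normal_chains js bad t s \<Longrightarrow> y \<in> normal_chains js bad t s \<Longrightarrow>
    f t s (p t s (x + y)) = f t s (p t s x) \<oplus>\<^bsub>M t s\<^esub> f t s (p t s y)"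
  unfolding clinear_add[OF p_lin] by (rule pres_add[OF M p_Zc p_Zc])

lemma fp_scale: "x \<in> normal_chains js bad t s \<Longrightarrow> f t s (p t s (c *\<^sub>C x)) = c \<odot>\<^bsub>M t s\<^esub> f t s (p t s x)"
  unfolding clinear_scale[OF p_lin] by (rule pres_smult[OF M p_Zc])

text \<open>Vanishing in negative degrees, stated as multiplication by 0 so that the tensor
  relations apply to it directly in \<open>negative_Rt\<close>.\<close>

lemma negative_trivial:
  assumes "t < 0 \<or> s < 0" "\<xi> \<in> carrier (M t s)" shows "\<xi> = 0 \<odot>\<^bsub>M t s\<^esub> \<xi>"
proof -
  obtain x where x: "x \<in> Zc js L bad t s" "\<xi> = f t s x" using assms(2) by (rule carrierE)
  have "x S = 0" for S
  proof (cases "t < 0")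
    case True then show ?thesis by (intro Ch_zero[OF ZcD(1)[OF x(1)]]) auto
  next
    case False
    then have "keys (x S) = {}"
      using Ch_homogeneous[OF ZcD(1)[OF x(1)], of S] assms(1) by (auto simp: homogeneous_iff)
    then show ?thesis by simp
  qed
  then have "x = 0" by (simp add: fun_eq_iff)
  then show ?thesis using pres_smult[OF M x(1), of 0] x(2) by simp
qed

end

subsection \<open>The Kuenneth isomorphism\<close>

text \<open>By \<open>b0\<close> the monomial 1 is a normal form of the first factor, so the second
  complex embeds into the product by multiplication with 1.\<close>

locale kunneth_pres = kunneth J1 J2 A L bB bC bD + B: retract J1 L bB pB hB MB fB + C: retract J2 L bC pC hC MC fC
  for J1 J2 :: "int list" and A :: "'v set" and L :: "int \<Rightarrow> 'v cpoly" and bB bC bD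
    and pB hB and MB :: "int \<Rightarrow> int \<Rightarrow> (complex, 'x) module" and fB and pC hC
    and MC :: "int \<Rightarrow> int \<Rightarrow> (complex, 'y) module" and fC +
  assumes b0: "\<not> bB 0"
begin

definition Ix :: "int \<Rightarrow> int \<Rightarrow> (int \<times> int \<times> int \<times> int) set" where
  "Ix t s = {(t1, t2, s1, s2). t1 + t2 = t \<and> s1 + s2 = s \<and> t1 + s1 > 0}"

text \<open>Over the integers the index set \<open>Ix\<close> is infinite, but a summand with a
  negative degree vanishes. The remaining indices form this finite set.\<close>

definition Iplus :: "int \<Rightarrow> int \<Rightarrow> (int \<times> int \<times> int \<times> int) set" where
  "Iplus t s = {(t1, t2, s1, s2). t1 + t2 = t \<and> s1 + s2 = s \<and> t1 + s1 > 0 \<and> t1 \<ge> 0 \<and> t2 \<ge> 0 \<and> s1 \<ge> 0 \<and> s2 \<ge> 0}"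

definition Zt :: "int \<times> int \<times> int \<times> int \<Rightarrow> ('x \<times> 'y \<Rightarrow>\<^sub>0 complex) set" where
  "Zt = (\<lambda>(t1, t2, s1, s2). {p. keys p \<subseteq> carrier (MB t1 s1) \<times> carrier (MC t2 s2)})"

definition Rt :: "int \<times> int \<times> int \<times> int \<Rightarrow> ('x \<times> 'y \<Rightarrow>\<^sub>0 complex) set" where
  "Rt = (\<lambda>(t1, t2, s1, s2). cv.span (tensor_relations (MB t1 s1) (MC t2 s2)))"

text \<open>The Kuenneth map on one summand, defined on formal sums of pairs of classes through
  their canonical representatives.\<close>

definition G1 :: "int \<times> int \<times> int \<times> int \<Rightarrow> ('x \<times> 'y \<Rightarrow>\<^sub>0 complex) \<Rightarrow> 'v chain" where
  "G1 = (\<lambda>(t1, t2, s1, s2). lin (\<lambda>(a, b). B.r t1 s1 a \<star> C.r t2 s2 b))"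

definition G :: "int \<Rightarrow> int \<Rightarrow> (int \<times> int \<times> int \<times> int \<Rightarrow> 'x \<times> 'y \<Rightarrow>\<^sub>0 complex) \<Rightarrow> 'v chain" where
  "G t s u = (\<Sum>i\<in>Iplus t s. G1 i (u i))"

text \<open>Component \<open>i\<close> of the inverse Kuenneth map on a product of chains; other
  degrees are sent to 0.\<close>

definition \<gamma> :: "int \<times> int \<times> int \<times> int \<Rightarrow> int \<Rightarrow> int \<Rightarrow> int \<Rightarrow> int \<Rightarrow> ('v chain) \<Rightarrow> ('v chain) \<Rightarrow> 'x \<times> 'y \<Rightarrow>\<^sub>0 complex" where
  "\<gamma> i t1 s1 t2 s2 x y = (if (t1, t2, s1, s2) = i then gen (fB t1 s1 (pB t1 s1 x), fC t2 s2 (pC t2 s2 y)) else 0)"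

definition Pc :: "('v chain) \<Rightarrow> 'v chain" where
  "Pc = Lm (\<lambda>t1 s1 t2 s2 x y. pB t1 s1 x \<star> pC t2 s2 y)"

text \<open>The tensor product homotopy: contract the first factor, then the second one after
  projecting the first.\<close>

definition Hc :: "('v chain) \<Rightarrow> 'v chain" where
  "Hc = Lm (\<lambda>t1 s1 t2 s2 x y. hB t1 s1 x \<star> y + sgt t1 *\<^sub>C (pB t1 s1 x \<star> hC t2 s2 y))"

text \<open>Cycles of the second factor, which are at the same time their products with 1 and hence
  cycles of the tensor product. They represent the summand \<open>t1 = s1 = 0\<close> that
  \<open>Ix\<close> omits.\<close>

definition NC :: "int \<Rightarrow> int \<Rightarrow> ('v chain) set" where
  "NC t s = {c \<in> WC t s. dC c = 0}"

definition BN :: "int \<Rightarrow> int \<Rightarrow> ('v chain) set" where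
  "BN t s = {b + n | b n. b \<in> Bd (J1 @ J2) L bD t s \<and> n \<in> NC t s}"

lemma finite_Iplus: "finite (Iplus t s)"
proof -
  have "Iplus t s \<subseteq> (\<lambda>(t1, s1). (t1, t - t1, s1, s - s1)) ` ({0..t} \<times> {0..s})" by (auto simp: Iplus_def image_iff)
  then show ?thesis by (rule finite_subset) simp
qed

lemma Iplus_Ix: "Iplus t s \<subseteq> Ix t s"
  by (auto simp: Iplus_def Ix_def)

lemma subspace_Rt: "cv.subspace (Rt i)"
  unfolding Rt_def by (cases i) (simp add: cv.subspace_span)

lemma subspace_Zt: "cv.subspace (Zt i)"
  unfolding Zt_def by (cases i) (simp add: subspace_keys)

lemma clinear_G1: "clinear (G1 i)"
  unfolding G1_def by (cases i) (simp add: clinear_lin)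

lemma clinear_G: "clinear (G t s)"
  unfolding G_def
  by (rule clinearI) (simp_all add: clinear_add[OF clinear_G1] clinear_scale[OF clinear_G1] sum.distrib cv.scale_sum_right)

lemma WD_induct:
  assumes T: "cv.subspace T"
    and step: "\<And>S1 S2 m1 m2. S1 \<subseteq> set J1 \<Longrightarrow> S2 \<subseteq> set J2 \<Longrightarrow> keys m1 \<subseteq> A \<Longrightarrow> keys m2 \<inter> A = {} \<Longrightarrow>
      int (card S1) + int (card S2) = t \<Longrightarrow> int (mdeg m1) + int (mdeg m2) = s \<Longrightarrow>
      bs S1 m1 \<in> WB (int (card S1)) (int (mdeg m1)) \<Longrightarrow> bs S2 m2 \<in> WC (int (card S2)) (int (mdeg m2)) \<Longrightarrow>
      bs S1 m1 \<star> bs S2 m2 \<in> T"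
    and c: "c \<in> WD t s"
  shows "c \<in> T"
proof (rule normal_chains_induct[OF T _ c])
  fix S and m :: "'v \<Rightarrow>\<^sub>0 nat"
  assume S: "S \<subseteq> set (J1 @ J2)" "int (card S) = t" "int (mdeg m) = s" "\<not> bD m"
  let ?S1 = "S \<inter> set J1" and ?S2 = "S \<inter> set J2" and ?m1 = "part A m" and ?m2 = "part (- A) m"
  have k: "keys ?m1 \<subseteq> A" "keys ?m2 \<inter> A = {}" by (auto simp: keys_part)
  have nb: "\<not> bB ?m1" "\<not> bC ?m2" using gD[OF k] S(4) by (simp_all add: part_plus_part)
  have SS: "?S1 \<union> ?S2 = S" using S(1) by auto
  have "finite S" using S(1) by (rule finite_subset) simp
  then have "card (?S1 \<union> ?S2) = card ?S1 + card ?S2" using disj by (intro card_Un_disjoint) auto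
  then have "int (card ?S1) + int (card ?S2) = t" using S(2) by (simp add: SS)
  moreover have "int (mdeg ?m1) + int (mdeg ?m2) = s" using S(3) mdeg_plus[of ?m1 ?m2] by (simp add: part_plus_part)
  ultimately have "bs ?S1 ?m1 \<star> bs ?S2 ?m2 \<in> T"
    using bs_normal[of ?S1 J1 bB ?m1, OF _ nb(1)] bs_normal[of ?S2 J2 bC ?m2, OF _ nb(2)] by (intro step k) auto
  then show "bs S m \<in> T" by (simp add: bs_conv SS part_plus_part)
qed

lemma Lam_conv:
  assumes "\<And>y. clinear (\<lambda>x. g t1 s1 t2 s2 x y)" "\<And>x. clinear (g t1 s1 t2 s2 x)"
    and "x \<in> WB t1 s1" "y \<in> WC t2 s2"
  shows "Lm g (x \<star> y) = g t1 s1 t2 s2 x y"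
proof -
  have "Lm g (x \<star> y) - g t1 s1 t2 s2 x y \<in> {0}"
    by (rule Lam_conv_mod[OF _ _ _ _ _ assms(3,4)])
      (simp_all add: clinear_add[OF assms(1)] clinear_scale[OF assms(1)] clinear_add[OF assms(2)] clinear_scale[OF assms(2)])
  then show ?thesis by simp
qed

lemma Pc_conv: "x \<in> WB t1 s1 \<Longrightarrow> y \<in> WC t2 s2 \<Longrightarrow> Pc (x \<star> y) = pB t1 s1 x \<star> pC t2 s2 y"
  unfolding Pc_def
  by (rule Lam_conv) (rule clinear_comp[OF clinear_conv_left B.p_lin] clinear_comp[OF clinear_conv_right C.p_lin] | assumption)+

lemma clinear_plus: "clinear f \<Longrightarrow> clinear g \<Longrightarrow> clinear (\<lambda>x. f x + c *\<^sub>C g x)"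
  by (rule clinearI) (simp_all add: clinear_add clinear_scale cv.scale_right_distrib cv.scale_left_commute)

lemma Hc_conv: "x \<in> WB t1 s1 \<Longrightarrow> y \<in> WC t2 s2 \<Longrightarrow>
    Hc (x \<star> y) = hB t1 s1 x \<star> y + sgt t1 *\<^sub>C (pB t1 s1 x \<star> hC t2 s2 y)"
  unfolding Hc_def
  by (rule Lam_conv) (rule clinear_plus clinear_comp[OF clinear_conv_left B.p_lin] clinear_comp[OF clinear_conv_left B.h_lin]
      clinear_conv_right clinear_comp[OF clinear_conv_right C.h_lin] | assumption)+

lemma clinear_Pc: "clinear Pc" and clinear_Hc: "clinear Hc"
  unfolding Pc_def Hc_def by (rule clinear_Lam)+

lemma dB_normal: "x \<in> WB t1 s1 \<Longrightarrow> dB x \<in> WB (t1 - 1) (s1 + 1)"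
  by (rule dl_normal[OF LB1 normal_Ch])

lemma dC_normal: "x \<in> WC t1 s1 \<Longrightarrow> dC x \<in> WC (t1 - 1) (s1 + 1)"
  by (rule dl_normal[OF LC1 normal_Ch])

lemma pB_dB: "x \<in> WB t1 s1 \<Longrightarrow> pB (t1 - 1) (s1 + 1) (dB x) = 0"
  by (rule B.p_dl) simp

lemma pC_dC: "x \<in> WC t1 s1 \<Longrightarrow> pC (t1 - 1) (s1 + 1) (dC x) = 0"
  by (rule C.p_dl) simp

text \<open>The difference is split into \<open>x\<close> minus its projection, times
  \<open>y\<close>, plus the projection of \<open>x\<close> times \<open>y\<close> minus its
  projection. The mixed terms with \<open>hB\<close> and \<open>dC\<close> cancel by the sign
  \<open>sgt\<close>.\<close>

lemma homotopy_conv: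
  assumes x: "x \<in> WB t1 s1" and y: "y \<in> WC t2 s2"
  shows "x \<star> y - Pc (x \<star> y) = dD (Hc (x \<star> y)) + Hc (dD (x \<star> y))"
proof -
  let ?hx = "hB t1 s1 x" and ?px = "pB t1 s1 x" and ?hy = "hC t2 s2 y" and ?py = "pC t2 s2 y"
  have 1: "dD (Hc (x \<star> y)) = (dB ?hx \<star> y - sgt t1 *\<^sub>C (?hx \<star> dC y)) + ?px \<star> dC ?hy"
    unfolding Hc_conv[OF x y] dl_lin dl_conv[OF B.h_normal[OF x] y] dl_conv[OF B.p_normal[OF x] C.h_normal[OF y]] B.dl_p[OF x]
    by (simp add: conv_lin sgt_simps cv.scale_minus_left)
  have 2: "Hc (dD (x \<star> y)) = hB (t1 - 1) (s1 + 1) (dB x) \<star> y + (sgt t1 *\<^sub>C (?hx \<star> dC y) + ?px \<star> hC (t2 - 1) (s2 + 1) (dC y))"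
    unfolding dl_conv[OF x y] clinear_add[OF clinear_Hc] clinear_scale[OF clinear_Hc] Hc_conv[OF dB_normal[OF x] y]
      Hc_conv[OF x dC_normal[OF y]] pB_dB[OF x]
    by (simp add: conv_lin sgt_simps cv.scale_right_distrib)
  have "x \<star> y - ?px \<star> ?py = (x - ?px) \<star> y + ?px \<star> (y - ?py)" by (simp add: conv_lin)
  also have "\<dots> = (dB ?hx + hB (t1 - 1) (s1 + 1) (dB x)) \<star> y + ?px \<star> (dC ?hy + hC (t2 - 1) (s2 + 1) (dC y))"
    by (simp only: B.homotopy[OF x] C.homotopy[OF y])
  also have "\<dots> = dD (Hc (x \<star> y)) + Hc (dD (x \<star> y))"
    unfolding 1 2 conv_lin by (simp only: diff_conv_add_uminus add_ac) simp
  finally show ?thesis by (simp only: Pc_conv[OF x y])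
qed

lemma homotopy_WD:
  assumes "c \<in> WD t s" shows "c - Pc c = dD (Hc c) + Hc (dD c)"
proof -
  have "c \<in> {c. c - Pc c = dD (Hc c) + Hc (dD c)}"
  proof (rule WD_induct[OF _ _ assms])
    show "cv.subspace {c. c - Pc c = dD (Hc c) + Hc (dD c)}"
    proof -
      have l: "clinear (\<lambda>c. (c - Pc c) - (dD (Hc c) + Hc (dD c)))"
        by (rule clinearI) (simp_all add: clinear_add[OF clinear_Pc] clinear_scale[OF clinear_Pc] clinear_add[OF clinear_Hc]
            clinear_scale[OF clinear_Hc] dl_lin cv.scale_right_diff_distrib cv.scale_right_distrib)
      show ?thesis using cvp.linear_subspace_kernel[OF l] by simp
    qed
  qed (simp add: homotopy_conv)
  then show ?thesis by simp
qed

lemma Hc_normal: "c \<in> WD t s \<Longrightarrow> Hc c \<in> WD (t + 1) (s - 1)"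
proof -
  assume "c \<in> WD t s"
  then have "c \<in> {c. Hc c \<in> WD (t + 1) (s - 1)}"
  proof (rule WD_induct[rotated 2])
    show "cv.subspace {c. Hc c \<in> WD (t + 1) (s - 1)}"
      using cvp.linear_subspace_vimage[OF clinear_Hc subspace_normal_chains] by (simp add: vimage_def)
  next
    fix S1 S2 :: "int set" and m1 m2 :: "'v \<Rightarrow>\<^sub>0 nat"
    let ?t1 = "int (card S1)" and ?t2 = "int (card S2)" and ?s1 = "int (mdeg m1)" and ?s2 = "int (mdeg m2)"
    assume ts: "?t1 + ?t2 = t" "?s1 + ?s2 = s" and x: "bs S1 m1 \<in> WB ?t1 ?s1" and y: "bs S2 m2 \<in> WC ?t2 ?s2"
    have e: "?t1 + 1 + ?t2 = t + 1" "?s1 - 1 + ?s2 = s - 1" "?t1 + (?t2 + 1) = t + 1" "?s1 + (?s2 - 1) = s - 1" using ts by simp_all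
    show "bs S1 m1 \<star> bs S2 m2 \<in> {c. Hc c \<in> WD (t + 1) (s - 1)}"
      unfolding mem_Collect_eq Hc_conv[OF x y]
      using conv_normal[OF B.h_normal[OF x] y] conv_normal[OF B.p_normal[OF x] C.h_normal[OF y]] unfolding e
      by (intro normal_closed)
  qed
  then show ?thesis by simp
qed

lemma unit_normal: "bs {} 0 \<in> WB 0 0"
  using bs_normal[of "{}" J1 bB 0] b0 by simp

lemma dB_unit: "dB (bs {} 0) = 0"
proof -
  have "dK J1 L (bs {} 0) = (0 :: 'v chain)" by (auto simp: dK_def bs_def fun_eq_iff)
  then show ?thesis by (simp add: dl_def trc_lin)
qed

lemma unit_conv: "y \<in> WC t s \<Longrightarrow> bs {} 0 \<star> y = y"
proof
  fix S assume y: "y \<in> WC t s"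
  have z: "y S = 0" if "\<not> S \<subseteq> set J2" using Ch_zero[OF normal_Ch[OF y], of S] that by auto
  show "(bs {} 0 \<star> y) S = y S"
  proof (cases "S \<subseteq> set J2")
    case True
    then have "S \<inter> set J1 = {}" "S \<inter> set J2 = S" "S \<subseteq> set J1 \<union> set J2" using disj by auto
    then show ?thesis by (simp add: conv_def bs_def)
  next
    case False
    have "S \<inter> set J1 \<noteq> {}" if "S \<subseteq> set J1 \<union> set J2" using that False by auto
    then show ?thesis using z[OF False] by (simp add: conv_def bs_def)
  qed
qed

lemma NC_normal: "n \<in> NC t s \<Longrightarrow> n \<in> WD t s"
  using conv_normal[OF unit_normal, of n t s] unit_conv[of n t s] by (simp add: NC_def)

lemma dD_NC: "n \<in> NC t s \<Longrightarrow> dD n = 0"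
proof -
  assume n: "n \<in> NC t s"
  then have n': "n \<in> WC t s" "dC n = 0" by (simp_all add: NC_def)
  have "dD (bs {} 0 \<star> n) = dB (bs {} 0) \<star> n + sgt 0 *\<^sub>C (bs {} 0 \<star> dC n)" by (rule dl_conv[OF unit_normal n'(1)])
  then show ?thesis by (simp add: dB_unit conv_lin n'(2) unit_conv[OF n'(1)])
qed

lemma subspace_NC: "cv.subspace (NC t s)"
  using subspace_normal_chains[of J2 bC t s] unfolding cv.subspace_def NC_def by (simp add: dl_lin)

lemma NC_Zc: "n \<in> NC t s \<Longrightarrow> n \<in> Zc (J1 @ J2) L bD t s"
  using normal_cycle[OF NC_normal] dD_NC by blast

lemma subspace_BN: "cv.subspace (BN t s)"
  unfolding BN_def by (rule cv.subspace_sums[OF subspace_Bd subspace_NC])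

lemma Bd_BN: "b \<in> Bd (J1 @ J2) L bD t s \<Longrightarrow> b \<in> BN t s"
  unfolding BN_def using cv.subspace_0[OF subspace_NC, of t s] by (auto intro: exI[of _ b] exI[of _ 0])

lemma NC_BN: "n \<in> NC t s \<Longrightarrow> n \<in> BN t s"
  unfolding BN_def mem_Collect_eq using Bd_closed(1) by (intro exI[of _ 0] exI[of _ n]) simp

lemma G1_Rt: "p \<in> Rt i \<Longrightarrow> G1 i p = 0"
proof -
  obtain t1 t2 s1 s2 where i: "i = (t1, t2, s1, s2)" by (cases i)
  have "tensor_relations (MB t1 s1) (MC t2 s2) \<subseteq> {p. G1 i p = 0}"
  proof -
    note l = clinear_diff[OF clinear_lin]
    show ?thesis unfolding tensor_relations_def G1_def i
      by (auto simp: l B.r_add C.r_add B.r_scale C.r_scale conv_lin)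
  qed
  moreover have "cv.subspace {p. G1 i p = 0}" by (rule cvp.linear_subspace_kernel[OF clinear_G1])
  ultimately have "cv.span (tensor_relations (MB t1 s1) (MC t2 s2)) \<subseteq> {p. G1 i p = 0}" by (rule cv.span_minimal)
  then show "p \<in> Rt i \<Longrightarrow> G1 i p = 0" by (auto simp: Rt_def i)
qed

lemma \<gamma>_linear:
  assumes "x \<in> WB t1 s1" "y \<in> WC t2 s2"
  shows "x' \<in> WB t1 s1 \<Longrightarrow> \<gamma> i t1 s1 t2 s2 (x + x') y - \<gamma> i t1 s1 t2 s2 x y - \<gamma> i t1 s1 t2 s2 x' y \<in> Rt i" (is "_ \<Longrightarrow> ?A")
    and "y' \<in> WC t2 s2 \<Longrightarrow> \<gamma> i t1 s1 t2 s2 x (y + y') - \<gamma> i t1 s1 t2 s2 x y - \<gamma> i t1 s1 t2 s2 x y' \<in> Rt i" (is "_ \<Longrightarrow> ?B")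
    and "\<gamma> i t1 s1 t2 s2 (c *\<^sub>C x) y - c *\<^sub>C \<gamma> i t1 s1 t2 s2 x y \<in> Rt i" (is ?C)
    and "\<gamma> i t1 s1 t2 s2 x (c *\<^sub>C y) - c *\<^sub>C \<gamma> i t1 s1 t2 s2 x y \<in> Rt i" (is ?D)
proof -
  have zero: "(0 :: 'x \<times> 'y \<Rightarrow>\<^sub>0 complex) \<in> Rt i" by (rule cv.subspace_0[OF subspace_Rt])
  note fB = B.fp_carrier[OF assms(1)] and fC = C.fp_carrier[OF assms(2)]
  have rel: "p \<in> Rt i" if "(t1, t2, s1, s2) = i" "p \<in> tensor_relations (MB t1 s1) (MC t2 s2)" for p
    unfolding that(1)[symmetric] Rt_def using cv.span_base[OF that(2)] by simp
  show ?A if x': "x' \<in> WB t1 s1"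
  proof (cases "(t1, t2, s1, s2) = i")
    case True
    show ?thesis unfolding \<gamma>_def if_P[OF True] B.fp_add[OF assms(1) x']
      by (rule rel[OF True]) (use fB fC B.fp_carrier[OF x'] in \<open>unfold tensor_relations_def, blast\<close>)
  qed (simp add: \<gamma>_def zero)
  show ?B if y': "y' \<in> WC t2 s2"
  proof (cases "(t1, t2, s1, s2) = i")
    case True
    show ?thesis unfolding \<gamma>_def if_P[OF True] C.fp_add[OF assms(2) y']
      by (rule rel[OF True]) (use fB fC C.fp_carrier[OF y'] in \<open>unfold tensor_relations_def, blast\<close>)
  qed (simp add: \<gamma>_def zero)
  show ?C
  proof (cases "(t1, t2, s1, s2) = i")
    case True
    show ?thesis unfolding \<gamma>_def if_P[OF True] B.fp_scale[OF assms(1)] single_eq_cscale_gen[of _ c, symmetric]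
      by (rule rel[OF True]) (use fB fC in \<open>unfold tensor_relations_def, blast\<close>)
  qed (simp add: \<gamma>_def zero)
  show ?D
  proof (cases "(t1, t2, s1, s2) = i")
    case True
    show ?thesis unfolding \<gamma>_def if_P[OF True] C.fp_scale[OF assms(2)] single_eq_cscale_gen[of _ c, symmetric]
      by (rule rel[OF True]) (use fB fC in \<open>unfold tensor_relations_def, blast\<close>)
  qed (simp add: \<gamma>_def zero)
qed

lemma Lam_\<gamma>: "x \<in> WB t1 s1 \<Longrightarrow> y \<in> WC t2 s2 \<Longrightarrow> Lm (\<gamma> i) (x \<star> y) - \<gamma> i t1 s1 t2 s2 x y \<in> Rt i"
  by (rule Lam_conv_mod[OF subspace_Rt]) (rule \<gamma>_linear | assumption)+

lemma Lam_\<gamma>_in: "x \<in> WB t1 s1 \<Longrightarrow> y \<in> WC t2 s2 \<Longrightarrow> \<gamma> i t1 s1 t2 s2 x y \<in> Rt i \<Longrightarrow> Lm (\<gamma> i) (x \<star> y) \<in> Rt i"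
proof -
  assume *: "x \<in> WB t1 s1" "y \<in> WC t2 s2" "\<gamma> i t1 s1 t2 s2 x y \<in> Rt i"
  have "(Lm (\<gamma> i) (x \<star> y) - \<gamma> i t1 s1 t2 s2 x y) + \<gamma> i t1 s1 t2 s2 x y \<in> Rt i"
    by (rule cv.subspace_add[OF subspace_Rt Lam_\<gamma>[OF *(1,2)] *(3)])
  then show ?thesis by simp
qed

lemma \<gamma>_zero_left: "y \<in> WC t2 s2 \<Longrightarrow> \<gamma> i t1 s1 t2 s2 0 y \<in> Rt i"
  using \<gamma>_linear(3)[OF normal_closed(1), of y t2 s2 i t1 s1 0] by simp

lemma \<gamma>_zero_right: "x \<in> WB t1 s1 \<Longrightarrow> \<gamma> i t1 s1 t2 s2 x 0 \<in> Rt i"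
  using \<gamma>_linear(4)[OF _ normal_closed(1), of x t1 s1 i t2 s2 0] by simp

text \<open>A boundary is a sum of products in which one factor is a boundary, and \<open>pB\<close>
  and \<open>pC\<close> kill boundaries.\<close>

lemma Lam_\<gamma>_dD:
  assumes "w \<in> WD t s" shows "Lm (\<gamma> i) (dD w) \<in> Rt i"
proof -
  have "w \<in> {w. Lm (\<gamma> i) (dD w) \<in> Rt i}"
  proof (rule WD_induct[OF _ _ assms])
    show "cv.subspace {w. Lm (\<gamma> i) (dD w) \<in> Rt i}"
      using cvp.linear_subspace_vimage[OF clinear_comp[OF clinear_Lam clinear_dl] subspace_Rt] by (simp add: vimage_def)
  next
    fix S1 S2 :: "int set" and m1 m2 :: "'v \<Rightarrow>\<^sub>0 nat"
    let ?t1 = "int (card S1)" and ?t2 = "int (card S2)" and ?s1 = "int (mdeg m1)" and ?s2 = "int (mdeg m2)"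
    let ?x = "bs S1 m1" and ?y = "bs S2 m2"
    assume x: "?x \<in> WB ?t1 ?s1" and y: "?y \<in> WC ?t2 ?s2"
    have "\<gamma> i (?t1 - 1) (?s1 + 1) ?t2 ?s2 (dB ?x) ?y = \<gamma> i (?t1 - 1) (?s1 + 1) ?t2 ?s2 0 ?y"
      unfolding \<gamma>_def pB_dB[OF x] clinear_zero[OF B.p_lin] ..
    then have 1: "Lm (\<gamma> i) (dB ?x \<star> ?y) \<in> Rt i"
      using \<gamma>_zero_left[OF y] by (intro Lam_\<gamma>_in[OF dB_normal[OF x] y]) simp
    have "\<gamma> i ?t1 ?s1 (?t2 - 1) (?s2 + 1) ?x (dC ?y) = \<gamma> i ?t1 ?s1 (?t2 - 1) (?s2 + 1) ?x 0"
      unfolding \<gamma>_def pC_dC[OF y] clinear_zero[OF C.p_lin] ..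
    then have 2: "Lm (\<gamma> i) (?x \<star> dC ?y) \<in> Rt i"
      using \<gamma>_zero_right[OF x] by (intro Lam_\<gamma>_in[OF x dC_normal[OF y]]) simp
    show "?x \<star> ?y \<in> {w. Lm (\<gamma> i) (dD w) \<in> Rt i}"
      unfolding mem_Collect_eq dl_conv[OF x y] clinear_add[OF clinear_Lam] clinear_scale[OF clinear_Lam]
      by (rule cv.subspace_add[OF subspace_Rt 1 cv.subspace_scale[OF subspace_Rt 2]])
  qed
  then show ?thesis by simp
qed

text \<open>A member of \<open>NC\<close> is a product whose first factor has both degrees 0, and
  this index does not belong to \<open>Ix\<close>.\<close>

lemma Lam_\<gamma>_NC:
  assumes "n \<in> NC t s" "i \<in> Ix t s" shows "Lm (\<gamma> i) n \<in> Rt i"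
proof -
  have n: "n \<in> WC t s" using assms(1) by (simp add: NC_def)
  have "\<gamma> i 0 0 t s (bs {} 0) n = 0" using assms(2) by (auto simp: \<gamma>_def Ix_def)
  then have "Lm (\<gamma> i) (bs {} 0 \<star> n) \<in> Rt i"
    by (intro Lam_\<gamma>_in[OF unit_normal n]) (simp only: cv.subspace_0[OF subspace_Rt])
  then show ?thesis by (simp only: unit_conv[OF n])
qed

lemma G1_normal:
  assumes "p \<in> Zt i" "i \<in> Iplus t s" shows "G1 i p \<in> WD t s" "dD (G1 i p) = 0"
proof -
  obtain t1 t2 s1 s2 where i: "i = (t1, t2, s1, s2)" by (cases i)
  have "G1 i p \<in> {c \<in> WD t s. dD c = 0}"
    unfolding i G1_def prod.case
  proof (rule lin_in_subspace)
    show "cv.subspace {c \<in> WD t s. dD c = 0}"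
      using subspace_normal_chains[of "J1 @ J2" bD t s] unfolding cv.subspace_def by (simp add: dl_lin)
    fix k assume "k \<in> keys p"
    then obtain a b where k: "k = (a, b)" "a \<in> carrier (MB t1 s1)" "b \<in> carrier (MC t2 s2)"
      using assms(1) by (auto simp: Zt_def i)
    have "B.r t1 s1 a \<star> C.r t2 s2 b \<in> WD (t1 + t2) (s1 + s2)" by (rule conv_normal[OF B.r_normal[OF k(2)] C.r_normal[OF k(3)]])
    moreover have "dD (B.r t1 s1 a \<star> C.r t2 s2 b) = 0"
      by (simp add: dl_conv[OF B.r_normal[OF k(2)] C.r_normal[OF k(3)]] B.dl_r[OF k(2)] C.dl_r[OF k(3)] conv_lin)
    ultimately show "(case k of (a, b) \<Rightarrow> B.r t1 s1 a \<star> C.r t2 s2 b) \<in> {c \<in> WD t s. dD c = 0}"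
      using assms(2) by (simp add: k(1) i Iplus_def)
  qed
  then show "G1 i p \<in> WD t s" "dD (G1 i p) = 0" by simp_all
qed

lemma Lam_\<gamma>_G1:
  assumes "p \<in> Zt j" shows "Lm (\<gamma> i) (G1 j p) - (if i = j then p else 0) \<in> Rt i"
proof -
  obtain t1 t2 s1 s2 where j: "j = (t1, t2, s1, s2)" by (cases j)
  have "p \<in> {p. Lm (\<gamma> i) (G1 j p) - (if i = j then p else 0) \<in> Rt i}"
  proof (rule in_subspace_gen)
    have l: "clinear (\<lambda>p. Lm (\<gamma> i) (G1 j p) - (if i = j then p else 0))"
      by (rule clinearI) (simp_all add: clinear_add[OF clinear_Lam] clinear_scale[OF clinear_Lam] clinear_add[OF clinear_G1]
        clinear_scale[OF clinear_G1] cv.scale_right_diff_distrib)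
    show "cv.subspace {p. Lm (\<gamma> i) (G1 j p) - (if i = j then p else 0) \<in> Rt i}"
      using cvp.linear_subspace_vimage[OF l subspace_Rt] by (simp add: vimage_def)
  next
    fix k assume "k \<in> keys p"
    then obtain a b where k: "k = (a, b)" "a \<in> carrier (MB t1 s1)" "b \<in> carrier (MC t2 s2)"
      using assms by (auto simp: Zt_def j)
    have G1k: "G1 j (gen k) = B.r t1 s1 a \<star> C.r t2 s2 b" by (simp add: G1_def j k(1))
    have "\<gamma> i t1 s1 t2 s2 (B.r t1 s1 a) (C.r t2 s2 b) = (if i = j then gen k else 0)"
      unfolding \<gamma>_def B.p_r[OF k(2)] C.p_r[OF k(3)] B.f_r[OF k(2)] C.f_r[OF k(3)] by (auto simp: j k(1))
    then show "gen k \<in> {p. Lm (\<gamma> i) (G1 j p) - (if i = j then p else 0) \<in> Rt i}"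
      using Lam_\<gamma>[OF B.r_normal[OF k(2)] C.r_normal[OF k(3)], of i] by (simp only: G1k mem_Collect_eq)
  qed
  then show ?thesis by simp
qed


lemma mdeg_eq_0: "mdeg m = 0 \<Longrightarrow> m = 0"
  by (auto simp: mdeg_def in_keys_iff intro: poly_mapping_eqI)

lemma WB_00: "x \<in> WB 0 0 \<Longrightarrow> \<exists>c. x = c *\<^sub>C bs {} 0"
proof -
  assume x: "x \<in> WB 0 0"
  have "x \<in> range (\<lambda>c :: complex. c *\<^sub>C bs {} 0)"
  proof (rule normal_chains_induct[OF _ _ x])
    have "clinear (\<lambda>c :: complex. c *\<^sub>C (bs {} 0 :: 'v chain))"
      by (rule clinearI) (simp_all add: cv.scale_left_distrib cscale_complex_def)
    then show "cv.subspace (range (\<lambda>c :: complex. c *\<^sub>C (bs {} 0 :: 'v chain)))"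
      by (rule cvp.linear_subspace_image[OF _ cv.subspace_UNIV])
    fix S and m :: "'v \<Rightarrow>\<^sub>0 nat" assume S: "S \<subseteq> set J1" "int (card S) = 0" "int (mdeg m) = 0"
    have "finite S" using S(1) by (rule finite_subset) simp
    then have "S = {}" "m = 0" using S mdeg_eq_0[of m] by auto
    then show "bs S m \<in> range (\<lambda>c :: complex. c *\<^sub>C bs {} 0)" by (auto intro!: image_eqI[of _ _ 1])
  qed
  then show ?thesis by blast
qed

text \<open>Inverse of \<open>G\<close> modulo relations and \<open>BN\<close>; the cut-off to
  \<open>Iplus\<close> makes the family finite.\<close>

definition U :: "int \<Rightarrow> int \<Rightarrow> ('v chain) \<Rightarrow> int \<times> int \<times> int \<times> int \<Rightarrow> 'x \<times> 'y \<Rightarrow>\<^sub>0 complex" where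
  "U t s c = (\<lambda>i. if i \<in> Iplus t s then Lm (\<gamma> i) c else 0)"

lemma clinear_U: "clinear (U t s)"
  by (rule clinearI) (auto simp: U_def fun_eq_iff clinear_add[OF clinear_Lam] clinear_scale[OF clinear_Lam])

lemma Lam_\<gamma>_Zt:
  assumes "c \<in> WD t s" shows "Lm (\<gamma> i) c \<in> Zt i"
proof -
  have "c \<in> {c. Lm (\<gamma> i) c \<in> Zt i}"
  proof (rule WD_induct[OF _ _ assms])
    show "cv.subspace {c. Lm (\<gamma> i) c \<in> Zt i}"
      using cvp.linear_subspace_vimage[OF clinear_Lam subspace_Zt] by (simp add: vimage_def)
  next
    fix S1 S2 :: "int set" and m1 m2 :: "'v \<Rightarrow>\<^sub>0 nat"
    assume *: "S1 \<subseteq> set J1" "S2 \<subseteq> set J2" "keys m1 \<subseteq> A" "keys m2 \<inter> A = {}"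
      and x: "bs S1 m1 \<in> WB (int (card S1)) (int (mdeg m1))" and y: "bs S2 m2 \<in> WC (int (card S2)) (int (mdeg m2))"
    show "bs S1 m1 \<star> bs S2 m2 \<in> {c. Lm (\<gamma> i) c \<in> Zt i}"
      unfolding mem_Collect_eq Lam_conv_bs[OF *] \<gamma>_def
      using B.fp_carrier[OF x] C.fp_carrier[OF y] cv.subspace_0[OF subspace_Zt, of i] by (auto simp: Zt_def)
  qed
  then show ?thesis by simp
qed

lemma U_dsum: "c \<in> WD t s \<Longrightarrow> U t s c \<in> dsum (Ix t s) Zt"
proof -
  assume c: "c \<in> WD t s"
  have "{i. U t s c i \<noteq> 0} \<subseteq> Iplus t s" by (auto simp: U_def)
  then have "finite {i. U t s c i \<noteq> 0}" using finite_Iplus by (rule finite_subset)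
  then show ?thesis using Lam_\<gamma>_Zt[OF c] cv.subspace_0[OF subspace_Zt] subsetD[OF Iplus_Ix[of t s]] by (fastforce simp: dsum_def U_def)
qed

text \<open>\<open>G\<close> after \<open>U\<close> reproduces all of \<open>Pc\<close> except for
  the degree \<open>t1 = s1 = 0\<close>. There the first factor is a multiple of 1, so the product
  falls into \<open>NC\<close>.\<close>

lemma Pc_G_U:
  assumes "c \<in> WD t s" shows "Pc c - G t s (U t s c) \<in> NC t s"
proof -
  have "c \<in> {c. Pc c - G t s (U t s c) \<in> NC t s}"
  proof (rule WD_induct[OF _ _ assms])
    have "clinear (\<lambda>c. Pc c - G t s (U t s c))"
      by (rule clinearI) (simp_all add: clinear_add[OF clinear_Pc] clinear_scale[OF clinear_Pc] clinear_add[OF clinear_G]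
          clinear_scale[OF clinear_G] clinear_add[OF clinear_U] clinear_scale[OF clinear_U] cv.scale_right_diff_distrib)
    then show "cv.subspace {c. Pc c - G t s (U t s c) \<in> NC t s}"
      using cvp.linear_subspace_vimage[OF _ subspace_NC] by (simp add: vimage_def)
  next
    fix S1 S2 :: "int set" and m1 m2 :: "'v \<Rightarrow>\<^sub>0 nat"
    let ?t1 = "int (card S1)" and ?t2 = "int (card S2)" and ?s1 = "int (mdeg m1)" and ?s2 = "int (mdeg m2)"
    let ?x = "bs S1 m1" and ?y = "bs S2 m2"
    let ?px = "pB ?t1 ?s1 ?x" and ?py = "pC ?t2 ?s2 ?y"
    let ?i = "(?t1, ?t2, ?s1, ?s2)"
    assume *: "S1 \<subseteq> set J1" "S2 \<subseteq> set J2" "keys m1 \<subseteq> A" "keys m2 \<inter> A = {}"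
      and ts: "?t1 + ?t2 = t" "?s1 + ?s2 = s" and x: "?x \<in> WB ?t1 ?s1" and y: "?y \<in> WC ?t2 ?s2"
    have g: "G1 i (U t s (?x \<star> ?y) i) = (if i = ?i then ?px \<star> ?py else 0)" if "i \<in> Iplus t s" for i
    proof -
      have "U t s (?x \<star> ?y) i = \<gamma> i ?t1 ?s1 ?t2 ?s2 ?x ?y" using that by (simp add: U_def Lam_conv_bs[OF *])
      moreover have "G1 ?i (gen (fB ?t1 ?s1 ?px, fC ?t2 ?s2 ?py)) = ?px \<star> ?py"
        by (simp add: G1_def B.r_fp[OF x] C.r_fp[OF y])
      ultimately show ?thesis by (auto simp: \<gamma>_def clinear_zero[OF clinear_G1])
    qed
    have G: "G t s (U t s (?x \<star> ?y)) = (if ?i \<in> Iplus t s then ?px \<star> ?py else 0)"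
      unfolding G_def using finite_Iplus by (simp add: g sum.delta cong: sum.cong)
    show "?x \<star> ?y \<in> {c. Pc c - G t s (U t s c) \<in> NC t s}"
    proof (cases "?i \<in> Iplus t s")
      case True
      then show ?thesis using cv.subspace_0[OF subspace_NC] by (simp add: G Pc_conv[OF x y])
    next
      case False
      \<comment> \<open>Degrees of basis chains are natural numbers, so only the condition
        \<open>t1 + s1 > 0\<close> can fail.\<close>
      then have 0: "?t1 = 0" "?s1 = 0" using ts by (auto simp: Iplus_def)
      then have ts': "?t2 = t" "?s2 = s" using ts by auto
      have "?px \<in> WB 0 0" using B.p_normal[OF x] 0 by simp
      then obtain k where k: "?px = k *\<^sub>C bs {} 0" using WB_00 by blast
      have py: "?py \<in> WC t s" using C.p_normal[OF y] ts' by simp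
      have "?px \<star> ?py = k *\<^sub>C ?py" by (simp add: k conv_lin unit_conv[OF py])
      moreover have "?py \<in> NC t s" using py C.dl_p[OF y] by (simp add: NC_def)
      ultimately have "?px \<star> ?py \<in> NC t s" using cv.subspace_scale[OF subspace_NC] by simp
      then show ?thesis using False by (simp add: G Pc_conv[OF x y])
    qed
  qed
  then show ?thesis by simp
qed

lemma negative_Rt:
  assumes "i \<in> Ix t s" "i \<notin> Iplus t s" "p \<in> Zt i" shows "p \<in> Rt i"
proof -
  obtain t1 t2 s1 s2 where i: "i = (t1, t2, s1, s2)" by (cases i)
  have neg: "(t1 < 0 \<or> s1 < 0) \<or> (t2 < 0 \<or> s2 < 0)" using assms(1,2) by (auto simp: i Ix_def Iplus_def)
  show ?thesis
  proof (rule in_subspace_gen[OF subspace_Rt])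
    fix k assume "k \<in> keys p"
    then obtain a b where k: "k = (a, b)" "a \<in> carrier (MB t1 s1)" "b \<in> carrier (MC t2 s2)"
      using assms(3) by (auto simp: Zt_def i)
    have "gen (0 \<odot>\<^bsub>MB t1 s1\<^esub> a, b) - single (a, b) 0 \<in> tensor_relations (MB t1 s1) (MC t2 s2)"
      "gen (a, 0 \<odot>\<^bsub>MC t2 s2\<^esub> b) - single (a, b) 0 \<in> tensor_relations (MB t1 s1) (MC t2 s2)"
      unfolding tensor_relations_def using k(2,3) by blast+
    then have "gen (0 \<odot>\<^bsub>MB t1 s1\<^esub> a, b) \<in> Rt i" "gen (a, 0 \<odot>\<^bsub>MC t2 s2\<^esub> b) \<in> Rt i"
      using cv.span_base by (auto simp: Rt_def i)
    then show "gen k \<in> Rt i"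
      using neg B.negative_trivial[OF _ k(2)] C.negative_trivial[OF _ k(3)] by (auto simp: k(1))
  qed
qed

text \<open>Onto: the homotopy moves a cycle to its projection \<open>Pc\<close>, which
  \<open>Pc_G_U\<close> expresses through \<open>G\<close>. Injective: the components
  \<open>Lm (\<gamma> i)\<close> recover \<open>u\<close> from \<open>G t s u\<close> modulo
  relations and send boundaries and \<open>NC\<close> to relations.\<close>

theorem pres_E:
  obtains q where "pres (direct_sum (Ix t s) (\<lambda>(t1, t2, s1, s2). tensor (MB t1 s1) (MC t2 s2)))
    (Zc (J1 @ J2) L bD t s) (BN t s) q"
proof -
  let ?E = "direct_sum (Ix t s) (\<lambda>(t1, t2, s1, s2). tensor (MB t1 s1) (MC t2 s2))"
  let ?Z = "Zc (J1 @ J2) L bD t s"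
  let ?q = "\<lambda>(t1, t2, s1, s2) p. cv.span (tensor_relations (MB t1 s1) (MC t2 s2)) +>\<^bsub>free_space (carrier (MB t1 s1) \<times> carrier (MC t2 s2))\<^esub> p"
  have W: "pres ?E (dsum (Ix t s) Zt) (dsum (Ix t s) Rt) (\<lambda>u. \<lambda>i\<in>Ix t s. ?q i (u i))"
  proof (rule pres_direct_sum)
    fix i assume "i \<in> Ix t s"
    obtain t1 t2 s1 s2 where i: "i = (t1, t2, s1, s2)" by (cases i)
    show "pres (case i of (t1, t2, s1, s2) \<Rightarrow> tensor (MB t1 s1) (MC t2 s2)) (Zt i) (Rt i) (?q i)"
      unfolding i Zt_def Rt_def prod.case by (rule pres_tensor[OF B.M C.M])
  qed
  have Bd_Zc: "Bd (J1 @ J2) L bD t s \<subseteq> ?Z" by (rule Bd_subset_Zc[OF dist upD L1])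
  have BNZ: "BN t s \<subseteq> ?Z"
    unfolding BN_def using Bd_Zc NC_Zc Zc_closed(2) by blast
  have GZ: "G t s u \<in> WD t s \<and> dD (G t s u) = 0" if u: "u \<in> dsum (Ix t s) Zt" for u
  proof -
    have "u i \<in> Zt i" if "i \<in> Iplus t s" for i using u that Iplus_Ix[of t s] by (auto simp: dsum_def)
    then have g: "G1 i (u i) \<in> WD t s" "dD (G1 i (u i)) = 0" if "i \<in> Iplus t s" for i using G1_normal that by auto
    have "G t s u \<in> WD t s" unfolding G_def by (rule cv.subspace_sum[OF subspace_normal_chains g(1)])
    moreover have "dD (G t s u) = 0" unfolding G_def clinear_sum[OF clinear_dl] by (rule sum.neutral) (simp add: g(2))
    ultimately show ?thesis by simp
  qed
  show thesis
  proof (rule pres_pushforward[OF W subspace_Zc subspace_BN BNZ clinear_G, where ?t1 = t and ?s1 = s])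
    show "G t s u \<in> ?Z" if "u \<in> dsum (Ix t s) Zt" for u
      using GZ[OF that] normal_cycle by blast
  next
    fix c assume c: "c \<in> ?Z"
    define c' where "c' = nf bD c"
    have c': "c' \<in> WD t s" unfolding c'_def by (rule trc_normal[OF ZcD(1)[OF c]])
    have dc': "dD c' = 0" unfolding c'_def by (rule trc_Zc[OF upD c])
    have "c' - Pc c' = dD (Hc c')" using homotopy_WD[OF c'] by (simp add: dc' clinear_zero[OF clinear_Hc])
    also have "\<dots> \<in> Bd (J1 @ J2) L bD t s" by (rule dl_Bd[OF L1 normal_Ch[OF Hc_normal[OF c']]])
    finally have 1: "c' - Pc c' \<in> BN t s" by (rule Bd_BN)
    have "c - c' \<in> Bd (J1 @ J2) L bD t s"
      unfolding c'_def by (rule IC_subset_Bd[OF Ch_closed(3)[OF ZcD(1)[OF c] trc_Ch[OF ZcD(1)[OF c]]] diff_trc_IC])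
    then have 2: "c - c' \<in> BN t s" by (rule Bd_BN)
    have 3: "Pc c' - G t s (U t s c') \<in> BN t s" by (rule NC_BN[OF Pc_G_U[OF c']])
    have "- ((Pc c' - G t s (U t s c')) + ((c' - Pc c') + (c - c'))) \<in> BN t s"
      by (intro cv.subspace_neg[OF subspace_BN] cv.subspace_add[OF subspace_BN] 1 2 3)
    then have "G t s (U t s c') - c \<in> BN t s" by simp
    then show "\<exists>u\<in>dsum (Ix t s) Zt. G t s u - c \<in> BN t s" using U_dsum[OF c'] by blast
  next
    fix u assume u: "u \<in> dsum (Ix t s) Zt"
    have uZ: "u i \<in> Zt i" if "i \<in> Ix t s" for i using u that by (simp add: dsum_def)
    show "G t s u \<in> BN t s \<longleftrightarrow> u \<in> dsum (Ix t s) Rt"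
    proof
      assume "u \<in> dsum (Ix t s) Rt"
      then have "G1 i (u i) = 0" if "i \<in> Iplus t s" for i using that Iplus_Ix[of t s] by (intro G1_Rt) (auto simp: dsum_def)
      then have "G t s u = 0" unfolding G_def by (rule sum.neutral[rule_format])
      then show "G t s u \<in> BN t s" by (simp add: cv.subspace_0[OF subspace_BN])
    next
      assume "G t s u \<in> BN t s"
      then obtain b n where bn: "G t s u = b + n" "b \<in> Bd (J1 @ J2) L bD t s" "n \<in> NC t s" unfolding BN_def by blast
      obtain b1 i1 where b: "b = dK (J1 @ J2) L b1 + i1" "b1 \<in> Ch (J1 @ J2) (t + 1) (s - 1)" "i1 \<in> IC bD"
        using bn(2) by (rule BdE)
      define w where "w = nf bD b1"
      have w: "w \<in> WD (t + 1) (s - 1)" unfolding w_def by (rule trc_normal[OF b(2)])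
      have "nf bD b = dD b1" by (simp add: b(1) trc_lin trc_IC[OF b(3)] dl_def)
      also have "\<dots> = dD w" unfolding w_def by (rule dl_trc[OF upD, symmetric])
      finally have "nf bD (G t s u) = dD w + n"
        by (simp add: bn(1) trc_lin trc_fix[OF NC_normal[OF bn(3)]])
      then have Gw: "G t s u = dD w + n" using GZ[OF u] trc_fix[of "G t s u" "J1 @ J2" bD t s] by simp
      have "u i \<in> Rt i" if i: "i \<in> Ix t s" for i
      proof (cases "i \<in> Iplus t s")
        case True
        have 1: "Lm (\<gamma> i) (G t s u) \<in> Rt i"
          unfolding Gw clinear_add[OF clinear_Lam]
          by (rule cv.subspace_add[OF subspace_Rt Lam_\<gamma>_dD[OF w] Lam_\<gamma>_NC[OF bn(3) i]])
        have "Lm (\<gamma> i) (G t s u) - u i = (\<Sum>j\<in>Iplus t s. Lm (\<gamma> i) (G1 j (u j)) - (if i = j then u j else 0))"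
          unfolding G_def clinear_sum[OF clinear_Lam] sum_subtractf using finite_Iplus True by simp
        also have "\<dots> \<in> Rt i"
          using uZ Iplus_Ix[of t s] by (intro cv.subspace_sum[OF subspace_Rt] Lam_\<gamma>_G1) auto
        finally have 2: "Lm (\<gamma> i) (G t s u) - u i \<in> Rt i" .
        have "Lm (\<gamma> i) (G t s u) - (Lm (\<gamma> i) (G t s u) - u i) \<in> Rt i" by (rule cv.subspace_diff[OF subspace_Rt 1 2])
        then show ?thesis by simp
      next
        case False
        show ?thesis by (rule negative_Rt[OF i False uZ[OF i]])
      qed
      then show "u \<in> dsum (Ix t s) Rt" using u by (simp add: dsum_def)
    qed
  next
    fix q assume "pres ?E ?Z (BN t s) q"
    then show thesis by (rule that)
  qed
qed

end

section \<open>Adding one flat to an order filter\<close>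

definition EL :: "(sr_var \<Rightarrow>\<^sub>0 nat) \<Rightarrow> int set" where "EL m = {i. Elt i \<in> keys m}"
definition FL :: "(sr_var \<Rightarrow>\<^sub>0 nat) \<Rightarrow> int set set" where "FL m = {F. Flat F \<in> keys m}"

text \<open>Face conditions are stated for the set of elements and the set of flats that occur in a
  monomial; multiplicities are ignored.\<close>

definition bd :: "(int set \<Rightarrow> int set set \<Rightarrow> bool) \<Rightarrow> (sr_var \<Rightarrow>\<^sub>0 nat) \<Rightarrow> bool" where
  "bd g m \<longleftrightarrow> \<not> g (EL m) (FL m)"

definition antitone :: "(int set \<Rightarrow> int set set \<Rightarrow> bool) \<Rightarrow> bool" where
  "antitone g \<longleftrightarrow> (\<forall>I \<F> I' \<F>'. g I \<F> \<longrightarrow> I' \<subseteq> I \<longrightarrow> \<F>' \<subseteq> \<F> \<longrightarrow> g I' \<F>')"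

lemma antitoneD: "antitone g \<Longrightarrow> g I \<F> \<Longrightarrow> I' \<subseteq> I \<Longrightarrow> \<F>' \<subseteq> \<F> \<Longrightarrow> g I' \<F>'"
  unfolding antitone_def by blast

lemma EL_FL_simps [simp]:
  "EL (m + n) = EL m \<union> EL n" "FL (m + n) = FL m \<union> FL n" "EL 0 = {}" "FL 0 = {}"
  "EL (single (Elt i) (Suc 0)) = {i}" "FL (single (Elt i) (Suc 0)) = {}"
  "EL (single (Flat F) (Suc 0)) = {}" "FL (single (Flat F) (Suc 0)) = {F}"
  by (auto simp: EL_def FL_def keys_plus_nat)

lemma upward_bd: "antitone g \<Longrightarrow> upward (bd g)"
  unfolding upward_def bd_def using antitoneD[of g] by (auto simp: subset_iff)

lemma Var_Elt_bd: "Var (Elt i) \<in> mono_ideal (bd g) \<longleftrightarrow> \<not> g {i} {}" and Var_Flat_bd: "Var (Flat F) \<in> mono_ideal (bd g) \<longleftrightarrow> \<not> g {} {F}"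
  by (simp_all add: mono_ideal_def keys_Var bd_def)

lemma chain_anti: "subset.chain P \<F> \<Longrightarrow> \<F>' \<subseteq> \<F> \<Longrightarrow> subset.chain P \<F>'"
  unfolding subset_chain_def by blast

lemma chain_mono: "subset.chain P \<F> \<Longrightarrow> P \<subseteq> P' \<Longrightarrow> subset.chain P' \<F>"
  unfolding subset_chain_def by blast

text \<open>By \<open>mono\<close> the closure condition on the whole set of elements implies that
  each single element is a variable of the ring.\<close>

lemma sr_face_iff:
  assumes mono: "\<And>i I. i \<in> I \<Longrightarrow> I \<subseteq> ground N \<Longrightarrow> cl N {i} \<in> P \<union> {ground N} \<Longrightarrow> cl N I \<in> P \<union> {ground N}"
  shows "sr_face N P \<sigma> \<longleftrightarrow> {i. Elt i \<in> \<sigma>} \<subseteq> ground N \<and> subset.chain P {F. Flat F \<in> \<sigma>} \<and>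
    (\<forall>F\<in>{F. Flat F \<in> \<sigma>}. {i. Elt i \<in> \<sigma>} \<subseteq> F) \<and> cl N {i. Elt i \<in> \<sigma>} \<notin> P \<union> {ground N}" (is "_ \<longleftrightarrow> ?R")
proof
  assume "sr_face N P \<sigma>"
  then obtain I \<F> where *: "\<sigma> \<subseteq> sr_vars N P" "\<sigma> = Elt ` I \<union> Flat ` \<F>" "subset.chain P \<F>" "\<forall>F\<in>\<F>. I \<subseteq> F" "cl N I \<notin> P \<union> {ground N}"
    unfolding sr_face_def by blast
  have "{i. Elt i \<in> \<sigma>} = I" "{F. Flat F \<in> \<sigma>} = \<F>" using *(2) by auto
  moreover have "I \<subseteq> ground N" using *(1,2) by (auto simp: sr_vars_def)
  ultimately show ?R using *(3-5) by simp
next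
  assume R: ?R
  let ?I = "{i. Elt i \<in> \<sigma>}" and ?F = "{F. Flat F \<in> \<sigma>}"
  have s: "\<sigma> = Elt ` ?I \<union> Flat ` ?F"
  proof (intro equalityI subsetI)
    fix v assume "v \<in> \<sigma>" then show "v \<in> Elt ` ?I \<union> Flat ` ?F" by (cases v) auto
  qed auto
  have "v \<in> sr_vars N P" if "v \<in> \<sigma>" for v
  proof (cases v)
    case (Elt i)
    then have "i \<in> ?I" using that by simp
    then have "cl N {i} \<notin> P \<union> {ground N}" "i \<in> ground N" using R mono[of i ?I] by blast+
    then show ?thesis by (simp add: sr_vars_def Elt)
  next
    case (Flat F)
    then show ?thesis using R that by (auto simp: sr_vars_def subset_chain_def)
  qed
  then have "\<sigma> \<subseteq> sr_vars N P" by blast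
  then show "sr_face N P \<sigma>" unfolding sr_face_def using s R by blast
qed

lemma free_of_closed: "free_of y a \<Longrightarrow> free_of y b \<Longrightarrow> free_of y (a + b)" "free_of y a \<Longrightarrow> free_of y b \<Longrightarrow> free_of y (a - b)"
    "free_of y a \<Longrightarrow> free_of y (- a)" "(\<And>i. i \<in> I \<Longrightarrow> free_of y (f i)) \<Longrightarrow> free_of y (sum f I)"
proof -
  have *: "free_of y p \<longleftrightarrow> p \<in> mono_ideal (\<lambda>m. y \<notin> keys m)" for p :: "'a cpoly"
    by (auto simp: free_of_def mono_ideal_def)
  show "free_of y a \<Longrightarrow> free_of y b \<Longrightarrow> free_of y (a + b)" "free_of y a \<Longrightarrow> free_of y b \<Longrightarrow> free_of y (a - b)"
    "free_of y a \<Longrightarrow> free_of y (- a)" "(\<And>i. i \<in> I \<Longrightarrow> free_of y (f i)) \<Longrightarrow> free_of y (sum f I)"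
    unfolding * by (rule mono_ideal_closed; assumption)+
qed

lemma free_of_Var: "v \<noteq> y \<Longrightarrow> free_of y (Var v)"
  by (simp add: free_of_def keys_Var)

text \<open>\<open>f0\<close> is the reference element for the Koszul variables of \<open>M\<close>
  and of the contraction, \<open>e0\<close> the one for the restriction.\<close>

locale one_flat = matroid_loc M for M +
  fixes Pm Pp :: "int set set" and Z :: "int set" and e0 f0 :: int
  assumes loopless: "loopless M" and Pm: "order_filter M Pm" and Pp: "order_filter M Pp"
    and sub: "Pm \<subseteq> Pp" and diff: "Pp - Pm = {Z}" and e0: "e0 \<in> Z" and f0: "f0 \<in> E - Z"
begin

text \<open>These flats correspond to the proper flats of the contraction
  (\<open>PC_iff\<close>).\<close>

definition "PZ = {F \<in> proper_flats M. Z \<subset> F}"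

text \<open>Faces, as conditions on the elements \<open>I\<close> and the flats \<open>\<F>\<close> occurring in a monomial: \<open>gP\<close> for the two
  Stanley--Reisner rings, \<open>gW Z\<close> for \<open>Y\<^sub>-\<close>, \<open>gY\<close> for \<open>Y\<^sub>+\<close>, \<open>gB\<close> for the restriction, \<open>gW {}\<close> for the
  contraction (with \<open>F\<close> in place of \<open>F - Z\<close>), and \<open>gD\<close> for the tensor product of the last two.\<close>

definition "gP P I \<F> \<longleftrightarrow> I \<subseteq> E \<and> subset.chain P \<F> \<and> (\<forall>F\<in>\<F>. I \<subseteq> F) \<and> cl M I \<notin> P \<union> {E}"
definition "gW W I \<F> \<longleftrightarrow> I \<subseteq> W \<and> subset.chain PZ \<F>"
definition "gY I \<F> \<longleftrightarrow> I \<subseteq> Z \<and> cl M I \<noteq> Z \<and> subset.chain PZ (\<F> - {Z})"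
definition "gD I \<F> \<longleftrightarrow> I \<subseteq> Z \<and> cl M I \<noteq> Z \<and> subset.chain PZ \<F>"
definition "gB I \<F> \<longleftrightarrow> I \<subseteq> Z \<and> cl M I \<noteq> Z \<and> \<F> = ({} :: int set set)"

definition sF :: "int set set \<Rightarrow> int \<Rightarrow> sr_var cpoly" where
  "sF P e = (\<Sum>F | F \<in> P \<and> e \<in> F. Var (Flat F))"
definition opr :: "int set set \<Rightarrow> int \<Rightarrow> sr_var cpoly" where
  "opr P i = (Var (Elt i) + sF P i) - (Var (Elt f0) + sF P f0)"
text \<open>A flat strictly above \<open>Z\<close> contains all of \<open>Z\<close>; so these flats
  contribute the same form to the difference of \<open>i\<close> and \<open>f0\<close> for every
  \<open>i\<close> in \<open>Z\<close>.\<close>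

definition wp :: "sr_var cpoly" where
  "wp = (\<Sum>F\<in>PZ. Var (Flat F)) - sF PZ f0"
text \<open>The Koszul forms of the tensor product: for elements of \<open>Z\<close> those of the
  restriction, relative to \<open>e0\<close>, and otherwise those of the contraction, relative to
  \<open>f0\<close>.\<close>

definition opD :: "int \<Rightarrow> sr_var cpoly" where
  "opD i = (if i \<in> Z then Var (Elt i) - Var (Elt e0) else sF PZ i - sF PZ f0)"
text \<open>The Koszul forms of Y_-, reduced modulo its non-faces.\<close>

definition opN :: "int \<Rightarrow> sr_var cpoly" where
  "opN i = (if i \<in> Z then Var (Elt i) + wp else sF PZ i - sF PZ f0)"

definition "js1 = sorted_list_of_set (Z - {e0})"
definition "js2 = sorted_list_of_set (E - Z - {f0})"
text \<open>\<open>e0\<close> comes first because its Koszul variable is spent on eliminating the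
  variable of the flat \<open>Z\<close>; the rest splits into the lists of the two factors.\<close>

abbreviation "js \<equiv> e0 # js1 @ js2"

lemma Z_facts: "Z \<in> Pp" "Z \<notin> Pm" "Z \<in> proper_flats M" "Z \<subseteq> E" "flat M Z" "Z \<noteq> {}" "Z \<noteq> E"
proof -
  show Z: "Z \<in> Pp" "Z \<notin> Pm" using diff by auto
  show "Z \<in> proper_flats M" using Z(1) Pp by (auto simp: order_filter_def)
  then show "Z \<subseteq> E" "flat M Z" "Z \<noteq> {}" "Z \<noteq> E" using proper_flatsD by auto
qed

lemma Pp_eq: "Pp = insert Z Pm"
  using diff sub Z_facts by auto

lemma filters: "Pm \<subseteq> proper_flats M" "Pp \<subseteq> proper_flats M"
  using Pm Pp by (auto simp: order_filter_def)

lemma PZ_facts: "PZ \<subseteq> Pm" "Z \<notin> PZ" "finite PZ" "F \<in> PZ \<Longrightarrow> Z \<subseteq> F" "F \<in> PZ \<Longrightarrow> F \<in> proper_flats M"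
proof -
  show "PZ \<subseteq> Pm"
  proof
    fix F assume "F \<in> PZ"
    then have "F \<in> proper_flats M" "Z \<subseteq> F" "F \<noteq> Z" by (auto simp: PZ_def)
    then have "F \<in> Pp" using Pp Z_facts(1) unfolding order_filter_def by blast
    then show "F \<in> Pm" using \<open>F \<noteq> Z\<close> Pp_eq by auto
  qed
  show "Z \<notin> PZ" "F \<in> PZ \<Longrightarrow> Z \<subseteq> F" "F \<in> PZ \<Longrightarrow> F \<in> proper_flats M" by (auto simp: PZ_def)
  show "finite PZ" by (rule finite_subset[OF _ finite_proper_flats]) (auto simp: PZ_def)
qed

text \<open>A flat of the smaller filter inside \<open>Z\<close> would force \<open>Z\<close> into
  that filter.\<close>

lemma Pm_PZ: "F \<in> Pm \<Longrightarrow> Z \<subseteq> F \<Longrightarrow> F \<in> PZ" and Pm_not: "F \<in> Pm \<Longrightarrow> \<not> F \<subseteq> Z"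
proof -
  show "F \<in> Pm \<Longrightarrow> Z \<subseteq> F \<Longrightarrow> F \<in> PZ" using filters Z_facts(2) by (auto simp: PZ_def)
  show "\<not> F \<subseteq> Z" if "F \<in> Pm"
  proof
    assume "F \<subseteq> Z"
    then have "Z \<in> Pm" using Pm that Z_facts(3) unfolding order_filter_def by blast
    then show False using Z_facts(2) by simp
  qed
qed

text \<open>This is where looplessness enters.\<close>

lemma cl_empty: "cl M {} = {}"
proof -
  have b: "basis_of {} {}" by (auto simp: basis_of_def indep_empty)
  show ?thesis unfolding cl_basis_of[OF b] using loopless by (auto simp: loopless_def)
qed

lemma cl_below: "I \<subseteq> Z \<Longrightarrow> cl M I \<subseteq> Z"
  using cl_subset_flat[OF _ Z_facts(5)] .

lemma cl_neq_anti: "I \<subseteq> Z \<Longrightarrow> cl M I \<noteq> Z \<Longrightarrow> I' \<subseteq> I \<Longrightarrow> cl M I' \<noteq> Z"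
  using cl_mono[of I' I] cl_below[of I] by auto

lemma antitone_gP: "order_filter M P \<Longrightarrow> antitone (gP P)"
  unfolding antitone_def
proof (intro allI impI)
  fix I \<F> I' \<F>' assume P: "order_filter M P" and g: "gP P I \<F>" and s: "I' \<subseteq> I" "\<F>' \<subseteq> \<F>"
  have "cl M I' \<notin> P \<union> {E}"
  proof (cases "I' = {}")
    case True
    have "{} \<notin> P" using P proper_flatsD(3) by (auto simp: order_filter_def)
    then show ?thesis using True Z_facts(4,6) by (auto simp: cl_empty)
  next
    case False
    then show ?thesis using cl_in_filter[OF P s(1) _ False] g by (auto simp: gP_def)
  qed
  moreover have "subset.chain P \<F>'" using g s(2) chain_anti by (auto simp: gP_def)
  ultimately show "gP P I' \<F>'" using g s unfolding gP_def by blast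
qed

lemma antitone_gW: "antitone (gW W)"
  unfolding antitone_def gW_def using chain_anti by blast

lemma antitone_gY: "antitone gY"
  unfolding antitone_def gY_def
proof (intro allI impI conjI; elim conjE)
  fix I \<F> I' and \<F>' :: "int set set"
  assume *: "I' \<subseteq> I" "\<F>' \<subseteq> \<F>" "I \<subseteq> Z" "cl M I \<noteq> Z" "subset.chain PZ (\<F> - {Z})"
  show "I' \<subseteq> Z" using * by blast
  show "cl M I' \<noteq> Z" by (rule cl_neq_anti[OF *(3,4,1)])
  show "subset.chain PZ (\<F>' - {Z})" by (rule chain_anti[OF *(5)]) (use * in blast)
qed

lemma antitone_gD: "antitone gD"
  unfolding antitone_def gD_def using chain_anti cl_neq_anti by blast

lemma antitone_gB: "antitone gB"
  unfolding antitone_def gB_def using cl_neq_anti by blast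

lemma up: "upward (bd (gP Pm))" "upward (bd (gP Pp))" "upward (bd (gW W))" "upward (bd gY)" "upward (bd gD)" "upward (bd gB)"
  using antitone_gP[OF Pm] antitone_gP[OF Pp] antitone_gW antitone_gY antitone_gD antitone_gB by (auto intro: upward_bd)

lemma gW_gP: "gW Z I \<F> \<Longrightarrow> gP Pm I \<F>"
proof -
  assume g: "gW Z I \<F>"
  then have I: "I \<subseteq> Z" and ch: "subset.chain PZ \<F>" by (auto simp: gW_def)
  have "I \<subseteq> F" if "F \<in> \<F>" for F using that I ch PZ_facts(4) by (auto simp: subset_chain_def)
  moreover have "cl M I \<notin> Pm \<union> {E}" using cl_below[OF I] Pm_not Z_facts(4,7) by auto
  moreover have "subset.chain Pm \<F>" by (rule chain_mono[OF ch PZ_facts(1)])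
  ultimately show ?thesis using I Z_facts(4) by (auto simp: gP_def)
qed

lemma gY_gP: "gY I \<F> \<Longrightarrow> gP Pp I \<F>"
proof -
  assume g: "gY I \<F>"
  then have I: "I \<subseteq> Z" "cl M I \<noteq> Z" and ch: "subset.chain PZ (\<F> - {Z})" by (auto simp: gY_def)
  have F: "F \<in> PZ \<or> F = Z" if "F \<in> \<F>" for F using that ch by (auto simp: subset_chain_def)
  then have "I \<subseteq> F" if "F \<in> \<F>" for F using that I PZ_facts(4) by blast
  moreover have "cl M I \<notin> Pp \<union> {E}" using cl_below[OF I(1)] I(2) Pm_not Z_facts(4,7) by (auto simp: Pp_eq)
  moreover have "subset.chain Pp \<F>"
    unfolding subset_chain_def
  proof (intro conjI ballI)
    show "\<F> \<subseteq> Pp" using F PZ_facts(1) Z_facts(1) sub by blast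
    fix F F' assume FF: "F \<in> \<F>" "F' \<in> \<F>"
    show "F \<subseteq> F' \<or> F' \<subseteq> F"
    proof (cases "F = Z \<or> F' = Z")
      case True then show ?thesis using F[OF FF(1)] F[OF FF(2)] PZ_facts(4) by blast
    next
      case False then show ?thesis using ch FF by (auto simp: subset_chain_def)
    qed
  qed
  ultimately show ?thesis using I Z_facts(4) by (auto simp: gP_def)
qed

text \<open>The faces through \<open>Z\<close>: all their other flats are comparable with
  \<open>Z\<close>, and none of the filter lies strictly below it.\<close>

lemma gP_with_Z: "gP Pp I \<F> \<Longrightarrow> Z \<in> \<F> \<Longrightarrow> I \<subseteq> Z \<and> cl M I \<noteq> Z \<and> subset.chain PZ (\<F> - {Z})"
proof -
  assume g: "gP Pp I \<F>" and Z: "Z \<in> \<F>"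
  have ch: "subset.chain Pp \<F>" using g by (simp add: gP_def)
  have "F \<in> PZ" if "F \<in> \<F> - {Z}" for F
  proof -
    have "F \<in> Pm" "F \<subseteq> Z \<or> Z \<subseteq> F" using that ch Z by (auto simp: subset_chain_def Pp_eq)
    then show ?thesis using Pm_PZ Pm_not by blast
  qed
  then have "subset.chain PZ (\<F> - {Z})" using ch unfolding subset_chain_def by blast
  moreover have "cl M I \<noteq> Z" using g Z_facts(1) by (auto simp: gP_def)
  ultimately show ?thesis using g Z by (auto simp: gP_def)
qed

text \<open>The faces that disappear in Y_- and Y_+ are the same. If the elements of a face of the
  smaller filter have closure \<open>Z\<close>, then its flats contain \<open>Z\<close>, so it is a
  face of Y_-; and every face of the larger filter through \<open>Z\<close> is a face of
  Y_+.\<close>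

lemma new_iff: "\<not> gW Z I \<F> \<and> gP Pm I \<F> \<longleftrightarrow> \<not> gY I \<F> \<and> gP Pp I \<F>"
proof
  assume a: "\<not> gW Z I \<F> \<and> gP Pm I \<F>"
  then have ch: "subset.chain Pm \<F>" and I: "I \<subseteq> E" "\<forall>F\<in>\<F>. I \<subseteq> F" "cl M I \<notin> Pm \<union> {E}" by (auto simp: gP_def)
  have ZF: "Z \<notin> \<F>" using ch Z_facts(2) by (auto simp: subset_chain_def)
  have chZ: "subset.chain PZ \<F>" if "\<And>F. F \<in> \<F> \<Longrightarrow> Z \<subseteq> F"
    using ch Pm_PZ that unfolding subset_chain_def by blast
  have "cl M I \<noteq> Z"
  proof
    assume cl: "cl M I = Z"
    have "Z \<subseteq> F" if "F \<in> \<F>" for F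
    proof -
      have "F \<in> Pm" using ch that by (auto simp: subset_chain_def)
      then have "flat M F" using filters(1) proper_flatsD(2) by blast
      then show ?thesis using cl_subset_flat[of I F] I(2) that cl by blast
    qed
    then have "gW Z I \<F>" using chZ cl_superset[OF I(1)] cl by (auto simp: gW_def)
    then show False using a by simp
  qed
  then have "gP Pp I \<F>" using I chain_mono[OF ch sub] by (auto simp: gP_def Pp_eq)
  moreover have "\<not> gY I \<F>" using a ZF by (auto simp: gY_def gW_def)
  ultimately show "\<not> gY I \<F> \<and> gP Pp I \<F>" by simp
next
  assume a: "\<not> gY I \<F> \<and> gP Pp I \<F>"
  then have ZF: "Z \<notin> \<F>" using gP_with_Z[of I \<F>] by (auto simp: gY_def)
  have g: "gP Pp I \<F>" using a by simp
  have "subset.chain Pm \<F>" using g ZF unfolding gP_def subset_chain_def Pp_eq by blast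
  then have "gP Pm I \<F>" using g by (auto simp: gP_def Pp_eq)
  moreover have "\<not> gW Z I \<F>"
  proof
    assume w: "gW Z I \<F>"
    have "cl M I \<noteq> Z" using g Z_facts(1) by (auto simp: gP_def)
    then have "gY I \<F>" using w ZF by (auto simp: gY_def gW_def)
    then show False using a by simp
  qed
  ultimately show "\<not> gW Z I \<F> \<and> gP Pm I \<F>" by simp
qed

text \<open>The flat \<open>Z\<close> is not a variable of the smaller ring; its image 0 keeps the
  monomials that contain it in the ideal.\<close>

definition \<phi> :: "sr_var \<Rightarrow> sr_var cpoly" where
  "\<phi> v = (case v of Elt e \<Rightarrow> Var (Elt e) + (if e \<in> Z then Var (Flat Z) else 0) | Flat F \<Rightarrow> (if F = Z then 0 else Var (Flat F)))"

text \<open>Apart from \<open>gen m\<close> itself, every term of the expansion has traded at least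
  one element of \<open>Z\<close> for the flat \<open>Z\<close>.\<close>

lemma \<phi>_keys:
  assumes "Z \<notin> FL m" "k \<in> keys (substitute \<phi> (gen m) - gen m)"
  shows "Z \<in> FL k \<and> FL m \<subseteq> FL k \<and> FL k \<subseteq> insert Z (FL m) \<and> EL k \<subseteq> EL m \<and> EL m \<subseteq> EL k \<union> Z"
  using assms
proof (induction m arbitrary: k rule: monomial_induct)
  case zero
  then show ?case by (simp add: substitute_one)
next
  case (Var v m)
  have eq: "substitute \<phi> (gen (single v 1 + m)) - gen (single v 1 + m) =
      \<phi> v * (substitute \<phi> (gen m) - gen m) + (\<phi> v - Var v) * gen m"
    unfolding gen_Var substitute_mult substitute_Var by (simp add: algebra_simps)
  have "k \<in> keys (\<phi> v * (substitute \<phi> (gen m) - gen m)) \<union> keys ((\<phi> v - Var v) * gen m)"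
    using subsetD[OF keys_add Var.prems(2)[unfolded eq]] .
  then show ?case
  proof
    assume "k \<in> keys (\<phi> v * (substitute \<phi> (gen m) - gen m))"
    then obtain k1 k2 where k: "k = k1 + k2" "k1 \<in> keys (\<phi> v)" "k2 \<in> keys (substitute \<phi> (gen m) - gen m)"
      using subsetD[OF keys_mult] by blast
    have IH: "Z \<in> FL k2 \<and> FL m \<subseteq> FL k2 \<and> FL k2 \<subseteq> insert Z (FL m) \<and> EL k2 \<subseteq> EL m \<and> EL m \<subseteq> EL k2 \<union> Z"
      using Var.prems(1) by (intro Var.IH k(3)) simp
    show ?thesis
    proof (cases v)
      case (Elt e)
      then have "k1 = single (Elt e) 1 \<or> (e \<in> Z \<and> k1 = single (Flat Z) 1)"
        using k(2) keys_add[of "Var (Elt e)" "Var (Flat Z)"] by (auto simp: \<phi>_def keys_Var split: if_splits)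
      then show ?thesis using IH by (auto simp: k(1) Elt)
    next
      case (Flat F)
      then have "F \<noteq> Z" "k1 = single (Flat F) 1" using k(2) by (auto simp: \<phi>_def keys_Var split: if_splits)
      then show ?thesis using IH by (auto simp: k(1) Flat)
    qed
  next
    assume k: "k \<in> keys ((\<phi> v - Var v) * gen m)"
    show ?thesis
    proof (cases v)
      case (Elt e)
      then have "\<phi> v - Var v = (if e \<in> Z then Var (Flat Z) else 0)" by (simp add: \<phi>_def)
      then have "e \<in> Z" "k = single (Flat Z) 1 + m" using k by (auto simp: gen_Var[symmetric] split: if_splits)
      then show ?thesis by (auto simp: Elt)
    next
      case (Flat F)
      then have "\<phi> v - Var v = 0" using Var.prems(1) by (auto simp: \<phi>_def)
      then show ?thesis using k by simp
    qed
  qed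
qed

text \<open>A further term contains the flat \<open>Z\<close>. Were it a face, its elements would
  lie in \<open>Z\<close> and its other flats above \<open>Z\<close>, so \<open>m\<close> would be a
  face of Y_-.\<close>

lemma \<phi>_bad:
  assumes "Z \<notin> FL m" "bd (gW Z) m" shows "substitute \<phi> (gen m) - gen m \<in> mono_ideal (bd (gP Pp))"
  unfolding mono_ideal_def
proof (intro CollectI subsetI)
  fix k assume "k \<in> keys (substitute \<phi> (gen m) - gen m)"
  then have k: "Z \<in> FL k" "FL m \<subseteq> FL k" "FL k \<subseteq> insert Z (FL m)" "EL k \<subseteq> EL m" "EL m \<subseteq> EL k \<union> Z"
    using \<phi>_keys[OF assms(1)] by blast+
  show "bd (gP Pp) k" unfolding bd_def
  proof
    assume "gP Pp (EL k) (FL k)"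
    then have "EL k \<subseteq> Z" "subset.chain PZ (FL k - {Z})" using gP_with_Z k(1) by blast+
    moreover have "FL m \<subseteq> FL k - {Z}" using k(2) assms(1) by auto
    ultimately have "gW Z (EL m) (FL m)" using k(5) chain_anti unfolding gW_def by blast
    then show False using assms(2) by (simp add: bd_def)
  qed
qed

lemma \<phi>_Z: "Z \<in> FL m \<Longrightarrow> substitute \<phi> (gen m) = 0"
proof (induction m rule: monomial_induct)
  case (Var v m)
  show ?case
  proof (cases "v = Flat Z")
    case True then show ?thesis unfolding substitute_gen_Var by (simp add: \<phi>_def)
  next
    case False
    then have "Z \<in> FL m" using Var.prems by (cases v) auto
    then have "substitute \<phi> (gen m) = 0" by (rule Var.IH)
    then show ?thesis unfolding substitute_gen_Var by simp
  qed
qed simp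

lemma homogeneous_sF: "sF P e \<in> homogeneous 1"
  unfolding sF_def by (rule homogeneous_closed(6)[OF homogeneous_Var])

lemma homogeneous_ops: "opr P i \<in> homogeneous 1" "wp \<in> homogeneous 1" "opD i \<in> homogeneous 1" "opN i \<in> homogeneous 1" "\<phi> v \<in> homogeneous 1"
proof -
  show wp: "wp \<in> homogeneous 1" unfolding wp_def by (intro homogeneous_closed homogeneous_Var homogeneous_sF)
  show "opr P i \<in> homogeneous 1" unfolding opr_def by (intro homogeneous_closed homogeneous_Var homogeneous_sF)
  show "opD i \<in> homogeneous 1" "opN i \<in> homogeneous 1" unfolding opD_def opN_def
    using homogeneous_closed homogeneous_Var homogeneous_sF wp by (auto intro!: homogeneous_closed)
  show "\<phi> v \<in> homogeneous 1" unfolding \<phi>_def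
    by (cases v) (auto intro!: homogeneous_closed simp: homogeneous_Var homogeneous_closed(1))
qed

lemma finite_filters: "finite Pm" "finite Pp"
  using filters finite_proper_flats finite_subset by blast+

lemma \<phi>_opr: "substitute \<phi> (opr Pm i) = opr Pp i"
proof -
  have s: "substitute \<phi> (sF Pm e) = sF Pm e" for e
    unfolding sF_def substitute_linear(5) substitute_Var using Z_facts(2) by (intro sum.cong) (auto simp: \<phi>_def)
  have p: "sF Pp e = (if e \<in> Z then Var (Flat Z) else 0) + sF Pm e" for e
  proof (cases "e \<in> Z")
    case True
    then have "{F. F \<in> Pp \<and> e \<in> F} = insert Z {F. F \<in> Pm \<and> e \<in> F}" by (auto simp: Pp_eq)
    then show ?thesis using True Z_facts(2) finite_filters(1) by (simp add: sF_def)
  next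
    case False
    then have "{F. F \<in> Pp \<and> e \<in> F} = {F. F \<in> Pm \<and> e \<in> F}" by (auto simp: Pp_eq)
    then show ?thesis using False by (simp add: sF_def)
  qed
  show ?thesis unfolding opr_def substitute_linear(1,2) s substitute_Var p by (simp add: \<phi>_def)
qed

lemma js_facts: "distinct js" "set js1 = Z - {e0}" "set js2 = E - Z - {f0}" "set js = E - {f0}" "set (js1 @ js2) \<subseteq> E"
proof -
  have "finite Z" using Z_facts(4) finE finite_subset by blast
  then show 1: "set js1 = Z - {e0}" "set js2 = E - Z - {f0}" using finE by (simp_all add: js1_def js2_def)
  have "distinct js1" "distinct js2" by (simp_all add: js1_def js2_def)
  then show "distinct js" using 1 e0 by auto
  show "set js = E - {f0}" "set (js1 @ js2) \<subseteq> E" using 1 e0 f0 Z_facts(4) by auto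
qed

sublocale les js "opr Pm" "opr Pp" "bd (gP Pm)" "bd (gP Pp)" "bd (gW Z)" "bd gY" \<phi>
proof (unfold_locales, goal_cases)
  case 1 show ?case by (rule js_facts)
next
  case (9 m) then show ?case using gW_gP by (auto simp: bd_def)
next
  case (10 m) then show ?case using gY_gP by (auto simp: bd_def)
next
  case (11 m) show ?case using new_iff[of "EL m" "FL m"] by (auto simp: bd_def)
next
  case (12 m)
  show ?case
  proof (cases "Z \<in> FL m")
    case True then show ?thesis by (simp add: \<phi>_Z mono_ideal_closed(1))
  next
    case False
    have w: "bd (gW Z) m" using 12 gW_gP by (auto simp: bd_def)
    have "bd (gP Pp) m"
      unfolding bd_def
    proof
      assume g: "gP Pp (EL m) (FL m)"
      then have "subset.chain Pm (FL m)" using False unfolding gP_def subset_chain_def Pp_eq by blast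
      then have "gP Pm (EL m) (FL m)" using g by (auto simp: gP_def Pp_eq)
      then show False using 12 by (simp add: bd_def)
    qed
    then have "gen m \<in> mono_ideal (bd (gP Pp))" by (simp add: gen_in_mono_ideal)
    then show ?thesis by (rule eq_mod_sub[OF \<phi>_bad[OF False w]])
  qed
next
  case (13 m)
  then have "gP Pm (EL m) (FL m)" by (simp add: bd_def)
  then have "Z \<notin> FL m" using Z_facts(2) by (auto simp: gP_def subset_chain_def)
  then show ?case using 13(1) by (rule \<phi>_bad)
qed (use up homogeneous_ops \<phi>_opr in auto)

end

section \<open>Eliminations in Y_+ and Y_-, and injectivity on homology\<close>

lemma dK_cong: "(\<And>i. i \<in> set js \<Longrightarrow> L i = L' i) \<Longrightarrow> dK js L c = dK js L' c"
  by (simp add: dK_def)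

lemma Bd_cong_mod:
  assumes "upward bad" "\<And>i. i \<in> set js \<Longrightarrow> L i - L' i \<in> mono_ideal bad"
    and L1: "\<And>i. i \<in> set js \<Longrightarrow> L i \<in> homogeneous 1" "\<And>i. i \<in> set js \<Longrightarrow> L' i \<in> homogeneous 1"
    and x: "x \<in> Bd js L bad t s"
  shows "x \<in> Bd js L' bad t s"
proof -
  obtain b i where b: "x = dK js L b + i" "b \<in> Ch js (t + 1) (s - 1)" "i \<in> Ch js t s" "i \<in> IC bad"
    using x by (rule BdE)
  have d: "dK js L b \<in> Ch js t s" "dK js L' b \<in> Ch js t s" using dK_Ch[OF L1(1) b(2)] dK_Ch[OF L1(2) b(2)] by simp_all
  have "dK js L' b + (i + (dK js L b - dK js L' b)) \<in> Bd js L' bad t s"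
    by (rule BdI[OF b(2) Ch_closed(2)[OF b(3) Ch_closed(3)[OF d]] IC_closed(2)[OF b(4) dK_cong_mod[OF assms(1,2)]]])
  moreover have "dK js L' b + (i + (dK js L b - dK js L' b)) = x" unfolding b(1) by (rule ext) simp
  ultimately show ?thesis by (simp only:)
qed

text \<open>Lets chains of the contraction count as chains over the full list: no index of
  \<open>pre\<close> occurs in them, so the signs agree.\<close>

lemma dK_append:
  assumes "distinct (pre @ js)" "c \<in> Ch js t s" shows "dK (pre @ js) L c = dK js L c"
proof
  fix S
  have "dK (pre @ js) L c S = (\<Sum>i\<in>set js - S. sg (pre @ js) i S * (L i * c (insert i S)))"
    unfolding dK_def
  proof (rule sum.mono_neutral_right)
    show "\<forall>i\<in>set (pre @ js) - S - (set js - S). sg (pre @ js) i S * (L i * c (insert i S)) = 0"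
    proof
      fix i assume "i \<in> set (pre @ js) - S - (set js - S)"
      then have "\<not> insert i S \<subseteq> set js" by auto
      then have "c (insert i S) = 0" by (intro Ch_zero[OF assms(2)]) blast
      then show "sg (pre @ js) i S * (L i * c (insert i S)) = 0" by simp
    qed
  qed auto
  also have "\<dots> = dK js L c S"
    unfolding dK_def
  proof (rule sum.cong[OF refl])
    fix i assume i: "i \<in> set js - S"
    show "sg (pre @ js) i S * (L i * c (insert i S)) = sg js i S * (L i * c (insert i S))"
    proof (cases "S \<subseteq> set js")
      case True
      have "takeWhile (\<lambda>k. k \<noteq> i) (pre @ js) = pre @ takeWhile (\<lambda>k. k \<noteq> i) js"
        using assms(1) i by (intro takeWhile_append2) auto
      moreover have "filter (\<lambda>k. k \<in> S) pre = []" using True assms(1) by (auto simp: filter_empty_conv)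
      ultimately show ?thesis by (simp add: sg_def)
    next
      case False
      then have "c (insert i S) = 0" by (intro Ch_zero[OF assms(2)]) blast
      then show ?thesis by simp
    qed
  qed
  finally show "dK (pre @ js) L c S = dK js L c S" .
qed

lemma upd_mono_ideal:
  assumes C1: "\<And>m k. bad m \<Longrightarrow> keys m - {y} \<subseteq> keys k \<Longrightarrow> bad2 k"
    and "p \<in> mono_ideal bad"
  shows "substitute (Var(y := a)) p \<in> mono_ideal bad2"
proof (rule substitute_in_mono_ideal)
  fix m assume "m \<in> keys p"
  then have "bad m" using assms(2) by (auto simp: mono_ideal_def)
  then show "substitute (Var(y := a)) (gen m) \<in> mono_ideal bad2"
    unfolding mono_ideal_def by (intro CollectI subsetI) (rule C1[OF _ keys_upd_lower])
qed

context one_flat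
begin

lemma sF_all: "e \<in> Z \<Longrightarrow> sF PZ e = (\<Sum>F\<in>PZ. Var (Flat F))"
proof -
  assume "e \<in> Z"
  then have "{F. F \<in> PZ \<and> e \<in> F} = PZ" using PZ_facts(4) by blast
  then show ?thesis by (simp add: sF_def)
qed

lemma sF_mod:
  assumes P: "PZ \<subseteq> P" "finite P" and I: "\<And>F. F \<notin> PZ \<Longrightarrow> F \<noteq> Z \<Longrightarrow> Var (Flat F) \<in> mono_ideal bad"
  shows "sF P e - ((if e \<in> Z \<and> Z \<in> P then Var (Flat Z) else 0) + sF PZ e) \<in> mono_ideal bad"
proof -
  define f where "f F = (if e \<in> F then Var (Flat F) else (0 :: sr_var cpoly))" for F
  have s: "sF Q e = sum f Q" if "finite Q" for Q
  proof -
    have "f = (\<lambda>F. if e \<in> F then Var (Flat F) else 0)" by (rule ext) (simp add: f_def)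
    then show ?thesis unfolding sF_def by (simp only: sum.inter_filter[OF that])
  qed
  have "sum f P = sum f (P - PZ) + sum f PZ" by (rule sum.subset_diff[OF P])
  moreover have "sum f (P - PZ) = sum f ((P - PZ) \<inter> {Z}) + sum f (P - PZ - {Z})" using P(2) by (intro sum.Int_Diff) simp
  moreover have "sum f ((P - PZ) \<inter> {Z}) = (if e \<in> Z \<and> Z \<in> P then Var (Flat Z) else 0)"
    using PZ_facts(2) by (cases "Z \<in> P") (simp_all add: f_def)
  ultimately have "sF P e - ((if e \<in> Z \<and> Z \<in> P then Var (Flat Z) else 0) + sF PZ e) = sum f (P - PZ - {Z})"
    by (simp add: s[OF P(2)] s[OF PZ_facts(3)])
  moreover have "sum f (P - PZ - {Z}) \<in> mono_ideal bad"
    by (rule mono_ideal_closed(6)) (auto simp: f_def I mono_ideal_closed(1))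
  ultimately show ?thesis by simp
qed

text \<open>Common to both quotients, in which only the elements of \<open>Z\<close>, the flats of
  \<open>PZ\<close> and possibly \<open>Z\<close> itself survive as variables. Since
  \<open>f0\<close> is not in \<open>Z\<close>, the variables of \<open>f0\<close> and
  \<open>Z\<close> do not enter through the reference element.\<close>

lemma opr_mod:
  assumes P: "PZ \<subseteq> P" "finite P" and I: "\<And>F. F \<notin> PZ \<Longrightarrow> F \<noteq> Z \<Longrightarrow> Var (Flat F) \<in> mono_ideal bad"
    and J: "\<And>i. i \<notin> Z \<Longrightarrow> Var (Elt i) \<in> mono_ideal bad"
  shows "i \<in> Z \<Longrightarrow> opr P i - ((Var (Elt i) + (if Z \<in> P then Var (Flat Z) else 0)) + wp) \<in> mono_ideal bad"
    and "i \<notin> Z \<Longrightarrow> opr P i - (sF PZ i - sF PZ f0) \<in> mono_ideal bad"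
proof -
  have f0Z: "f0 \<notin> Z" using f0 by simp
  let ?d = "\<lambda>e. sF P e - ((if e \<in> Z \<and> Z \<in> P then Var (Flat Z) else 0) + sF PZ e)"
  note d = sF_mod[OF P I]
  show "opr P i - ((Var (Elt i) + (if Z \<in> P then Var (Flat Z) else 0)) + wp) \<in> mono_ideal bad" if i: "i \<in> Z"
  proof -
    have "opr P i - ((Var (Elt i) + (if Z \<in> P then Var (Flat Z) else 0)) + wp) = ?d i - (?d f0 + Var (Elt f0))"
      using i f0Z by (simp add: opr_def wp_def sF_all[symmetric, OF i])
    also have "\<dots> \<in> mono_ideal bad" by (intro mono_ideal_closed(2,3) d J[OF f0Z])
    finally show ?thesis .
  qed
  show "opr P i - (sF PZ i - sF PZ f0) \<in> mono_ideal bad" if i: "i \<notin> Z"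
  proof -
    have "opr P i - (sF PZ i - sF PZ f0) = (?d i + Var (Elt i)) - (?d f0 + Var (Elt f0))"
      using i f0Z by (simp add: opr_def)
    also have "\<dots> \<in> mono_ideal bad" by (intro mono_ideal_closed(2,3) d J[OF f0Z] J[OF i])
    finally show ?thesis .
  qed
qed

lemma Var_bad:
  "Q \<notin> PZ \<Longrightarrow> Var (Flat Q) \<in> mono_ideal (bd (gW W))" "i \<notin> W \<Longrightarrow> Var (Elt i) \<in> mono_ideal (bd (gW W))"
  "Q \<notin> PZ \<Longrightarrow> Q \<noteq> Z \<Longrightarrow> Var (Flat Q) \<in> mono_ideal (bd gY)" "i \<notin> Z \<Longrightarrow> Var (Elt i) \<in> mono_ideal (bd gY)"
  by (auto simp: Var_Flat_bd Var_Elt_bd gW_def gY_def subset_chain_def)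

lemma opr_Pm: "i \<in> set js \<Longrightarrow> opr Pm i - opN i \<in> mono_ideal (bd (gW Z))"
  using opr_mod[of Pm "bd (gW Z)" i, OF PZ_facts(1) finite_filters(1) Var_bad(1,2)] Z_facts(2)
  by (cases "i \<in> Z") (simp_all add: opN_def)

lemma opr_Pp: "i \<in> Z \<Longrightarrow> opr Pp i - (Var (Elt i) + Var (Flat Z) + wp) \<in> mono_ideal (bd gY)"
    "i \<notin> Z \<Longrightarrow> opr Pp i - opD i \<in> mono_ideal (bd gY)"
  using opr_mod[of Pp "bd gY" i, OF _ finite_filters(2) Var_bad(3,4)] Z_facts(1) PZ_facts(1) sub
  by (simp_all add: opD_def)

lemma free_sF: "Z \<notin> P \<Longrightarrow> free_of (Flat Z) (sF P e)" "free_of (Elt i) (sF P e)"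
  unfolding sF_def by (auto intro!: free_of_closed(4) free_of_Var)

lemma free_wp: "free_of (Flat Z) wp" "free_of (Elt i) wp"
  unfolding wp_def using PZ_facts(2) by (auto intro!: free_of_closed(4) free_of_closed(2) free_of_Var free_sF)

lemma gY_from_gD: "gD (EL k) (FL k) \<Longrightarrow> keys m - {Flat Z} \<subseteq> keys k \<Longrightarrow> gY (EL m) (FL m)"
proof -
  assume g: "gD (EL k) (FL k)" and k: "keys m - {Flat Z} \<subseteq> keys k"
  have "gY (EL k) (FL k)" using g chain_anti unfolding gD_def gY_def by blast
  then have "gY (EL m) (FL m - {Z})" using k by (elim antitoneD[OF antitone_gY]) (auto simp: EL_def FL_def)
  then show ?thesis by (simp add: gY_def)
qed

text \<open>In Y_+ the form of \<open>e0\<close> is the variable of the flat \<open>Z\<close> plus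
  \<open>Var (Elt e0) + wp\<close>. Membership of \<open>Z\<close> is irrelevant to
  \<open>gY\<close>, so this flat is a cone point and can be eliminated.\<close>

sublocale EA: elim e0 "js1 @ js2" "opr Pp" opD "bd gY" "bd gD" "Var(Flat Z := - (Var (Elt e0) + wp))"
proof (rule elim_variable)
  have C1: "bd gD k" if "bd gY m" "keys m - {Flat Z} \<subseteq> keys k" for m k
    using that gY_from_gD unfolding bd_def by blast
  show "bd gD k" if "bd gY m" "keys m - {Flat Z} \<subseteq> keys k" for m k using that by (rule C1)
  show "distinct (js1 @ js2)" "e0 \<notin> set (js1 @ js2)" using js_facts(1) by auto
  show "upward (bd gY)" "upward (bd gD)" by (rule up)+
  show "opr Pp i \<in> homogeneous 1" for i by (rule homogeneous_ops)
  show "Var (Elt e0) + wp \<in> homogeneous 1" by (intro homogeneous_closed homogeneous_Var homogeneous_ops)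
  have free: "free_of (Flat Z) (Var (Elt e0) + wp)" by (intro free_of_closed free_of_Var free_wp) simp
  show "free_of (Flat Z) (Var (Elt e0) + wp)" by (rule free)
  show "bd gY m" if "bd gD m" "Flat Z \<notin> keys m" for m
  proof -
    have "FL m - {Z} = FL m" using that(2) by (auto simp: FL_def)
    then show ?thesis using that(1) by (simp add: bd_def gD_def gY_def)
  qed
  show "bd gY m" if "bd gY (single (Flat Z) 1 + m)" for m
    using that by (simp add: bd_def gY_def)
  show "bd gD m" if "Flat Z \<in> keys m" for m
  proof -
    have "Z \<in> FL m" using that by (simp add: FL_def)
    then show ?thesis using PZ_facts(2) by (auto simp: bd_def gD_def subset_chain_def)
  qed
  show "opr Pp e0 - (Var (Flat Z) + (Var (Elt e0) + wp)) \<in> mono_ideal (bd gY)"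
    using opr_Pp(1)[OF e0] by (simp add: add_ac)
  fix i assume i: "i \<in> set (js1 @ js2)"
  let ?\<theta> = "Var(Flat Z := - (Var (Elt e0) + wp)) :: sr_var \<Rightarrow> sr_var cpoly"
  show "substitute ?\<theta> (opr Pp i) - opD i \<in> mono_ideal (bd gD)"
  proof (cases "i \<in> Z")
    case True
    have "substitute ?\<theta> (opr Pp i - (Var (Elt i) + Var (Flat Z) + wp)) \<in> mono_ideal (bd gD)"
      by (rule upd_mono_ideal[OF C1 opr_Pp(1)[OF True]])
    moreover have "substitute ?\<theta> wp = wp" by (rule substitute_free_of[OF free_wp(1)])
    moreover have "substitute ?\<theta> (Var (Elt i)) = Var (Elt i)" "substitute ?\<theta> (Var (Flat Z)) = - (Var (Elt e0) + wp)"
      by (simp_all add: substitute_Var)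
    ultimately show ?thesis using True by (simp add: substitute_linear(1,2) opD_def)
  next
    case False
    have "substitute ?\<theta> (opr Pp i - opD i) \<in> mono_ideal (bd gD)"
      by (rule upd_mono_ideal[OF C1 opr_Pp(2)[OF False]])
    moreover have "substitute ?\<theta> (opD i) = opD i"
      using False PZ_facts(2) by (intro substitute_free_of) (simp add: opD_def free_of_closed free_sF)
    ultimately show ?thesis by (simp add: substitute_linear(2))
  qed
qed

definition \<omega> :: "int set \<Rightarrow> sr_var \<Rightarrow> sr_var cpoly" where
  "\<omega> W v = (case v of Elt e \<Rightarrow> (if e \<in> W then - wp else Var (Elt e)) | Flat Q \<Rightarrow> Var (Flat Q))"

text \<open>The composite of the eliminations of all elements of \<open>W\<close>, in a closed form
  that does not depend on their order.\<close>

definition \<kappa>m :: "int set \<Rightarrow> (sr_var chain) \<Rightarrow> sr_var chain" where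
  "\<kappa>m W c = (\<lambda>S. if S \<inter> W \<noteq> {} then 0 else substitute (\<omega> W) (c S))"

lemma substitute_\<omega>_wp: "substitute (\<omega> W) wp = wp"
  by (simp add: wp_def sF_def substitute_linear substitute_Var \<omega>_def)

text \<open>In \<open>gW\<close> the elements are subject to no condition besides lying in the given
  set, so each element of that set is a cone point.\<close>

lemma elim_step:
  assumes "distinct (w # ws)" "set (w # ws) \<subseteq> Z"
  shows "elim w (ws @ js2) opN opN (bd (gW (set (w # ws)))) (bd (gW (set ws))) (Var(Elt w := - wp))"
proof (rule elim_variable)
  show "distinct (ws @ js2)" "w \<notin> set (ws @ js2)" using assms js_facts(1,3) by auto
  show "opN i \<in> homogeneous 1" "wp \<in> homogeneous 1" for i by (rule homogeneous_ops)+
  show "bd (gW (set ws)) k" if "bd (gW (set (w # ws))) m" "keys m - {Elt w} \<subseteq> keys k" for m k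
    unfolding bd_def
  proof
    assume g: "gW (set ws) (EL k) (FL k)"
    have "EL m \<subseteq> insert w (EL k)" "FL m \<subseteq> FL k" using that(2) by (auto simp: EL_def FL_def)
    then have "gW (set (w # ws)) (EL m) (FL m)" using g chain_anti unfolding gW_def by auto
    then show False using that(1) by (simp add: bd_def)
  qed
  show "bd (gW (set (w # ws))) m" if "bd (gW (set ws)) m" "Elt w \<notin> keys m" for m
    using that by (auto simp: bd_def gW_def EL_def)
  show "bd (gW (set (w # ws))) m" if "bd (gW (set (w # ws))) (single (Elt w) 1 + m)" for m
    using that by (auto simp: bd_def gW_def)
  show "bd (gW (set ws)) m" if "Elt w \<in> keys m" for m
    using that assms(1) by (auto simp: bd_def gW_def EL_def)
  show "opN w - (Var (Elt w) + wp) \<in> mono_ideal (bd (gW (set (w # ws))))"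
    using assms(2) by (simp add: opN_def mono_ideal_closed(1))
  fix i assume i: "i \<in> set (ws @ js2)"
  have "free_of (Elt w) (opN i)"
    using i assms(1) js_facts(3) assms(2) by (auto simp: opN_def intro!: free_of_closed free_of_Var free_wp free_sF)
  then have "substitute (Var(Elt w := - wp)) (opN i) = opN i" by (rule substitute_free_of)
  then show "substitute (Var(Elt w := - wp)) (opN i) - opN i \<in> mono_ideal (bd (gW (set ws)))"
    by (simp add: mono_ideal_closed(1))
qed (rule free_wp up)+

lemma \<kappa>m_elim:
  assumes "distinct ws" "set ws \<subseteq> Z" "z \<in> Zc (ws @ js2) opN (bd (gW (set ws))) t s"
  shows "\<kappa>m (set ws) z \<in> Zc js2 opN (bd (gW {})) t s"
    and "\<kappa>m (set ws) z \<in> Bd js2 opN (bd (gW {})) t s \<Longrightarrow> z \<in> Bd (ws @ js2) opN (bd (gW (set ws))) t s"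
  using assms
proof (induction ws arbitrary: z)
  case Nil
  have "\<omega> {} v = Var v" for v by (cases v) (auto simp: \<omega>_def)
  then have "\<omega> {} = Var" by (rule ext)
  then have id: "\<kappa>m (set []) z = z" for z by (simp add: \<kappa>m_def substitute_Var_id)
  {
    case 1 then show ?case unfolding id by simp
  next
    case 2 then show ?case unfolding id by simp
  }
next
  case (Cons w ws)
  {
    fix z :: "sr_var chain"
    assume ws: "distinct (w # ws)" "set (w # ws) \<subseteq> Z"
    assume z: "z \<in> Zc ((w # ws) @ js2) opN (bd (gW (set (w # ws)))) t s"
    interpret S: elim w "ws @ js2" opN opN "bd (gW (set (w # ws)))" "bd (gW (set ws))" "Var(Elt w := - wp)"
      using ws by (rule elim_step)
    \<comment> \<open>The closed form is the composite because \<open>wp\<close> contains no element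
      variable.\<close>
    have "substitute (\<omega> (set ws)) ((Var(Elt w := - wp)) v) = \<omega> (set (w # ws)) v" for v
      by (cases v) (auto simp: substitute_linear substitute_\<omega>_wp substitute_Var \<omega>_def)
    then have sub: "substitute (\<omega> (set ws)) (substitute (Var(Elt w := - wp)) p) = substitute (\<omega> (set (w # ws))) p" for p
      unfolding substitute_substitute by (simp only:)
    have eq: "\<kappa>m (set ws) (S.\<kappa> z) = \<kappa>m (set (w # ws)) z"
    proof
      fix S
      show "\<kappa>m (set ws) (S.\<kappa> z) S = \<kappa>m (set (w # ws)) z S"
        using sub[of "z S"] by (auto simp: \<kappa>m_def S.\<kappa>_def substitute_linear(3))
    qed
    have \<kappa>z: "S.\<kappa> z \<in> Zc (ws @ js2) opN (bd (gW (set ws))) t s" using z by (intro S.\<kappa>_Zc) simp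
    have 1: "\<kappa>m (set (w # ws)) z \<in> Zc js2 opN (bd (gW {})) t s"
      using Cons.IH(1)[of "S.\<kappa> z"] ws \<kappa>z unfolding eq by simp
    have 2: "z \<in> Bd ((w # ws) @ js2) opN (bd (gW (set (w # ws)))) t s" if "\<kappa>m (set (w # ws)) z \<in> Bd js2 opN (bd (gW {})) t s"
    proof -
      have "S.\<kappa> z \<in> Bd (ws @ js2) opN (bd (gW (set ws))) t s"
        using Cons.IH(2)[of "S.\<kappa> z"] ws \<kappa>z that unfolding eq by simp
      then show ?thesis using S.\<kappa>_inj[of z t s] z by simp
    qed
    note 1 2
  }
  note * = this
  {
    case 1 then show ?case by (intro *(1))
  next
    case 2 then show ?case by (intro *(2))
  }
qed

text \<open>Element variables belong to the restriction and flat variables to the contraction;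
  \<open>gD\<close> describes the join.\<close>

sublocale KN: kunneth js1 js2 "range Elt" opD "bd gB" "bd (gW {})" "bd gD"
proof (unfold_locales, goal_cases)
  case 1 then show ?case using js_facts(1) by simp
next
  case (6 i)
  then have "i \<in> Z" using js_facts(2) by auto
  moreover have "Var (Elt j) \<in> mono_ideal (\<lambda>m. keys m \<subseteq> range Elt)" for j
    by (auto simp: mono_ideal_def keys_Var)
  ultimately show ?case unfolding opD_def by (simp add: mono_ideal_closed(3))
next
  case (7 i)
  then have "i \<notin> Z" using js_facts(3) by auto
  moreover have "Var (Flat F) \<in> mono_ideal (\<lambda>m. keys m \<inter> range Elt = {})" for F
    by (auto simp: mono_ideal_def keys_Var)
  then have "sF P e \<in> mono_ideal (\<lambda>m. keys m \<inter> range Elt = {})" for P e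
    unfolding sF_def by (intro mono_ideal_closed(6))
  ultimately show ?case unfolding opD_def by (simp add: mono_ideal_closed(3))
next
  case (8 m)
  then have "FL m = {}" by (simp add: bd_def gB_def)
  then show ?case by (auto simp: FL_def) (metis sr_var.exhaust rangeI)
next
  case (9 m)
  then have "EL m = {}" by (simp add: bd_def gW_def)
  then show ?case by (auto simp: EL_def)
next
  case (10 m1 m2)
  have "FL m1 = {}" "EL m2 = {}" using 10 by (auto simp: EL_def FL_def)
  then show ?case by (auto simp: bd_def gD_def gB_def gW_def)
qed (use up homogeneous_ops in auto)

text \<open>Cycles of the contraction in normal form. They are simultaneously cycles of Y_- and of
  the tensor product, and \<open>F\<close>, \<open>EA.\<kappa>\<close>, \<open>\<kappa>m Z\<close>
  and \<open>st\<close> all fix them.\<close>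

definition NCs :: "int \<Rightarrow> int \<Rightarrow> (sr_var chain) set" where
  "NCs t s = {c \<in> normal_chains js2 (bd (gW {})) t s. dl js2 opD (bd (gW {})) c = 0}"

definition BNs :: "int \<Rightarrow> int \<Rightarrow> (sr_var chain) set" where
  "BNs t s = {b + n | b n. b \<in> Bd (js1 @ js2) opD (bd gD) t s \<and> n \<in> NCs t s}"

lemma NCs_Ch: "n \<in> NCs t s \<Longrightarrow> n \<in> Ch js2 t s"
  unfolding NCs_def by (auto dest: normal_Ch)

lemma NCs_zero: "n \<in> NCs t s \<Longrightarrow> S \<inter> Z \<noteq> {} \<Longrightarrow> n S = 0"
  using js_facts(3) by (intro Ch_zero[OF NCs_Ch]) auto

lemma NCs_keys: "n \<in> NCs t s \<Longrightarrow> m \<in> keys (n S) \<Longrightarrow> EL m = {} \<and> FL m \<subseteq> PZ"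
  using KN.normal_keys[of n js2 "bd (gW {})" t s m S] by (auto simp: NCs_def bd_def gW_def subset_chain_def)

lemma NCs_substitute:
  assumes n: "n \<in> NCs t s" and \<eta>: "\<And>F. F \<in> PZ \<Longrightarrow> \<eta> (Flat F) = Var (Flat F)"
  shows "substitute \<eta> (n S) = n S"
proof -
  have "substitute \<eta> (n S) = substitute Var (n S)"
  proof (rule substitute_cong)
    fix m v assume m: "m \<in> keys (n S)" "v \<in> keys m"
    note k = NCs_keys[OF n m(1)]
    show "\<eta> v = Var v"
    proof (cases v)
      case (Elt e) then show ?thesis using k m(2) by (auto simp: EL_def)
    next
      case (Flat F) then show ?thesis using k m(2) by (auto simp: FL_def \<eta>)
    qed
  qed
  then show ?thesis by (simp only: substitute_Var_id)
qed

lemma opD_opN: "i \<in> set js2 \<Longrightarrow> opN i = opD i"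
  using js_facts(3) by (simp add: opN_def opD_def)

lemma Zc_js2: "Zc js2 opN (bd (gW {})) t s = Zc js2 opD (bd (gW {})) t s"
  unfolding Zc_def using dK_cong[of js2 opN opD, OF opD_opN] by simp

lemma Bd_js2: "Bd js2 opN (bd (gW {})) t s = Bd js2 opD (bd (gW {})) t s"
  unfolding Bd_def using dK_cong[of js2 opN opD, OF opD_opN] by simp

abbreviation "Zm \<equiv> Zc js (opr Pm) (bd (gW Z))"
abbreviation "Bm \<equiv> Bd js (opr Pm) (bd (gW Z))"

lemma Zm_eq: "Zm t s = Zc js opN (bd (gW Z)) t s"
  by (rule Zc_cong_mod[OF up(3) opr_Pm])

lemma Bm_eq: "x \<in> Bd js opN (bd (gW Z)) t s \<Longrightarrow> x \<in> Bm t s"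
proof (rule Bd_cong_mod[OF up(3)])
  show "opN i - opr Pm i \<in> mono_ideal (bd (gW Z))" if "i \<in> set js" for i
    using mono_ideal_closed(4)[OF opr_Pm[OF that]] by (simp only: minus_diff_eq)
qed (rule homogeneous_ops)+

lemma NCs_Zm: "n \<in> NCs t s \<Longrightarrow> n \<in> Zm t s"
  unfolding Zm_eq
proof (rule ZcI)
  assume n: "n \<in> NCs t s"
  have nW: "n \<in> normal_chains js2 (bd (gW {})) t s" and nZ: "n \<in> Zc js2 opD (bd (gW {})) t s"
    using n normal_cycle[of n js2 "bd (gW {})" t s opD] by (simp_all add: NCs_def)
  show "n \<in> Ch js t s" using NCs_Ch[OF n] by (auto simp: Ch_def)
  have "dK js opN n = dK js2 opN n" using dK_append[of "e0 # js1" js2 n t s opN] js_facts(1) NCs_Ch[OF n] by simp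
  also have "\<dots> = dK js2 opD n" by (rule dK_cong[OF opD_opN])
  finally have d: "dK js opN n = dK js2 opD n" .
  show "dK js opN n \<in> IC (bd (gW Z))"
    unfolding d IC_def
  proof (intro CollectI allI)
    fix S
    have "dK js2 opD n S \<in> mono_ideal (\<lambda>m. keys m \<inter> range Elt = {})" by (rule KN.dK_pureC[OF nW])
    moreover have "dK js2 opD n S \<in> mono_ideal (bd (gW {}))" using ZcD(2)[OF nZ] by (simp add: IC_def)
    \<comment> \<open>Without element variables, being bad means that the flats are no chain in
      \<open>PZ\<close>, whatever set of elements is allowed.\<close>
    moreover have "bd (gW Z) m" if "bd (gW {}) m" "keys m \<inter> range Elt = {}" for m
    proof -
      have "EL m = {}" using that(2) by (auto simp: EL_def)
      then show ?thesis using that(1) by (simp add: bd_def gW_def)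
    qed
    ultimately show "dK js2 opD n S \<in> mono_ideal (bd (gW Z))" unfolding mono_ideal_def by blast
  qed
qed

lemma F_NCs: "n \<in> NCs t s \<Longrightarrow> F n = n"
  unfolding mapc_def by (rule ext, rule NCs_substitute) (use PZ_facts(2) in \<open>auto simp: \<phi>_def\<close>)

lemma \<kappa>_NCs: "n \<in> NCs t s \<Longrightarrow> EA.\<kappa> n = n"
proof (rule ext)
  fix S assume n: "n \<in> NCs t s"
  have "substitute (Var(Flat Z := - (Var (Elt e0) + wp))) (n S) = n S"
    using PZ_facts(2) by (intro NCs_substitute[OF n]) auto
  then show "EA.\<kappa> n S = n S" unfolding EA.\<kappa>_def
  proof (cases "e0 \<in> S")
    case True
    then have "n S = 0" using e0 by (intro NCs_zero[OF n]) blast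
    then show "(if e0 \<in> S then 0 else substitute (Var(Flat Z := - (Var (Elt e0) + wp))) (n S)) = n S" using True by simp
  qed (simp only: if_False)
qed

lemma clinear_\<kappa>m: "clinear (\<kappa>m W)"
  by (rule clinearI) (auto simp: \<kappa>m_def substitute_linear)

lemma \<kappa>m_NCs: "n \<in> NCs t s \<Longrightarrow> \<kappa>m Z n = n"
proof (rule ext)
  fix S assume n: "n \<in> NCs t s"
  have "substitute (\<omega> Z) (n S) = n S" by (rule NCs_substitute[OF n]) (simp add: \<omega>_def)
  then show "\<kappa>m Z n S = n S" using NCs_zero[OF n, of S] by (auto simp: \<kappa>m_def)
qed

lemma js_split: "js = (e0 # js1) @ js2" "set (e0 # js1) = Z" "distinct (e0 # js1)"
  using js_facts e0 by auto

lemma \<kappa>m_Zm: "z \<in> Zm t s \<Longrightarrow> \<kappa>m Z z \<in> Zc js2 opD (bd (gW {})) t s"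
    and \<kappa>m_Bm: "z \<in> Zm t s \<Longrightarrow> \<kappa>m Z z \<in> Bd js2 opD (bd (gW {})) t s \<Longrightarrow> z \<in> Bm t s"
  using \<kappa>m_elim[of "e0 # js1" z t s] js_split(2,3) Bm_eq[of z t s]
  unfolding Zm_eq js_split(2) js_split(1)[symmetric] Zc_js2 Bd_js2 by blast+

text \<open>The representative of a cycle of Y_- that comes from the contraction.\<close>

definition y0 :: "(sr_var chain) \<Rightarrow> sr_var chain" where
  "y0 y = nf (bd (gW {})) (\<kappa>m Z y)"

lemma y0_NCs: "y \<in> Zm t s \<Longrightarrow> y0 y \<in> NCs t s"
  unfolding NCs_def y0_def using trc_normal[OF ZcD(1)[OF \<kappa>m_Zm]] trc_Zc[OF up(3) \<kappa>m_Zm] by blast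

lemma y0_diff: "y \<in> Zm t s \<Longrightarrow> \<kappa>m Z y - y0 y \<in> Bd js2 opD (bd (gW {})) t s"
  unfolding y0_def
  by (rule IC_subset_Bd[OF Ch_closed(3)[OF ZcD(1)[OF \<kappa>m_Zm] trc_Ch[OF ZcD(1)[OF \<kappa>m_Zm]]] diff_trc_IC])

text \<open>\<open>\<kappa>m Z\<close> is injective on homology and fixes \<open>y0 y\<close>, so it
  is enough to compare the images.\<close>

lemma y0_Bm: "y \<in> Zm t s \<Longrightarrow> y - y0 y \<in> Bm t s"
proof -
  assume y: "y \<in> Zm t s"
  note n = y0_NCs[OF y]
  have "\<kappa>m Z (y - y0 y) = \<kappa>m Z y - y0 y" by (simp only: clinear_diff[OF clinear_\<kappa>m] \<kappa>m_NCs[OF n])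
  then show ?thesis using y0_diff[OF y] by (intro \<kappa>m_Bm[OF Zc_closed(3)[OF y NCs_Zm[OF n]]]) simp
qed

lemma \<kappa>F_Bm: "x \<in> Bm t s \<Longrightarrow> EA.\<kappa> (F x) \<in> Bd (js1 @ js2) opD (bd gD) t s"
  by (rule EA.\<kappa>_Bd[OF homogeneous_ops(3) F_Bd'])

lemma \<kappa>F_y0: "y \<in> Zm t s \<Longrightarrow> EA.\<kappa> (F y) - y0 y \<in> Bd (js1 @ js2) opD (bd gD) t s"
proof -
  assume y: "y \<in> Zm t s"
  note n = y0_NCs[OF y]
  have "EA.\<kappa> (F (y - y0 y)) \<in> Bd (js1 @ js2) opD (bd gD) t s" by (rule \<kappa>F_Bm[OF y0_Bm[OF y]])
  then show ?thesis by (simp only: F_lin EA.\<kappa>_lin F_NCs[OF n] \<kappa>_NCs[OF n])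
qed

text \<open>The retraction of the tensor product onto the contraction: element variables and the
  Koszul variables of the restriction are set to 0.\<close>

definition st :: "(sr_var chain) \<Rightarrow> sr_var chain" where
  "st c = (\<lambda>S. if S \<subseteq> set js2 then substitute (case_sr_var (\<lambda>_. 0) (\<lambda>F. Var (Flat F))) (c S) else 0)"

lemma st_dK: "st (dK (js1 @ js2) opD u) = dK js2 opD (st u)"
proof
  fix S
  let ?\<sigma> = "substitute (case_sr_var (\<lambda>_. 0) (\<lambda>F. Var (Flat F))) :: sr_var cpoly \<Rightarrow> sr_var cpoly"
  show "st (dK (js1 @ js2) opD u) S = dK js2 opD (st u) S"
  proof (cases "S \<subseteq> set js2")
    case False
    then have "st u (insert i S) = 0" for i by (simp add: st_def)
    then show ?thesis using False by (simp add: dK_def st_def)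
  next
    case True
    have o1: "?\<sigma> (opD i) = 0" if "i \<in> set js1" for i
      using that js_facts(2) by (simp add: opD_def substitute_linear(2) substitute_Var)
    have o2: "?\<sigma> (opD i) = opD i" if "i \<in> set js2" for i
      using that js_facts(3) by (simp add: opD_def sF_def substitute_linear substitute_Var)
    have s: "sg (js1 @ js2) i S = (sg js2 i S :: sr_var cpoly)" if "i \<in> set js2" for i
    proof -
      have "takeWhile (\<lambda>k. k \<noteq> i) (js1 @ js2) = js1 @ takeWhile (\<lambda>k. k \<noteq> i) js2"
        using that js_facts(1) by (intro takeWhile_append2) auto
      moreover have "filter (\<lambda>k. k \<in> S) js1 = []" using True js_facts(1) by (auto simp: filter_empty_conv)
      ultimately show ?thesis by (simp add: sg_def)
    qed
    have "st (dK (js1 @ js2) opD u) S = (\<Sum>i\<in>set (js1 @ js2) - S. sg (js1 @ js2) i S * (?\<sigma> (opD i) * ?\<sigma> (u (insert i S))))"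
      using True by (simp add: st_def dK_def substitute_linear(5) substitute_mult substitute_sg)
    also have "\<dots> = (\<Sum>i\<in>set js2 - S. sg (js1 @ js2) i S * (?\<sigma> (opD i) * ?\<sigma> (u (insert i S))))"
    proof (rule sum.mono_neutral_right)
      show "\<forall>i\<in>set (js1 @ js2) - S - (set js2 - S). sg (js1 @ js2) i S * (?\<sigma> (opD i) * ?\<sigma> (u (insert i S))) = 0"
        using o1 by auto
    qed auto
    also have "\<dots> = dK js2 opD (st u) S"
      unfolding dK_def
    proof (rule sum.cong[OF refl])
      fix i assume i: "i \<in> set js2 - S"
      then have "st u (insert i S) = ?\<sigma> (u (insert i S))" using True by (simp add: st_def)
      then show "sg (js1 @ js2) i S * (?\<sigma> (opD i) * ?\<sigma> (u (insert i S))) = sg js2 i S * (opD i * st u (insert i S))"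
        using i s[of i] o2[of i] by simp
    qed
    finally show ?thesis .
  qed
qed

lemma st_Ch: "u \<in> Ch (js1 @ js2) t s \<Longrightarrow> st u \<in> Ch js2 t s"
proof (rule Ch_cases)
  fix S assume u: "u \<in> Ch (js1 @ js2) t s"
  have h: "case_sr_var (\<lambda>_. 0) (\<lambda>F. Var (Flat F)) v \<in> homogeneous 1" for v
    by (cases v) (simp_all add: homogeneous_closed(1) homogeneous_Var)
  show "st u S \<in> homogeneous s" using substitute_homogeneous[OF h Ch_homogeneous[OF u]] by (simp add: st_def homogeneous_closed(1))
  assume "st u S \<noteq> 0"
  then have "S \<subseteq> set js2" "u S \<noteq> 0" by (auto simp: st_def substitute_linear split: if_splits)
  then show "S \<subseteq> set js2 \<and> int (card S) = t" using Ch_zero[OF u, of S] by auto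
qed

lemma st_IC: "i \<in> IC (bd gD) \<Longrightarrow> st i \<in> IC (bd (gW {}))"
proof -
  assume i: "i \<in> IC (bd gD)"
  let ?\<eta> = "case_sr_var (\<lambda>_. 0) (\<lambda>F. Var (Flat F)) :: sr_var \<Rightarrow> sr_var cpoly"
  have z: "substitute ?\<eta> (gen m) = (if EL m = {} then gen m else 0)" for m
  proof (induction m rule: monomial_induct)
    case zero show ?case by (simp add: substitute_one)
  next
    case (Var v m)
    show ?case unfolding substitute_gen_Var Var using gen_Var[of v m] by (cases v) auto
  qed
  have "substitute ?\<eta> (gen m) \<in> mono_ideal (bd (gW {}))" if "bd gD m" for m
  proof (cases "EL m = {}")
    case True
    \<comment> \<open>The empty set of elements is a face of the restriction. Hence a monomial
      without elements is bad in the tensor product only because of its flats, and then it is bad in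
      the contraction.\<close>
    have "cl M {} \<noteq> Z" using Z_facts(6) by (simp add: cl_empty)
    then have "bd (gW {}) m" using that True by (auto simp: bd_def gD_def gW_def)
    then show ?thesis using True by (simp add: z gen_in_mono_ideal)
  qed (simp add: z mono_ideal_closed(1))
  then have "mapc ?\<eta> i \<in> IC (bd (gW {}))" using i by (rule mapc_IC)
  then show ?thesis by (simp add: IC_def st_def mapc_def mono_ideal_closed(1))
qed

lemma clinear_st: "clinear st"
  by (rule clinearI) (auto simp: st_def substitute_linear)

lemma st_NCs: "n \<in> NCs t s \<Longrightarrow> st n = n"
proof (rule ext)
  fix S assume n: "n \<in> NCs t s"
  have "substitute (case_sr_var (\<lambda>_. 0) (\<lambda>F. Var (Flat F))) (n S) = n S" by (rule NCs_substitute[OF n]) simp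
  then show "st n S = n S" using Ch_zero[OF NCs_Ch[OF n], of S] by (auto simp: st_def)
qed

lemma NCs_Bd: "n \<in> NCs t s \<Longrightarrow> n \<in> Bd (js1 @ js2) opD (bd gD) t s \<Longrightarrow> n \<in> Bd js2 opD (bd (gW {})) t s"
proof -
  assume n: "n \<in> NCs t s" "n \<in> Bd (js1 @ js2) opD (bd gD) t s"
  obtain u i where u: "n = dK (js1 @ js2) opD u + i" "u \<in> Ch (js1 @ js2) (t + 1) (s - 1)" "i \<in> Ch (js1 @ js2) t s" "i \<in> IC (bd gD)"
    using n(2) by (rule BdE)
  have "n = st n" by (simp only: st_NCs[OF n(1)])
  also have "\<dots> = dK js2 opD (st u) + st i" unfolding u(1) clinear_add[OF clinear_st] st_dK ..
  finally show ?thesis using BdI[OF st_Ch[OF u(2)] st_Ch[OF u(3)] st_IC[OF u(4)], of opD] by simp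
qed

text \<open>In the tensor product the image of \<open>y\<close> is homologous to
  \<open>y0 y\<close>. The retraction \<open>st\<close> turns a primitive there into one over the
  contraction, where \<open>\<kappa>m Z\<close> detects boundaries of Y_-.\<close>

lemma inj: "y \<in> Zm t s \<Longrightarrow> F y \<in> Bd js (opr Pp) (bd gY) t s \<Longrightarrow> y \<in> Bm t s"
proof -
  assume y: "y \<in> Zm t s" and Fy: "F y \<in> Bd js (opr Pp) (bd gY) t s"
  have "EA.\<kappa> (F y) \<in> Bd (js1 @ js2) opD (bd gD) t s" by (rule EA.\<kappa>_Bd[OF homogeneous_ops(3) Fy])
  then have "EA.\<kappa> (F y) - (EA.\<kappa> (F y) - y0 y) \<in> Bd (js1 @ js2) opD (bd gD) t s" by (rule Bd_closed(3)[OF _ \<kappa>F_y0[OF y]])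
  then have "y0 y \<in> Bd js2 opD (bd (gW {})) t s" by (intro NCs_Bd[OF y0_NCs[OF y]]) simp
  then have "(\<kappa>m Z y - y0 y) + y0 y \<in> Bd js2 opD (bd (gW {})) t s" by (rule Bd_closed(2)[OF y0_diff[OF y]])
  then show "y \<in> Bm t s" by (intro \<kappa>m_Bm[OF y]) simp
qed

text \<open>Under the isomorphism \<open>EA.\<kappa>\<close> the image of the cycles of Y_- becomes,
  up to boundaries, the omitted summand: it contains every \<open>NCs\<close> cycle, and each of its
  members is homologous to one.\<close>

lemma BE_iff:
  assumes z: "z \<in> Zc js (opr Pp) (bd gY) t s"
  shows "EA.\<kappa> z \<in> BNs t s \<longleftrightarrow> z \<in> BE t s"
proof
  assume "z \<in> BE t s"
  then obtain b y where b: "z = b + F y" "b \<in> Bd js (opr Pp) (bd gY) t s" "y \<in> Zm t s" unfolding BE_def by blast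
  have "EA.\<kappa> z = (EA.\<kappa> b + (EA.\<kappa> (F y) - y0 y)) + y0 y" unfolding b(1) EA.\<kappa>_lin by (rule ext) simp
  moreover have "EA.\<kappa> b + (EA.\<kappa> (F y) - y0 y) \<in> Bd (js1 @ js2) opD (bd gD) t s"
    by (rule Bd_closed(2)[OF EA.\<kappa>_Bd[OF homogeneous_ops(3) b(2)] \<kappa>F_y0[OF b(3)]])
  ultimately show "EA.\<kappa> z \<in> BNs t s" unfolding BNs_def using y0_NCs[OF b(3)] by blast
next
  assume "EA.\<kappa> z \<in> BNs t s"
  then obtain b n where b: "EA.\<kappa> z = b + n" "b \<in> Bd (js1 @ js2) opD (bd gD) t s" "n \<in> NCs t s" unfolding BNs_def by blast
  have "EA.\<kappa> (z - F n) = b" unfolding EA.\<kappa>_lin b(1) F_NCs[OF b(3)] \<kappa>_NCs[OF b(3)] by simp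
  then have "z - F n \<in> Bd js (opr Pp) (bd gY) t s"
    using b(2) by (intro EA.\<kappa>_inj[OF Zc_closed(3)[OF z F_Zc'[OF NCs_Zm[OF b(3)]]]]) simp
  then have "(z - F n) + F n \<in> BE t s" by (rule BE_I[OF _ NCs_Zm[OF b(3)]])
  then show "z \<in> BE t s" by simp
qed

end

section \<open>Identification of the Tor spaces and of the direct sum, and conclusion\<close>

lemma retract_exists:
  fixes L :: "int \<Rightarrow> 'v cpoly"
  assumes js: "distinct js" and up: "upward bad" and L1: "\<And>i. i \<in> set js \<Longrightarrow> L i \<in> homogeneous 1"
    and M: "\<And>t s. \<exists>f. pres (M t s) (Zc js L bad t s) (Bd js L bad t s) f"
  obtains p h f where "retract js L bad p h M f"
proof -
  define f where "f t s = (SOME f. pres (M t s) (Zc js L bad t s) (Bd js L bad t s) f)" for t s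
  have f: "pres (M t s) (Zc js L bad t s) (Bd js L bad t s) (f t s)" for t s
    unfolding f_def by (rule someI_ex[OF M])
  show thesis
  proof (rule homotopy_exists[of js bad L])
    fix p h :: "int \<Rightarrow> int \<Rightarrow> ('v chain) \<Rightarrow> 'v chain"
    assume *: "\<And>t s. clinear (p t s)" "\<And>t s. clinear (h t s)"
      "\<And>t s x. x \<in> normal_chains js bad t s \<Longrightarrow> p t s x \<in> normal_chains js bad t s"
      "\<And>t s x. x \<in> normal_chains js bad t s \<Longrightarrow> dl js L bad (p t s x) = 0"
      "\<And>t s x. p t s (p t s x) = p t s x"
      "\<And>t s x. x \<in> normal_chains js bad t s \<Longrightarrow> h t s x \<in> normal_chains js bad (t + 1) (s - 1)"
      "\<And>t s x. x \<in> normal_chains js bad t s \<Longrightarrow> x - p t s x = dl js L bad (h t s x) + h (t - 1) (s + 1) (dl js L bad x)"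
      "\<And>t s u. u \<in> normal_chains js bad (t + 1) (s - 1) \<Longrightarrow> p t s (dl js L bad u) = 0"
    have "retract js L bad p h M f"
      by (rule retract.intro) (rule assms f *; assumption?)+
    then show thesis by (rule that)
  qed (rule assms; assumption?)+
qed

lemma ren_id: "ren id p = p"
  by (simp add: ren_def substitute_Var_id)

context one_flat
begin

lemma sr_face_M: "order_filter M P \<Longrightarrow> sr_face M P \<sigma> \<longleftrightarrow> gP P {i. Elt i \<in> \<sigma>} {Q. Flat Q \<in> \<sigma>}"
proof -
  assume P: "order_filter M P"
  show ?thesis unfolding gP_def
  proof (rule sr_face_iff)
    fix i I assume "i \<in> I" "I \<subseteq> E" "cl M {i} \<in> P \<union> {E}"
    then show "cl M I \<in> P \<union> {E}" by (intro cl_in_filter[OF P, of "{i}" I]) auto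
  qed
qed

lemma model_M:
  assumes P: "order_filter M P" shows "sr_model M P f0 js (sr_vars M P) id id (bd (gP P)) (opr P)"
proof (rule sr_model.intro, goal_cases)
  case 2
  have "finite P" using P finite_proper_flats by (auto simp: order_filter_def intro: finite_subset)
  then show ?case using finE by (simp add: sr_vars_def)
next
  case (6 \<sigma> \<tau>)
  then show ?case unfolding sr_face_M[OF P] by (elim antitoneD[OF antitone_gP[OF P]]) auto
next
  case (11 m)
  have "sr_face M P (keys m) \<Longrightarrow> keys m \<subseteq> sr_vars M P" by (simp add: sr_face_def)
  then show ?case using sr_face_M[OF P, of "keys m"] by (auto simp: bd_def EL_def FL_def)
next
  case (12 i)
  \<comment> \<open>An element that is no variable of the ring may stay in \<open>opr\<close>, being
    a bad monomial.\<close>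
  have d: "Var (Elt e) - (if Elt e \<in> sr_vars M P then Var (Elt e) else 0) \<in> mono_ideal (bd (gP P))" for e
  proof (cases "Elt e \<in> sr_vars M P")
    case False
    then have "Var (Elt e) \<in> mono_ideal (bd (gP P))" by (auto simp: Var_Elt_bd gP_def sr_vars_def)
    then show ?thesis using False by simp
  qed (simp add: mono_ideal_closed(1))
  have "opr P i - ren id (sr_image M P i - sr_image M P f0) =
      (Var (Elt i) - (if Elt i \<in> sr_vars M P then Var (Elt i) else 0)) - (Var (Elt f0) - (if Elt f0 \<in> sr_vars M P then Var (Elt f0) else 0))"
    by (simp add: ren_id opr_def sr_image_def sF_def)
  then show ?case using mono_ideal_closed(3)[OF d d] by simp
qed (use finE f0 js_facts homogeneous_ops in auto)

lemma sr_face_restriction: "sr_face (restriction M Z) {} \<sigma> \<longleftrightarrow> gB {i. Elt i \<in> \<sigma>} {Q. Flat Q \<in> \<sigma>}"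
proof -
  have c: "cl (restriction M Z) I = cl M I" if "I \<subseteq> Z" for I
    using cl_restriction[OF Z_facts(4) that] cl_below[OF that] by auto
  have "sr_face (restriction M Z) {} \<sigma> \<longleftrightarrow> {i. Elt i \<in> \<sigma>} \<subseteq> ground (restriction M Z) \<and> subset.chain {} {Q. Flat Q \<in> \<sigma>} \<and>
    (\<forall>Q\<in>{Q. Flat Q \<in> \<sigma>}. {i. Elt i \<in> \<sigma>} \<subseteq> Q) \<and> cl (restriction M Z) {i. Elt i \<in> \<sigma>} \<notin> {} \<union> {ground (restriction M Z)}"
  proof (rule sr_face_iff)
    fix i I assume *: "i \<in> I" "I \<subseteq> ground (restriction M Z)" "cl (restriction M Z) {i} \<in> {} \<union> {ground (restriction M Z)}"
    then have "cl M {i} = Z" using c[of "{i}"] by auto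
    then have "cl M I = Z" using cl_mono[of "{i}" I] cl_below[of I] * by auto
    then show "cl (restriction M Z) I \<in> {} \<union> {ground (restriction M Z)}" using c[of I] * by simp
  qed
  then show ?thesis using c[of "{i. Elt i \<in> \<sigma>}"] by (auto simp: gB_def subset_chain_def)
qed

lemma model_restriction:
  "sr_model (restriction M Z) {} e0 js1 (sr_vars (restriction M Z) {}) id id (bd gB) opD"
proof (rule sr_model.intro, goal_cases)
  case 1 show ?case using Z_facts(4) finE finite_subset by auto
next
  case 2
  have "finite Z" using Z_facts(4) finE finite_subset by blast
  then show ?case by (simp add: sr_vars_def)
next
  case (6 \<sigma> \<tau>)
  then show ?case unfolding sr_face_restriction by (elim antitoneD[OF antitone_gB]) auto
next
  case (11 m)
  have "sr_face (restriction M Z) {} (keys m) \<Longrightarrow> keys m \<subseteq> sr_vars (restriction M Z) {}" by (simp add: sr_face_def)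
  then show ?case using sr_face_restriction[of "keys m"] by (auto simp: bd_def EL_def FL_def)
next
  case (12 i)
  have i: "i \<in> Z" using 12 js_facts(2) by auto
  have d: "Var (Elt e) - (if Elt e \<in> sr_vars (restriction M Z) {} then Var (Elt e) else 0) \<in> mono_ideal (bd gB)" if e: "e \<in> Z" for e
  proof (cases "Elt e \<in> sr_vars (restriction M Z) {}")
    case False
    then have "cl (restriction M Z) {e} = Z" using e by (auto simp: sr_vars_def)
    then have "cl M {e} = Z" using cl_restriction[OF Z_facts(4), of "{e}"] cl_below[of "{e}"] e by auto
    then have "Var (Elt e) \<in> mono_ideal (bd gB)" by (simp add: Var_Elt_bd gB_def)
    then show ?thesis using False by simp
  qed (simp add: mono_ideal_closed(1))
  have "opD i - ren id (sr_image (restriction M Z) {} i - sr_image (restriction M Z) {} e0) =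
      (Var (Elt i) - (if Elt i \<in> sr_vars (restriction M Z) {} then Var (Elt i) else 0)) -
      (Var (Elt e0) - (if Elt e0 \<in> sr_vars (restriction M Z) {} then Var (Elt e0) else 0))"
    using i by (simp add: ren_id opD_def sr_image_def)
  then show ?case using mono_ideal_closed(3)[OF d[OF i] d[OF e0]] by simp
qed (use e0 js_facts homogeneous_ops in auto)

abbreviation "MZ \<equiv> contraction M Z"
abbreviation "PC \<equiv> proper_flats MZ"

text \<open>Flats of the contraction are represented with \<open>Z\<close> added back, so that they
  are the same variables as in the rings of \<open>M\<close>.\<close>

definition \<rho> :: "sr_var \<Rightarrow> sr_var" where
  "\<rho> v = (case v of Elt i \<Rightarrow> Elt i | Flat Q \<Rightarrow> Flat (Q - Z))"
definition \<rho>' :: "sr_var \<Rightarrow> sr_var" where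
  "\<rho>' v = (case v of Elt i \<Rightarrow> Elt i | Flat Q \<Rightarrow> Flat (Q \<union> Z))"

lemma PC_iff: "G \<in> PC \<longleftrightarrow> G \<inter> Z = {} \<and> G \<union> Z \<in> PZ"
  using proper_flats_contraction[OF Z_facts(5), of G] by (auto simp: PZ_def)

lemma PZ_PC: "Q \<in> PZ \<Longrightarrow> Q - Z \<in> PC"
proof -
  assume Q: "Q \<in> PZ"
  then have "(Q - Z) \<union> Z = Q" using PZ_facts(4) by auto
  then show ?thesis using Q by (auto simp: PC_iff)
qed

lemma sr_vars_contraction: "sr_vars MZ PC = Flat ` PC"
  using cl_contraction_nonempty[OF Z_facts(5), of "{i}" for i] by (auto simp: sr_vars_def)

lemma sr_face_contraction: "sr_face MZ PC \<sigma> \<longleftrightarrow> {i. Elt i \<in> \<sigma>} = {} \<and> subset.chain PC {Q. Flat Q \<in> \<sigma>}"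
proof -
  have c: "cl MZ I \<in> PC \<union> {ground MZ}" if "I \<subseteq> ground MZ" "I \<noteq> {}" for I
    using cl_contraction_nonempty[OF Z_facts(5), of I] that by simp
  have e: "cl MZ {} \<notin> PC \<union> {ground MZ}"
    using cl_contraction_empty[OF Z_facts(5)] f0 by (auto simp: proper_flats_def)
  have "sr_face MZ PC \<sigma> \<longleftrightarrow> {i. Elt i \<in> \<sigma>} \<subseteq> ground MZ \<and> subset.chain PC {Q. Flat Q \<in> \<sigma>} \<and>
    (\<forall>Q\<in>{Q. Flat Q \<in> \<sigma>}. {i. Elt i \<in> \<sigma>} \<subseteq> Q) \<and> cl MZ {i. Elt i \<in> \<sigma>} \<notin> PC \<union> {ground MZ}"
    by (rule sr_face_iff) (rule c, auto)
  then show ?thesis using c[of "{i. Elt i \<in> \<sigma>}"] e by (cases "{i. Elt i \<in> \<sigma>} = {}") auto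
qed

lemma ren_sF: "e \<in> E - Z \<Longrightarrow> ren \<rho>' (sr_image MZ PC e) = sF PZ e"
proof -
  assume e: "e \<in> E - Z"
  have "ren \<rho>' (sr_image MZ PC e) = (\<Sum>G | G \<in> PC \<and> e \<in> G. Var (Flat (G \<union> Z)))"
    by (simp add: ren_def sr_image_def sr_vars_contraction image_iff substitute_linear substitute_Var \<rho>'_def)
  also have "\<dots> = sF PZ e"
    unfolding sF_def
  proof (rule sum.reindex_bij_witness[where i = "\<lambda>Q. Q - Z" and j = "\<lambda>G. G \<union> Z"])
    fix Q assume "Q \<in> {Q. Q \<in> PZ \<and> e \<in> Q}"
    then show "Q - Z \<in> {G. G \<in> PC \<and> e \<in> G}" "Q - Z \<union> Z = Q" using PZ_PC e PZ_facts(4) by auto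
  next
    fix G assume "G \<in> {G. G \<in> PC \<and> e \<in> G}"
    then show "G \<union> Z - Z = G" "G \<union> Z \<in> {Q. Q \<in> PZ \<and> e \<in> Q}" by (auto simp: PC_iff)
  qed simp
  finally show ?thesis .
qed

lemma model_contraction: "sr_model MZ PC f0 js2 (Flat ` PZ) \<rho> \<rho>' (bd (gW {})) opD"
proof (rule sr_model.intro, goal_cases)
  case 2
  have "PC \<subseteq> (\<lambda>Q. Q - Z) ` PZ"
  proof
    fix G assume "G \<in> PC"
    then have "G \<union> Z \<in> PZ" "G = (G \<union> Z) - Z" by (auto simp: PC_iff)
    then show "G \<in> (\<lambda>Q. Q - Z) ` PZ" by blast
  qed
  then have "finite PC" using PZ_facts(3) finite_subset by blast
  then show ?case by (simp add: sr_vars_contraction)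
next
  case (6 \<sigma> \<tau>)
  have "{Q. Flat Q \<in> \<sigma>} \<subseteq> {Q. Flat Q \<in> \<tau>}" using 6(2) by auto
  then show ?case using 6 chain_anti unfolding sr_face_contraction by blast
next
  case (7 v) then show ?case using PZ_PC by (auto simp: sr_vars_contraction \<rho>_def)
next
  case (8 v)
  then obtain Q where Q: "v = Flat Q" "Q \<in> PZ" by blast
  then have "Q - Z \<union> Z = Q" using PZ_facts(4) by auto
  then show ?case by (simp add: Q(1) \<rho>_def \<rho>'_def)
next
  case (9 v) then show ?case by (auto simp: sr_vars_contraction \<rho>'_def PC_iff)
next
  case (10 v) then show ?case by (auto simp: sr_vars_contraction \<rho>'_def \<rho>_def PC_iff)
next
  case (11 m)
  have keys: "keys m \<subseteq> Flat ` PZ \<longleftrightarrow> EL m = {} \<and> FL m \<subseteq> PZ"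
  proof
    assume "EL m = {} \<and> FL m \<subseteq> PZ"
    then show "keys m \<subseteq> Flat ` PZ"
      unfolding EL_def FL_def by (auto) (metis sr_var.exhaust imageI mem_Collect_eq subsetD empty_iff Collect_empty_eq)
  qed (auto simp: EL_def FL_def)
  have ch: "subset.chain PC {Q. Flat Q \<in> \<rho> ` keys m} \<longleftrightarrow> subset.chain PZ (FL m)" if FL: "FL m \<subseteq> PZ" and EL: "EL m = {}"
  proof -
    have "\<rho> ` keys m = Flat ` (\<lambda>Q. Q - Z) ` FL m"
    proof -
      have "keys m = Flat ` FL m"
      proof (intro equalityI subsetI)
        fix v assume "v \<in> keys m" then show "v \<in> Flat ` FL m" using EL by (cases v) (auto simp: EL_def FL_def)
      qed (auto simp: FL_def)
      then show ?thesis by (simp add: image_image \<rho>_def)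
    qed
    then have eq: "{Q. Flat Q \<in> \<rho> ` keys m} = (\<lambda>Q. Q - Z) ` FL m" by auto
    \<comment> \<open>All these flats contain \<open>Z\<close>, so removing it preserves and
      reflects inclusions.\<close>
    have "Q - Z \<subseteq> Q' - Z \<longleftrightarrow> Q \<subseteq> Q'" if "Q \<in> FL m" "Q' \<in> FL m" for Q Q' using that FL PZ_facts(4) by blast
    then have "(\<forall>Q\<in>FL m. \<forall>Q'\<in>FL m. Q - Z \<subseteq> Q' - Z \<or> Q' - Z \<subseteq> Q - Z) \<longleftrightarrow> (\<forall>Q\<in>FL m. \<forall>Q'\<in>FL m. Q \<subseteq> Q' \<or> Q' \<subseteq> Q)"
      by (intro ball_cong refl) (simp only:)
    moreover have "(\<lambda>Q. Q - Z) ` FL m \<subseteq> PC" using FL PZ_PC by blast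
    ultimately show ?thesis unfolding eq subset_chain_def using FL by (simp only: ball_simps simp_thms)
  qed
  have "{i. Elt i \<in> \<rho> ` keys m} = EL m"
    by (auto simp: EL_def \<rho>_def image_iff split: sr_var.splits) (metis sr_var.exhaust)+
  moreover have "bd (gW {}) m \<longleftrightarrow> \<not> (EL m = {} \<and> FL m \<subseteq> PZ \<and> subset.chain PZ (FL m))"
    by (auto simp: bd_def gW_def subset_chain_def)
  ultimately show ?case unfolding keys sr_face_contraction using ch by (simp only:) blast
next
  case (12 i)
  then have i: "i \<in> E - Z" using js_facts(3) by auto
  have "ren \<rho>' (sr_image MZ PC i - sr_image MZ PC f0) = sF PZ i - sF PZ f0"
    by (simp only: clinear_diff[OF clinear_ren] ren_sF[OF i] ren_sF[OF f0])
  then show ?case using i by (simp add: opD_def mono_ideal_closed(1))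
qed (use finE f0 js_facts homogeneous_ops in auto)

lemma E_pres: "\<exists>q. pres (E_space M Z t s) (Zc (js1 @ js2) opD (bd gD) t s) (BNs t s) q"
proof -
  obtain pB hB fB where B: "retract js1 opD (bd gB) pB hB (tor_sr (restriction M Z) {}) fB"
  proof (rule retract_exists[of js1 "bd gB" opD "tor_sr (restriction M Z) {}"])
    show "\<exists>f. pres (tor_sr (restriction M Z) {} t s) (Zc js1 opD (bd gB) t s) (Bd js1 opD (bd gB) t s) f" for t s
      using sr_model.tor_sr_presentation[OF model_restriction] by metis
  qed (use KN.dist1 KN.upB KN.LB1 in auto)
  obtain pC hC fC where C: "retract js2 opD (bd (gW {})) pC hC (tor_sr MZ PC) fC"
  proof (rule retract_exists[of js2 "bd (gW {})" opD "tor_sr MZ PC"])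
    show "\<exists>f. pres (tor_sr MZ PC t s) (Zc js2 opD (bd (gW {})) t s) (Bd js2 opD (bd (gW {})) t s) f" for t s
      using sr_model.tor_sr_presentation[OF model_contraction] by metis
  qed (use KN.dist2 KN.upC KN.LC1 in auto)
  have "\<not> bd gB 0" using Z_facts(6) by (simp add: bd_def gB_def cl_empty)
  then interpret KP: kunneth_pres js1 js2 "range Elt" opD "bd gB" "bd (gW {})" "bd gD" pB hB "tor_sr (restriction M Z) {}" fB
      pC hC "tor_sr MZ PC" fC
    by (intro kunneth_pres.intro KN.kunneth_axioms B C kunneth_pres_axioms.intro)
  have "E_space M Z t s = direct_sum (KP.Ix t s) (\<lambda>(t1, t2, s1, s2). tensor (tor_sr (restriction M Z) {} t1 s1) (tor_sr MZ PC t2 s2))"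
    by (simp add: E_space_def KP.Ix_def)
  moreover have "KP.BN t s = BNs t s" by (simp add: KP.BN_def BNs_def KP.NC_def NCs_def)
  ultimately show ?thesis using KP.pres_E[of t s] by metis
qed

text \<open>Moves the Kuenneth presentation from the tensor product to the cycles of Y_+, where the
  diagram chase takes place.\<close>

lemma E_pres_Y: "\<exists>q. pres (E_space M Z t s) (Zc js (opr Pp) (bd gY) t s) (BE t s) q"
proof -
  obtain q where q: "pres (E_space M Z t s) (Zc (js1 @ js2) opD (bd gD) t s) (BNs t s) q" using E_pres by blast
  have "pres (E_space M Z t s) (Zc js (opr Pp) (bd gY) t s) (BE t s) (\<lambda>z. q (EA.\<kappa> z))"
  proof (rule pres_pullback[OF q subspace_Zc subspace_BE _ EA.clinear_\<kappa>])
    show "BE t s \<subseteq> Zc js (opr Pp) (bd gY) t s" using BE_ZY by blast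
    show "EA.\<kappa> z \<in> Zc (js1 @ js2) opD (bd gD) t s" if "z \<in> Zc js (opr Pp) (bd gY) t s" for z using that by (rule EA.\<kappa>_Zc)
    show "EA.\<kappa> z \<in> BNs t s \<longleftrightarrow> z \<in> BE t s" if "z \<in> Zc js (opr Pp) (bd gY) t s" for z using that by (rule BE_iff)
    fix y assume y: "y \<in> Zc (js1 @ js2) opD (bd gD) t s"
    obtain z where z: "z \<in> Zc js (opr Pp) (bd gY) t s" "EA.\<kappa> z - y \<in> IC (bd gD)" using y by (rule EA.\<kappa>_onto)
    have "EA.\<kappa> z - y \<in> Bd (js1 @ js2) opD (bd gD) t s"
      by (rule IC_subset_Bd[OF Ch_closed(3)[OF EA.\<kappa>_Ch[OF ZcD(1)[OF z(1)]] ZcD(1)[OF y]] z(2)])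
    moreover have "0 \<in> NCs t s" by (simp add: NCs_def normal_closed(1) dl_lin)
    ultimately have "EA.\<kappa> z - y \<in> BNs t s" unfolding BNs_def mem_Collect_eq by (intro exI[of _ "EA.\<kappa> z - y"] exI[of _ 0]) simp
    then show "\<exists>z\<in>Zc js (opr Pp) (bd gY) t s. EA.\<kappa> z - y \<in> BNs t s" using z(1) by blast
  qed
  then show ?thesis by blast
qed

end

theorem theorem5p7:
  fixes M :: matroid_data and Pminus Pplus :: "int set set" and Z :: "int set"
  assumes "matroid M" and "loopless M"
    and "order_filter M Pminus" and "order_filter M Pplus"
    and "Pminus \<subseteq> Pplus" and "Pplus - Pminus = {Z}"
  shows "\<exists>f g h. \<forall>t s :: int.
      f t s \<in> linear_maps (tor_sr M Pminus t s) (tor_sr M Pplus t s) \<and>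
      g t s \<in> linear_maps (tor_sr M Pplus t s) (E_space M Z t s) \<and>
      h t s \<in> linear_maps (E_space M Z t s) (tor_sr M Pminus (t - 1) (s + 1)) \<and>
      f t s ` carrier (tor_sr M Pminus t s) = a_kernel (tor_sr M Pplus t s) (E_space M Z t s) (g t s) \<and>
      g t s ` carrier (tor_sr M Pplus t s)
        = a_kernel (E_space M Z t s) (tor_sr M Pminus (t - 1) (s + 1)) (h t s) \<and>
      h t s ` carrier (E_space M Z t s)
        = a_kernel (tor_sr M Pminus (t - 1) (s + 1)) (tor_sr M Pplus (t - 1) (s + 1)) (f (t - 1) (s + 1))"
proof -
  have "Z \<in> proper_flats M" using assms(4,6) by (auto simp: order_filter_def)
  \<comment> \<open>A proper flat is neither empty nor the whole ground set.\<close>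
  then obtain e0 f0 where "e0 \<in> Z" "f0 \<in> ground M - Z" by (auto simp: proper_flats_def flat_def)
  then interpret one_flat M Pminus Pplus Z e0 f0
    by unfold_locales (use assms in auto)
  let ?Zm = "Zc js (opr Pminus) (bd (gP Pminus))" and ?Bm = "Bd js (opr Pminus) (bd (gP Pminus))"
  let ?Zp = "Zc js (opr Pplus) (bd (gP Pplus))" and ?Bp = "Bd js (opr Pplus) (bd (gP Pplus))"
  let ?ZY = "Zc js (opr Pplus) (bd gY)"
  have "\<exists>q. pres (tor_sr M Pminus t s) (?Zm t s) (?Bm t s) q" for t s
    using sr_model.tor_sr_presentation[OF model_M[OF Pm]] by metis
  then obtain qm where qm: "\<And>t s. pres (tor_sr M Pminus t s) (?Zm t s) (?Bm t s) (qm t s)" by metis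
  have "\<exists>q. pres (tor_sr M Pplus t s) (?Zp t s) (?Bp t s) q" for t s
    using sr_model.tor_sr_presentation[OF model_M[OF Pp]] by metis
  then obtain qp where qp: "\<And>t s. pres (tor_sr M Pplus t s) (?Zp t s) (?Bp t s) (qp t s)" by metis
  obtain qe where qe: "\<And>t s. pres (E_space M Z t s) (?ZY t s) (BE t s) (qe t s)" using E_pres_Y by metis
  have id: "clinear (\<lambda>z :: sr_var chain. z)" by (rule clinearI) simp_all
  define f where "f t s = induced (qm t s) (?Zm t s) (qp t s) F" for t s
  \<comment> \<open>The identity on chains: a cycle of the larger ring is also a cycle of its
    quotient Y_+.\<close>
  define g where "g t s = induced (qp t s) (?Zp t s) (qe t s) (\<lambda>z. z)" for t s
  define h where "h t s = induced (qe t s) (?ZY t s) (qm (t - 1) (s + 1)) H" for t s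
  show ?thesis
  proof (rule exI[of _ f], rule exI[of _ g], rule exI[of _ h], intro allI, goal_cases)
    case (1 t s)
    note rules = induced_linear[OF qm qp clinear_mapc F_Zc F_Bd] induced_linear[OF qp qe id Zp_ZY Bp_BE]
      induced_linear[OF qe qm clinear_H H_Zc H_BE]
      induced_exact[OF qm qp qe clinear_mapc F_Zc F_Bd id Zp_ZY Bp_BE exact1]
      induced_exact[OF qp qe qm id Zp_ZY Bp_BE clinear_H H_Zc H_BE exact2]
      induced_exact[OF qe qm qp clinear_H H_Zc H_BE clinear_mapc F_Zc F_Bd exact3[OF inj]]
    show ?case unfolding f_def g_def h_def
      by (intro conjI) (rule rules; assumption)+
  qed
qed

end
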